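(* Let $N\geq1$, $0<s<1$ with $s\leq N/2$. Let $\Omega\subset\mathbb{R}^N$ be open with finite measure, let $B$ be an open ball with $\overline B\subset\Omega$, and let $B'$ be an open ball with $\overline{B'}\subset B$. Let $f,V:\mathbb{R}^N\to\mathbb{C}$ with $f\in L^p(B)\cap L^1_{loc}(\Omega)$ and $V\in L^p(B)$ for some $1<p\leq\infty$, and let $\psi$ be a distributional solution of $(-\Delta)^s\psi+V\psi=f$ on $\Omega$. If $1/2\leq s<1$, assume additionally that $\psi\in W^{s',1+\delta}(\Omega)$ for some $s'>2s-1$ and $\delta>0$. Set $\alpha=2s-N/p$. Then (with $\psi$ modified on a null set): (I) If $0<s\leq1/2$ and $p>\frac N{2s}$, then $\psi\in\tilde C^{0,\alpha}(B')$. (II) Let $1/2<s<1$. (II.A) If $\frac N{2s}<p\leq\frac N{2s-1}$, then $\psi\in\tilde C^{0,\alpha}(B')$. (II.B) If $p>\frac N{2s-1}$, then $\psi\in\tilde C^{1,\alpha-1}(B')$.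
   Context: $(-\Delta)^s\varphi=(|\xi|^{2s}\hat\varphi)^\vee$ for Schwartz $\varphi$, $\hat\varphi(\xi)=(2\pi)^{-N/2}\int e^{-i\xi x}\varphi(x)dx$; equivalently $C_{N,s}\mathrm{P.V.}\int\frac{\varphi(x)-\varphi(y)}{|x-y|^{N+2s}}dy$. $\langle x\rangle=(1+|x|^2)^{1/2}$. Distributional solution on $\Omega$ (for $s<1$): $f\in L^1_{loc}(\Omega)$, $\int_{\mathbb{R}^N}\langle x\rangle^{-N-2s}|\psi(x)|dx<\infty$, $V\psi\in L^1_{loc}(\Omega)$, and $\int\overline{(-\Delta)^s\varphi}\psi+\int\bar\varphi V\psi=\int\bar\varphi f$ for all $\varphi\in C_0^\infty(\Omega)$. $W^{s',q}(\Omega)$ is the fractional Sobolev (Sobolev–Slobodeckij) space; for $0<s'<1$ it consists of $u\in L^q(\Omega)$ with $\int_\Omega\int_\Omega\frac{|u(x)-u(y)|^q}{|x-y|^{N+s'q}}dxdy<\infty$. Hölder spaces: for $U$ open, $0<\beta\leq1$, $g\in\tilde C^{0,\beta}(U)$ if $\exists c$: $|g(x)-g(y)|\leq c|x-y|^\beta$ ($\beta<1$), resp. $\leq c|x-y|\log(|x-y|^{-1})$ ($\beta=1$), for all $x,y\in U$; $g\in\tilde C^{1,\beta}(U)$ if $g\in C^1(U)$ and $\nabla g\in\tilde C^{0,\beta}(U)$.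
   Formalization: For β = 1 the bound |g(x)−g(y)| ≤ c|x−y| log(1/|x−y|) is required only for |x−y| ≤ 1/2, since for all x, y in U it fails for any g taking different values at two points at distance 1. *)

theory Defs
  imports "HOL-Analysis.Analysis"
begin

fun iter_deriv :: "'a::euclidean_space list \<Rightarrow> ('a \<Rightarrow> complex) \<Rightarrow> ('a \<Rightarrow> complex)" where
  "iter_deriv [] g = g"
| "iter_deriv (v # vs) g = (\<lambda>x. frechet_derivative (iter_deriv vs g) (at x) v)"

definition smooth_fun :: "('a::euclidean_space \<Rightarrow> complex) \<Rightarrow> bool" where
  "smooth_fun g \<longleftrightarrow> (\<forall>vs x. iter_deriv vs g differentiable (at x))"

definition test_fun :: "'a::euclidean_space set \<Rightarrow> ('a \<Rightarrow> complex) \<Rightarrow> bool" where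
  "test_fun \<Omega> \<phi> \<longleftrightarrow> smooth_fun \<phi> \<and> compact (closure {x. \<phi> x \<noteq> 0})
      \<and> closure {x. \<phi> x \<noteq> 0} \<subseteq> \<Omega>"

definition fourier :: "('a::euclidean_space \<Rightarrow> complex) \<Rightarrow> 'a \<Rightarrow> complex" where
  "fourier \<phi> \<xi> = complex_of_real ((2 * pi) powr (- real DIM('a) / 2)) *
     (LINT x|lebesgue. exp (- \<i> * complex_of_real (\<xi> \<bullet> x)) * \<phi> x)"

definition fourier_inv :: "('a::euclidean_space \<Rightarrow> complex) \<Rightarrow> 'a \<Rightarrow> complex" where
  "fourier_inv h x = complex_of_real ((2 * pi) powr (- real DIM('a) / 2)) *
     (LINT \<xi>|lebesgue. exp (\<i> * complex_of_real (\<xi> \<bullet> x)) * h \<xi>)"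

definition frac_lap :: "real \<Rightarrow> ('a::euclidean_space \<Rightarrow> complex) \<Rightarrow> 'a \<Rightarrow> complex" where
  "frac_lap s \<phi> = fourier_inv (\<lambda>\<xi>. complex_of_real (norm \<xi> powr (2 * s)) * fourier \<phi> \<xi>)"

definition japanese :: "'a::real_normed_vector \<Rightarrow> real" where
  "japanese x = sqrt (1 + (norm x)\<^sup>2)"

definition Lp_on :: "ereal \<Rightarrow> 'a::euclidean_space set \<Rightarrow> ('a \<Rightarrow> complex) \<Rightarrow> bool" where
  "Lp_on p S f \<longleftrightarrow> f \<in> borel_measurable (lebesgue_on S) \<and>
     (if p = \<infinity> then (\<exists>C. AE x in lebesgue_on S. norm (f x) \<le> C)
      else integrable (lebesgue_on S) (\<lambda>x. norm (f x) powr real_of_ereal p))"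

definition L1_loc :: "'a::euclidean_space set \<Rightarrow> ('a \<Rightarrow> complex) \<Rightarrow> bool" where
  "L1_loc \<Omega> f \<longleftrightarrow> (\<forall>K. compact K \<and> K \<subseteq> \<Omega> \<longrightarrow> integrable (lebesgue_on K) f)"

definition frac_sobolev :: "real \<Rightarrow> real \<Rightarrow> 'a::euclidean_space set \<Rightarrow> ('a \<Rightarrow> complex) \<Rightarrow> bool" where
  "frac_sobolev s' q \<Omega> u \<longleftrightarrow> 0 < s' \<and> s' < 1 \<and> Lp_on (ereal q) \<Omega> u \<and>
     (\<integral>\<^sup>+ x. (\<integral>\<^sup>+ y. indicator (\<Omega> \<times> \<Omega>) (x, y) *
        ennreal (norm (u x - u y) powr q / dist x y powr (real DIM('a) + s' * q)) \<partial>lebesgue) \<partial>lebesgue)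
     < \<infinity>"

definition distr_solution ::
  "real \<Rightarrow> 'a::euclidean_space set \<Rightarrow> ('a \<Rightarrow> complex) \<Rightarrow> ('a \<Rightarrow> complex) \<Rightarrow> ('a \<Rightarrow> complex) \<Rightarrow> bool" where
  "distr_solution s \<Omega> V f \<psi> \<longleftrightarrow>
     L1_loc \<Omega> f \<and>
     \<psi> \<in> borel_measurable lebesgue \<and>
     (\<integral>\<^sup>+ x. ennreal (japanese x powr (- real DIM('a) - 2 * s) * norm (\<psi> x)) \<partial>lebesgue) < \<infinity> \<and>
     L1_loc \<Omega> (\<lambda>x. V x * \<psi> x) \<and>
     (\<forall>\<phi>. test_fun \<Omega> \<phi> \<longrightarrow>
        (LINT x|lebesgue. cnj (frac_lap s \<phi> x) * \<psi> x)
        + (LINT x|lebesgue. cnj (\<phi> x) * (V x * \<psi> x))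
        = (LINT x|lebesgue. cnj (\<phi> x) * f x))"

definition holder0 :: "real \<Rightarrow> 'a::euclidean_space set \<Rightarrow> ('a \<Rightarrow> complex) \<Rightarrow> bool" where
  "holder0 \<beta> U g \<longleftrightarrow>
     (if \<beta> < 1 then (\<exists>c. \<forall>x\<in>U. \<forall>y\<in>U. norm (g x - g y) \<le> c * dist x y powr \<beta>)
      else (\<exists>c. \<forall>x\<in>U. \<forall>y\<in>U. dist x y \<le> 1/2 \<longrightarrow>
              norm (g x - g y) \<le> c * dist x y * ln (inverse (dist x y))))"

definition holder1 :: "real \<Rightarrow> 'a::euclidean_space set \<Rightarrow> ('a \<Rightarrow> complex) \<Rightarrow> bool" where
  "holder1 \<beta> U g \<longleftrightarrow>
     (\<exists>D. (\<forall>x\<in>U. (g has_derivative D x) (at x)) \<and>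
          (\<forall>i\<in>Basis. continuous_on U (\<lambda>x. D x i) \<and> holder0 \<beta> U (\<lambda>x. D x i)))"

end

theory Submission
  imports Defs "HOL-Probability.Probability"
begin

text \<open>Test the equation against the bump \<open>eta ((x - y) / t)\<close> and integrate over the scales \<open>r < t < b\<close> with
  weight \<open>t powr (- N - 1)\<close>. On the side of \<open>\<psi>\<close> this yields a difference of convolutions with an approximate
  identity of mass \<open>kappa > 0\<close>, so \<open>r \<rightarrow> 0\<close> gives almost everywhere: \<open>kappa \<psi>\<close> is a smooth convolution of \<open>\<psi>\<close>
  plus a truncated Riesz potential of \<open>f - V \<psi>\<close>. Functions in \<open>L\<^sup>p\<close> satisfy a Morrey condition under which such
  potentials are small at small scales; iterating the representation on shrinking balls gives \<open>|V \<psi>| \<le> 2 A |V|\<close>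
  locally. Hence \<open>f - V \<psi>\<close> satisfies the same Morrey condition, and splitting its potential at the scale
  \<open>|x - x'|\<close> gives the Hoelder bounds. By Fourier inversion, \<open>(-\<Delta>)\<^sup>s\<close> is a multiple of the symmetrised
  singular integral on test functions.\<close>

text \<open>Two features of the problem shape the proof. The operator is nonlocal and
  \<open>\<psi>\<close> has only a weighted integral, so cutting \<open>\<psi>\<close> off would
  leave commutator terms without a bound. Averaging test functions over scales keeps every bump
  inside the ball where f and V are controlled, and only the averaged kernel \<open>Theta\<close>
  meets the tail of \<open>\<psi>\<close>. It must therefore decay like the weight, by N + 2s
  powers. Estimating the average over scales t \<ge> 1 directly gives just N powers; the rest is
  cancellation: the average over all scales is homogeneous of degree -N, and its integral over a
  shell is a multiple of the integral of \<open>theta\<close>, which is 0. So large scales may be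
  traded for small ones. The mass is positive because the bump decreases with the norm, which makes
  the (-Delta)^s pairing of any two dilates positive.

  Secondly, \<open>V \<psi>\<close> is a priori just locally integrable, too little for a Morrey
  bound. The iteration is therefore dual: the potential is transposed onto bounded weights, and the
  only a priori information on \<open>V \<psi>\<close> that enters is its L1 norm on the
  ball.\<close>

abbreviation lborel2 :: "('a::euclidean_space \<times> 'b::euclidean_space) measure" where
  "lborel2 \<equiv> lborel \<Otimes>\<^sub>M lborel"

abbreviation ph :: "'a::euclidean_space \<Rightarrow> 'a \<Rightarrow> complex" where
  "ph \<xi> x \<equiv> \<i> * complex_of_real (\<xi> \<bullet> x)"

section \<open>Affine substitutions, polar coordinates and integrable weights\<close>

lemma nn_integral_affine:
  fixes f :: "'a::euclidean_space \<Rightarrow> ennreal"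
  assumes [measurable]: "f \<in> borel_measurable borel" and c: "c \<noteq> 0"
  shows "(\<integral>\<^sup>+x. f x \<partial>lborel) = ennreal (\<bar>c\<bar> ^ DIM('a)) * (\<integral>\<^sup>+x. f (t + c *\<^sub>R x) \<partial>lborel)"
  by (subst lborel_affine[OF c, of t])
     (simp add: nn_integral_density nn_integral_distr nn_integral_cmult ennreal_power)

lemma integral_affine:
  fixes f :: "'a::euclidean_space \<Rightarrow> 'b::{banach, second_countable_topology}"
  assumes [measurable]: "f \<in> borel_measurable borel" and c: "c \<noteq> 0"
  shows "(LBINT x. f x) = (\<bar>c\<bar> ^ DIM('a)) *\<^sub>R (LBINT x. f (t + c *\<^sub>R x))"
  by (subst lborel_affine[OF c, of t])
     (simp add: integral_density integral_distr)

lemma integrable_affine: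
  fixes f :: "'a::euclidean_space \<Rightarrow> 'b::{banach, second_countable_topology}"
  assumes [measurable]: "f \<in> borel_measurable borel" and c: "c \<noteq> 0"
  shows "integrable lborel f \<longleftrightarrow> integrable lborel (\<lambda>x. f (t + c *\<^sub>R x))"
proof -
  have "0 < ennreal (\<bar>c\<bar> ^ DIM('a))" using c by simp
  then show ?thesis
  using nn_integral_affine[of "\<lambda>x. ennreal (norm (f x))" c t] c
  by (auto simp: integrable_iff_bounded ennreal_mult_less_top)
qed

text \<open>Polar coordinates without a measure on the sphere: the image of \<open>lborel\<close>
  under the norm and a weighted measure on the line agree on the rays \<open>{..a}\<close>, by the
  volume formula for balls, and these rays generate the Borel sets.\<close>

lemma nn_integral_radial:
  fixes f :: "real \<Rightarrow> ennreal"
  assumes [measurable]: "f \<in> borel_measurable borel"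
  shows "(\<integral>\<^sup>+x. f (norm (x::'a::euclidean_space)) \<partial>lborel) =
    ennreal (real DIM('a) * unit_ball_vol DIM('a)) * (\<integral>\<^sup>+r. indicator {0..} r * ennreal (r ^ (DIM('a) - 1)) * f r \<partial>lborel)"
proof -
  let ?n = "DIM('a)"
  define K where "K = real ?n * unit_ball_vol ?n"
  have K0: "K \<ge> 0" by (simp add: K_def)
  let ?d = "\<lambda>r::real. ennreal K * (indicator {0..} r * ennreal (r ^ (?n - 1)))"
  have *: "distr lborel borel (norm :: 'a \<Rightarrow> real) = density lborel ?d"
  proof (rule measure_eqI_generator_eq_countable[where E="range (\<lambda>a::real. {..a})" and \<Omega>=UNIV and A="range (\<lambda>n::nat. {..real n})"])
    show "Int_stable (range (\<lambda>a::real. {..a}))"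
      by (auto simp: Int_stable_def)
    show "sets (distr lborel borel (norm :: 'a \<Rightarrow> real)) = sigma_sets UNIV (range (\<lambda>a::real. {..a}))"
      by (simp add: borel_eq_atMost)
    show "sets (density lborel ?d) = sigma_sets UNIV (range (\<lambda>a::real. {..a}))"
      by (simp add: borel_eq_atMost)
    have e1: "emeasure (distr lborel borel (norm :: 'a \<Rightarrow> real)) {..a} = (if a < 0 then 0 else ennreal (unit_ball_vol ?n * a ^ ?n))" for a
    proof -
      have "(norm :: 'a \<Rightarrow> real) -` {..a} = cball 0 a" by auto
      then show ?thesis by (auto simp: emeasure_distr emeasure_cball)
    qed
    have e2: "emeasure (density lborel ?d) {..a} = (if a < 0 then 0 else ennreal (unit_ball_vol ?n * a ^ ?n))" for a
    proof (cases "a < 0")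
      case True
      have "emeasure (density lborel ?d) {..a} = (\<integral>\<^sup>+r. 0 \<partial>(lborel :: real measure))"
        using True by (subst emeasure_density) (auto intro!: nn_integral_cong split: split_indicator simp del: nn_integral_0_iff_AE nn_integral_const)
      then show ?thesis using True by simp
    next
      case False
      have "emeasure (density lborel ?d) {..a} = (\<integral>\<^sup>+r. ennreal (K * r ^ (?n - 1)) * indicator {0..a} r \<partial>lborel)"
        by (subst emeasure_density) (auto intro!: nn_integral_cong split: split_indicator simp: ennreal_mult'' K0)
      also have "\<dots> = ennreal (unit_ball_vol ?n * a ^ ?n - unit_ball_vol ?n * 0 ^ ?n)"
        using False K0
        by (intro nn_integral_FTC_Icc) (auto simp: K_def intro!: derivative_eq_intros)
      finally show ?thesis using False by simp
    qed
    show "emeasure (distr lborel borel (norm :: 'a \<Rightarrow> real)) X = emeasure (density lborel ?d) X"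
      if X: "X \<in> range (\<lambda>a::real. {..a})" for X
    proof -
      obtain a where a: "X = {..a}" using X by blast
      show ?thesis unfolding a by (simp only: e1 e2)
    qed
    show "emeasure (distr lborel borel (norm :: 'a \<Rightarrow> real)) a \<noteq> \<infinity>" if A: "a \<in> range (\<lambda>n::nat. {..real n})" for a
    proof -
      obtain n where a: "a = {..real n}" using A by blast
      show ?thesis unfolding a e1 by simp
    qed
    show "\<Union> (range (\<lambda>n::nat. {..real n})) = UNIV"
    proof (intro set_eqI iffI UNIV_I)
      fix x :: real
      obtain n :: nat where "x \<le> real n" using real_arch_simple by blast
      then show "x \<in> \<Union> (range (\<lambda>n::nat. {..real n}))" by blast
    qed
    show "range (\<lambda>n::nat. {..real n}) \<subseteq> range (\<lambda>a::real. {..a})" by blast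
  qed simp_all
  have "(\<integral>\<^sup>+x. f (norm (x::'a)) \<partial>lborel) = (\<integral>\<^sup>+r. f r \<partial>distr lborel borel (norm :: 'a \<Rightarrow> real))"
    by (simp add: nn_integral_distr)
  also have "\<dots> = (\<integral>\<^sup>+r. ennreal K * (indicator {0..} r * ennreal (r ^ (?n - 1)) * f r) \<partial>lborel)"
    unfolding * by (simp add: nn_integral_density mult.assoc)
  also have "\<dots> = ennreal K * (\<integral>\<^sup>+r. (indicator {0..} r * ennreal (r ^ (?n - 1)) * f r) \<partial>lborel)"
    by (rule nn_integral_cmult) measurable
  finally show ?thesis unfolding K_def .
qed

lemma nn_integral_powr_0:
  assumes "-1 < b" "0 \<le> a"
  shows "(\<integral>\<^sup>+x. indicator {0..a} x * ennreal (x powr b) \<partial>lborel) = ennreal (a powr (b + 1) / (b + 1))"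
  using nn_integral_has_integral_lebesgue[OF _ has_integral_powr_from_0[OF assms]]
  by (simp add: nn_integral_completion ennreal_indicator ennreal_mult' flip: ennreal_indicator)

lemma nn_integral_powr_inf:
  assumes "e < -1" "0 < a"
  shows "(\<integral>\<^sup>+x. indicator {a..} x * ennreal (x powr e) \<partial>lborel) = ennreal (a powr (e + 1) / (- e - 1))"
proof -
  have *: "- (a powr (e + 1) / (e + 1)) = a powr (e + 1) / (- e - 1)"
    using assms by (simp add: field_simps)
  show ?thesis
  using nn_integral_has_integral_lebesgue[OF _ has_integral_powr_to_inf[OF assms]]
  by (simp add: * nn_integral_completion ennreal_mult' flip: ennreal_indicator)
qed

text \<open>In polar coordinates the integrand is at most r^(1-2s) up to radius 1 and r^(-1-2s)
  beyond it. The conditions s < 1 and 0 < s are exactly integrability at 0 and at infinity.\<close>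

lemma nn_integral_kernel_finite:
  assumes "0 < s" "s < 1"
  shows "(\<integral>\<^sup>+y. ennreal (norm (y::'a::euclidean_space) powr (- real DIM('a) - 2 * s) * min 1 ((norm y)\<^sup>2)) \<partial>lborel) < \<infinity>"
proof -
  let ?n = "DIM('a)"
  have "(\<integral>\<^sup>+r. indicator {0..} r * ennreal (r ^ (?n - 1)) * ennreal (r powr (- real ?n - 2 * s) * min 1 (r\<^sup>2)) \<partial>lborel)
    \<le> (\<integral>\<^sup>+r. indicator {0..1} r * ennreal (r powr (1 - 2 * s)) + indicator {1..} r * ennreal (r powr (- 1 - 2 * s)) \<partial>lborel)"
  proof (intro nn_integral_mono)
    fix r :: real
    show "indicator {0..} r * ennreal (r ^ (?n - 1)) * ennreal (r powr (- real ?n - 2 * s) * min 1 (r\<^sup>2))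
      \<le> indicator {0..1} r * ennreal (r powr (1 - 2 * s)) + indicator {1..} r * ennreal (r powr (- 1 - 2 * s))"
    proof (cases "0 < r")
      case False
      then show ?thesis by (cases "r = 0") auto
    next
      case True
      have a: "r ^ (?n - 1) = r powr (real ?n - 1)" using True
        by (simp add: powr_realpow[symmetric] of_nat_diff Suc_leI)
      have b: "r\<^sup>2 = r powr 2" using True by (simp add: powr_numeral)
      have "indicator {0..} r * ennreal (r ^ (?n - 1)) * ennreal (r powr (- real ?n - 2 * s) * min 1 (r\<^sup>2))
         = ennreal (r powr (real ?n - 1) * r powr (- real ?n - 2 * s) * min 1 (r\<^sup>2))"
        using True unfolding a by (simp add: ennreal_mult'' mult.assoc)
      also have "\<dots> = ennreal (r powr (-1 - 2 * s) * min 1 (r\<^sup>2))"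
        by (simp add: powr_add[symmetric])
      also have "\<dots> \<le> indicator {0..1} r * ennreal (r powr (1 - 2 * s)) + indicator {1..} r * ennreal (r powr (- 1 - 2 * s))"
      proof (cases "r \<le> 1")
        case True
        have "r powr (-1 - 2 * s) * min 1 (r\<^sup>2) \<le> r powr (-1 - 2 * s) * r powr 2"
          by (intro mult_left_mono) (auto simp: b)
        also have "\<dots> = r powr (1 - 2 * s)" by (simp add: powr_add[symmetric])
        finally show ?thesis using True \<open>0<r\<close>
          by - (rule order_trans[OF ennreal_leI], auto split: split_indicator)
      next
        case False
        have "r powr (-1 - 2 * s) * min 1 (r\<^sup>2) \<le> r powr (-1 - 2 * s) * 1"
          by (intro mult_left_mono) auto
        then show ?thesis using False True
          by - (rule order_trans[OF ennreal_leI], auto split: split_indicator)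
      qed
      finally show ?thesis .
    qed
  qed
  also have "\<dots> = (\<integral>\<^sup>+r. indicator {0..1} r * ennreal (r powr (1 - 2 * s)) \<partial>lborel) + (\<integral>\<^sup>+r. indicator {1..} r * ennreal (r powr (- 1 - 2 * s)) \<partial>lborel)"
    by (rule nn_integral_add) auto
  also have "\<dots> < \<infinity>"
    using assms by (subst nn_integral_powr_0, simp, simp, subst nn_integral_powr_inf) auto
  finally show ?thesis
    by (subst nn_integral_radial[where f="\<lambda>r. ennreal (r powr (- real DIM('a) - 2 * s) * min 1 (r\<^sup>2))"])
       (auto simp: ennreal_mult_less_top)
qed

lemma japanese_ge1: "1 \<le> japanese x"
  by (simp add: japanese_def)

lemma japanese_pos [simp]: "0 < japanese x"
  using japanese_ge1[of x] by linarith

lemma japanese_ge_norm: "norm x \<le> japanese x"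
  by (simp add: japanese_def real_le_rsqrt)

lemma japanese_le: "japanese x \<le> 1 + norm x"
  unfolding japanese_def by (rule real_le_lsqrt) (auto simp: power2_eq_square algebra_simps)

lemma japanese_measurable [measurable]: "japanese \<in> borel_measurable borel"
  unfolding japanese_def[abs_def] by measurable

text \<open>A form of Peetre's inequality. It moves the weight from a shifted argument back to the
  integration variable, at the price of a factor that depends on the shift alone.\<close>

lemma japanese_add: "japanese (x + y) \<le> (1 + norm y) * japanese x"
proof -
  have "japanese (x + y) \<le> sqrt ((1 + norm x ^ 2) * (1 + norm y) ^ 2)"
    unfolding japanese_def
  proof (rule real_sqrt_le_mono)
    have "norm (x+y) ^ 2 \<le> (norm x + norm y)^2"
      by (intro power_mono norm_triangle_ineq) auto
    moreover have "2 * norm x * norm y \<le> 2 * norm y + 2 * norm x ^ 2 * norm y"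
    proof -
      have "norm x \<le> 1 + norm x ^ 2"
        using zero_le_power2[of "norm x - 1/2"] by (simp add: power2_eq_square algebra_simps)
      from mult_right_mono[OF this, of "2 * norm y"] show ?thesis by (simp add: algebra_simps)
    qed
    moreover have "0 \<le> (norm x)^2 * (norm y)^2" by simp
    moreover have "(1 + (norm x)\<^sup>2) * (1 + norm y)\<^sup>2 = 1 + norm x^2 + 2 * norm y + norm y ^ 2 + 2 * norm x ^ 2 * norm y + (norm x)^2 * (norm y)^2"
      by (simp add: power2_eq_square algebra_simps)
    moreover have "(norm x + norm y)^2 = norm x ^ 2 + 2 * norm x * norm y + norm y ^ 2"
      by (simp add: power2_eq_square algebra_simps)
    ultimately show "1 + (norm (x + y))\<^sup>2 \<le> (1 + (norm x)\<^sup>2) * (1 + norm y)\<^sup>2"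
      by linarith
  qed
  also have "\<dots> = (1 + norm y) * japanese x"
    by (simp add: japanese_def real_sqrt_mult)
  finally show ?thesis .
qed

lemma nn_integral_japanese_finite:
  assumes "0 < g"
  shows "(\<integral>\<^sup>+y. ennreal (japanese (y::'a::euclidean_space) powr (- real DIM('a) - g)) \<partial>lborel) < \<infinity>"
proof -
  let ?n = "DIM('a)" and ?j = "\<lambda>r::real. sqrt (1 + r\<^sup>2)"
  have "(\<integral>\<^sup>+r. indicator {0..} r * ennreal (r ^ (?n - 1)) * ennreal (?j r powr (- real ?n - g)) \<partial>lborel)
    \<le> (\<integral>\<^sup>+r. indicator {0..1} r * ennreal (r powr 0) + indicator {1..} r * ennreal (r powr (- 1 - g)) \<partial>lborel)"
  proof (intro nn_integral_mono_AE)
    \<comment> \<open>The point 0 is removed because \<open>0 powr 0 = 0\<close>, so that in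
      dimension 1 the bound fails there.\<close>
    have "AE r in lborel. r \<noteq> (0::real)" by (rule AE_lborel_singleton)
    then show "AE r in lborel. indicator {0..} r * ennreal (r ^ (?n - 1)) * ennreal (?j r powr (- real ?n - g))
      \<le> indicator {0..1} r * ennreal (r powr 0) + indicator {1..} r * ennreal (r powr (- 1 - g))"
    proof eventually_elim
      fix r :: real assume r: "r \<noteq> 0"
      show "indicator {0..} r * ennreal (r ^ (?n - 1)) * ennreal (?j r powr (- real ?n - g))
      \<le> indicator {0..1} r * ennreal (r powr 0) + indicator {1..} r * ennreal (r powr (- 1 - g))"
      proof (cases "0 < r")
        case False
        then show ?thesis using r by auto
      next
        case True
        have a: "r ^ (?n - 1) = r powr (real ?n - 1)" using True
          by (simp add: powr_realpow[symmetric] of_nat_diff Suc_leI)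
        show ?thesis
        proof (cases "r \<le> 1")
          case r1: True
          have "r ^ (?n - 1) * ?j r powr (- real ?n - g) \<le> 1 * 1"
          proof (rule mult_mono)
            have "?j r powr (- real ?n - g) \<le> ?j r powr 0"
              by (rule powr_mono) (use assms in auto)
            then show "?j r powr (- real ?n - g) \<le> 1" by (auto split: if_splits)
          qed (use r1 True in \<open>auto intro: power_le_one\<close>)
          then show ?thesis using True r1
            by - (rule order_trans[OF _ add_increasing2[OF zero_le order_refl]], auto simp: ennreal_mult''[symmetric])
        next
          case r1: False
          have "r powr (real ?n - 1) * ?j r powr (- real ?n - g) \<le> r powr (real ?n - 1) * r powr (- real ?n - g)"
            by (intro mult_left_mono powr_mono2') (use True assms in \<open>auto simp: real_le_rsqrt\<close>)
          also have "\<dots> = r powr (-1 - g)" by (simp add: powr_add[symmetric])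
          finally show ?thesis using True r1
            by (auto simp: a[simplified] ennreal_mult''[symmetric] ennreal_leI)
        qed
      qed
    qed
  qed
  also have "\<dots> = (\<integral>\<^sup>+r. indicator {0..1} r * ennreal (r powr 0) \<partial>lborel) + (\<integral>\<^sup>+r. indicator {1..} r * ennreal (r powr (- 1 - g)) \<partial>lborel)"
    by (rule nn_integral_add) auto
  also have "\<dots> < \<infinity>"
    using assms by (subst nn_integral_powr_0, simp, simp, subst nn_integral_powr_inf) auto
  finally show ?thesis unfolding japanese_def
    by (subst nn_integral_radial[where f="\<lambda>r. ennreal (?j r powr (- real DIM('a) - g))"])
       (auto simp: ennreal_mult_less_top)
qed

section \<open>Invariance of Lebesgue measure under orthogonal maps\<close>

lemma nn_integral_orthogonal:
  fixes f :: "'a::euclidean_space \<Rightarrow> ennreal" and T :: "'a \<Rightarrow> 'a"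
  assumes [measurable]: "f \<in> borel_measurable borel" and T: "orthogonal_transformation T"
  shows "(\<integral>\<^sup>+x. f (T x) \<partial>lborel) = (\<integral>\<^sup>+x. f x \<partial>lborel)"
proof -
  define S where "S = inv T"
  have S: "orthogonal_transformation S" unfolding S_def by (rule orthogonal_transformation_inv[OF T])
  have TS: "T (S y) = y" for y unfolding S_def
    using orthogonal_transformation_surj[OF T] by (simp add: surj_f_inv_f)
  have lT: "linear T" using T by (rule orthogonal_transformation_linear)
  have [measurable]: "T \<in> borel_measurable borel"
    by (intro borel_measurable_continuous_onI linear_continuous_on linear_conv_bounded_linear[THEN iffD1] lT)
  have [measurable]: "S \<in> borel_measurable borel"
    by (intro borel_measurable_continuous_onI linear_continuous_on linear_conv_bounded_linear[THEN iffD1] orthogonal_transformation_linear[OF S])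
  \<comment> \<open>The indicator of the unit ball is invariant under T and has finite nonzero mass.
    Multiplying by its integral turns the claim into an identity of double integrals that needs only
    translations and Fubini: T is moved from the argument of f to that of g, where it
    disappears.\<close>
  define g :: "'a \<Rightarrow> ennreal" where "g = indicator (ball 0 1)"
  have gm [measurable]: "g \<in> borel_measurable borel" unfolding g_def
    by (rule borel_measurable_indicator) simp
  have gT: "g (T x) = g x" for x
    unfolding g_def by (simp add: indicator_def orthogonal_transformation_norm[OF T])
  have gneg: "g (- x) = g x" for x unfolding g_def by (simp add: indicator_def)
  have G: "(\<integral>\<^sup>+y. g y \<partial>lborel) = ennreal (unit_ball_vol DIM('a))"
    unfolding g_def by (simp add: emeasure_ball)
  have tr: "(\<integral>\<^sup>+x. h (t + x) \<partial>lborel) = (\<integral>\<^sup>+x. h x \<partial>lborel)" if "h \<in> borel_measurable borel" for h t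
    using nn_integral_affine[OF that, of 1 t] by simp
  have "(\<integral>\<^sup>+x. f (T x) \<partial>lborel) * (\<integral>\<^sup>+y. g y \<partial>lborel) = (\<integral>\<^sup>+y. (\<integral>\<^sup>+x. f (T x) * g y \<partial>lborel) \<partial>lborel)"
    by (simp add: nn_integral_multc nn_integral_cmult)
  also have "\<dots> = (\<integral>\<^sup>+y. (\<integral>\<^sup>+x. f (T x + y) * g y \<partial>lborel) \<partial>lborel)"
  proof (rule nn_integral_cong)
    fix y
    have "(\<integral>\<^sup>+x. f (T (S y + x)) * g y \<partial>lborel) = (\<integral>\<^sup>+x. f (T x) * g y \<partial>lborel)"
      by (rule tr) measurable
    then show "(\<integral>\<^sup>+x. f (T x) * g y \<partial>lborel) = (\<integral>\<^sup>+x. f (T x + y) * g y \<partial>lborel)"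
      by (simp add: linear_add[OF lT] TS add.commute)
  qed
  also have "\<dots> = (\<integral>\<^sup>+x. (\<integral>\<^sup>+y. f (T x + y) * g y \<partial>lborel) \<partial>lborel)"
    by (rule lborel_pair.Fubini') measurable
  also have "\<dots> = (\<integral>\<^sup>+x. (\<integral>\<^sup>+y. f y * g (y - T x) \<partial>lborel) \<partial>lborel)"
  proof (rule nn_integral_cong)
    fix x
    show "(\<integral>\<^sup>+y. f (T x + y) * g y \<partial>lborel) = (\<integral>\<^sup>+y. f y * g (y - T x) \<partial>lborel)"
      using tr[of "\<lambda>y. f y * g (y - T x)" "T x"] by simp
  qed
  also have "\<dots> = (\<integral>\<^sup>+y. (\<integral>\<^sup>+x. f y * g (y - T x) \<partial>lborel) \<partial>lborel)"
    by (rule lborel_pair.Fubini') measurable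
  also have "\<dots> = (\<integral>\<^sup>+y. f y * (\<integral>\<^sup>+x. g x \<partial>lborel) \<partial>lborel)"
  proof (rule nn_integral_cong)
    fix y
    have "g (y - T x) = g (- S y + x)" for x
    proof -
      have "g (y - T x) = g (T (S y - x))" by (simp add: linear_diff[OF lT] TS)
      also have "\<dots> = g (- (S y - x))" by (simp only: gT gneg)
      finally show ?thesis by simp
    qed
    then show "(\<integral>\<^sup>+x. f y * g (y - T x) \<partial>lborel) = f y * (\<integral>\<^sup>+x. g x \<partial>lborel)"
      using tr[of g "- S y"] by (simp add: nn_integral_cmult)
  qed
  also have "\<dots> = (\<integral>\<^sup>+x. f x \<partial>lborel) * (\<integral>\<^sup>+y. g y \<partial>lborel)"
    by (simp add: nn_integral_multc)
  finally have "ennreal (unit_ball_vol DIM('a)) * (\<integral>\<^sup>+x. f (T x) \<partial>lborel) = ennreal (unit_ball_vol DIM('a)) * (\<integral>\<^sup>+x. f x \<partial>lborel)"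
    unfolding G by (simp only: mult.commute)
  moreover have "ennreal (unit_ball_vol DIM('a)) \<noteq> 0"
    using unit_ball_vol_pos[of "DIM('a)"] by (simp add: ennreal_eq_0_iff not_le del: unit_ball_vol_pos)
  ultimately show ?thesis
    by (simp only: ennreal_mult_cancel_left) simp
qed

lemma lborel_distr_orthogonal:
  assumes T: "orthogonal_transformation (T :: 'a::euclidean_space \<Rightarrow> 'a)"
  shows "distr lborel borel T = lborel"
proof (rule measure_eqI)
  have [measurable]: "T \<in> borel_measurable borel"
    by (intro borel_measurable_continuous_onI linear_continuous_on linear_conv_bounded_linear[THEN iffD1] orthogonal_transformation_linear[OF T])
  fix A assume "A \<in> sets (distr lborel borel T)"
  then have [measurable]: "A \<in> sets borel" by simp
  show "emeasure (distr lborel borel T) A = emeasure lborel A"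
    using nn_integral_orthogonal[OF _ T, of "indicator A"] 
    by (simp add: emeasure_distr nn_integral_distr[symmetric, of T lborel borel "indicator A"])
qed simp

lemma integral_orthogonal:
  fixes f :: "'a::euclidean_space \<Rightarrow> 'b::{banach, second_countable_topology}" and T :: "'a \<Rightarrow> 'a"
  assumes [measurable]: "f \<in> borel_measurable borel" and T: "orthogonal_transformation T"
  shows "(LBINT x. f (T x)) = (LBINT x. f x)"
proof -
  have [measurable]: "T \<in> borel_measurable borel"
    by (intro borel_measurable_continuous_onI linear_continuous_on linear_conv_bounded_linear[THEN iffD1] orthogonal_transformation_linear[OF T])
  show ?thesis
    using integral_distr[of T lborel borel f] by (simp add: lborel_distr_orthogonal[OF T])
qed

lemma orthogonal_transformation_mapping:
  fixes a b :: "'a::euclidean_space"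
  assumes "norm a = norm b"
  obtains T where "orthogonal_transformation T" "T a = b"
proof (cases "a = b")
  case True
  then show ?thesis using that[of "\<lambda>x. x"] by simp
next
  case False
  \<comment> \<open>T is the reflection in the hyperplane orthogonal to a - b; for vectors of equal
    norm 2 (a . u) = u . u, which is why it maps a to b.\<close>
  define u where "u = a - b"
  have u0: "u \<bullet> u \<noteq> 0" using False by (simp add: u_def)
  define T where "T x = x - (2 * (x \<bullet> u) / (u \<bullet> u)) *\<^sub>R u" for x
  have "linear T" unfolding T_def
    by (rule linearI) (simp_all add: inner_add_left algebra_simps add_divide_distrib)
  moreover have "T x \<bullet> T y = x \<bullet> y" for x y
    unfolding T_def using u0 by (simp add: inner_diff_left inner_diff_right inner_commute field_simps)
  ultimately have "orthogonal_transformation T" by (simp add: orthogonal_transformation_def)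
  moreover have "T a = b"
  proof -
    have "a \<bullet> a = b \<bullet> b" using assms by (simp add: norm_eq)
    then have "2 * (a \<bullet> u) = u \<bullet> u"
      unfolding u_def by (simp add: inner_diff_left inner_diff_right inner_commute)
    then show ?thesis unfolding T_def using u0 by (simp add: u_def)
  qed
  ultimately show ?thesis by (rule that)
qed

section \<open>Gaussians and Fourier inversion\<close>

lemma gaussian_char:
  fixes t :: real
  shows "integrable lborel (\<lambda>x. exp (\<i> * complex_of_real (t * x)) * complex_of_real (exp (- x\<^sup>2 / 2)))" (is ?A)
    and "(LBINT x. exp (\<i> * complex_of_real (t * x)) * complex_of_real (exp (- x\<^sup>2 / 2)))
      = complex_of_real (sqrt (2 * pi) * exp (- t\<^sup>2 / 2))" (is ?B)
proof -
  have i: "integrable lborel (\<lambda>x::real. exp (- x\<^sup>2 / 2))"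
  proof -
    have "integrable lborel (\<lambda>x. sqrt (2 * pi) * std_normal_density x)"
      by (intro integrable_mult_right integrable_normal_density) simp
    then show ?thesis by (simp add: std_normal_density_def)
  qed
  show ?A
    by (rule Bochner_Integration.integrable_bound[OF i]) (auto simp: norm_mult)
  have "char std_normal_distribution t = (LBINT x. std_normal_density x *\<^sub>R exp (\<i> * complex_of_real (t * x)))"
    unfolding char_def by (subst integral_density) (auto simp: normal_density_nonneg)
  also have "\<dots> = (LBINT x. complex_of_real (1 / sqrt (2 * pi)) * (exp (\<i> * complex_of_real (t * x)) * complex_of_real (exp (- x\<^sup>2 / 2))))"
    by (intro Bochner_Integration.integral_cong) (auto simp: std_normal_density_def scaleR_conv_of_real)
  also have "\<dots> = complex_of_real (1 / sqrt (2 * pi)) * (LBINT x. (exp (\<i> * complex_of_real (t * x)) * complex_of_real (exp (- x\<^sup>2 / 2))))"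
    by (rule integral_mult_right_zero)
  finally show ?B
    using char_std_normal_distribution
    by (simp add: field_simps fun_eq_iff)
qed

text \<open>\<open>lborel\<close> is the image of a product of one-dimensional Lebesgue measures, so
  the integral factors into values of the characteristic function of the normal
  distribution.\<close>

lemma gaussian_fourier:
  fixes x :: "'a::euclidean_space"
  shows "integrable lborel (\<lambda>\<xi>. exp (ph \<xi> x) * complex_of_real (exp (- (norm \<xi>)\<^sup>2 / 2)))" (is ?A)
    and "(LINT \<xi>|lborel. exp (ph \<xi> x) * complex_of_real (exp (- (norm \<xi>)\<^sup>2 / 2)))
      = complex_of_real ((2 * pi) powr (DIM('a) / 2) * exp (- (norm x)\<^sup>2 / 2))" (is ?B)
proof -
  let ?h = "\<lambda>b t. exp (\<i> * complex_of_real ((x \<bullet> b) * t)) * complex_of_real (exp (- t\<^sup>2 / 2))"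
  let ?S = "\<lambda>f. \<Sum>b\<in>Basis. f b *\<^sub>R (b::'a)"
  let ?P = "\<Pi>\<^sub>M b\<in>(Basis::'a set). (lborel :: real measure)"
  have [measurable]: "?S \<in> ?P \<rightarrow>\<^sub>M borel"
    by measurable
  interpret product_sigma_finite "\<lambda>_::'a. lborel :: real measure" ..
  have sum_sq: "(norm v)\<^sup>2 = (\<Sum>b\<in>Basis. (v \<bullet> b)\<^sup>2)" for v :: 'a
    by (subst norm_eq_sqrt_inner, simp, subst euclidean_inner) (simp add: power2_eq_square)
  have eq: "exp (\<i> * complex_of_real (?S f \<bullet> x)) * complex_of_real (exp (- (norm (?S f))\<^sup>2 / 2)) = (\<Prod>b\<in>Basis. ?h b (f b))" for f
  proof -
    have 1: "?S f \<bullet> x = (\<Sum>b\<in>Basis. (x \<bullet> b) * f b)"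
      by (subst inner_sum_left) (simp add: inner_commute[of x] mult.commute)
    have 2: "(norm (?S f))\<^sup>2 = (\<Sum>b\<in>Basis. (f b)\<^sup>2)"
      by (simp add: sum_sq)
    have "exp (\<i> * complex_of_real (?S f \<bullet> x)) = (\<Prod>b\<in>Basis. exp (\<i> * complex_of_real ((x \<bullet> b) * f b)))"
      unfolding 1 of_real_sum sum_distrib_left by (rule exp_sum) simp
    moreover have "exp (- (norm (?S f))\<^sup>2 / 2) = (\<Prod>b\<in>Basis. exp (- (f b)\<^sup>2 / 2))"
      unfolding 2 sum_negf[symmetric] sum_divide_distrib by (rule exp_sum) simp
    ultimately show ?thesis by (simp add: prod.distrib)
  qed
  have int: "integrable ?P (\<lambda>f. \<Prod>b\<in>Basis. ?h b (f b))"
    by (rule product_integrable_prod) (simp, rule gaussian_char(1))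
  show ?A
    by (subst lborel_eq, subst integrable_distr_eq) (measurable, measurable, simp only: eq int)
  have "(LINT \<xi>|lborel. exp (ph \<xi> x) * complex_of_real (exp (- (norm \<xi>)\<^sup>2 / 2)))
     = integral\<^sup>L ?P (\<lambda>f. \<Prod>b\<in>Basis. ?h b (f b))"
    by (subst lborel_eq, subst integral_distr) (measurable, measurable, simp only: eq)
  also have "\<dots> = (\<Prod>b\<in>(Basis::'a set). complex_of_real (sqrt (2 * pi) * exp (- (x \<bullet> b)\<^sup>2 / 2)))"
    by (subst product_integral_prod) (simp, rule gaussian_char(1), simp only: gaussian_char(2))
  also have "\<dots> = complex_of_real (sqrt (2 * pi) ^ DIM('a) * exp (\<Sum>b\<in>(Basis::'a set). - (x \<bullet> b)\<^sup>2 / 2))"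
    by (simp add: exp_sum prod.distrib)
  also have "sqrt (2 * pi) ^ DIM('a) = (2 * pi) powr (DIM('a) / 2)"
    by (simp add: powr_half_sqrt[symmetric] powr_realpow[symmetric] powr_powr)
  also have "(\<Sum>b\<in>(Basis::'a set). - (x \<bullet> b)\<^sup>2 / 2) = - (norm x)\<^sup>2 / 2"
    by (simp add: sum_sq sum_negf sum_divide_distrib)
  finally show ?B .
qed

lemma gaussian_fourier_scaled:
  fixes x :: "'a::euclidean_space"
  assumes e: "0 < e"
  shows "integrable lborel (\<lambda>\<xi>. exp (ph \<xi> x) * complex_of_real (exp (- (norm (e *\<^sub>R \<xi>))\<^sup>2 / 2)))" (is ?A)
    and "(LINT \<xi>|lborel. exp (ph \<xi> x) * complex_of_real (exp (- (norm (e *\<^sub>R \<xi>))\<^sup>2 / 2)))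
      = complex_of_real ((2 * pi) powr (DIM('a) / 2) * exp (- (norm (x /\<^sub>R e))\<^sup>2 / 2) / e ^ DIM('a))" (is ?B)
proof -
  let ?g = "\<lambda>\<xi>. exp (ph \<xi> x) * complex_of_real (exp (- (norm (e *\<^sub>R \<xi>))\<^sup>2 / 2))"
  have eq: "?g (0 + (1/e) *\<^sub>R \<xi>) = exp (\<i> * complex_of_real (\<xi> \<bullet> (x /\<^sub>R e))) * complex_of_real (exp (- (norm \<xi>)\<^sup>2 / 2))" for \<xi>
  proof -
    have "e *\<^sub>R (0 + (1/e) *\<^sub>R \<xi>) = \<xi>" using e by simp
    moreover have "(0 + (1/e) *\<^sub>R \<xi>) \<bullet> x = \<xi> \<bullet> (x /\<^sub>R e)" by (simp add: divide_inverse)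
    ultimately show ?thesis by (simp only:)
  qed
  show ?A
    using e gaussian_fourier(1)[of "x /\<^sub>R e"]
    by (subst integrable_affine[where c="1/e" and t=0]) (auto simp only: eq, auto)
  have "(LINT \<xi>|lborel. ?g \<xi>) = \<bar>1/e\<bar> ^ DIM('a) *\<^sub>R (LINT \<xi>|lborel. ?g (0 + (1/e) *\<^sub>R \<xi>))"
    using e by (intro integral_affine) auto
  also have "\<dots> = complex_of_real ((2 * pi) powr (DIM('a) / 2) * exp (- (norm (x /\<^sub>R e))\<^sup>2 / 2) / e ^ DIM('a))"
    unfolding eq gaussian_fourier(2) using e by (simp add: scaleR_conv_of_real field_simps)
  finally show ?B .
qed

lemma fourier_lborel:
  assumes [measurable]: "g \<in> borel_measurable borel"
  shows "fourier g \<xi> = complex_of_real ((2 * pi) powr (- real DIM('a) / 2)) *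
     (LBINT x. exp (- \<i> * complex_of_real (\<xi> \<bullet> (x::'a::euclidean_space))) * g x)"
  unfolding fourier_def by (subst integral_completion) auto

lemma fourier_inv_lborel:
  assumes [measurable]: "g \<in> borel_measurable borel"
  shows "fourier_inv g x = complex_of_real ((2 * pi) powr (- real DIM('a) / 2)) *
     (LINT \<xi>|lborel. exp (ph (\<xi>::'a::euclidean_space) x) * g \<xi>)"
  unfolding fourier_inv_def by (subst integral_completion) auto

lemma fourier_measurable [measurable]:
  assumes [measurable]: "g \<in> borel_measurable borel"
  shows "fourier (g :: 'a::euclidean_space \<Rightarrow> complex) \<in> borel_measurable borel"
proof -
  have "(\<lambda>\<xi>. LBINT x. exp (- \<i> * complex_of_real (\<xi> \<bullet> (x::'a))) * g x) \<in> borel_measurable borel"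
    by (rule lborel.borel_measurable_lebesgue_integral) measurable
  then show ?thesis unfolding fourier_lborel[OF assms, abs_def] by measurable
qed

text \<open>Gaussian regularisation. Damping the inverse integral by a Gaussian of width 1/e makes
  the double integral absolutely convergent, and Fubini turns it into a Gaussian average of g around
  x at scale e. As e tends to 0, the damped integral converges because the transform is integrable,
  the average because g is bounded and continuous.\<close>

lemma fourier_inversion:
  fixes g :: "'a::euclidean_space \<Rightarrow> complex"
  assumes int: "integrable lborel g" and cont: "continuous_on UNIV g" and bd: "\<And>x. norm (g x) \<le> M"
    and intF: "integrable lborel (fourier g)"
  shows "fourier_inv (fourier g) x = g x"
proof -
  let ?n = "DIM('a)"
  have gm [measurable]: "g \<in> borel_measurable borel" using cont by (rule borel_measurable_continuous_onI)
  define e where "e n = 1 / real (Suc n)" for n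
  have e: "0 < e n" for n by (simp add: e_def)
  have e0: "e \<longlonglongrightarrow> 0" unfolding e_def by (rule LIMSEQ_Suc[OF lim_1_over_n])
  define c where "c = (2 * pi) powr (- real ?n / 2)"
  define d where "d = (2 * pi) powr (real ?n / 2)"
  have cd: "c * d = 1" unfolding c_def d_def by (simp add: powr_add[symmetric])
  let ?G = "\<lambda>n \<xi>. complex_of_real (exp (- (norm (e n *\<^sub>R \<xi>))\<^sup>2 / 2))"
  let ?I = "\<lambda>n. LINT \<xi>|lborel. exp (ph \<xi> x) * fourier g \<xi> * ?G n (\<xi>::'a)"
  have "?I \<longlonglongrightarrow> (LINT \<xi>|lborel. exp (ph \<xi> x) * fourier g \<xi>)"
  proof (rule integral_dominated_convergence[where w="\<lambda>\<xi>. norm (fourier g \<xi>)"])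
    show "AE \<xi> in lborel. (\<lambda>n. exp (ph \<xi> x) * fourier g \<xi> * ?G n \<xi>) \<longlonglongrightarrow> exp (ph \<xi> x) * fourier g \<xi>"
    proof (intro AE_I2)
      fix \<xi> :: 'a
      have "(\<lambda>n. exp (ph \<xi> x) * fourier g \<xi> * ?G n \<xi>) \<longlonglongrightarrow> exp (ph \<xi> x) * fourier g \<xi> * complex_of_real (exp (- (norm (0 *\<^sub>R \<xi>))\<^sup>2 / 2))"
        by (intro tendsto_intros e0) simp_all
      then show "(\<lambda>n. exp (ph \<xi> x) * fourier g \<xi> * ?G n \<xi>) \<longlonglongrightarrow> exp (ph \<xi> x) * fourier g \<xi>"
        by simp
    qed
    show "AE \<xi> in lborel. norm (exp (ph \<xi> x) * fourier g \<xi> * ?G n \<xi>) \<le> norm (fourier g \<xi>)" for n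
      by (intro AE_I2) (auto simp: norm_mult intro!: mult_left_le)
  qed (use intF in auto)
  moreover have "?I = (\<lambda>n. complex_of_real (c * d) * (LBINT z. g (x + e n *\<^sub>R z) * complex_of_real (exp (- (norm z)\<^sup>2 / 2))))"
  proof
    fix n
    let ?k = "\<lambda>\<xi> y. exp (\<i> * complex_of_real (\<xi> \<bullet> (x - y))) * ?G n \<xi> * g y"
    have k_int: "integrable lborel2 (case_prod ?k)"
    proof (rule lborel_pair.Fubini_integrable)
      show "integrable lborel (\<lambda>\<xi>. LBINT y. norm (case (\<xi>, y) of (\<xi>, y) \<Rightarrow> ?k \<xi> y))"
      proof -
        have "(\<lambda>\<xi>. LBINT y. norm (?k \<xi> y)) = (\<lambda>\<xi>. norm (?G n \<xi>) * (LBINT y. norm (g y)))"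
          by (intro ext) (simp add: norm_mult)
        moreover have "integrable lborel (\<lambda>\<xi>::'a. norm (?G n \<xi>))"
          using gaussian_fourier_scaled(1)[OF e, of "0::'a" n] by (intro integrable_norm) simp
        ultimately show ?thesis by simp
      qed
      show "AE \<xi> in lborel. integrable lborel (\<lambda>y. case (\<xi>, y) of (\<xi>, y) \<Rightarrow> ?k \<xi> y)"
      proof (intro AE_I2)
        fix \<xi> :: 'a
        show "integrable lborel (\<lambda>y. case (\<xi>, y) of (\<xi>, y) \<Rightarrow> ?k \<xi> y)"
          by (rule Bochner_Integration.integrable_bound[OF int]) (auto simp: norm_mult intro!: AE_I2 mult_left_le_one_le)
      qed
    qed measurable
    have "?I n = (LINT \<xi>|lborel. complex_of_real c * (LBINT y. ?k \<xi> y))"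
    proof (rule Bochner_Integration.integral_cong[OF refl])
      fix \<xi> :: 'a
      have "exp (ph \<xi> x) * fourier g \<xi> * ?G n \<xi>
        = complex_of_real c * ((exp (ph \<xi> x) * ?G n \<xi>) * (LBINT y. exp (- \<i> * complex_of_real (\<xi> \<bullet> y)) * g y))"
        unfolding fourier_lborel[OF gm] c_def by (simp add: mult_ac)
      also have "\<dots> = complex_of_real c * (LBINT y. (exp (ph \<xi> x) * ?G n \<xi>) * (exp (- \<i> * complex_of_real (\<xi> \<bullet> y)) * g y))"
        by (simp only: integral_mult_right_zero)
      also have "(\<lambda>y. (exp (ph \<xi> x) * ?G n \<xi>) * (exp (- \<i> * complex_of_real (\<xi> \<bullet> y)) * g y)) = ?k \<xi>"
        by (simp add: fun_eq_iff inner_diff_right right_diff_distrib exp_diff exp_minus field_simps)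
      finally show "exp (ph \<xi> x) * fourier g \<xi> * ?G n \<xi> = complex_of_real c * (LBINT y. ?k \<xi> y)" .
    qed
    also have "\<dots> = complex_of_real c * (LINT \<xi>|lborel. (LBINT y. ?k \<xi> y))"
      by (rule integral_mult_right_zero)
    also have "(LINT \<xi>|lborel. (LBINT y. ?k \<xi> y)) = (LBINT y. (LINT \<xi>|lborel. ?k \<xi> y))"
      by (rule lborel_pair.Fubini_integral[OF k_int, symmetric])
    also have "\<dots> = (LBINT y. complex_of_real (d * exp (- (norm ((x - y) /\<^sub>R e n))\<^sup>2 / 2) / e n ^ ?n) * g y)"
      by (intro Bochner_Integration.integral_cong refl) (simp only: integral_mult_left_zero gaussian_fourier_scaled(2)[OF e] d_def)
    also have "\<dots> = \<bar>e n\<bar> ^ ?n *\<^sub>R (LBINT z. complex_of_real (d * exp (- (norm ((x - (x + e n *\<^sub>R z)) /\<^sub>R e n))\<^sup>2 / 2) / e n ^ ?n) * g (x + e n *\<^sub>R z))"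
      using e[of n] by (intro integral_affine) auto
    also have "\<dots> = (LBINT z. complex_of_real d * (g (x + e n *\<^sub>R z) * complex_of_real (exp (- (norm z)\<^sup>2 / 2))))"
      using e[of n] by (subst integral_scaleR_right[symmetric]) (intro Bochner_Integration.integral_cong refl, simp add: scaleR_conv_of_real mult_ac)
    also have "\<dots> = complex_of_real d * (LBINT z. (g (x + e n *\<^sub>R z) * complex_of_real (exp (- (norm z)\<^sup>2 / 2))))"
      by (rule integral_mult_right_zero)
    finally show "?I n = complex_of_real (c * d) * (LBINT z. g (x + e n *\<^sub>R z) * complex_of_real (exp (- (norm z)\<^sup>2 / 2)))"
      by simp
  qed
  ultimately have A: "(\<lambda>n. LBINT z. g (x + e n *\<^sub>R z) * complex_of_real (exp (- (norm z)\<^sup>2 / 2))) \<longlonglongrightarrow> (LINT \<xi>|lborel. exp (ph \<xi> x) * fourier g \<xi>)"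
    by (simp add: cd)
  have B: "(\<lambda>n. LBINT z. g (x + e n *\<^sub>R z) * complex_of_real (exp (- (norm z)\<^sup>2 / 2))) \<longlonglongrightarrow> (LBINT z. g x * complex_of_real (exp (- (norm (z::'a))\<^sup>2 / 2)))"
  proof (rule integral_dominated_convergence[where w="\<lambda>z. M * exp (- (norm z)\<^sup>2 / 2)"])
    show "integrable lborel (\<lambda>z::'a. M * exp (- (norm z)\<^sup>2 / 2))"
      using integrable_norm[OF gaussian_fourier(1)[of "0::'a"]] by simp
    show "AE z in lborel. (\<lambda>n. g (x + e n *\<^sub>R z) * complex_of_real (exp (- (norm z)\<^sup>2 / 2))) \<longlonglongrightarrow> g x * complex_of_real (exp (- (norm z)\<^sup>2 / 2))"
    proof (intro AE_I2 tendsto_mult_right)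
      fix z :: 'a
      have "(\<lambda>n. x + e n *\<^sub>R z) \<longlonglongrightarrow> x + 0 *\<^sub>R z" by (intro tendsto_intros e0)
      then have "(\<lambda>n. x + e n *\<^sub>R z) \<longlonglongrightarrow> x" by simp
      then show "(\<lambda>n. g (x + e n *\<^sub>R z)) \<longlonglongrightarrow> g x"
        using cont by (intro continuous_on_tendsto_compose[of UNIV g]) auto
    qed
    show "AE z in lborel. norm (g (x + e n *\<^sub>R z) * complex_of_real (exp (- (norm z)\<^sup>2 / 2))) \<le> M * exp (- (norm z)\<^sup>2 / 2)" for n
      by (intro AE_I2) (simp add: norm_mult bd mult_right_mono)
  qed measurable
  have C: "(LBINT z. g x * complex_of_real (exp (- (norm (z::'a))\<^sup>2 / 2))) = g x * complex_of_real d"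
    using gaussian_fourier(2)[of "0::'a"] by (simp add: d_def del: of_real_exp)
  have "(LINT \<xi>|lborel. exp (ph \<xi> x) * fourier g \<xi>) = g x * complex_of_real d"
    using LIMSEQ_unique[OF A B] C by simp
  then have "fourier_inv (fourier g) x = complex_of_real c * (g x * complex_of_real d)"
    by (subst fourier_inv_lborel) (auto simp: c_def)
  also have "\<dots> = complex_of_real (c * d) * g x" by simp
  finally show ?thesis by (simp add: cd)
qed

subsection \<open>Symmetrised singular integrals\<close>

text \<open>Up to the constant \<open>symb_const\<close>, \<open>fL s\<close> is \<open>(-\<Delta>)\<^sup>s\<close>; the second difference replaces the principal value.\<close>
definition sdiff :: "('a::real_vector \<Rightarrow> 'b::real_vector) \<Rightarrow> 'a \<Rightarrow> 'a \<Rightarrow> 'b" where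
  "sdiff \<phi> x y = 2 *\<^sub>R \<phi> x - \<phi> (x + y) - \<phi> (x - y)"

definition kern :: "real \<Rightarrow> 'a::euclidean_space \<Rightarrow> real" where
  "kern s y = norm y powr (- real DIM('a) - 2 * s)"

definition fL :: "real \<Rightarrow> ('a::euclidean_space \<Rightarrow> 'b::{banach, second_countable_topology}) \<Rightarrow> 'a \<Rightarrow> 'b" where
  "fL s \<phi> x = (LBINT y. kern s y *\<^sub>R sdiff \<phi> x y)"

text \<open>R and M are explicit so that every bound for \<open>fL\<close> is linear in M with a
  factor depending on R and s alone. The quadratic bound on second differences stands in for two
  bounded derivatives and passes easily to translates, differences and Taylor remainders.\<close>

definition c2bd :: "real \<Rightarrow> real \<Rightarrow> ('a::euclidean_space \<Rightarrow> 'b::{banach, second_countable_topology}) \<Rightarrow> bool" where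
  "c2bd R M \<phi> \<longleftrightarrow> \<phi> \<in> borel_measurable borel \<and> 0 \<le> M \<and> (\<forall>x. norm (\<phi> x) \<le> M) \<and> (\<forall>x. R < norm x \<longrightarrow> \<phi> x = 0)
     \<and> (\<forall>x y. norm (sdiff \<phi> x y) \<le> M * (norm y)\<^sup>2)"

definition kern_mass :: "'a::euclidean_space itself \<Rightarrow> real \<Rightarrow> real" where
  "kern_mass _ s = (LBINT y. kern s (y::'a) * min 1 ((norm y)\<^sup>2))"

lemma c2bdD:
  assumes "c2bd R M \<phi>"
  shows "\<phi> \<in> borel_measurable borel" "0 \<le> M" "norm (\<phi> x) \<le> M" "R < norm x \<Longrightarrow> \<phi> x = 0"
    "norm (sdiff \<phi> x y) \<le> M * (norm y)\<^sup>2"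
  using assms by (auto simp: c2bd_def)

lemma kern_measurable [measurable]: "kern s \<in> borel_measurable borel"
  unfolding kern_def[abs_def] by measurable

lemma sdiff_measurable [measurable]:
  fixes \<phi> :: "'a::euclidean_space \<Rightarrow> 'b::{banach, second_countable_topology}"
  assumes [measurable]: "\<phi> \<in> borel_measurable borel" "f \<in> borel_measurable M" "g \<in> borel_measurable M"
  shows "(\<lambda>x. sdiff \<phi> (f x) (g x)) \<in> borel_measurable M"
  unfolding sdiff_def by measurable

lemma fL_measurable [measurable]:
  fixes \<phi> :: "'a::euclidean_space \<Rightarrow> 'b::{banach, second_countable_topology}"
  assumes [measurable]: "\<phi> \<in> borel_measurable borel"
  shows "fL s \<phi> \<in> borel_measurable borel"
  unfolding fL_def[abs_def] by (rule lborel.borel_measurable_lebesgue_integral) measurable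

lemma kern_nonneg [simp]: "0 \<le> kern s y"
  by (simp add: kern_def)

lemma kern_scale: "0 < t \<Longrightarrow> kern s (t *\<^sub>R y :: 'a::euclidean_space) = t powr (- real DIM('a) - 2 * s) * kern s y"
  by (simp add: kern_def powr_mult)

lemma kern_mass_integrable:
  assumes "0 < s" "s < 1"
  shows "integrable lborel (\<lambda>y::'a::euclidean_space. kern s y * min 1 ((norm y)\<^sup>2))"
  using nn_integral_kernel_finite[OF assms, where 'a='a]
  by (intro integrableI_bounded) (auto simp: kern_def abs_mult)

lemma c2bd_sdiff:
  assumes "c2bd R M \<phi>"
  shows "norm (sdiff \<phi> x y) \<le> 4 * M * min 1 ((norm y)\<^sup>2)"
proof -
  have "norm (sdiff \<phi> x y) \<le> norm (2 *\<^sub>R \<phi> x) + norm (\<phi> (x + y)) + norm (\<phi> (x - y))"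
    unfolding sdiff_def by (meson add_mono norm_triangle_ineq4 order_refl order_trans)
  also have "\<dots> \<le> 4 * M" using c2bdD(3)[OF assms, of x] c2bdD(3)[OF assms, of "x+y"] c2bdD(3)[OF assms, of "x-y"] by simp
  finally have 1: "norm (sdiff \<phi> x y) \<le> 4 * M" .
  have "M * (norm y)\<^sup>2 \<le> 4 * M * (norm y)\<^sup>2" using c2bdD(2)[OF assms] by (simp add: mult_right_mono)
  then have "norm (sdiff \<phi> x y) \<le> 4 * M * (norm y)\<^sup>2" using c2bdD(5)[OF assms, of x y] by linarith
  with 1 show ?thesis by (simp add: min_def)
qed

lemma c2bd_integrable:
  assumes s: "0 < s" "s < 1" and \<phi>: "c2bd R M \<phi>"
  shows "integrable lborel (\<lambda>y. kern s y *\<^sub>R sdiff \<phi> x y)"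
proof (rule Bochner_Integration.integrable_bound[OF integrable_mult_right[OF kern_mass_integrable[OF s], of "4 * M"]])
  note [measurable] = c2bdD(1)[OF \<phi>]
  show "(\<lambda>y. kern s y *\<^sub>R sdiff \<phi> x y) \<in> borel_measurable lborel" by measurable
  show "AE y in lborel. norm (kern s y *\<^sub>R sdiff \<phi> x y) \<le> norm (4 * M * (kern s y * min 1 ((norm y)\<^sup>2)))"
  proof (intro AE_I2)
    fix y
    have "norm (kern s y *\<^sub>R sdiff \<phi> x y) \<le> kern s y * (4 * M * min 1 ((norm y)\<^sup>2))"
      using mult_left_mono[OF c2bd_sdiff[OF \<phi>, of x y] kern_nonneg[of s y]] by simp
    also have "\<dots> = 4 * M * (kern s y * min 1 ((norm y)\<^sup>2))" by simp
    finally show "norm (kern s y *\<^sub>R sdiff \<phi> x y) \<le> norm (4 * M * (kern s y * min 1 ((norm y)\<^sup>2)))"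
      by (simp only: real_norm_def)
  qed
qed

lemma fL_le:
  assumes s: "0 < s" "s < 1" and \<phi>: "c2bd R M (\<phi> :: 'a::euclidean_space \<Rightarrow> 'b::{banach, second_countable_topology})"
  shows "norm (fL s \<phi> x) \<le> 4 * M * kern_mass TYPE('a) s"
proof -
  have "norm (fL s \<phi> x) \<le> (LBINT y. norm (kern s y *\<^sub>R sdiff \<phi> x y))"
    unfolding fL_def by (rule integral_norm_bound)
  also have "\<dots> \<le> (LBINT y. 4 * M * (kern s (y::'a) * min 1 ((norm y)\<^sup>2)))"
  proof (rule integral_mono)
    show "integrable lborel (\<lambda>y. norm (kern s y *\<^sub>R sdiff \<phi> x y))"
      by (rule integrable_norm[OF c2bd_integrable[OF s \<phi>]])
    show "integrable lborel (\<lambda>y. 4 * M * (kern s (y::'a) * min 1 ((norm y)\<^sup>2)))"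
      by (rule integrable_mult_right[OF kern_mass_integrable[OF s]])
    fix y show "norm (kern s y *\<^sub>R sdiff \<phi> x y) \<le> 4 * M * (kern s y * min 1 ((norm y)\<^sup>2))"
      using mult_left_mono[OF c2bd_sdiff[OF \<phi>, of x y] kern_nonneg[of s y]] by (simp add: mult_ac)
  qed
  also have "\<dots> = 4 * M * kern_mass TYPE('a) s" unfolding kern_mass_def by simp
  finally show ?thesis .
qed

lemma integrable_cball_bounded:
  fixes \<phi> :: "'a::euclidean_space \<Rightarrow> 'b::{banach, second_countable_topology}"
  assumes [measurable]: "\<phi> \<in> borel_measurable borel" and "\<And>x. norm (\<phi> x) \<le> M" "\<And>x. R < norm x \<Longrightarrow> \<phi> x = 0" "0 \<le> R"
  shows "integrable lborel \<phi>" "(LBINT x. norm (\<phi> x)) \<le> M * (unit_ball_vol DIM('a) * R ^ DIM('a))"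
proof -
  have i: "integrable lborel (\<lambda>x. M * indicator (cball (0::'a) R) x)"
    by (intro integrable_mult_right integrable_real_indicator) (simp, metis emeasure_lborel_cball_finite)
  have b: "norm (\<phi> x) \<le> M * indicator (cball (0::'a) R) x" for x
    using assms(2)[of x] assms(3)[of x] by (auto simp: indicator_def)
  show "integrable lborel \<phi>"
    by (rule Bochner_Integration.integrable_bound[OF i]) (auto intro!: AE_I2 order_trans[OF b])
  then have "(LBINT x. norm (\<phi> x)) \<le> (LBINT x. M * indicator (cball (0::'a) R) x)"
    by (intro integral_mono i integrable_norm b)
  also have "\<dots> = M * (unit_ball_vol DIM('a) * R ^ DIM('a))"
    using \<open>0 \<le> R\<close> by (simp add: content_cball)
  finally show "(LBINT x. norm (\<phi> x)) \<le> M * (unit_ball_vol DIM('a) * R ^ DIM('a))" .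
qed

lemma integral_translate:
  fixes f :: "'a::euclidean_space \<Rightarrow> 'b::{banach, second_countable_topology}"
  assumes [measurable]: "f \<in> borel_measurable borel"
  shows "(LBINT x. f (x + t)) = (LBINT x. f x)" "(LBINT x. f (t - x)) = (LBINT x. f x)"
    "(LBINT x. f (x - t)) = (LBINT x. f x)"
  using integral_affine[OF assms, of 1 t] integral_affine[OF assms, of "-1" t] integral_affine[OF assms, of 1 "-t"]
  by (simp_all add: add.commute)

lemma integrable_translate:
  fixes f :: "'a::euclidean_space \<Rightarrow> 'b::{banach, second_countable_topology}"
  assumes "integrable lborel f"
  shows "integrable lborel (\<lambda>x. f (x + t))" "integrable lborel (\<lambda>x. f (t - x))" "integrable lborel (\<lambda>x. f (x - t))"
proof -
  have m: "f \<in> borel_measurable borel" using assms by auto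
  show "integrable lborel (\<lambda>x. f (x + t))" "integrable lborel (\<lambda>x. f (t - x))" "integrable lborel (\<lambda>x. f (x - t))"
  using integrable_affine[OF m, of 1 t] integrable_affine[OF m, of "-1" t] integrable_affine[OF m, of 1 "-t"] assms
  by (simp_all add: add.commute)
qed

text \<open>Far from the support only shifts y of length at least |x|/2 contribute, and there the
  kernel is at most its value at length |x|/2. What remains is twice the L1 norm of the
  function.\<close>

lemma fL_far:
  assumes s: "0 < s" "s < 1" and \<phi>: "c2bd R M (\<phi> :: 'a::euclidean_space \<Rightarrow> 'b::{banach, second_countable_topology})"
    and R: "0 \<le> R" and x: "2 * R < norm x"
  shows "norm (fL s \<phi> x) \<le> (norm x / 2) powr (- real DIM('a) - 2 * s) * (2 * M * (unit_ball_vol DIM('a) * R ^ DIM('a)))"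
proof -
  note m [measurable] = c2bdD(1)[OF \<phi>]
  note I = integrable_cball_bounded[OF m c2bdD(3)[OF \<phi>] c2bdD(4)[OF \<phi>] R]
  let ?a = "(norm x / 2) powr (- real DIM('a) - 2 * s)"
  have x0: "\<phi> x = 0" using x R by (intro c2bdD(4)[OF \<phi>]) linarith
  have pw: "norm (kern s y *\<^sub>R sdiff \<phi> x y) \<le> ?a * (norm (\<phi> (x + y)) + norm (\<phi> (x - y)))" for y
  proof (cases "norm y < norm x / 2")
    case True
    have "norm x \<le> norm (x + y) + norm y" "norm x \<le> norm (x - y) + norm y"
      using norm_triangle_ineq4[of "x+y" y] norm_triangle_ineq[of "x-y" y] by auto
    then have "\<phi> (x + y) = 0" "\<phi> (x - y) = 0"
      using True x by (auto intro!: c2bdD(4)[OF \<phi>])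
    then show ?thesis by (simp add: sdiff_def x0)
  next
    case False
    have "kern s y \<le> ?a" unfolding kern_def using False x R s by (intro powr_mono2') auto
    moreover have "norm (sdiff \<phi> x y) \<le> norm (\<phi> (x + y)) + norm (\<phi> (x - y))"
      unfolding sdiff_def x0 using norm_triangle_ineq4[of "- \<phi> (x+y)" "\<phi> (x-y)"] by simp
    ultimately show ?thesis by (simp add: mult_mono)
  qed
  have i: "integrable lborel (\<lambda>y. norm (\<phi> (x + y)))" "integrable lborel (\<lambda>y. norm (\<phi> (x - y)))"
    using integrable_norm[OF integrable_translate(1)[OF I(1), of x]] integrable_norm[OF integrable_translate(2)[OF I(1), of x]]
    by (simp_all add: add.commute)
  have "norm (fL s \<phi> x) \<le> (LBINT y. norm (kern s y *\<^sub>R sdiff \<phi> x y))"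
    unfolding fL_def by (rule integral_norm_bound)
  also have "\<dots> \<le> (LBINT y. ?a * (norm (\<phi> (x + y)) + norm (\<phi> (x - y))))"
    by (rule integral_mono[OF integrable_norm[OF c2bd_integrable[OF s \<phi>]] _ pw]) (use i in auto)
  also have "\<dots> = ?a * (2 * (LBINT y. norm (\<phi> y)))"
    using i integral_translate(1)[of "\<lambda>y. norm (\<phi> y)" x] integral_translate(2)[of "\<lambda>y. norm (\<phi> y)" x]
    by (simp add: add.commute)
  also have "\<dots> \<le> ?a * (2 * (M * (unit_ball_vol DIM('a) * R ^ DIM('a))))"
    using I(2) by (intro mult_left_mono) auto
  finally show ?thesis by (simp add: mult_ac)
qed

text \<open>The decay is that of the weight in the definition of a solution, so the result can be
  integrated against \<open>\<psi>\<close>. One factor C serves all functions of the class; the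
  later estimates for \<open>theta\<close> and its derivatives insert different values of M.\<close>

lemma fL_bound:
  assumes s: "0 < s" "s < 1" and R: "1 \<le> R"
  obtains C where "0 < C" "\<And>(\<phi> :: 'a::euclidean_space \<Rightarrow> 'b::{banach, second_countable_topology}) M x. c2bd R M \<phi> \<Longrightarrow>
    norm (fL s \<phi> x) \<le> C * M * japanese x powr (- real DIM('a) - 2 * s)"
proof -
  let ?e = "- real DIM('a) - 2 * s"
  define K where "K = kern_mass TYPE('a) s"
  define v where "v = unit_ball_vol DIM('a) * R ^ DIM('a)"
  define A where "A = 4 * K / (1 + 2 * R) powr ?e"
  define B where "B = 4 powr (- ?e) * (2 * v)"
  have K0: "0 \<le> K" unfolding K_def kern_mass_def by (intro integral_nonneg_AE) auto
  have v0: "0 \<le> v" using R by (simp add: v_def)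
  have A0: "0 \<le> A" using K0 by (simp add: A_def)
  have B0: "0 \<le> B" using v0 by (simp add: B_def)
  show ?thesis
  proof (rule that[of "A + B + 1"])
    show "0 < A + B + 1" using A0 B0 by simp
    fix \<phi> :: "'a \<Rightarrow> 'b" and M x assume \<phi>: "c2bd R M \<phi>"
    have M0: "0 \<le> M" by (rule c2bdD(2)[OF \<phi>])
    show "norm (fL s \<phi> x) \<le> (A + B + 1) * M * japanese x powr ?e"
    proof (cases "2 * R < norm x")
      case True
      have n1: "1 \<le> norm x" using True R by linarith
      have "norm (fL s \<phi> x) \<le> (norm x / 2) powr ?e * (2 * M * v)"
        unfolding v_def using R by (intro fL_far[OF s \<phi> _ True]) auto
      also have "(norm x / 2) powr ?e \<le> (japanese x / 4) powr ?e"
        using japanese_le[of x] n1 s by (intro powr_mono2') (auto simp: less_imp_le)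
      also have "(japanese x / 4) powr ?e = 4 powr (- ?e) * japanese x powr ?e"
        by (subst powr_divide) (auto simp: less_imp_le powr_minus_divide simp del: minus_diff_eq)
      also have "4 powr (- ?e) * japanese x powr ?e * (2 * M * v) = B * M * japanese x powr ?e"
        by (simp add: B_def)
      also have "\<dots> \<le> (A + B + 1) * M * japanese x powr ?e"
        using A0 M0 by (intro mult_right_mono) auto
      finally show ?thesis using M0 v0 by (simp add: mult_right_mono)
    next
      case False
      have "japanese x \<le> 1 + 2 * R" using japanese_le[of x] False by linarith
      then have j: "(1 + 2 * R) powr ?e \<le> japanese x powr ?e"
        using s R by (intro powr_mono2') auto
      have p: "0 < (1 + 2 * R) powr ?e" using R by simp
      have "norm (fL s \<phi> x) \<le> 4 * M * K" unfolding K_def by (rule fL_le[OF s \<phi>])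
      also have "\<dots> = A * M * (1 + 2 * R) powr ?e" using p by (simp add: A_def)
      also have "\<dots> \<le> (A + B + 1) * M * japanese x powr ?e"
        using A0 B0 M0 j by (intro mult_mono) auto
      finally show ?thesis .
    qed
  qed
qed

lemma fL_diff:
  assumes "integrable lborel (\<lambda>y. kern s y *\<^sub>R sdiff \<phi> x y)" "integrable lborel (\<lambda>y. kern s y *\<^sub>R sdiff \<psi> x y)"
  shows "fL s (\<lambda>x. \<phi> x - \<psi> x) x = fL s \<phi> x - fL s \<psi> x"
proof -
  have "sdiff (\<lambda>x. \<phi> x - \<psi> x) x y = sdiff \<phi> x y - sdiff \<psi> x y" for y by (simp add: sdiff_def algebra_simps)
  then show ?thesis unfolding fL_def using assms by (simp add: scaleR_diff_right)
qed

lemma fL_shift: "fL s (\<lambda>x. \<phi> (x + w)) x = fL s \<phi> (x + w)"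
  unfolding fL_def sdiff_def by (simp add: algebra_simps)

lemma fL_reflect: "fL s (\<lambda>x. \<phi> (a - x)) x = fL s \<phi> (a - x)"
  unfolding fL_def sdiff_def by (simp add: algebra_simps)

lemma fL_scale:
  fixes \<phi> :: "'a::euclidean_space \<Rightarrow> 'b::{banach, second_countable_topology}"
  assumes [measurable]: "\<phi> \<in> borel_measurable borel" and t: "0 < t"
  shows "fL s (\<lambda>x. \<phi> (x /\<^sub>R t)) x = t powr (- 2 * s) *\<^sub>R fL s \<phi> (x /\<^sub>R t)"
proof -
  have "fL s (\<lambda>x. \<phi> (x /\<^sub>R t)) x = \<bar>t\<bar> ^ DIM('a) *\<^sub>R (LBINT y. kern s (0 + t *\<^sub>R y) *\<^sub>R sdiff (\<lambda>x. \<phi> (x /\<^sub>R t)) x (0 + t *\<^sub>R y))"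
    unfolding fL_def using t by (intro integral_affine) auto
  also have "(\<lambda>y. kern s (0 + t *\<^sub>R y) *\<^sub>R sdiff (\<lambda>x. \<phi> (x /\<^sub>R t)) x (0 + t *\<^sub>R y)) = (\<lambda>y. t powr (- real DIM('a) - 2 * s) *\<^sub>R (kern s y *\<^sub>R sdiff \<phi> (x /\<^sub>R t) y))"
    using t by (auto simp: fun_eq_iff kern_scale sdiff_def scaleR_add_right scaleR_diff_right)
  also have "(LBINT y. t powr (- real DIM('a) - 2 * s) *\<^sub>R (kern s y *\<^sub>R sdiff \<phi> (x /\<^sub>R t) y)) = t powr (- real DIM('a) - 2 * s) *\<^sub>R fL s \<phi> (x /\<^sub>R t)"
    unfolding fL_def by (rule integral_scaleR_right)
  finally show ?thesis using t
    by (simp add: powr_realpow[symmetric] powr_add[symmetric])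
qed

text \<open>This justifies Fubini in every pairing with \<open>fL\<close>. For fixed y the second
  difference lives in three balls of radius R, so its L1 norm in x is at most a multiple of
  \<open>min 1 ((norm y)\<^sup>2)\<close>, which the kernel integrates.\<close>

lemma sdiff_joint:
  assumes s: "0 < s" "s < 1" and \<phi>: "c2bd R M (\<phi> :: 'a::euclidean_space \<Rightarrow> 'b::{banach, second_countable_topology})" and R: "0 \<le> R"
  shows "integrable lborel2 (\<lambda>(y, x). kern s y *\<^sub>R sdiff \<phi> x y)"
proof -
  note m [measurable] = c2bdD(1)[OF \<phi>]
  note M0 = c2bdD(2)[OF \<phi>]
  note I = integrable_cball_bounded[OF m c2bdD(3)[OF \<phi>] c2bdD(4)[OF \<phi>] R]
  define S where "S y = cball 0 R \<union> cball (-y) R \<union> cball (y::'a) R" for y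
  define v where "v = unit_ball_vol DIM('a) * R ^ DIM('a)"
  have v0: "0 \<le> v" using R by (simp add: v_def)
  have Sm: "measure lborel (S y) \<le> 3 * v" "emeasure lborel (S y) < \<infinity>" for y
  proof -
    have "measure lborel (S y) \<le> measure lborel (cball (0::'a) R \<union> cball (-y) R) + measure lborel (cball (y::'a) R)"
      unfolding S_def by (rule measure_Un_le) auto
    also have "measure lborel (cball (0::'a) R \<union> cball (-y) R) \<le> measure lborel (cball (0::'a) R) + measure lborel (cball (-y) R)"
      by (rule measure_Un_le) auto
    finally show "measure lborel (S y) \<le> 3 * v"
      using R by (simp add: v_def content_cball)
    have "bounded (S y)" unfolding S_def by simp
    then show "emeasure lborel (S y) < \<infinity>" by (rule emeasure_bounded_finite)
  qed
  have [measurable]: "S y \<in> sets borel" for y unfolding S_def by simp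
  have sup: "norm (sdiff \<phi> x y) \<le> 4 * M * min 1 ((norm y)\<^sup>2) * indicator (S y) x" for x y
  proof (cases "x \<in> S y")
    case True then show ?thesis using c2bd_sdiff[OF \<phi>, of x y] by simp
  next
    case False
    then have "R < norm x" "R < norm (x + y)" "R < norm (x - y)"
      by (auto simp: S_def dist_norm norm_minus_commute add.commute)
    then show ?thesis using M0 by (simp add: sdiff_def c2bdD(4)[OF \<phi>])
  qed
  have i1: "integrable lborel (\<lambda>x. kern s y *\<^sub>R sdiff \<phi> x y)" for y
    unfolding sdiff_def
    using I(1) integrable_translate(1)[OF I(1), of y] integrable_translate(3)[OF I(1), of y] by auto
  have le: "(LBINT x. norm (kern s y *\<^sub>R sdiff \<phi> x y)) \<le> 12 * M * v * (kern s y * min 1 ((norm y)\<^sup>2))" for y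
  proof -
    have "(LBINT x. norm (kern s y *\<^sub>R sdiff \<phi> x y)) \<le> (LBINT x. kern s y * (4 * M * min 1 ((norm y)\<^sup>2)) * indicator (S y) x)"
    proof (rule integral_mono[OF integrable_norm[OF i1]])
      show "integrable lborel (\<lambda>x. kern s y * (4 * M * min 1 ((norm y)\<^sup>2)) * indicator (S y) x)"
        using Sm(2)[of y] by (intro integrable_mult_right integrable_real_indicator) auto
      show "norm (kern s y *\<^sub>R sdiff \<phi> x y) \<le> kern s y * (4 * M * min 1 ((norm y)\<^sup>2)) * indicator (S y) x" for x
        using mult_left_mono[OF sup[of x y] kern_nonneg[of s y]] by (simp add: mult_ac)
    qed
    also have "\<dots> = kern s y * (4 * M * min 1 ((norm y)\<^sup>2)) * measure lborel (S y)"
      by simp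
    also have "\<dots> \<le> kern s y * (4 * M * min 1 ((norm y)\<^sup>2)) * (3 * v)"
      using Sm(1) M0 by (intro mult_left_mono) auto
    finally show ?thesis by (simp add: mult_ac)
  qed
  show ?thesis
  proof (rule lborel_pair.Fubini_integrable)
  show "AE y in lborel. integrable lborel (\<lambda>x. case (y, x) of (y, x) \<Rightarrow> kern s y *\<^sub>R sdiff \<phi> x y)"
    using i1 by (intro AE_I2) simp
  show "integrable lborel (\<lambda>y. LBINT x. norm (case (y, x) of (y, x) \<Rightarrow> kern s y *\<^sub>R sdiff \<phi> x y))"
  proof (rule Bochner_Integration.integrable_bound[OF integrable_mult_right[OF kern_mass_integrable[OF s, where 'a='a], of "12 * M * v"]])
    show "AE y in lborel. norm (LBINT x. norm (case (y, x) of (y, x) \<Rightarrow> kern s y *\<^sub>R sdiff \<phi> x y)) \<le> norm (12 * M * v * (kern s y * min 1 ((norm y)\<^sup>2)))"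
    proof (intro AE_I2)
      fix y :: 'a
      have "0 \<le> 12 * M * v * (kern s y * min 1 ((norm y)\<^sup>2))" using M0 v0 by simp
      moreover have "0 \<le> (LBINT x. norm (kern s y *\<^sub>R sdiff \<phi> x y))" by (intro integral_nonneg_AE) auto
      ultimately show "norm (LBINT x. norm (case (y, x) of (y, x) \<Rightarrow> kern s y *\<^sub>R sdiff \<phi> x y)) \<le> norm (12 * M * v * (kern s y * min 1 ((norm y)\<^sup>2)))"
        using le[of y] by (simp only: prod.case real_norm_def abs_of_nonneg)
    qed
    show "(\<lambda>y. LBINT x. norm (case (y, x) of (y, x) \<Rightarrow> kern s y *\<^sub>R sdiff \<phi> x y)) \<in> borel_measurable lborel"
      by (rule lborel.borel_measurable_lebesgue_integral) measurable
  qed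
qed measurable
qed

lemma fL_integrable:
  assumes s: "0 < s" "s < 1" and \<phi>: "c2bd R M (\<phi> :: 'a::euclidean_space \<Rightarrow> 'b::{banach, second_countable_topology})" and R: "0 \<le> R"
  shows "integrable lborel (fL s \<phi>)"
  unfolding fL_def[abs_def] by (rule lborel_pair.integrable_snd[OF sdiff_joint[OF assms]])

lemma fL_pairing:
  fixes \<phi> g :: "'a::euclidean_space \<Rightarrow> 'b::{banach, second_countable_topology, real_normed_field}"
  assumes s: "0 < s" "s < 1" and \<phi>: "c2bd R M \<phi>" and R: "0 \<le> R"
    and [measurable]: "g \<in> borel_measurable borel" and g: "\<And>x. norm (g x) \<le> B"
  shows "(LBINT x. g x * fL s \<phi> x) = (LBINT y. kern s y *\<^sub>R (LBINT x. g x * sdiff \<phi> x y))"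
    "integrable lborel (\<lambda>x. g x * fL s \<phi> x)"
    "integrable lborel (\<lambda>y. kern s y *\<^sub>R (LBINT x. g x * sdiff \<phi> x y))"
proof -
  note m [measurable] = c2bdD(1)[OF \<phi>]
  have i: "integrable lborel2 (\<lambda>(y, x). g x * (kern s y *\<^sub>R sdiff \<phi> x y))"
  proof (rule Bochner_Integration.integrable_bound)
    show "integrable lborel2 (\<lambda>z. B *\<^sub>R (\<lambda>(y, x). kern s y *\<^sub>R sdiff \<phi> x y) z)"
      by (intro integrable_scaleR_right sdiff_joint[OF s \<phi> R])
    show "AE z in lborel \<Otimes>\<^sub>M lborel. norm ((\<lambda>(y, x). g x * (kern s y *\<^sub>R sdiff \<phi> x y)) z) \<le> norm (B *\<^sub>R (\<lambda>(y, x). kern s y *\<^sub>R sdiff \<phi> x y) z)"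
    proof (intro AE_I2, clarsimp simp: norm_mult)
      fix y x
      have "norm (g x) * (kern s y * norm (sdiff \<phi> x y)) \<le> \<bar>B\<bar> * (kern s y * norm (sdiff \<phi> x y))"
        using g[of x] by (intro mult_right_mono) auto
      then show "kern s y * (norm (g x) * norm (sdiff \<phi> x y)) \<le> \<bar>B\<bar> * (kern s y * norm (sdiff \<phi> x y))"
        by (simp only: mult.left_commute)
    qed
  qed measurable
  have "(LBINT x. g x * fL s \<phi> x) = (LBINT x. (LBINT y. g x * (kern s y *\<^sub>R sdiff \<phi> x y)))"
    unfolding fL_def by (simp only: integral_mult_right_zero)
  also have "\<dots> = (LBINT y. (LBINT x. g x * (kern s y *\<^sub>R sdiff \<phi> x y)))"
    by (rule lborel_pair.Fubini_integral[OF i])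
  also have "\<dots> = (LBINT y. kern s y *\<^sub>R (LBINT x. g x * sdiff \<phi> x y))"
    by simp
  finally show "(LBINT x. g x * fL s \<phi> x) = (LBINT y. kern s y *\<^sub>R (LBINT x. g x * sdiff \<phi> x y))" .
  show "integrable lborel (\<lambda>x. g x * fL s \<phi> x)"
    using lborel_pair.integrable_snd[OF i] unfolding fL_def by (simp only: integral_mult_right_zero)
  show "integrable lborel (\<lambda>y. kern s y *\<^sub>R (LBINT x. g x * sdiff \<phi> x y))"
    using lborel_pair.integrable_fst[OF i] by simp
qed

lemma c2bd_L1:
  assumes \<phi>: "c2bd R M (\<phi> :: 'a::euclidean_space \<Rightarrow> 'b::{banach, second_countable_topology})" and R: "0 \<le> R"
  shows "integrable lborel \<phi>"
  by (rule integrable_cball_bounded(1)[OF c2bdD(1)[OF \<phi>] c2bdD(3)[OF \<phi>] c2bdD(4)[OF \<phi>] R])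

text \<open>After Fubini each second difference integrates to 0 by translation invariance. This
  cancellation is the source of the decay of \<open>Theta\<close>.\<close>

lemma fL_integral_zero:
  fixes \<phi> :: "'a::euclidean_space \<Rightarrow> 'b::{banach, second_countable_topology, real_normed_field}"
  assumes s: "0 < s" "s < 1" and \<phi>: "c2bd R M \<phi>" and R: "0 \<le> R"
  shows "(LBINT x. fL s \<phi> x) = 0"
proof -
  note i = c2bd_L1[OF \<phi> R]
  have "(LBINT x. sdiff \<phi> x y) = 0" for y
    unfolding sdiff_def using i integrable_translate(1)[OF i, of y] integrable_translate(3)[OF i, of y]
      integral_translate(1)[OF c2bdD(1)[OF \<phi>], of y] integral_translate(3)[OF c2bdD(1)[OF \<phi>], of y]
    by (simp add: scaleR_2)
  then show ?thesis
    using fL_pairing(1)[OF s \<phi> R, of "\<lambda>_. 1" 1] by simp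
qed

text \<open>Translating by y moves one difference onto g and produces the polarised Gagliardo form,
  from which the sign of the pairing can be read off.\<close>

lemma fL_form:
  fixes \<phi> g :: "'a::euclidean_space \<Rightarrow> real"
  assumes s: "0 < s" "s < 1" and \<phi>: "c2bd R M \<phi>" and R: "0 \<le> R" and g: "c2bd R' M' g" and R': "0 \<le> R'"
  shows "(LBINT x. g x * fL s \<phi> x) = (LBINT y. kern s y * (LBINT x. (g x - g (x + y)) * (\<phi> x - \<phi> (x + y))))"
    "integrable lborel (\<lambda>y. kern s y * (LBINT x. (g x - g (x + y)) * (\<phi> x - \<phi> (x + y))))"
proof -
  note m [measurable] = c2bdD(1)[OF \<phi>] c2bdD(1)[OF g]
  have ig: "integrable lborel g" by (rule c2bd_L1[OF g R'])
  have bm: "integrable lborel (\<lambda>x. f x * h x)" if "integrable lborel f" "h \<in> borel_measurable borel" "\<And>x. \<bar>h x\<bar> \<le> B" for f h :: "'a \<Rightarrow> real" and B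
  proof (rule Bochner_Integration.integrable_bound[OF integrable_mult_right[OF that(1), of B]])
    show "AE x in lborel. norm (f x * h x) \<le> norm (B * f x)"
      using that(3) by (intro AE_I2) (auto simp: abs_mult mult.commute[of B] intro!: mult_left_mono order_trans[OF that(3)])
  qed (use that in measurable)
  have b\<phi>: "\<bar>\<phi> x\<bar> \<le> M" for x using c2bdD(3)[OF \<phi>, of x] by simp
  have eq: "(LBINT x. g x * sdiff \<phi> x y) = (LBINT x. (g x - g (x + y)) * (\<phi> x - \<phi> (x + y)))" for y
  proof -
    have i1: "integrable lborel (\<lambda>x. g x * \<phi> x)" "integrable lborel (\<lambda>x. g x * \<phi> (x + y))" "integrable lborel (\<lambda>x. g x * \<phi> (x - y))"
      "integrable lborel (\<lambda>x. g (x + y) * \<phi> x)" "integrable lborel (\<lambda>x. g (x + y) * \<phi> (x + y))"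
      by (rule bm[where B=M], use ig integrable_translate(1)[OF ig] b\<phi> in auto)+
    have t: "(LBINT x. g (x + y) * \<phi> x) = (LBINT x. g x * \<phi> (x - y))"
      using integral_translate(1)[of "\<lambda>x. g x * \<phi> (x - y)" y] by simp
    have t2: "(LBINT x. g (x + y) * \<phi> (x + y)) = (LBINT x. g x * \<phi> x)"
      using integral_translate(1)[of "\<lambda>x. g x * \<phi> x" y] by simp
    have "(LBINT x. g x * sdiff \<phi> x y) = (LBINT x. 2 * (g x * \<phi> x) - g x * \<phi> (x + y) - g x * \<phi> (x - y))"
      by (simp add: sdiff_def algebra_simps)
    also have "\<dots> = 2 * (LBINT x. g x * \<phi> x) - (LBINT x. g x * \<phi> (x + y)) - (LBINT x. g x * \<phi> (x - y))"
      using i1 by simp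
    also have "\<dots> = (LBINT x. g x * \<phi> x) - (LBINT x. g x * \<phi> (x + y)) - (LBINT x. g (x + y) * \<phi> x) + (LBINT x. g (x + y) * \<phi> (x + y))"
      using t t2 by simp
    also have "\<dots> = (LBINT x. g x * \<phi> x - g x * \<phi> (x + y) - g (x + y) * \<phi> x + g (x + y) * \<phi> (x + y))"
      using i1 by simp
    also have "\<dots> = (LBINT x. (g x - g (x + y)) * (\<phi> x - \<phi> (x + y)))"
      by (simp add: algebra_simps)
    finally show ?thesis .
  qed
  have gb: "\<And>x. norm (g x) \<le> M'" by (rule c2bdD(3)[OF g])
  show "(LBINT x. g x * fL s \<phi> x) = (LBINT y. kern s y * (LBINT x. (g x - g (x + y)) * (\<phi> x - \<phi> (x + y))))"
    "integrable lborel (\<lambda>y. kern s y * (LBINT x. (g x - g (x + y)) * (\<phi> x - \<phi> (x + y))))"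
    using fL_pairing(1,3)[OF s \<phi> R m(2) gb] by (simp_all add: eq)
qed

section \<open>The Fourier symbol of the singular integral\<close>

definition symb :: "real \<Rightarrow> 'a::euclidean_space \<Rightarrow> real" where
  "symb s \<xi> = (LBINT y. kern s y * (2 - 2 * cos (\<xi> \<bullet> y)))"

lemma fourier_fL:
  fixes \<phi> :: "'a::euclidean_space \<Rightarrow> complex"
  assumes s: "0 < s" "s < 1" and \<phi>: "c2bd R M \<phi>" and R: "0 \<le> R"
  shows "fourier (fL s \<phi>) \<xi> = complex_of_real (symb s \<xi>) * fourier \<phi> \<xi>"
proof -
  note m [measurable] = c2bdD(1)[OF \<phi>]
  note i = c2bd_L1[OF \<phi> R]
  let ?e = "\<lambda>x. exp (- \<i> * complex_of_real (\<xi> \<bullet> x))"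
  define F where "F = (LBINT x. ?e x * \<phi> x)"
  have ie: "integrable lborel (\<lambda>x. ?e x * f x)" if "integrable lborel f" for f
    by (rule Bochner_Integration.integrable_bound[OF that]) (use that in \<open>auto simp: norm_mult\<close>)
  have tr: "(LBINT x. ?e x * \<phi> (x + y)) = exp (ph \<xi> y) * F" for y
  proof -
    have "(LBINT x. ?e x * \<phi> (x + y)) = (LBINT x. ?e (x - y) * \<phi> x)"
      using integral_translate(1)[of "\<lambda>x. ?e (x - y) * \<phi> x" y] by simp
    also have "\<dots> = (LBINT x. exp (ph \<xi> y) * (?e x * \<phi> x))"
      by (simp add: inner_diff_right right_diff_distrib exp_diff exp_minus field_simps)
    finally show ?thesis by (simp add: F_def)
  qed
  have sd: "(LBINT x. ?e x * sdiff \<phi> x y) = complex_of_real (2 - 2 * cos (\<xi> \<bullet> y)) * F" for y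
  proof -
    have "(LBINT x. ?e x * sdiff \<phi> x y) = (LBINT x. 2 * (?e x * \<phi> x) - ?e x * \<phi> (x + y) - ?e x * \<phi> (x + - y))"
      by (simp add: sdiff_def algebra_simps scaleR_conv_of_real)
    also have "\<dots> = 2 * F - exp (ph \<xi> y) * F - exp (\<i> * complex_of_real (\<xi> \<bullet> - y)) * F"
      using ie[OF i] ie[OF integrable_translate(1)[OF i, of y]] ie[OF integrable_translate(1)[OF i, of "-y"]]
      by (simp add: tr[of y, simplified] tr[of "-y", simplified] F_def[simplified])
    also have "\<dots> = (2 - (exp (ph \<xi> y) + exp (- (ph \<xi> y)))) * F"
      by (simp add: algebra_simps)
    also have "exp (ph \<xi> y) + exp (- (ph \<xi> y)) = 2 * cos (complex_of_real (\<xi> \<bullet> y))"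
      by (simp add: cos_exp_eq)
    also have "cos (complex_of_real (\<xi> \<bullet> y)) = complex_of_real (cos (\<xi> \<bullet> y))" by (simp add: cos_of_real)
    finally show ?thesis by simp
  qed
  have "(LBINT x. ?e x * fL s \<phi> x) = (LBINT y. complex_of_real (kern s y * (2 - 2 * cos (\<xi> \<bullet> y))) * F)"
    by (subst fL_pairing(1)[OF s \<phi> R, of _ 1]) (auto simp: sd[simplified] scaleR_conv_of_real mult.assoc)
  also have "\<dots> = (LBINT y. complex_of_real (kern s y * (2 - 2 * cos (\<xi> \<bullet> y)))) * F"
    by (rule integral_mult_left_zero)
  also have "\<dots> = complex_of_real (symb s \<xi>) * F"
    unfolding symb_def by (simp only: integral_complex_of_real)
  finally show ?thesis
    by (subst (1 2) fourier_lborel) (auto simp: F_def mult_ac)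
qed

lemma symb_integrable:
  assumes s: "0 < s" "s < 1"
  shows "integrable lborel (\<lambda>y::'a::euclidean_space. kern s y * (2 - 2 * cos (\<xi> \<bullet> y)))"
proof (rule Bochner_Integration.integrable_bound[OF integrable_mult_right[OF kern_mass_integrable[OF s, where 'a='a], of "4 + (norm \<xi>)\<^sup>2"]])
  show "AE y::'a in lborel. norm (kern s y * (2 - 2 * cos (\<xi> \<bullet> y))) \<le> norm ((4 + (norm \<xi>)\<^sup>2) * (kern s y * min 1 ((norm y)\<^sup>2)))"
  proof (intro AE_I2)
    fix y :: 'a
    let ?a = "\<xi> \<bullet> y"
    have "2 - 2 * cos ?a = 4 * (sin (?a / 2))\<^sup>2"
      using cos_double_sin[of "?a/2"] by simp
    moreover have "(sin (?a / 2))\<^sup>2 \<le> (?a / 2)\<^sup>2"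
      using abs_sin_x_le_abs_x[of "?a/2"] by (metis abs_le_square_iff)
    ultimately have a: "2 - 2 * cos ?a \<le> ?a\<^sup>2" by (simp add: power_divide)
    have "?a\<^sup>2 \<le> (norm \<xi> * norm y)\<^sup>2"
      using Cauchy_Schwarz_ineq2[of \<xi> y] by (metis abs_le_square_iff abs_of_nonneg mult_nonneg_nonneg norm_ge_zero)
    then have 1: "2 - 2 * cos ?a \<le> (norm \<xi>)\<^sup>2 * (norm y)\<^sup>2" using a by (simp add: power_mult_distrib)
    have 2: "2 - 2 * cos ?a \<le> 4" using cos_ge_minus_one[of ?a] by linarith
    have 3: "0 \<le> 2 - 2 * cos ?a" by simp
    have "2 - 2 * cos ?a \<le> (4 + (norm \<xi>)\<^sup>2) * min 1 ((norm y)\<^sup>2)"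
    proof (cases "(norm y)\<^sup>2 \<le> 1")
      case True
      then show ?thesis using 1 by (simp add: min_def distrib_right) (smt (verit) zero_le_power2)
    next
      case False then show ?thesis using 2 by (simp add: min_def) (smt (verit) zero_le_power2)
    qed
    then show "norm (kern s y * (2 - 2 * cos ?a)) \<le> norm ((4 + (norm \<xi>)\<^sup>2) * (kern s y * min 1 ((norm y)\<^sup>2)))"
      using 3 by (simp add: abs_mult mult_left_mono mult.left_commute)
  qed
qed measurable

text \<open>The symbol is rotation invariant, so the choice of the basis vector is immaterial.\<close>
definition symb_const :: "'a::euclidean_space itself \<Rightarrow> real \<Rightarrow> real" where
  "symb_const _ s = symb s (SOME b. b \<in> (Basis::'a set))"

text \<open>A rotation carries the direction of \<xi> to a fixed basis vector, and the substitution
  of y / |\<xi>| for y takes out the power of |\<xi>|.\<close>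

lemma symb_eq:
  fixes \<xi> :: "'a::euclidean_space"
  assumes s: "0 < s" "s < 1"
  shows "symb s \<xi> = symb_const TYPE('a) s * norm \<xi> powr (2 * s)"
proof (cases "\<xi> = 0")
  case True then show ?thesis using s by (simp add: symb_def)
next
  case False
  define e where "e = (SOME b. b \<in> (Basis::'a set))"
  have eB: "e \<in> Basis" unfolding e_def by (rule someI_ex) (use nonempty_Basis in blast)
  define r where "r = norm \<xi>"
  have r: "0 < r" using False by (simp add: r_def)
  obtain T :: "'a \<Rightarrow> 'a" where T: "orthogonal_transformation T" "T e = \<xi> /\<^sub>R r"
    by (rule orthogonal_transformation_mapping[of e "\<xi> /\<^sub>R r"]) (use eB r in \<open>auto simp: r_def\<close>)
  have \<xi>T: "\<xi> = r *\<^sub>R T e" using T r by simp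
  have "symb s \<xi> = (LBINT y. kern s (T y) * (2 - 2 * cos (\<xi> \<bullet> T y)))"
    unfolding symb_def by (rule integral_orthogonal[OF _ T(1), symmetric]) measurable
  also have "\<dots> = (LBINT y. kern s y * (2 - 2 * cos (r * (e \<bullet> y))))"
    unfolding \<xi>T using T(1) by (simp add: kern_def orthogonal_transformation_norm orthogonal_transformation_def)
  also have "\<dots> = \<bar>1/r\<bar> ^ DIM('a) *\<^sub>R (LBINT y. kern s (0 + (1/r) *\<^sub>R y) * (2 - 2 * cos (r * (e \<bullet> (0 + (1/r) *\<^sub>R y)))))"
    using r by (intro integral_affine) auto
  also have "(\<lambda>y. kern s (0 + (1/r) *\<^sub>R y) * (2 - 2 * cos (r * (e \<bullet> (0 + (1/r) *\<^sub>R y))))) = (\<lambda>y. (1/r) powr (- real DIM('a) - 2 * s) * (kern s y * (2 - 2 * cos (e \<bullet> y))))"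
    using r kern_scale[of "1/r" s] by (auto simp: fun_eq_iff)
  also have "(LBINT y. (1/r) powr (- real DIM('a) - 2 * s) * (kern s y * (2 - 2 * cos (e \<bullet> y)))) = (1/r) powr (- real DIM('a) - 2 * s) * symb s e"
    unfolding symb_def by simp
  finally have "symb s \<xi> = (1/r) ^ DIM('a) * (1/r) powr (- real DIM('a) - 2 * s) * symb s e" using r by simp
  also have "(1/r) ^ DIM('a) * (1/r) powr (- real DIM('a) - 2 * s) = (1/r) powr (- (2 * s))"
    using r by (subst powr_realpow[symmetric]) (auto simp: powr_add[symmetric])
  also have "\<dots> = r powr (2 * s)" using r by (simp add: powr_divide powr_minus field_simps)
  finally show ?thesis by (simp add: symb_const_def e_def r_def)
qed

lemma symb_const_pos:
  assumes s: "0 < s" "s < 1"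
  shows "0 < symb_const TYPE('a::euclidean_space) s"
proof -
  define e where "e = (SOME b. b \<in> (Basis::'a set))"
  have eB: "e \<in> Basis" unfolding e_def by (rule someI_ex) (use nonempty_Basis in blast)
  let ?f = "\<lambda>y. kern s y * (2 - 2 * cos (e \<bullet> y))"
  have nn: "0 \<le> ?f y" for y by simp
  have "symb s e \<noteq> 0"
  proof
    assume "symb s e = 0"
    then have "AE y in lborel. ?f y = 0"
      unfolding symb_def using integral_nonneg_eq_0_iff_AE[OF symb_integrable[OF s, of e]] nn by auto
    \<comment> \<open>On this ball e . y lies strictly between 1/2 and 3/2, hence below pi, so the
      cosine stays below 1 and the integrand is positive.\<close>
    then have "AE y in lborel. y \<notin> ball e (1/2)"
    proof eventually_elim
      fix y assume y: "?f y = 0"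
      show "y \<notin> ball e (1/2)"
      proof
        assume "y \<in> ball e (1/2)"
        then have "norm (y - e) < 1/2" by (simp add: dist_norm norm_minus_commute)
        moreover have "\<bar>e \<bullet> (y - e)\<bar> \<le> norm (y - e)" using Cauchy_Schwarz_ineq2[of e "y - e"] eB by simp
        ultimately have "\<bar>e \<bullet> y - 1\<bar> < 1/2" using eB by (simp add: inner_diff_right)
        then have "0 < e \<bullet> y" "e \<bullet> y \<le> pi" using pi_gt3 by linarith+
        then have "cos (e \<bullet> y) < 1" "y \<noteq> 0" using cos_monotone_0_pi[of 0 "e \<bullet> y"] by auto
        with y show False by (simp add: kern_def)
      qed
    qed
    then have "ball e (1/2) \<in> null_sets lborel" by (subst (asm) AE_iff_null_sets[symmetric]) auto
    then have "emeasure lborel (ball e (1/2)) = 0" by auto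
    moreover have "0 < unit_ball_vol (real DIM('a)) * (1/2) ^ DIM('a)" by (intro mult_pos_pos) auto
    ultimately show False
      by (simp add: emeasure_ball ennreal_eq_0_iff not_le[symmetric])
  qed
  moreover have "0 \<le> symb s e" unfolding symb_def using nn by (intro integral_nonneg_AE) auto
  ultimately show ?thesis by (simp add: symb_const_def e_def[symmetric])
qed

section \<open>Derivatives of smooth functions with bounded support\<close>

definition dd :: "'a::euclidean_space \<Rightarrow> ('a \<Rightarrow> complex) \<Rightarrow> 'a \<Rightarrow> complex" where
  "dd v \<phi> = (\<lambda>x. frechet_derivative \<phi> (at x) v)"

text \<open>The radius is carried along because the constants depend on it; differentiation does not
  enlarge it.\<close>

definition smc :: "real \<Rightarrow> ('a::euclidean_space \<Rightarrow> complex) \<Rightarrow> bool" where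
  "smc R \<phi> \<longleftrightarrow> 0 \<le> R \<and> smooth_fun \<phi> \<and> (\<forall>x. R < norm x \<longrightarrow> \<phi> x = 0)"

lemma iter_deriv_dd: "iter_deriv vs (dd v \<phi>) = iter_deriv (vs @ [v]) \<phi>"
  by (induction vs) (simp_all add: dd_def)

lemma smc_diff:
  assumes "smc R \<phi>"
  shows "(\<phi> has_derivative (\<lambda>v. dd v \<phi> x)) (at x)"
proof -
  have "iter_deriv [] \<phi> differentiable (at x)" using assms unfolding smc_def smooth_fun_def by blast
  then show ?thesis unfolding dd_def by (simp add: frechet_derivative_works)
qed

lemma smc_dd:
  assumes "smc R \<phi>" shows "smc R (dd v \<phi>)"
  unfolding smc_def
proof (intro conjI allI impI)
  show "0 \<le> R" using assms by (simp add: smc_def)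
  show "smooth_fun (dd v \<phi>)" using assms unfolding smc_def smooth_fun_def iter_deriv_dd by blast
  fix x :: 'a assume x: "R < norm x"
  have "((\<lambda>x. 0) has_derivative (\<lambda>v. dd v \<phi> x)) (at x)"
  proof (rule has_derivative_transform_within_open[OF smc_diff[OF assms]])
    show "open {x. R < norm (x::'a)}" by (intro open_Collect_less continuous_intros)
    show "x \<in> {x. R < norm x}" using x by simp
    fix y :: 'a assume "y \<in> {x. R < norm x}" then show "\<phi> y = 0" using assms by (simp add: smc_def)
  qed
  then have "(\<lambda>v. dd v \<phi> x) = (\<lambda>v. 0)" by (rule has_derivative_unique) (rule has_derivative_const)
  then show "dd v \<phi> x = 0" by meson
qed

lemma smc_cont: "smc R \<phi> \<Longrightarrow> continuous_on UNIV \<phi>"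
  by (meson continuous_at_imp_continuous_on has_derivative_continuous smc_diff)

lemma smc_measurable: "smc R \<phi> \<Longrightarrow> \<phi> \<in> borel_measurable borel"
  by (rule borel_measurable_continuous_onI[OF smc_cont])

lemma smc_bounded:
  fixes \<phi> :: "'a::euclidean_space \<Rightarrow> complex"
  assumes "smc R \<phi>" obtains B where "0 < B" "\<And>x. norm (\<phi> x) \<le> B"
proof -
  have "compact (\<phi> ` cball 0 R)"
    by (intro compact_continuous_image continuous_on_subset[OF smc_cont[OF assms]]) auto
  then obtain B where B: "0 < B" "\<forall>y\<in>\<phi> ` cball 0 R. norm y \<le> B"
    using bounded_pos compact_imp_bounded by metis
  have "norm (\<phi> x) \<le> B" for x
  proof (cases "norm x \<le> R")
    case True then show ?thesis using B by auto
  next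
    case False then show ?thesis using assms B by (auto simp: smc_def)
  qed
  then show ?thesis using that B by blast
qed

lemma dd_linear: 
  assumes "smc R \<phi>" shows "linear (\<lambda>v. dd v \<phi> x)"
  using smc_diff[OF assms] has_derivative_linear by blast

lemma dd_sum:
  fixes \<phi> :: "'a::euclidean_space \<Rightarrow> complex"
  assumes "smc R \<phi>" shows "dd w \<phi> x = (\<Sum>b\<in>Basis. (w \<bullet> b) *\<^sub>R dd b \<phi> x)"
proof -
  have "dd w \<phi> x = dd (\<Sum>b\<in>Basis. (w \<bullet> b) *\<^sub>R b) \<phi> x" by (simp add: euclidean_representation)
  also have "\<dots> = (\<Sum>b\<in>Basis. (w \<bullet> b) *\<^sub>R dd b \<phi> x)"
    by (simp only: linear_sum[OF dd_linear[OF assms]] linear_scale[OF dd_linear[OF assms]])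
  finally show ?thesis .
qed

lemma line_bound:
  fixes u :: "real \<Rightarrow> 'b::real_normed_vector"
  assumes "\<And>\<tau>. 0 \<le> \<tau> \<Longrightarrow> \<tau> \<le> 1 \<Longrightarrow> (u has_vector_derivative u' \<tau>) (at \<tau>)"
    and "\<And>\<tau>. 0 \<le> \<tau> \<Longrightarrow> \<tau> \<le> 1 \<Longrightarrow> norm (u' \<tau>) \<le> B"
  shows "norm (u 1 - u 0) \<le> B"
proof -
  have "norm (u 1 - u 0) \<le> B * norm (1 - 0 :: real)"
  proof (rule differentiable_bound[where S="{0..1}" and f'="\<lambda>\<tau> h. h *\<^sub>R u' \<tau>"])
    fix \<tau> :: real assume \<tau>: "\<tau> \<in> {0..1}"
    show "(u has_derivative (\<lambda>h. h *\<^sub>R u' \<tau>)) (at \<tau> within {0..1})"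
      using assms(1)[of \<tau>] \<tau> by (auto simp: has_vector_derivative_def intro: has_derivative_at_withinI)
    show "onorm (\<lambda>h. h *\<^sub>R u' \<tau>) \<le> B"
    proof (rule onorm_bound)
      show "0 \<le> B" using assms(2)[of \<tau>] \<tau> norm_ge_zero order_trans by (metis atLeastAtMost_iff)
      fix h :: real
      show "norm (h *\<^sub>R u' \<tau>) \<le> B * norm h" using assms(2)[of \<tau>] \<tau> by (simp add: mult.commute[of B] mult_left_mono)
    qed
  qed auto
  then show ?thesis by simp
qed

lemma smc_line:
  assumes "smc R \<phi>"
  shows "((\<lambda>\<tau>. \<phi> (x + \<tau> *\<^sub>R w)) has_vector_derivative dd w \<phi> (x + \<tau> *\<^sub>R w)) (at \<tau>)"
proof -
  have "((\<lambda>\<tau>. x + \<tau> *\<^sub>R w) has_derivative (\<lambda>h. h *\<^sub>R w)) (at \<tau>)"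
    by (auto intro!: derivative_eq_intros)
  then have "((\<lambda>\<tau>. \<phi> (x + \<tau> *\<^sub>R w)) has_derivative (\<lambda>h. dd (h *\<^sub>R w) \<phi> (x + \<tau> *\<^sub>R w))) (at \<tau>)"
    by (rule has_derivative_compose[OF _ smc_diff[OF assms]])
  then show ?thesis by (simp add: has_vector_derivative_def linear_scale[OF dd_linear[OF assms]])
qed

lemma smc_dd_le:
  fixes \<phi> :: "'a::euclidean_space \<Rightarrow> complex"
  assumes "smc R \<phi>" obtains B where "0 < B" "\<And>w x. norm (dd w \<phi> x) \<le> B * norm w"
proof -
  have "\<exists>B>0. \<forall>x. norm (dd b \<phi> x) \<le> B" for b using smc_bounded[OF smc_dd[OF assms, of b]] by metis
  then obtain B where B: "\<And>b. 0 < B b" "\<And>b x. norm (dd b \<phi> x) \<le> B b" by metis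
  show ?thesis
  proof (rule that)
    show "0 < (\<Sum>b\<in>(Basis::'a set). B b)" using B(1) by (intro sum_pos) auto
    fix w x :: 'a
    have "norm (dd w \<phi> x) \<le> (\<Sum>b\<in>(Basis::'a set). norm w * B b)"
      unfolding dd_sum[OF assms, of w]
    proof (rule sum_norm_le)
      fix b :: 'a assume "b \<in> Basis"
      then have "\<bar>w \<bullet> b\<bar> \<le> norm w" by (rule Basis_le_norm)
      then show "norm ((w \<bullet> b) *\<^sub>R dd b \<phi> x) \<le> norm w * B b"
        using B by (simp add: mult_mono)
    qed
    then show "norm (dd w \<phi> x) \<le> (\<Sum>b\<in>(Basis::'a set). B b) * norm w"
      unfolding sum_distrib_right by (simp only: mult.commute)
  qed
qed

lemma smc_lip:
  assumes "smc R \<phi>" and "\<And>w x. norm (dd w \<phi> x) \<le> B * norm w"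
  shows "norm (\<phi> (x + w) - \<phi> x) \<le> B * norm w"
  using line_bound[OF smc_line[OF assms(1)] assms(2), of x w] by simp

lemma smc_c2bd:
  fixes \<phi> :: "'a::euclidean_space \<Rightarrow> complex"
  assumes sm: "smc R \<phi>" obtains M where "0 < M" "c2bd R M \<phi>"
proof -
  obtain A where A: "0 < A" "\<And>x. norm (\<phi> x) \<le> A" using smc_bounded[OF sm] by blast
  have "\<exists>B>0. \<forall>w x. norm (dd w (dd b \<phi>) x) \<le> B * norm w" for b
    using smc_dd_le[OF smc_dd[OF sm, of b]] by metis
  then obtain B where B: "\<And>b. 0 < B b" "\<And>b w x. norm (dd w (dd b \<phi>) x) \<le> B b * norm w" by metis
  define C where "C = (\<Sum>b\<in>(Basis::'a set). B b)"
  have C0: "0 \<le> C" unfolding C_def using B(1) by (intro sum_nonneg) (simp add: less_imp_le)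
  have lip: "norm (dd w \<phi> a - dd w \<phi> b) \<le> C * norm w * norm (a - b)" for w a b
  proof -
    have "dd w \<phi> a - dd w \<phi> b = (\<Sum>i\<in>Basis. (w \<bullet> i) *\<^sub>R (dd i \<phi> a - dd i \<phi> b))"
      unfolding dd_sum[OF sm, of w] by (simp add: sum_subtractf scaleR_diff_right)
    also have "norm \<dots> \<le> (\<Sum>i\<in>(Basis::'a set). (norm w * norm (a - b)) * B i)"
    proof (rule sum_norm_le)
      fix i :: 'a assume "i \<in> Basis"
      then have 1: "\<bar>w \<bullet> i\<bar> \<le> norm w" by (rule Basis_le_norm)
      have 2: "norm (dd i \<phi> a - dd i \<phi> b) \<le> B i * norm (a - b)"
        using smc_lip[OF smc_dd[OF sm] B(2), of i b "a - b"] by simp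
      have "norm ((w \<bullet> i) *\<^sub>R (dd i \<phi> a - dd i \<phi> b)) \<le> norm w * (B i * norm (a - b))"
        using 1 2 by (simp add: mult_mono)
      then show "norm ((w \<bullet> i) *\<^sub>R (dd i \<phi> a - dd i \<phi> b)) \<le> (norm w * norm (a - b)) * B i" by (simp add: mult_ac)
    qed
    finally show ?thesis by (simp add: C_def sum_distrib_left sum_distrib_right mult_ac)
  qed
  have sd: "norm (sdiff \<phi> x y) \<le> 2 * C * (norm y)\<^sup>2" for x y
  proof -
    \<comment> \<open>Differentiating the symmetric sum along the segment leaves a difference of
      first derivatives at points 2 \<tau> |y| apart. The Lipschitz bound \<open>lip\<close> makes
      it quadratic in |y|.\<close>
    let ?u = "\<lambda>\<tau>. \<phi> (x + \<tau> *\<^sub>R y) + \<phi> (x + \<tau> *\<^sub>R (- y))"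
    let ?u' = "\<lambda>\<tau>. dd y \<phi> (x + \<tau> *\<^sub>R y) + dd (- y) \<phi> (x + \<tau> *\<^sub>R (- y))"
    have "norm (?u 1 - ?u 0) \<le> 2 * C * (norm y)\<^sup>2"
    proof (rule line_bound[where u' = ?u'])
      fix \<tau> :: real assume \<tau>: "0 \<le> \<tau>" "\<tau> \<le> 1"
      show "(?u has_vector_derivative ?u' \<tau>) (at \<tau>)"
        by (intro has_vector_derivative_add smc_line[OF sm])
      have "dd (- y) \<phi> z = - dd y \<phi> z" for z using linear_neg[OF dd_linear[OF sm]] by blast
      then have "?u' \<tau> = dd y \<phi> (x + \<tau> *\<^sub>R y) - dd y \<phi> (x + \<tau> *\<^sub>R (- y))" by simp
      also have "norm \<dots> \<le> C * norm y * norm ((x + \<tau> *\<^sub>R y) - (x + \<tau> *\<^sub>R (- y)))" by (rule lip)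
      also have "(x + \<tau> *\<^sub>R y) - (x + \<tau> *\<^sub>R (- y)) = (2 * \<tau>) *\<^sub>R y" by (simp add: scaleR_2[symmetric])
      also have "C * norm y * norm ((2 * \<tau>) *\<^sub>R y) \<le> C * norm y * (2 * norm y)"
        using \<tau> C0 by (intro mult_left_mono) (auto intro: mult_left_le_one_le)
      finally show "norm (?u' \<tau>) \<le> 2 * C * (norm y)\<^sup>2" by (simp add: power2_eq_square mult_ac)
    qed
    moreover have "?u 1 - ?u 0 = - sdiff \<phi> x y" by (simp add: sdiff_def scaleR_2 algebra_simps)
    ultimately show ?thesis by simp
  qed
  have "c2bd R (A + 2 * C) \<phi>"
    unfolding c2bd_def
  proof (intro conjI allI impI)
    show "\<phi> \<in> borel_measurable borel" by (rule smc_measurable[OF sm])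
    show "0 \<le> A + 2 * C" using A C0 by simp
    fix x y :: 'a show "norm (\<phi> x) \<le> A + 2 * C" using A(2)[of x] C0 by simp
    have "0 \<le> A * (norm y)\<^sup>2" using A by simp
    then show "norm (sdiff \<phi> x y) \<le> (A + 2 * C) * (norm y)\<^sup>2" using sd[of x y] by (simp add: distrib_right)
  next
    fix x :: 'a assume "R < norm x" then show "\<phi> x = 0" using sm by (simp add: smc_def)
  qed
  then show ?thesis using that[of "A + 2 * C"] A C0 by simp
qed

lemma sdiff_sum: "sdiff (\<lambda>x. \<Sum>b\<in>A. c b *\<^sub>R f b x) x y = (\<Sum>b\<in>A. c b *\<^sub>R sdiff (f b) x y)"
  by (induction A rule: infinite_finite_induct) (auto simp: sdiff_def algebra_simps)

text \<open>A directional derivative is the combination of the partial derivatives with the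
  coordinates of w as coefficients; this form keeps all constants linear in |w|.\<close>

lemma c2bd_basis_sum:
  fixes f :: "'a::euclidean_space \<Rightarrow> 'a \<Rightarrow> complex"
  assumes "\<And>b. b \<in> Basis \<Longrightarrow> c2bd R (M b * k) (f b)" "\<And>b. b \<in> Basis \<Longrightarrow> 0 \<le> M b" "0 \<le> k"
  shows "c2bd R ((\<Sum>b\<in>Basis. M b) * k * norm w) (\<lambda>x. \<Sum>b\<in>Basis. (w \<bullet> b) *\<^sub>R f b x)"
  unfolding c2bd_def
proof (intro conjI allI impI)
  show "(\<lambda>x. \<Sum>b\<in>Basis. (w \<bullet> b) *\<^sub>R f b x) \<in> borel_measurable borel"
    using c2bdD(1)[OF assms(1)] by (intro borel_measurable_sum borel_measurable_scaleR) auto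
  show "0 \<le> (\<Sum>b\<in>Basis. M b) * k * norm w"
    using assms by (intro mult_nonneg_nonneg sum_nonneg) auto
  have gen: "norm (\<Sum>b\<in>Basis. (w \<bullet> b) *\<^sub>R g b) \<le> (\<Sum>b\<in>Basis. M b) * k * norm w * m"
    if "\<And>b. b \<in> Basis \<Longrightarrow> norm (g b) \<le> M b * k * m" "0 \<le> m" for g :: "'a \<Rightarrow> complex" and m
  proof -
    have "norm (\<Sum>b\<in>Basis. (w \<bullet> b) *\<^sub>R g b) \<le> (\<Sum>b\<in>(Basis::'a set). norm w * (M b * k * m))"
    proof (rule sum_norm_le)
      fix b :: 'a assume b: "b \<in> Basis"
      then have "\<bar>w \<bullet> b\<bar> \<le> norm w" by (rule Basis_le_norm)
      then show "norm ((w \<bullet> b) *\<^sub>R g b) \<le> norm w * (M b * k * m)"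
        using that(1)[OF b] by (simp add: mult_mono)
    qed
    also have "\<dots> = (\<Sum>b\<in>Basis. M b) * k * norm w * m"
      by (simp add: sum_distrib_left sum_distrib_right mult_ac)
    finally show ?thesis .
  qed
  fix x y :: 'a
  show "norm (\<Sum>b\<in>Basis. (w \<bullet> b) *\<^sub>R f b x) \<le> (\<Sum>b\<in>Basis. M b) * k * norm w"
    using gen[of "\<lambda>b. f b x" 1] c2bdD(3)[OF assms(1)] by simp
  show "norm (sdiff (\<lambda>x. \<Sum>b\<in>Basis. (w \<bullet> b) *\<^sub>R f b x) x y) \<le> (\<Sum>b\<in>Basis. M b) * k * norm w * (norm y)\<^sup>2"
    unfolding sdiff_sum using c2bdD(5)[OF assms(1)] by (intro gen) auto
next
  fix x :: 'a assume "R < norm x"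
  then show "(\<Sum>b\<in>Basis. (w \<bullet> b) *\<^sub>R f b x) = 0" using c2bdD(4)[OF assms(1)] by (intro sum.neutral) auto
qed

lemma smc_c2bd_dd:
  fixes \<phi> :: "'a::euclidean_space \<Rightarrow> complex"
  assumes sm: "smc R \<phi>" obtains M where "0 < M" "\<And>w. c2bd R (M * norm w) (dd w \<phi>)"
proof -
  have "\<exists>M>0. c2bd R M (dd b \<phi>)" for b using smc_c2bd[OF smc_dd[OF sm]] by metis
  then obtain M where M: "\<And>b. 0 < M b" "\<And>b. c2bd R (M b) (dd b \<phi>)" by metis
  show ?thesis
  proof (rule that)
    show "0 < (\<Sum>b\<in>(Basis::'a set). M b)" using M by (intro sum_pos) auto
    fix w :: 'a
    have "dd w \<phi> = (\<lambda>x. \<Sum>b\<in>Basis. (w \<bullet> b) *\<^sub>R dd b \<phi> x)" using dd_sum[OF sm] by blast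
    then show "c2bd R ((\<Sum>b\<in>(Basis::'a set). M b) * norm w) (dd w \<phi>)"
      using c2bd_basis_sum[of R M 1 "\<lambda>b. dd b \<phi>" w] M by (simp add: less_imp_le)
  qed
qed

lemma dd_dd_sum:
  fixes \<phi> :: "'a::euclidean_space \<Rightarrow> complex"
  assumes sm: "smc R \<phi>"
  shows "dd u (dd w \<phi>) = (\<lambda>x. \<Sum>b\<in>Basis. (w \<bullet> b) *\<^sub>R dd u (dd b \<phi>) x)"
proof
  fix x
  have "((\<lambda>x. \<Sum>b\<in>Basis. (w \<bullet> b) *\<^sub>R dd b \<phi> x) has_derivative (\<lambda>u. \<Sum>b\<in>Basis. (w \<bullet> b) *\<^sub>R dd u (dd b \<phi>) x)) (at x)"
    by (intro has_derivative_sum has_derivative_scaleR_right smc_diff[OF smc_dd[OF sm]])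
  then have "(dd w \<phi> has_derivative (\<lambda>u. \<Sum>b\<in>Basis. (w \<bullet> b) *\<^sub>R dd u (dd b \<phi>) x)) (at x)"
    using dd_sum[OF sm] by (metis (no_types, lifting) ext)
  with smc_diff[OF smc_dd[OF sm]] have "(\<lambda>u. dd u (dd w \<phi>) x) = (\<lambda>u. \<Sum>b\<in>Basis. (w \<bullet> b) *\<^sub>R dd u (dd b \<phi>) x)"
    by (rule has_derivative_unique)
  then show "dd u (dd w \<phi>) x = (\<Sum>b\<in>Basis. (w \<bullet> b) *\<^sub>R dd u (dd b \<phi>) x)" by meson
qed

lemma smc_c2bd_dd2:
  fixes \<phi> :: "'a::euclidean_space \<Rightarrow> complex"
  assumes sm: "smc R \<phi>" obtains M where "0 < M" "\<And>u w. c2bd R (M * norm u * norm w) (dd u (dd w \<phi>))"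
proof -
  have "\<exists>M>0. \<forall>w. c2bd R (M * norm w) (dd w (dd b \<phi>))" for b using smc_c2bd_dd[OF smc_dd[OF sm]] by metis
  then obtain M where M: "\<And>b. 0 < M b" "\<And>b w. c2bd R (M b * norm w) (dd w (dd b \<phi>))" by metis
  show ?thesis
  proof (rule that)
    show "0 < (\<Sum>b\<in>(Basis::'a set). M b)" using M by (intro sum_pos) auto
    fix u w :: 'a
    show "c2bd R ((\<Sum>b\<in>(Basis::'a set). M b) * norm u * norm w) (dd u (dd w \<phi>))"
      by (subst dd_dd_sum[OF sm]) (use c2bd_basis_sum[of R M "norm u" "\<lambda>b. dd u (dd b \<phi>)" w] M in \<open>simp add: less_imp_le\<close>)
  qed
qed

lemma has_vector_derivative_sdiff:
  assumes "\<And>z. ((\<lambda>\<tau>. f \<tau> z) has_vector_derivative f' z) (at \<tau>)"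
  shows "((\<lambda>\<tau>. sdiff (f \<tau>) x y) has_vector_derivative sdiff f' x y) (at \<tau>)"
  unfolding sdiff_def
  by (intro has_vector_derivative_diff assms bounded_linear.has_vector_derivative[OF bounded_linear_scaleR_right])

lemma sdiff_minus [simp]: "sdiff (\<lambda>x. f x - g x) x y = sdiff f x y - sdiff g x y"
  by (simp add: sdiff_def algebra_simps)

text \<open>The mean value inequality inside the class \<open>c2bd\<close>: taking second
  differences commutes with differentiating in \<tau>, so the size and the second differences are
  both controlled by the \<tau>-derivative. Applied to translations it yields differences of
  translates and Taylor remainders with constants of first and second order in the shift.\<close>

lemma c2bd_line:
  fixes F :: "real \<Rightarrow> 'a::euclidean_space \<Rightarrow> complex"
  assumes d: "\<And>\<tau> z. 0 \<le> \<tau> \<Longrightarrow> \<tau> \<le> 1 \<Longrightarrow> ((\<lambda>\<tau>. F \<tau> z) has_vector_derivative F' \<tau> z) (at \<tau>)"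
    and b: "\<And>\<tau>. 0 \<le> \<tau> \<Longrightarrow> \<tau> \<le> 1 \<Longrightarrow> c2bd R M (F' \<tau>)"
    and m: "F 0 \<in> borel_measurable borel" "F 1 \<in> borel_measurable borel"
    and z: "\<And>z. R < norm z \<Longrightarrow> F 1 z - F 0 z = 0"
  shows "c2bd R M (\<lambda>z. F 1 z - F 0 z)"
  unfolding c2bd_def
proof (intro conjI allI impI)
  show "(\<lambda>z. F 1 z - F 0 z) \<in> borel_measurable borel" using m by measurable
  show "0 \<le> M" using c2bdD(2)[OF b[of 0]] by simp
  fix x y
  show "norm (F 1 x - F 0 x) \<le> M"
    by (rule line_bound[where u'="\<lambda>\<tau>. F' \<tau> x" and u="\<lambda>\<tau>. F \<tau> x"]) (auto intro: d c2bdD(3)[OF b])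
  show "norm (sdiff (\<lambda>z. F 1 z - F 0 z) x y) \<le> M * (norm y)\<^sup>2"
    unfolding sdiff_minus
    by (rule line_bound[where u'="\<lambda>\<tau>. sdiff (F' \<tau>) x y" and u="\<lambda>\<tau>. sdiff (F \<tau>) x y"])
       (auto intro: has_vector_derivative_sdiff d c2bdD(5)[OF b])
qed (use z in auto)

lemma c2bd_translate:
  assumes "c2bd R M \<phi>" "norm a \<le> k"
  shows "c2bd (R + k) M (\<lambda>x. \<phi> (x + a))"
proof -
  have "R < norm (x + a)" if "R + k < norm x" for x
    using that assms(2) norm_triangle_ineq4[of "x + a" a] by simp
  moreover have "sdiff (\<lambda>x. \<phi> (x + a)) x y = sdiff \<phi> (x + a) y" for x y
    by (simp add: sdiff_def algebra_simps)
  ultimately show ?thesis using assms(1) by (auto simp: c2bd_def)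
qed

lemma c2bd_mono:
  assumes "c2bd R M \<phi>" "R \<le> R'" "M \<le> M'"
  shows "c2bd R' M' \<phi>"
proof -
  have "M * (norm y)\<^sup>2 \<le> M' * (norm y)\<^sup>2" for y :: 'a using assms(3) by (intro mult_right_mono) auto
  then show ?thesis using assms unfolding c2bd_def by (meson le_less_trans order_trans)
qed

lemma smc_c2bd_shift:
  fixes \<phi> :: "'a::euclidean_space \<Rightarrow> complex"
  assumes sm: "smc R \<phi>" and M: "\<And>w. c2bd R (M * norm w) (dd w \<phi>)" and w: "norm w \<le> 1"
  shows "c2bd (R + 1) (M * norm w) (\<lambda>x. \<phi> (x + w) - \<phi> x)"
proof -
  have "c2bd (R + 1) (M * norm w) (\<lambda>x. \<phi> (x + 1 *\<^sub>R w) - \<phi> (x + 0 *\<^sub>R w))"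
  proof (rule c2bd_line[where F="\<lambda>\<tau> x. \<phi> (x + \<tau> *\<^sub>R w)" and F'="\<lambda>\<tau> x. dd w \<phi> (x + \<tau> *\<^sub>R w)"])
    fix \<tau> :: real assume \<tau>: "0 \<le> \<tau>" "\<tau> \<le> 1"
    show "c2bd (R + 1) (M * norm w) (\<lambda>x. dd w \<phi> (x + \<tau> *\<^sub>R w))"
      using \<tau> w by (intro c2bd_translate[OF M]) (auto intro: mult_le_one)
  next
    fix z :: 'a assume z: "R + 1 < norm z"
    then have "R < norm (z + w)" using w norm_triangle_ineq4[of "z + w" w] by simp
    then show "\<phi> (z + 1 *\<^sub>R w) - \<phi> (z + 0 *\<^sub>R w) = 0" using sm z by (simp add: smc_def)
  qed (auto intro!: smc_line[OF sm] measurable_compose[OF _ smc_measurable[OF sm]])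
  then show ?thesis by simp
qed

lemma smc_c2bd_dd_shift:
  fixes \<phi> :: "'a::euclidean_space \<Rightarrow> complex"
  assumes sm: "smc R \<phi>" and M: "\<And>u w. c2bd R (M * norm u * norm w) (dd u (dd w \<phi>))" and v: "norm v \<le> 1"
  shows "c2bd (R + 1) (M * norm w * norm v) (\<lambda>x. dd w \<phi> (x + v) - dd w \<phi> x)"
proof (rule smc_c2bd_shift[OF smc_dd[OF sm] _ v])
  fix u show "c2bd R (M * norm w * norm u) (dd u (dd w \<phi>))" using M[of u w] by (simp add: mult_ac)
qed

lemma smc_c2bd_taylor:
  fixes \<phi> :: "'a::euclidean_space \<Rightarrow> complex"
  assumes sm: "smc R \<phi>" and M: "\<And>u w. c2bd R (M * norm u * norm w) (dd u (dd w \<phi>))" and w: "norm w \<le> 1" and M0: "0 \<le> M"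
  shows "c2bd (R + 1) (M * (norm w)\<^sup>2) (\<lambda>x. \<phi> (x + w) - \<phi> x - dd w \<phi> x)"
proof -
  have "c2bd (R + 1) (M * (norm w)\<^sup>2) (\<lambda>x. (\<phi> (x + 1 *\<^sub>R w) - 1 *\<^sub>R dd w \<phi> x) - (\<phi> (x + 0 *\<^sub>R w) - 0 *\<^sub>R dd w \<phi> x))"
  proof (rule c2bd_line[where F="\<lambda>\<tau> x. \<phi> (x + \<tau> *\<^sub>R w) - \<tau> *\<^sub>R dd w \<phi> x" and F'="\<lambda>\<tau> x. dd w \<phi> (x + \<tau> *\<^sub>R w) - dd w \<phi> x"])
    fix \<tau> :: real and z assume \<tau>: "0 \<le> \<tau>" "\<tau> \<le> 1"
    show "((\<lambda>\<tau>. \<phi> (z + \<tau> *\<^sub>R w) - \<tau> *\<^sub>R dd w \<phi> z) has_vector_derivative dd w \<phi> (z + \<tau> *\<^sub>R w) - dd w \<phi> z) (at \<tau>)"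
      by (intro has_vector_derivative_diff smc_line[OF sm]) (auto intro!: derivative_eq_intros)
  next
    fix \<tau> :: real assume \<tau>: "0 \<le> \<tau>" "\<tau> \<le> 1"
    have 1: "norm (\<tau> *\<^sub>R w) \<le> norm w" using \<tau> by (simp add: mult_left_le_one_le)
    show "c2bd (R + 1) (M * (norm w)\<^sup>2) (\<lambda>x. dd w \<phi> (x + \<tau> *\<^sub>R w) - dd w \<phi> x)"
    proof (rule c2bd_mono[OF smc_c2bd_dd_shift[OF sm M]])
      show "norm (\<tau> *\<^sub>R w) \<le> 1" using 1 w by linarith
      show "M * norm w * norm (\<tau> *\<^sub>R w) \<le> M * (norm w)\<^sup>2"
        using mult_left_mono[OF 1, of "M * norm w"] M0 by (simp add: power2_eq_square mult_ac)
    qed simp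
  next
    fix z :: 'a assume z: "R + 1 < norm z"
    then have "R < norm (z + w)" using w norm_triangle_ineq4[of "z + w" w] by simp
    then show "(\<phi> (z + 1 *\<^sub>R w) - 1 *\<^sub>R dd w \<phi> z) - (\<phi> (z + 0 *\<^sub>R w) - 0 *\<^sub>R dd w \<phi> z) = 0"
      using sm smc_dd[OF sm, of w] z by (simp add: smc_def)
  qed (auto intro!: borel_measurable_diff measurable_compose[OF _ smc_measurable[OF sm]] smc_measurable[OF smc_dd[OF sm]])
  then show ?thesis by (simp add: algebra_simps)
qed

lemma smc_integrable:
  fixes \<phi> :: "'a::euclidean_space \<Rightarrow> complex"
  assumes "smc R \<phi>" shows "integrable lborel \<phi>"
proof -
  obtain B where "\<And>x. norm (\<phi> x) \<le> B" using smc_bounded[OF assms] by blast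
  then show ?thesis using assms
    by (intro integrable_cball_bounded(1)[of _ B R] smc_measurable[OF assms]) (auto simp: smc_def)
qed

section \<open>Fourier transforms of derivatives, and agreement with the fractional
  Laplacian\<close>

lemma has_derivative_quot:
  fixes f :: "real \<Rightarrow> 'b::real_normed_vector"
  assumes "(f has_derivative (\<lambda>h. h *\<^sub>R D)) (at 0)"
  shows "((\<lambda>t. (f t - f 0) /\<^sub>R t) \<longlongrightarrow> D) (at 0)"
proof -
  have "((\<lambda>t. (f t - f 0 - t *\<^sub>R D) /\<^sub>R norm t) \<longlongrightarrow> 0) (at 0)"
    using assms by (simp add: has_derivative_def)
  then have "((\<lambda>t. norm ((f t - f 0) /\<^sub>R t - D)) \<longlongrightarrow> 0) (at 0)"
  proof (rule Lim_transform_eventually[OF tendsto_norm_zero])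
    show "\<forall>\<^sub>F t in at 0. norm ((f t - f 0 - t *\<^sub>R D) /\<^sub>R norm t) = norm ((f t - f 0) /\<^sub>R t - D)"
      unfolding eventually_at
    proof (intro exI[of _ 1] conjI ballI impI)
      fix t :: real assume "t \<noteq> 0 \<and> dist t 0 < 1"
      then have "(f t - f 0) /\<^sub>R t - D = (f t - f 0 - t *\<^sub>R D) /\<^sub>R t" by (simp add: scaleR_diff_right)
      then show "norm ((f t - f 0 - t *\<^sub>R D) /\<^sub>R norm t) = norm ((f t - f 0) /\<^sub>R t - D)" by simp
    qed simp
  qed
  then show ?thesis by (simp add: tendsto_norm_zero_iff LIM_zero_iff)
qed

text \<open>The derivative is a limit of difference quotients, whose transforms are known from
  translation. Dominated convergence on a fixed ball takes the place of integration by
  parts.\<close>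

lemma fourier_dd:
  fixes \<phi> :: "'a::euclidean_space \<Rightarrow> complex"
  assumes sm: "smc R \<phi>"
  shows "fourier (dd v \<phi>) \<xi> = (ph \<xi> v) * fourier \<phi> \<xi>"
proof -
  note m [measurable] = smc_measurable[OF sm] smc_measurable[OF smc_dd[OF sm]]
  note i = smc_integrable[OF sm]
  have R0: "0 \<le> R" using sm by (simp add: smc_def)
  let ?e = "\<lambda>x. exp (- \<i> * complex_of_real (\<xi> \<bullet> x))"
  define F where "F = (LBINT x. ?e x * \<phi> x)"
  have ie: "integrable lborel (\<lambda>x. ?e x * f x)" if "integrable lborel f" for f
    by (rule Bochner_Integration.integrable_bound[OF that]) (use that in \<open>auto simp: norm_mult\<close>)
  obtain B where B: "0 < B" "\<And>w x. norm (dd w \<phi> x) \<le> B * norm w" using smc_dd_le[OF sm] by blast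
  define h where "h n = 1 / real (Suc n)" for n
  have h: "0 < h n" "h n \<le> 1" for n by (auto simp: h_def)
  have h0: "h \<longlonglongrightarrow> 0" unfolding h_def by (rule LIMSEQ_Suc[OF lim_1_over_n])
  let ?q = "\<lambda>n x. ?e x * ((\<phi> (x + h n *\<^sub>R v) - \<phi> x) /\<^sub>R h n)"
  have lim: "(\<lambda>n. (f (h n) - f 0) /\<^sub>R h n) \<longlonglongrightarrow> D" if "(f has_vector_derivative D) (at 0)" for f :: "real \<Rightarrow> complex" and D
  proof -
    have "((\<lambda>t. (f t - f 0) /\<^sub>R t) \<longlongrightarrow> D) (at 0)"
      using that unfolding has_vector_derivative_def by (rule has_derivative_quot)
    moreover have "filterlim h (at 0) sequentially"
      unfolding filterlim_at using h0 h(1) by (auto intro!: always_eventually simp: less_imp_neq[symmetric])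
    ultimately show ?thesis by (rule filterlim_compose)
  qed
  have A: "(\<lambda>n. LBINT x. ?q n x) \<longlonglongrightarrow> (LBINT x. ?e x * dd v \<phi> x)"
  proof (rule integral_dominated_convergence[where w="\<lambda>x. B * norm v * indicator (cball 0 (R + norm v)) x"])
    show "integrable lborel (\<lambda>x. B * norm v * indicator (cball (0::'a) (R + norm v)) x)"
      by (intro integrable_mult_right integrable_real_indicator) (simp, metis emeasure_lborel_cball_finite)
    show "AE x in lborel. (\<lambda>n. ?q n x) \<longlonglongrightarrow> ?e x * dd v \<phi> x"
    proof (intro AE_I2 tendsto_mult_left)
      fix x
      show "(\<lambda>n. (\<phi> (x + h n *\<^sub>R v) - \<phi> x) /\<^sub>R h n) \<longlonglongrightarrow> dd v \<phi> x"
        using lim[OF smc_line[OF sm, of x v 0, simplified]] by simp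
    qed
    show "AE x in lborel. norm (?q n x) \<le> B * norm v * indicator (cball 0 (R + norm v)) x" for n
    proof (intro AE_I2)
      fix x :: 'a
      have hv: "norm (h n *\<^sub>R v) \<le> norm v" using h[of n] by (simp add: mult_left_le_one_le)
      show "norm (?q n x) \<le> B * norm v * indicator (cball 0 (R + norm v)) x"
      proof (cases "norm x \<le> R + norm v")
        case True
        have "norm (\<phi> (x + h n *\<^sub>R v) - \<phi> x) \<le> B * norm (h n *\<^sub>R v)" by (rule smc_lip[OF sm B(2)])
        then have "norm ((\<phi> (x + h n *\<^sub>R v) - \<phi> x) /\<^sub>R h n) \<le> B * norm v"
          using h[of n] by (simp add: inverse_eq_divide pos_divide_le_eq mult_ac del: scaleR_right_diff_distrib)
        then show ?thesis using True by (simp add: norm_mult)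
      next
        case False
        then have "R < norm x" "R < norm (x + h n *\<^sub>R v)"
          using hv norm_triangle_ineq4[of "x + h n *\<^sub>R v" "h n *\<^sub>R v"] norm_ge_zero[of v] by (simp_all, linarith+)
        then show ?thesis using sm False by (simp add: smc_def)
      qed
    qed
  qed measurable
  have tr: "(LBINT x. ?e x * \<phi> (x + y)) = exp (ph \<xi> y) * F" for y
  proof -
    have "(LBINT x. ?e x * \<phi> (x + y)) = (LBINT x. ?e (x - y) * \<phi> x)"
      using integral_translate(1)[of "\<lambda>x. ?e (x - y) * \<phi> x" y] by simp
    also have "\<dots> = (LBINT x. exp (ph \<xi> y) * (?e x * \<phi> x))"
      by (simp add: inner_diff_right right_diff_distrib exp_diff exp_minus field_simps)
    finally show ?thesis by (simp add: F_def)
  qed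
  have q: "(LBINT x. ?q n x) = ((exp (\<i> * complex_of_real (h n * (\<xi> \<bullet> v))) - 1) /\<^sub>R h n) * F" for n
  proof -
    have "(LBINT x. ?q n x) = (LBINT x. (?e x * \<phi> (x + h n *\<^sub>R v) - ?e x * \<phi> x) /\<^sub>R h n)"
      by (simp add: algebra_simps)
    also have "\<dots> = ((LBINT x. ?e x * \<phi> (x + h n *\<^sub>R v)) - F) /\<^sub>R h n"
      unfolding F_def using ie[OF i] ie[OF integrable_translate(1)[OF i, of "h n *\<^sub>R v"]] by simp
    also have "\<dots> = ((exp (\<i> * complex_of_real (h n * (\<xi> \<bullet> v))) - 1) /\<^sub>R h n) * F"
      unfolding tr by (simp add: algebra_simps)
    finally show ?thesis .
  qed
  have "((\<lambda>t. exp (\<i> * complex_of_real (t * (\<xi> \<bullet> v)))) has_vector_derivative \<i> * complex_of_real (\<xi> \<bullet> v)) (at 0)"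
  proof -
    have "((\<lambda>z. exp (\<i> * (z * complex_of_real (\<xi> \<bullet> v)))) has_field_derivative \<i> * complex_of_real (\<xi> \<bullet> v)) (at (of_real 0))"
      by (auto intro!: derivative_eq_intros)
    from has_vector_derivative_real_field[OF this] show ?thesis by simp
  qed
  from tendsto_mult_right[OF lim[OF this], of F]
  have "(\<lambda>n. LBINT x. ?q n x) \<longlonglongrightarrow> (ph \<xi> v) * F"
    unfolding q by simp
  from LIMSEQ_unique[OF A this] show ?thesis
    by (subst (1 2) fourier_lborel) (auto simp: F_def m mult_ac)
qed

lemma fourier_le:
  fixes g :: "'a::euclidean_space \<Rightarrow> complex"
  assumes "integrable lborel g"
  shows "norm (fourier g \<xi>) \<le> (2 * pi) powr (- real DIM('a) / 2) * (LBINT x. norm (g x))"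
proof -
  have m: "g \<in> borel_measurable borel" using assms by auto
  have "norm (LBINT x. exp (- \<i> * complex_of_real (\<xi> \<bullet> x)) * g x) \<le> (LBINT x. norm (exp (- \<i> * complex_of_real (\<xi> \<bullet> x)) * g x))"
    by (rule integral_norm_bound)
  then have "norm (LBINT x. exp (- \<i> * complex_of_real (\<xi> \<bullet> x)) * g x) \<le> (LBINT x. norm (g x))"
    by (simp add: norm_mult)
  then show ?thesis unfolding fourier_lborel[OF m] by (simp add: norm_mult mult_left_mono)
qed

lemma smc_dd_iter: "smc R \<phi> \<Longrightarrow> smc R ((dd b ^^ n) \<phi>)"
  by (induction n) (auto intro: smc_dd)

lemma fourier_dd_iter:
  fixes \<phi> :: "'a::euclidean_space \<Rightarrow> complex"
  assumes "smc R \<phi>" shows "fourier ((dd b ^^ n) \<phi>) \<xi> = (ph \<xi> b) ^ n * fourier \<phi> \<xi>"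
  by (induction n) (simp_all add: fourier_dd[OF smc_dd_iter[OF assms]])

lemma norm_le_coord:
  fixes \<xi> :: "'a::euclidean_space"
  shows "\<exists>b\<in>Basis. norm \<xi> \<le> real DIM('a) * \<bar>\<xi> \<bullet> b\<bar>"
proof (rule ccontr)
  assume "\<not> ?thesis"
  then have "(\<Sum>b\<in>(Basis::'a set). \<bar>\<xi> \<bullet> b\<bar>) < (\<Sum>b\<in>(Basis::'a set). norm \<xi> / real DIM('a))"
    by (intro sum_strict_mono) (auto simp: field_simps not_le)
  then show False using norm_le_l1[of \<xi>] by simp
qed

text \<open>Differentiating m times along a basis vector b multiplies the transform by the m-th
  power of the coordinate \<xi> . b up to a unit factor. By \<open>norm_le_coord\<close> some
  coordinate is at least |\<xi>| / N in size, so the finitely many bounds together control the full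
  weight.\<close>

lemma fourier_decay:
  fixes \<phi> :: "'a::euclidean_space \<Rightarrow> complex"
  assumes sm: "smc R \<phi>"
  obtains C where "0 \<le> C" "\<And>\<xi>. norm (fourier \<phi> \<xi>) \<le> C * japanese \<xi> powr (- real m)"
proof -
  let ?n = "real DIM('a)"
  have "\<exists>B. \<forall>\<xi>. \<bar>\<xi> \<bullet> b\<bar> ^ m * norm (fourier \<phi> \<xi>) \<le> B" for b
    using fourier_le[OF smc_integrable[OF smc_dd_iter[OF sm, of m b]]] fourier_dd_iter[OF sm, of m b]
    by (auto simp: norm_mult norm_power)
  then obtain B where B: "\<And>b \<xi>. \<bar>\<xi> \<bullet> b\<bar> ^ m * norm (fourier \<phi> \<xi>) \<le> B b" by metis
  obtain B0 where B0: "\<And>\<xi>. norm (fourier \<phi> \<xi>) \<le> B0" using fourier_le[OF smc_integrable[OF sm]] by blast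
  have Bn: "0 \<le> B b" for b using B[of 0 b] norm_ge_zero by (meson abs_ge_zero mult_nonneg_nonneg order_trans zero_le_power)
  have B0n: "0 \<le> B0" using B0[of 0] norm_ge_zero order_trans by blast
  define C where "C = 2 ^ m * (B0 + ?n ^ m * (\<Sum>b\<in>(Basis::'a set). B b))"
  have "norm (fourier \<phi> \<xi>) \<le> C * japanese \<xi> powr (- real m)" for \<xi>
  proof -
    let ?F = "norm (fourier \<phi> \<xi>)"
    obtain b where b: "b \<in> Basis" "norm \<xi> \<le> ?n * \<bar>\<xi> \<bullet> b\<bar>" using norm_le_coord by blast
    have "japanese \<xi> ^ m \<le> (2 * max 1 (norm \<xi>)) ^ m"
      using japanese_le[of \<xi>] by (intro power_mono) (auto simp: less_imp_le)
    also have "\<dots> \<le> 2 ^ m * (1 + norm \<xi> ^ m)"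
      unfolding power_mult_distrib by (intro mult_left_mono) (auto simp: max_def)
    also have "\<dots> \<le> 2 ^ m * (1 + ?n ^ m * \<bar>\<xi> \<bullet> b\<bar> ^ m)"
      using power_mono[OF b(2), of m] by (simp add: power_mult_distrib)
    finally have "japanese \<xi> ^ m * ?F \<le> 2 ^ m * (1 + ?n ^ m * \<bar>\<xi> \<bullet> b\<bar> ^ m) * ?F"
      by (rule mult_right_mono) simp
    also have "\<dots> = 2 ^ m * (?F + ?n ^ m * (\<bar>\<xi> \<bullet> b\<bar> ^ m * ?F))"
      by (simp add: algebra_simps)
    also have "\<dots> \<le> C" unfolding C_def
    proof (intro mult_left_mono add_mono B0)
      have "B b \<le> (\<Sum>b\<in>(Basis::'a set). B b)" using b(1) Bn by (intro member_le_sum) auto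
      then show "\<bar>\<xi> \<bullet> b\<bar> ^ m * ?F \<le> (\<Sum>b\<in>(Basis::'a set). B b)" using B[of \<xi> b] by linarith
    qed auto
    finally have "japanese \<xi> ^ m * ?F \<le> C" .
    then have "?F \<le> C / japanese \<xi> ^ m" by (simp add: field_simps)
    then show ?thesis by (simp add: powr_minus powr_realpow divide_inverse)
  qed
  moreover have "0 \<le> C" unfolding C_def using Bn B0n by (intro mult_nonneg_nonneg add_nonneg_nonneg sum_nonneg) auto
  ultimately show ?thesis using that by blast
qed

lemma fL_smc_diff:
  fixes \<phi> :: "'a::euclidean_space \<Rightarrow> complex"
  assumes s: "0 < s" "s < 1" and sm: "smc R \<phi>"
  shows "fL s (\<lambda>x. \<phi> (x + w) - \<phi> x) x = fL s \<phi> (x + w) - fL s \<phi> x"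
proof -
  obtain M where M: "c2bd R M \<phi>" using smc_c2bd[OF sm] by blast
  have "fL s (\<lambda>x. \<phi> (x + w) - \<phi> x) x = fL s (\<lambda>x. \<phi> (x + w)) x - fL s \<phi> x"
    by (intro fL_diff c2bd_integrable[OF s M] c2bd_integrable[OF s c2bd_translate[OF M order_refl]])
  then show ?thesis by (simp add: fL_shift)
qed

lemma fL_smc_lip:
  fixes \<phi> :: "'a::euclidean_space \<Rightarrow> complex"
  assumes s: "0 < s" "s < 1" and sm: "smc R \<phi>"
  obtains K where "\<And>x w. norm w \<le> 1 \<Longrightarrow> norm (fL s \<phi> (x + w) - fL s \<phi> x) \<le> K * norm w"
proof -
  obtain M where M: "\<And>w. c2bd R (M * norm w) (dd w \<phi>)" using smc_c2bd_dd[OF sm] by blast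
  have "norm (fL s \<phi> (x + w) - fL s \<phi> x) \<le> (4 * M * kern_mass TYPE('a) s) * norm w" if "norm w \<le> 1" for x w
    using fL_le[OF s smc_c2bd_shift[OF sm M that], of x] by (simp add: fL_smc_diff[OF s sm] mult_ac)
  then show ?thesis by (rule that)
qed

lemma fL_smc_cont:
  fixes \<phi> :: "'a::euclidean_space \<Rightarrow> complex"
  assumes s: "0 < s" "s < 1" and sm: "smc R \<phi>"
  shows "continuous_on UNIV (fL s \<phi>)"
proof -
  obtain K where K: "\<And>x w. norm w \<le> 1 \<Longrightarrow> norm (fL s \<phi> (x + w) - fL s \<phi> x) \<le> K * norm w"
    using fL_smc_lip[OF s sm] by metis
  have "isCont (fL s \<phi>) x" for x
    unfolding isCont_iff LIM_zero_iff[symmetric, of "\<lambda>h. fL s \<phi> (x + h)"]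
  proof (rule Lim_null_comparison)
    show "((\<lambda>h. K * norm h) \<longlongrightarrow> 0) (at (0::'a))"
      by (auto intro!: tendsto_eq_intros)
    show "\<forall>\<^sub>F h in at 0. norm (fL s \<phi> (x + h) - fL s \<phi> x) \<le> K * norm h"
      unfolding eventually_at using K by (intro exI[of _ 1]) auto
  qed
  then show ?thesis by (simp add: continuous_at_imp_continuous_on)
qed

text \<open>The transform of \<open>fL s \<phi>\<close> is \<open>symb_const\<close> times the
  multiplier applied to the transform of \<phi>. Inversion is legitimate because
  \<open>fL s \<phi>\<close> is integrable, bounded and continuous, while its transform is
  integrable by the decay of that of \<phi>.\<close>

lemma frac_lap_eq:
  fixes \<phi> :: "'a::euclidean_space \<Rightarrow> complex"
  assumes s: "0 < s" "s < 1" and sm: "smc R \<phi>"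
  shows "frac_lap s \<phi> x = fL s \<phi> x / complex_of_real (symb_const TYPE('a) s)"
proof -
  let ?n = "real DIM('a)"
  let ?k = "symb_const TYPE('a) s"
  have k: "0 < ?k" by (rule symb_const_pos[OF s])
  have R0: "0 \<le> R" using sm by (simp add: smc_def)
  obtain M where M: "c2bd R M \<phi>" using smc_c2bd[OF sm] by blast
  note m [measurable] = smc_measurable[OF sm]
  let ?h = "\<lambda>\<xi>. complex_of_real (norm \<xi> powr (2 * s)) * fourier \<phi> \<xi>"
  have F: "fourier (fL s \<phi>) = (\<lambda>\<xi>. complex_of_real ?k * ?h \<xi>)"
    by (simp add: fun_eq_iff fourier_fL[OF s M R0] symb_eq[OF s])
  \<comment> \<open>Of the N + 3 powers two absorb |\<xi>|^(2s), and the remaining N + 1 are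
    integrable.\<close>
  obtain C where C: "0 \<le> C" "\<And>\<xi>. norm (fourier \<phi> \<xi>) \<le> C * japanese \<xi> powr (- real (DIM('a) + 3))"
    using fourier_decay[OF sm] by metis
  have jint: "integrable lborel (\<lambda>\<xi>::'a. C * japanese \<xi> powr (- ?n - 1))"
    by (intro integrable_mult_right integrableI_bounded)
       (use nn_integral_japanese_finite[of 1, where 'a='a] in auto)
  have hint: "integrable lborel ?h"
  proof (rule Bochner_Integration.integrable_bound[OF jint])
    show "AE \<xi>::'a in lborel. norm (?h \<xi>) \<le> norm (C * japanese \<xi> powr (- ?n - 1))"
    proof (intro AE_I2)
      fix \<xi> :: 'a
      have "norm \<xi> powr (2 * s) \<le> japanese \<xi> powr (2 * s)"
        using s by (intro powr_mono2 japanese_ge_norm) auto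
      also have "\<dots> \<le> japanese \<xi> powr 2" using s by (intro powr_mono japanese_ge1) auto
      finally have "norm (?h \<xi>) \<le> japanese \<xi> powr 2 * (C * japanese \<xi> powr (- real (DIM('a) + 3)))"
        unfolding norm_mult using C(2)[of \<xi>] by (intro mult_mono) auto
      also have "\<dots> = C * (japanese \<xi> powr 2 * japanese \<xi> powr (- real (DIM('a) + 3)))" by simp
      also have "japanese \<xi> powr 2 * japanese \<xi> powr (- real (DIM('a) + 3)) = japanese \<xi> powr (- ?n - 1)"
      proof -
        have e: "2 + - real (DIM('a) + 3) = - ?n - 1" by simp
        show ?thesis by (simp only: powr_add[symmetric] e)
      qed
      finally show "norm (?h \<xi>) \<le> norm (C * japanese \<xi> powr (- ?n - 1))" by (simp only: real_norm_def)
    qed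
  qed measurable
  have "fourier_inv (fourier (fL s \<phi>)) x = fL s \<phi> x"
    by (rule fourier_inversion[OF fL_integrable[OF s M R0] fL_smc_cont[OF s sm] fL_le[OF s M]])
       (simp only: F integrable_mult_right hint)
  moreover have "fourier_inv (fourier (fL s \<phi>)) x = complex_of_real ?k * frac_lap s \<phi> x"
  proof -
    have [measurable]: "?h \<in> borel_measurable borel" by measurable
    have "(LINT \<xi>|lborel. exp (ph \<xi> x) * (complex_of_real ?k * ?h \<xi>)) = (LINT \<xi>|lborel. complex_of_real ?k * (exp (ph \<xi> x) * ?h \<xi>))"
      by (simp only: mult.left_commute)
    also have "\<dots> = complex_of_real ?k * (LINT \<xi>|lborel. (exp (ph \<xi> x) * ?h \<xi>))"
      by (rule integral_mult_right_zero)
    finally have 0: "(LINT \<xi>|lborel. exp (ph \<xi> x) * (complex_of_real ?k * ?h \<xi>)) = complex_of_real ?k * (LINT \<xi>|lborel. (exp (ph \<xi> x) * ?h \<xi>))" .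
    define p where "p = complex_of_real ((2 * pi) powr (- ?n / 2))"
    have 1: "fourier_inv (\<lambda>\<xi>. complex_of_real ?k * ?h \<xi>) x = p * (LINT \<xi>|lborel. exp (ph \<xi> x) * (complex_of_real ?k * ?h \<xi>))"
      unfolding p_def by (rule fourier_inv_lborel) measurable
    have 2: "fourier_inv ?h x = p * (LINT \<xi>|lborel. exp (ph \<xi> x) * ?h \<xi>)"
      unfolding p_def by (rule fourier_inv_lborel) measurable
    show ?thesis unfolding frac_lap_def F 1 2 0 by (rule mult.left_commute)
  qed
  ultimately show ?thesis using k by (simp add: field_simps)
qed

lemma test_fun_smc:
  fixes \<phi> :: "'a::euclidean_space \<Rightarrow> complex"
  assumes "test_fun \<Omega> \<phi>" obtains R where "smc R \<phi>"
proof -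
  have "bounded {x. \<phi> x \<noteq> 0}" using assms compact_imp_bounded bounded_subset closure_subset
    unfolding test_fun_def by metis
  then obtain R where R: "0 < R" "\<And>x. \<phi> x \<noteq> 0 \<Longrightarrow> norm x \<le> R" unfolding bounded_pos by auto
  then have "smc R \<phi>" using assms unfolding smc_def test_fun_def by (meson less_imp_le not_le)
  then show ?thesis by (rule that)
qed

subsection \<open>A smooth bump\<close>

text \<open>For u > 0 these are u^(-k) exp(-1/u), the family that arises from differentiating
  exp(-1/u): each derivative is a combination of two members.\<close>

definition bk :: "nat \<Rightarrow> real \<Rightarrow> real" where
  "bk k u = (if u \<le> 0 then 0 else (1 / u) ^ k * exp (- 1 / u))"

lemma power_le_exp:
  assumes "0 \<le> (x::real)" shows "x ^ n / fact n \<le> exp x"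
proof -
  have "(\<Sum>k\<in>{n}. x ^ k / fact k) \<le> (\<Sum>k. x ^ k / fact k)"
    using summable_exp[of x] assms by (intro sum_le_suminf) (auto simp: field_simps)
  also have "\<dots> = exp x" by (simp add: exp_def divide_inverse scaleR_conv_of_real mult.commute)
  finally show ?thesis by simp
qed

lemma bk_nonneg: "0 \<le> bk k u" by (simp add: bk_def)

text \<open>The term of order k + 2 in the exponential series of 1/u gives quadratic vanishing at 0.
  This makes the derivative at 0 exist and be 0, where the two branches of the definition
  meet.\<close>

lemma bk_le: "bk k u \<le> fact (k + 2) * u\<^sup>2"
proof (cases "u \<le> 0")
  case False
  define F :: real where "F = fact (k + 2)"
  have F: "0 < F" unfolding F_def by (rule fact_gt_zero)
  have "(1 / u) ^ (k + 2) / F \<le> exp (1 / u)" unfolding F_def using False by (intro power_le_exp) simp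
  then have "(1 / u) ^ k * (1 / u)\<^sup>2 \<le> F * exp (1 / u)"
    unfolding power_add using F by (simp only: pos_divide_le_eq mult.commute)
  then have "(1 / u) ^ k * exp (- (1 / u)) \<le> F * u\<^sup>2"
    using False by (simp add: exp_minus power_divide field_simps)
  then show ?thesis using False by (simp add: bk_def F_def)
qed (simp add: bk_def)

lemma bk_deriv: "(bk k has_real_derivative (bk (k + 2) u - real k * bk (k + 1) u)) (at u)"
proof -
  consider "u < 0" | "u = 0" | "0 < u" by linarith
  then show ?thesis
  proof cases
    case 1
    have "((\<lambda>_. 0) has_real_derivative 0) (at u)" by simp
    then have "(bk k has_real_derivative 0) (at u)"
      by (rule has_field_derivative_transform_within_open[where S="{..<0}"]) (use 1 in \<open>auto simp: bk_def\<close>)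
    then show ?thesis using 1 by (simp add: bk_def)
  next
    case 2
    have "((\<lambda>h. (bk k (0 + h) - bk k 0) / h) \<longlongrightarrow> 0) (at 0)"
    proof (rule Lim_null_comparison)
      show "((\<lambda>h::real. fact (k + 2) * norm h) \<longlongrightarrow> 0) (at 0)"
        by (auto intro!: tendsto_eq_intros)
      have "norm ((bk k (0 + h) - bk k 0) / h) \<le> fact (k + 2) * norm h" for h
      proof (cases "h = 0")
        case False
        have "\<bar>bk k h\<bar> \<le> fact (k + 2) * \<bar>h\<bar> * \<bar>h\<bar>"
          using bk_le[of k h] bk_nonneg[of k h] by (simp add: power2_eq_square mult.assoc)
        then show ?thesis using False by (simp add: bk_def[of k 0] pos_divide_le_eq)
      qed simp
      then show "\<forall>\<^sub>F h in at 0. norm ((bk k (0 + h) - bk k 0) / h) \<le> fact (k + 2) * norm h" by simp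
    qed
    then have "(bk k has_real_derivative 0) (at 0)" by (simp add: DERIV_def)
    then show ?thesis using 2 by (simp add: bk_def)
  next
    case 3
    have "((\<lambda>u. (1 / u) ^ k * exp (- 1 / u)) has_real_derivative ((1 / u) ^ (k + 2) * exp (- 1 / u) - real k * ((1 / u) ^ (k + 1) * exp (- 1 / u)))) (at u)"
    proof -
      have a: "((\<lambda>u. 1 / u) has_real_derivative - ((1 / u)\<^sup>2)) (at u)"
        using 3 by (auto intro!: derivative_eq_intros simp: power2_eq_square)
      have b: "((\<lambda>u. exp (- 1 / u)) has_real_derivative exp (- 1 / u) * (1 / u)\<^sup>2) (at u)"
        using 3 by (auto intro!: derivative_eq_intros simp: power2_eq_square)
      show ?thesis
        by (rule DERIV_cong[OF DERIV_mult[OF DERIV_power[OF a, of k] b]])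
           (cases k; simp add: power2_eq_square algebra_simps)
    qed
    then have "(bk k has_real_derivative ((1 / u) ^ (k + 2) * exp (- 1 / u) - real k * ((1 / u) ^ (k + 1) * exp (- 1 / u)))) (at u)"
      by (rule has_field_derivative_transform_within_open[where S="{0<..}"]) (use 3 in \<open>auto simp: bk_def\<close>)
    then show ?thesis using 3 by (simp add: bk_def)
  qed
qed

text \<open>Chosen to contain the bump and to be closed under directional derivatives, so that
  smoothness of all orders follows from a single induction over the list of directions.\<close>

inductive bclass :: "('a::euclidean_space \<Rightarrow> real) \<Rightarrow> bool" where
  base: "bclass (\<lambda>x. bk k (1 - x \<bullet> x))"
| coord: "bclass g \<Longrightarrow> bclass (\<lambda>x. (x \<bullet> v) * g x)"
| plus: "bclass g \<Longrightarrow> bclass h \<Longrightarrow> bclass (\<lambda>x. g x + h x)"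
| scale: "bclass g \<Longrightarrow> bclass (\<lambda>x. c * g x)"

lemma bclass_deriv:
  assumes "bclass g"
  shows "\<exists>g'. (\<forall>v. bclass (g' v)) \<and> (\<forall>x. (g has_derivative (\<lambda>v. g' v x)) (at x))"
  using assms
proof induction
  case (base k)
  let ?g' = "\<lambda>v x::'a. (- 2) * ((x \<bullet> v) * (bk (k + 2) (1 - x \<bullet> x) + (- real k) * bk (k + 1) (1 - x \<bullet> x)))"
  have "((\<lambda>x. bk k (1 - x \<bullet> x)) has_derivative (\<lambda>v. ?g' v x)) (at x)" for x :: 'a
  proof -
    have "((\<lambda>x. 1 - x \<bullet> x) has_derivative (\<lambda>v. - 2 * (x \<bullet> v))) (at x)"
      by (auto intro!: derivative_eq_intros simp: fun_eq_iff inner_commute)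
    from has_derivative_compose[OF this has_field_derivative_imp_has_derivative[OF bk_deriv]]
    show ?thesis by (rule has_derivative_eq_rhs) (auto simp: fun_eq_iff algebra_simps)
  qed
  moreover have "bclass (?g' v)" for v by (intro bclass.intros)
  ultimately show ?case by (intro exI[of _ ?g']) auto
next
  case (coord g v)
  then obtain g' where g': "\<And>v. bclass (g' v)" "\<And>x. (g has_derivative (\<lambda>v. g' v x)) (at x)" by blast
  let ?g' = "\<lambda>w x. (w \<bullet> v) * g x + (x \<bullet> v) * g' w x"
  have "((\<lambda>x. (x \<bullet> v) * g x) has_derivative (\<lambda>w. ?g' w x)) (at x)" for x
    by (rule has_derivative_eq_rhs, rule has_derivative_mult[OF _ g'(2)])
       (auto intro!: derivative_eq_intros simp: fun_eq_iff)
  moreover have "bclass (?g' w)" for w by (intro bclass.intros coord g')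
  ultimately show ?case by (intro exI[of _ ?g']) auto
next
  case (plus g h)
  then obtain g' h' where "\<And>v. bclass (g' v)" "\<And>x. (g has_derivative (\<lambda>v. g' v x)) (at x)"
    "\<And>v. bclass (h' v)" "\<And>x. (h has_derivative (\<lambda>v. h' v x)) (at x)" by metis
  then show ?case by (intro exI[of _ "\<lambda>v x. g' v x + h' v x"]) (auto intro: bclass.intros has_derivative_add)
next
  case (scale g c)
  then obtain g' where "\<And>v. bclass (g' v)" "\<And>x. (g has_derivative (\<lambda>v. g' v x)) (at x)" by metis
  then show ?case by (intro exI[of _ "\<lambda>v x. c * g' v x"]) (auto intro: bclass.intros has_derivative_mult_right)
qed

lemma bclass_iter:
  assumes "bclass g"
  shows "\<exists>h. bclass h \<and> iter_deriv vs (\<lambda>x. complex_of_real (g x)) = (\<lambda>x. complex_of_real (h x))"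
proof (induction vs)
  case Nil then show ?case using assms by auto
next
  case (Cons v vs)
  then obtain h where h: "bclass h" "iter_deriv vs (\<lambda>x. complex_of_real (g x)) = (\<lambda>x. complex_of_real (h x))" by blast
  obtain h' where h': "\<And>v. bclass (h' v)" "\<And>x. (h has_derivative (\<lambda>v. h' v x)) (at x)" using bclass_deriv[OF h(1)] by blast
  have "frechet_derivative (\<lambda>x. complex_of_real (h x)) (at x) v = complex_of_real (h' v x)" for x
  proof -
    have "((\<lambda>x. complex_of_real (h x)) has_derivative (\<lambda>v. complex_of_real (h' v x))) (at x)"
      by (rule has_derivative_of_real[OF h'(2)])
    from frechet_derivative_at[OF this] show ?thesis by metis
  qed
  then show ?case using h' by (intro exI[of _ "h' v"]) (simp add: h(2))
qed

lemma bclass_smooth: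
  assumes "bclass g" shows "smooth_fun (\<lambda>x. complex_of_real (g x))"
  unfolding smooth_fun_def
proof (intro allI)
  fix vs x
  obtain h where h: "bclass h" "iter_deriv vs (\<lambda>x. complex_of_real (g x)) = (\<lambda>x. complex_of_real (h x))"
    using bclass_iter[OF assms] by blast
  obtain h' where "(h has_derivative (\<lambda>v. h' v x)) (at x)" using bclass_deriv[OF h(1)] by blast
  then have "((\<lambda>x. complex_of_real (h x)) has_derivative (\<lambda>v. complex_of_real (h' v x))) (at x)"
    by (rule has_derivative_of_real)
  then show "iter_deriv vs (\<lambda>x. complex_of_real (g x)) differentiable at x"
    unfolding h(2) differentiable_def by blast
qed

text \<open>The standard mollifier exp(-1/(1 - |x|^2)) on the unit ball. Its radial symmetry enters
  the vanishing of the average over all scales, its monotonicity in the norm the positivity of the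
  mass.\<close>

definition eta :: "'a::euclidean_space \<Rightarrow> real" where
  "eta x = bk 0 (1 - x \<bullet> x)"

definition ceta :: "'a::euclidean_space \<Rightarrow> complex" where
  "ceta x = complex_of_real (eta x)"

lemma eta_nonneg [simp]: "0 \<le> eta x" by (simp add: eta_def bk_nonneg)

lemma eta_le1: "eta x \<le> 1" by (simp add: eta_def bk_def)

lemma eta_outside: "1 \<le> norm x \<Longrightarrow> eta x = 0"
proof -
  assume "1 \<le> norm x"
  then have "1 \<le> (norm x)\<^sup>2" by (simp add: one_le_power)
  then show "eta x = 0" by (simp add: eta_def bk_def power2_norm_eq_inner)
qed

lemma eta_antimono: "norm x \<le> norm y \<Longrightarrow> eta y \<le> eta x"
proof -
  assume "norm x \<le> norm y"
  then have "x \<bullet> x \<le> y \<bullet> y" by (simp add: power2_norm_eq_inner[symmetric] power_mono)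
  then show ?thesis unfolding eta_def bk_def by (auto simp: field_simps)
qed

lemma eta_radial: "norm x = norm y \<Longrightarrow> eta x = eta y"
  using eta_antimono[of x y] eta_antimono[of y x] by simp

lemma eta_minus [simp]: "eta (- x) = eta x" by (simp add: eta_def)

lemma eta_pos: "norm x < 1 \<Longrightarrow> 0 < eta x"
proof -
  assume "norm x < 1"
  then have "x \<bullet> x < 1" by (simp add: power2_norm_eq_inner[symmetric] power_less_one_iff)
  then show ?thesis by (simp add: eta_def bk_def)
qed

lemma smc_ceta: "smc 1 ceta"
  unfolding smc_def
proof (intro conjI allI impI)
  have "ceta = (\<lambda>x::'a. complex_of_real (bk 0 (1 - x \<bullet> x)))" by (simp add: fun_eq_iff ceta_def eta_def)
  then show "smooth_fun (ceta :: 'a \<Rightarrow> complex)" using bclass_smooth[OF bclass.base] by metis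
  fix x :: 'a assume "1 < norm x" then show "ceta x = 0" by (simp add: ceta_def eta_outside)
qed simp

lemma eta_measurable [measurable]: "eta \<in> borel_measurable borel"
proof -
  have "(\<lambda>x. Re (ceta x)) \<in> borel_measurable borel"
    by (intro borel_measurable_Re[THEN measurable_compose[rotated]] smc_measurable[OF smc_ceta])
  then show ?thesis by (simp add: ceta_def)
qed

lemma iter_deriv_affine:
  fixes \<phi> :: "'a::euclidean_space \<Rightarrow> complex"
  assumes sm: "smooth_fun \<phi>"
  shows "iter_deriv vs (\<lambda>y. \<phi> (a + c *\<^sub>R y)) = (\<lambda>y. c ^ length vs *\<^sub>R iter_deriv vs \<phi> (a + c *\<^sub>R y))"
    "((\<lambda>y. c ^ length vs *\<^sub>R iter_deriv vs \<phi> (a + c *\<^sub>R y)) has_derivative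
      (\<lambda>v. c ^ length vs *\<^sub>R frechet_derivative (iter_deriv vs \<phi>) (at (a + c *\<^sub>R y)) (c *\<^sub>R v))) (at y)"
proof -
  show 2: "((\<lambda>y. c ^ length vs *\<^sub>R iter_deriv vs \<phi> (a + c *\<^sub>R y)) has_derivative
      (\<lambda>v. c ^ length vs *\<^sub>R frechet_derivative (iter_deriv vs \<phi>) (at (a + c *\<^sub>R y)) (c *\<^sub>R v))) (at y)" for vs y
  proof (rule has_derivative_scaleR_right)
    have d: "(iter_deriv vs \<phi> has_derivative frechet_derivative (iter_deriv vs \<phi>) (at (a + c *\<^sub>R y))) (at (a + c *\<^sub>R y))"
      using sm unfolding smooth_fun_def by (simp add: frechet_derivative_works[symmetric])
    have "((\<lambda>y. a + c *\<^sub>R y) has_derivative (\<lambda>v. c *\<^sub>R v)) (at y)" by (auto intro!: derivative_eq_intros)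
    from has_derivative_compose[OF this d]
    show "((\<lambda>y. iter_deriv vs \<phi> (a + c *\<^sub>R y)) has_derivative (\<lambda>v. frechet_derivative (iter_deriv vs \<phi>) (at (a + c *\<^sub>R y)) (c *\<^sub>R v))) (at y)" .
  qed
  show "iter_deriv vs (\<lambda>y. \<phi> (a + c *\<^sub>R y)) = (\<lambda>y. c ^ length vs *\<^sub>R iter_deriv vs \<phi> (a + c *\<^sub>R y))"
  proof (induction vs)
    case (Cons v vs)
    have "frechet_derivative (\<lambda>y. c ^ length vs *\<^sub>R iter_deriv vs \<phi> (a + c *\<^sub>R y)) (at y) v = c ^ length (v # vs) *\<^sub>R iter_deriv (v # vs) \<phi> (a + c *\<^sub>R y)" for y
    proof -
      have lin: "linear (frechet_derivative (iter_deriv vs \<phi>) (at (a + c *\<^sub>R y)))"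
        using sm unfolding smooth_fun_def by (intro linear_frechet_derivative) blast
      show ?thesis
        using fun_cong[OF frechet_derivative_at[OF 2[of vs y]], of v] by (simp add: linear_scale[OF lin] mult.commute)
    qed
    then show ?case by (simp add: Cons.IH fun_eq_iff)
  qed simp
qed

lemma smooth_affine:
  assumes "smooth_fun \<phi>" shows "smooth_fun (\<lambda>y. \<phi> (a + c *\<^sub>R y))"
  unfolding smooth_fun_def iter_deriv_affine(1)[OF assms] differentiable_def
  using iter_deriv_affine(2)[OF assms] by blast

lemma test_fun_eta:
  assumes t: "0 < t" and sub: "cball x t \<subseteq> \<Omega>"
  shows "test_fun \<Omega> (\<lambda>y. ceta ((x - y) /\<^sub>R t))"
proof -
  have "(\<lambda>y. ceta ((x - y) /\<^sub>R t)) = (\<lambda>y. ceta (x /\<^sub>R t + (- inverse t) *\<^sub>R y))"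
    by (simp add: fun_eq_iff scaleR_diff_right)
  then have 1: "smooth_fun (\<lambda>y. ceta ((x - y) /\<^sub>R t))"
    using smooth_affine[of ceta] smc_ceta unfolding smc_def by metis
  have "{y. ceta ((x - y) /\<^sub>R t) \<noteq> 0} \<subseteq> cball x t"
  proof
    fix y assume "y \<in> {y. ceta ((x - y) /\<^sub>R t) \<noteq> 0}"
    then have "norm ((x - y) /\<^sub>R t) < 1" using eta_outside[of "(x - y) /\<^sub>R t"] by (auto simp: ceta_def not_le[symmetric])
    then have "norm (x - y) / t < 1" using t by (simp add: divide_inverse mult.commute del: scaleR_right_diff_distrib)
    then show "y \<in> cball x t" using t by (simp add: dist_norm)
  qed
  then have 2: "closure {y. ceta ((x - y) /\<^sub>R t) \<noteq> 0} \<subseteq> cball x t" by (intro closure_minimal) auto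
  then have "compact (closure {y. ceta ((x - y) /\<^sub>R t) \<noteq> 0})"
    by (meson bounded_cball bounded_subset closed_closure compact_eq_bounded_closed)
  then show ?thesis using 1 2 sub unfolding test_fun_def by blast
qed

lemma c2bd_of_real:
  fixes f :: "'a::euclidean_space \<Rightarrow> real"
  assumes "c2bd R M (\<lambda>x. complex_of_real (f x))" shows "c2bd R M f"
proof -
  have "(\<lambda>x. Re (complex_of_real (f x))) \<in> borel_measurable borel"
    using c2bdD(1)[OF assms] by measurable
  moreover have "sdiff (\<lambda>x. complex_of_real (f x)) x y = complex_of_real (sdiff f x y)" for x y
    by (simp add: sdiff_def scaleR_conv_of_real)
  ultimately show ?thesis using assms unfolding c2bd_def by (simp add: norm_of_real)
qed

lemma c2bd_eta: obtains M where "0 < M" "c2bd 1 M (eta :: 'a::euclidean_space \<Rightarrow> real)"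
proof -
  obtain M where "0 < M" "c2bd 1 M (ceta :: 'a \<Rightarrow> complex)" using smc_c2bd[OF smc_ceta] by metis
  then show ?thesis using that[of M] c2bd_of_real[of 1 M eta] unfolding ceta_def[abs_def] by blast
qed

lemma fL_of_real:
  fixes f :: "'a::euclidean_space \<Rightarrow> real"
  shows "fL s (\<lambda>x. complex_of_real (f x)) x = complex_of_real (fL s f x)"
proof -
  have "kern s y *\<^sub>R sdiff (\<lambda>x. complex_of_real (f x)) x y = complex_of_real (kern s y *\<^sub>R sdiff f x y)" for y
    by (simp add: sdiff_def scaleR_conv_of_real)
  then show ?thesis unfolding fL_def by (simp only: integral_complex_of_real)
qed

section \<open>The bump under the fractional Laplacian: decay, derivatives, positivity\<close>

definition jw :: "real \<Rightarrow> 'a::euclidean_space \<Rightarrow> real" where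
  "jw s x = japanese x powr (- real DIM('a) - 2 * s)"

definition theta :: "real \<Rightarrow> 'a::euclidean_space \<Rightarrow> real" where
  "theta s = fL s eta"

text \<open>The candidate for the derivative of \<open>theta\<close> in direction w, obtained by
  letting the singular integral act on the derivative of the bump.\<close>

definition dtheta :: "real \<Rightarrow> 'a::euclidean_space \<Rightarrow> 'a \<Rightarrow> real" where
  "dtheta s w z = Re (fL s (dd w ceta) z)"

lemma japanese_neq_0 [simp]: "japanese x \<noteq> 0"
  using japanese_pos[of x] by linarith

lemma jw_pos [simp]: "0 < jw s x"
  by (simp add: jw_def)

lemma jw_nonneg [simp]: "0 \<le> jw s x"
  by (simp add: jw_def)

lemma jw_measurable [measurable]: "jw s \<in> borel_measurable borel"
  unfolding jw_def[abs_def] by measurable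

lemma jw_le1: "0 < s \<Longrightarrow> jw s (x::'a::euclidean_space) \<le> 1"
  using powr_mono[of "- real DIM('a) - 2 * s" 0 "japanese x"] japanese_ge1[of x] by (simp add: jw_def split: if_splits)

lemma jw_integrable:
  assumes "0 < s" shows "integrable lborel (jw s :: 'a::euclidean_space \<Rightarrow> real)"
  using nn_integral_japanese_finite[of "2 * s", where 'a='a] assms
  by (intro integrableI_bounded) (auto simp: jw_def)

lemma jw_add:
  assumes "0 < s"
  shows "jw s (x + y :: 'a::euclidean_space) \<le> (1 + norm y) powr (real DIM('a) + 2 * s) * jw s x"
proof -
  let ?n = "real DIM('a)"
  have "japanese x \<le> (1 + norm y) * japanese (x + y)" using japanese_add[of "x + y" "- y"] by simp
  then have "((1 + norm y) * japanese (x + y)) powr (- ?n - 2 * s) \<le> japanese x powr (- ?n - 2 * s)"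
    using assms by (intro powr_mono2') auto
  then have 1: "(1 + norm y) powr (- ?n - 2 * s) * jw s (x + y) \<le> jw s x"
    by (simp add: powr_mult jw_def less_imp_le)
  have 2: "(1 + norm y) powr (?n + 2 * s) * (1 + norm y) powr (- ?n - 2 * s) = 1"
    using norm_ge_zero[of y] by (simp add: powr_add[symmetric] add_nonneg_eq_0_iff)
  show ?thesis
    using mult_left_mono[OF 1, of "(1 + norm y) powr (?n + 2 * s)"] 2
    by (simp add: mult.assoc[symmetric])
qed

lemma fL_ceta: "fL s ceta x = complex_of_real (theta s x)"
  using fL_of_real[of s eta x] by (simp add: theta_def ceta_def[abs_def])

lemma dtheta_measurable [measurable]: "dtheta s w \<in> borel_measurable borel"
proof -
  have [measurable]: "dd w ceta \<in> borel_measurable (borel :: 'a measure)"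
    by (rule smc_measurable[OF smc_dd[OF smc_ceta]])
  show ?thesis unfolding dtheta_def[abs_def] by measurable
qed

lemma theta_measurable [measurable]: "theta s \<in> borel_measurable borel"
  unfolding theta_def by measurable

text \<open>All four estimates are \<open>fL_bound\<close> applied to the bump, to its derivative,
  to the difference of a derivative and its translate, and to a first-order Taylor remainder, each
  with M of the right order in w and v. Radius 2 leaves room for shifts of length at most 1.\<close>

lemma theta_bounds:
  assumes s: "0 < s" "s < 1"
  obtains C where "0 < C"
    "\<And>z::'a::euclidean_space. \<bar>theta s z\<bar> \<le> C * jw s z"
    "\<And>w z::'a. norm w \<le> 1 \<Longrightarrow> \<bar>theta s (z + w) - theta s z - dtheta s w z\<bar> \<le> C * (norm w)\<^sup>2 * jw s z"
    "\<And>w z::'a. \<bar>dtheta s w z\<bar> \<le> C * norm w * jw s z"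
    "\<And>w v z::'a. norm v \<le> 1 \<Longrightarrow> \<bar>dtheta s w (z + v) - dtheta s w z\<bar> \<le> C * norm w * norm v * jw s z"
proof -
  obtain K where K: "0 < K" "\<And>(\<phi> :: 'a \<Rightarrow> complex) M x. c2bd 2 M \<phi> \<Longrightarrow> norm (fL s \<phi> x) \<le> K * M * jw s x"
    using fL_bound[OF s, of 2, where 'a='a and 'b=complex] unfolding jw_def by auto
  obtain M0 where M0: "0 < M0" "c2bd 1 M0 (ceta :: 'a \<Rightarrow> complex)" using smc_c2bd[OF smc_ceta] by blast
  obtain M1 where M1: "0 < M1" "\<And>w. c2bd 1 (M1 * norm w) (dd w (ceta :: 'a \<Rightarrow> complex))" using smc_c2bd_dd[OF smc_ceta] by blast
  obtain M2 where M2: "0 < M2" "\<And>u w. c2bd 1 (M2 * norm u * norm w) (dd u (dd w (ceta :: 'a \<Rightarrow> complex)))" using smc_c2bd_dd2[OF smc_ceta] by blast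
  define C where "C = K * M0 + K * M1 + K * M2"
  have C: "0 < C" "K * M0 \<le> C" "K * M1 \<le> C" "K * M2 \<le> C" using K(1) M0(1) M1(1) M2(1) by (auto simp: C_def intro!: add_pos_pos mult_pos_pos)
  show ?thesis
  proof (rule that[OF C(1)])
    fix w v z :: 'a
    show "\<bar>theta s z\<bar> \<le> C * jw s z"
    proof -
      have "\<bar>theta s z\<bar> = norm (fL s ceta z)" by (simp add: fL_ceta)
      also have "\<dots> \<le> K * M0 * jw s z" by (rule K(2)) (rule c2bd_mono[OF M0(2)], auto)
      also have "\<dots> \<le> C * jw s z" using C by (intro mult_right_mono) auto
      finally show ?thesis .
    qed
    show "\<bar>dtheta s w z\<bar> \<le> C * norm w * jw s z"
    proof -
      have "\<bar>dtheta s w z\<bar> \<le> norm (fL s (dd w ceta) z)" unfolding dtheta_def by (rule abs_Re_le_cmod)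
      also have "\<dots> \<le> K * (M1 * norm w) * jw s z" by (rule K(2)) (rule c2bd_mono[OF M1(2)], auto)
      also have "\<dots> = K * M1 * norm w * jw s z" by simp
      also have "\<dots> \<le> C * norm w * jw s z" using C by (intro mult_right_mono) auto
      finally show ?thesis .
    qed
    show "\<bar>dtheta s w (z + v) - dtheta s w z\<bar> \<le> C * norm w * norm v * jw s z" if v: "norm v \<le> 1"
    proof -
      have "\<bar>dtheta s w (z + v) - dtheta s w z\<bar> \<le> norm (fL s (\<lambda>x. dd w ceta (x + v) - dd w ceta x) z)"
        unfolding dtheta_def fL_smc_diff[OF s smc_dd[OF smc_ceta]] using abs_Re_le_cmod by (metis minus_complex.simps(1))
      also have "\<dots> \<le> K * (M2 * norm w * norm v) * jw s z"
        by (rule K(2)) (rule c2bd_mono[OF smc_c2bd_dd_shift[OF smc_ceta M2(2) v]], auto)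
      also have "\<dots> = K * M2 * norm w * norm v * jw s z" by simp
      also have "\<dots> \<le> C * norm w * norm v * jw s z" using C by (intro mult_right_mono) auto
      finally show ?thesis .
    qed
    show "\<bar>theta s (z + w) - theta s z - dtheta s w z\<bar> \<le> C * (norm w)\<^sup>2 * jw s z" if w: "norm w \<le> 1"
    proof -
      have "fL s (\<lambda>x. ceta (x + w) - ceta x - dd w ceta x) z = fL s (\<lambda>x. ceta (x + w) - ceta x) z - fL s (dd w ceta) z"
        by (rule fL_diff[OF c2bd_integrable[OF s smc_c2bd_shift[OF smc_ceta M1(2) w]] c2bd_integrable[OF s M1(2)]])
      then have "fL s (\<lambda>x. ceta (x + w) - ceta x - dd w ceta x) z = complex_of_real (theta s (z + w)) - complex_of_real (theta s z) - fL s (dd w ceta) z"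
        by (simp add: fL_smc_diff[OF s smc_ceta] fL_ceta)
      then have "theta s (z + w) - theta s z - dtheta s w z = Re (fL s (\<lambda>x. ceta (x + w) - ceta x - dd w ceta x) z)"
        by (simp add: dtheta_def)
      also have "\<bar>\<dots>\<bar> \<le> norm (fL s (\<lambda>x. ceta (x + w) - ceta x - dd w ceta x) z)" by (rule abs_Re_le_cmod)
      also have "\<dots> \<le> K * (M2 * (norm w)\<^sup>2) * jw s z"
        by (rule K(2)) (rule c2bd_mono[OF smc_c2bd_taylor[OF smc_ceta M2(2) w]], use M2(1) in auto)
      also have "\<dots> = K * M2 * (norm w)\<^sup>2 * jw s z" by simp
      also have "\<dots> \<le> C * (norm w)\<^sup>2 * jw s z" using C by (intro mult_right_mono) auto
      finally show ?thesis .
    qed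
  qed
qed

lemma dtheta_linear:
  assumes s: "0 < s" "s < 1"
  shows "linear (\<lambda>w. dtheta s w (z::'a::euclidean_space))"
proof -
  obtain M1 where M1: "0 < M1" "\<And>w. c2bd 1 (M1 * norm w) (dd w (ceta :: 'a \<Rightarrow> complex))" using smc_c2bd_dd[OF smc_ceta] by blast
  note lin = dd_linear[OF smc_ceta]
  note i = c2bd_integrable[OF s M1(2)]
  show ?thesis
  proof (rule linearI)
    fix u v :: 'a and c :: real
    have "dd (u + v) ceta x - dd v ceta x = dd u ceta x" for x :: 'a using linear_add[OF lin[of x], of u v] by simp
    then have "fL s (dd u ceta) z = fL s (dd (u + v) ceta) z - fL s (dd v ceta) z"
      using fL_diff[OF i[of "u + v" z] i[of v z]] by simp
    then show "dtheta s (u + v) z = dtheta s u z + dtheta s v z" by (simp add: dtheta_def)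
    have "sdiff (dd (c *\<^sub>R u) ceta) z y = c *\<^sub>R sdiff (dd u ceta) z y" for y
      by (simp add: sdiff_def linear_scale[OF lin] scaleR_diff_right)
    then have "fL s (dd (c *\<^sub>R u) ceta) z = c *\<^sub>R fL s (dd u ceta) z"
      unfolding fL_def by (subst integral_scaleR_right[symmetric]) (simp add: mult.commute)
    then show "dtheta s (c *\<^sub>R u) z = c *\<^sub>R dtheta s u z" by (simp add: dtheta_def)
  qed
qed

lemma theta_integrable:
  assumes s: "0 < s" "s < 1" shows "integrable lborel (theta s :: 'a::euclidean_space \<Rightarrow> real)"
proof -
  obtain M where "c2bd 1 M (eta :: 'a \<Rightarrow> real)" using c2bd_eta by blast
  then show ?thesis unfolding theta_def by (rule fL_integrable[OF s]) simp
qed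

lemma theta_integral:
  assumes s: "0 < s" "s < 1" shows "(LBINT x. theta s (x::'a::euclidean_space)) = 0"
proof -
  obtain M where "c2bd 1 M (eta :: 'a \<Rightarrow> real)" using c2bd_eta by blast
  then show ?thesis unfolding theta_def by (rule fL_integral_zero[OF s]) simp
qed

lemma theta_radial:
  fixes x y :: "'a::euclidean_space"
  assumes "norm x = norm y" shows "theta s x = theta s y"
proof -
  obtain T :: "'a \<Rightarrow> 'a" where T: "orthogonal_transformation T" "T x = y"
    using orthogonal_transformation_mapping[OF assms] by blast
  have lin: "linear T" by (rule orthogonal_transformation_linear[OF T(1)])
  have e: "eta (T z) = eta z" for z by (intro eta_radial) (simp add: orthogonal_transformation_norm[OF T(1)])
  have "theta s y = (LBINT z. kern s (T z) *\<^sub>R sdiff eta y (T z))"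
    unfolding theta_def fL_def by (rule integral_orthogonal[OF _ T(1), symmetric]) measurable
  also have "\<dots> = (LBINT z. kern s z *\<^sub>R sdiff eta x z)"
    unfolding sdiff_def T(2)[symmetric] linear_add[OF lin, symmetric] linear_diff[OF lin, symmetric] e
    by (simp add: kern_def orthogonal_transformation_norm[OF T(1)])
  finally show ?thesis by (simp add: theta_def fL_def)
qed

definition etaform :: "real \<Rightarrow> 'a::euclidean_space itself \<Rightarrow> real \<Rightarrow> real" where
  "etaform s _ t = (LBINT x. eta (x /\<^sub>R t) * theta s (x::'a))"

lemma c2bd_eta_scaled:
  assumes t: "0 < t" obtains M where "c2bd t M (\<lambda>x::'a::euclidean_space. eta (x /\<^sub>R t))"
proof -
  have "smc t (\<lambda>x::'a. ceta (0 + inverse t *\<^sub>R x))"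
    unfolding smc_def
  proof (intro conjI allI impI)
    show "0 \<le> t" using t by simp
    show "smooth_fun (\<lambda>x::'a. ceta (0 + inverse t *\<^sub>R x))" using smc_ceta unfolding smc_def by (intro smooth_affine) auto
    fix x :: 'a assume "t < norm x"
    then have "1 \<le> norm (inverse t *\<^sub>R x)" using t by (simp add: field_simps)
    then show "ceta (0 + inverse t *\<^sub>R x) = 0" by (simp add: ceta_def eta_outside)
  qed
  from smc_c2bd[OF this] obtain M where "c2bd t M (\<lambda>x::'a. complex_of_real (eta (x /\<^sub>R t)))"
    unfolding ceta_def by auto
  from c2bd_of_real[OF this] show ?thesis by (rule that)
qed

text \<open>In the form given by \<open>fL_form\<close> the two differences have the same sign,
  because both dilates of the bump decrease with the norm. The integrand is thus nonnegative, and it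
  is positive for x near 0 and large y, where both shifted values vanish.\<close>

lemma etaform_pos:
  assumes s: "0 < s" "s < 1" and t: "0 < t"
  shows "0 < etaform s TYPE('a::euclidean_space) t"
proof -
  obtain M where M: "c2bd 1 M (eta :: 'a \<Rightarrow> real)" using c2bd_eta by blast
  obtain M' where M': "c2bd t M' (\<lambda>x::'a. eta (x /\<^sub>R t))" using c2bd_eta_scaled[OF t] by blast
  let ?g = "\<lambda>x::'a. eta (x /\<^sub>R t)"
  let ?p = "\<lambda>y x. (?g x - ?g (x + y)) * (eta x - eta (x + y))"
  let ?I = "\<lambda>y. LBINT x. ?p y x"
  have eq: "etaform s TYPE('a) t = (LBINT y. kern s y * ?I y)"
    and int: "integrable lborel (\<lambda>y. kern s y * ?I y)"
    unfolding etaform_def theta_def using fL_form[OF s M _ M'] t by simp_all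
  have p0: "0 \<le> ?p y x" for x y
  proof (cases "norm x \<le> norm (x + y)")
    case True
    then have "norm (x /\<^sub>R t) \<le> norm ((x + y) /\<^sub>R t)" using t by (simp add: mult_left_mono del: scaleR_add_right)
    then show ?thesis using eta_antimono[OF True] eta_antimono[of "x /\<^sub>R t" "(x + y) /\<^sub>R t"] by simp
  next
    case False
    then have le: "norm (x + y) \<le> norm x" by simp
    then have "norm ((x + y) /\<^sub>R t) \<le> norm (x /\<^sub>R t)" using t by (simp add: mult_left_mono del: scaleR_add_right)
    then show ?thesis using eta_antimono[OF le] eta_antimono[of "(x + y) /\<^sub>R t" "x /\<^sub>R t"] by (simp add: mult_nonpos_nonpos)
  qed
  have I0: "0 \<le> ?I y" for y by (intro integral_nonneg_AE AE_I2 p0)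
  have nn: "0 \<le> etaform s TYPE('a) t" unfolding eq using I0 by (intro integral_nonneg_AE AE_I2) simp
  have i1: "integrable lborel (?p y)" for y
  proof (rule integrable_cball_bounded(1)[where M="1" and R="t + 1 + norm y"])
    show "?p y \<in> borel_measurable borel" by measurable
    fix x
    have a: "\<bar>?g x - ?g (x + y)\<bar> \<le> 1" "\<bar>eta x - eta (x + y)\<bar> \<le> 1"
      using eta_nonneg[of "x /\<^sub>R t"] eta_nonneg[of "(x + y) /\<^sub>R t"] eta_le1[of "x /\<^sub>R t"] eta_le1[of "(x + y) /\<^sub>R t"]
        eta_nonneg[of x] eta_nonneg[of "x + y"] eta_le1[of x] eta_le1[of "x + y"] by (simp_all only: abs_le_iff) linarith+
    then show "norm (?p y x) \<le> 1" unfolding real_norm_def abs_mult by (rule mult_le_one[OF _ abs_ge_zero])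
    assume "t + 1 + norm y < norm x"
    then have "1 \<le> norm x" "1 \<le> norm (x + y)" using t norm_triangle_ineq4[of "x + y" y] norm_ge_zero[of y] by (simp_all, linarith+)
    then show "?p y x = 0" by (simp add: eta_outside)
  qed (use t in auto)
  have "etaform s TYPE('a) t \<noteq> 0"
  proof
    assume "etaform s TYPE('a) t = 0"
    then have ae: "AE y in lborel. kern s y * ?I y = 0"
      unfolding eq using integral_nonneg_eq_0_iff_AE[OF int] I0 by auto
    obtain b :: 'a where b: "b \<in> Basis" using nonempty_Basis by blast
    \<comment> \<open>Shifts near \<open>y0\<close> move the ball of radius \<open>min 1 t\<close>
      about 0 out of the supports of both dilates, whose radii are 1 and t.\<close>
    define y0 where "y0 = (t + 5) *\<^sub>R b"
    have ny0: "norm y0 = t + 5" using b t by (simp add: y0_def)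
    have "AE y in lborel. y \<notin> ball y0 1"
      using ae
    proof eventually_elim
      fix y assume y: "kern s y * ?I y = 0"
      show "y \<notin> ball y0 1"
      proof
        assume "y \<in> ball y0 1"
        then have "dist y0 y < 1" by simp
        then have ny: "t + 4 < norm y" using ny0 norm_triangle_sub[of y0 y] by (simp add: dist_norm)
        then have "y \<noteq> 0" using t by auto
        then have "kern s y \<noteq> 0" by (simp add: kern_def)
        then have "?I y = 0" using y by simp
        then have "AE x in lborel. ?p y x = 0"
          using integral_nonneg_eq_0_iff_AE[OF i1[of y]] p0 by auto
        then have "AE x in lborel. x \<notin> ball (0::'a) (min 1 t)"
        proof eventually_elim
          fix x assume x: "?p y x = 0"
          show "x \<notin> ball 0 (min 1 t)"
          proof
            assume "x \<in> ball 0 (min 1 t)"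
            then have x1: "norm x < 1" "norm x < t" by auto
            then have "norm (x /\<^sub>R t) < 1" using t by (simp add: field_simps)
            then have "0 < ?g x" by (rule eta_pos)
            have "0 < eta x" using x1 by (intro eta_pos)
            have n: "t + 1 \<le> norm (x + y)" using ny x1 norm_triangle_ineq4[of "x + y" x] t by simp
            then have "eta (x + y) = 0" using t by (intro eta_outside) simp
            moreover have "1 \<le> norm (x + y) / t" using n t by simp
            then have "1 \<le> norm ((x + y) /\<^sub>R t)" using t by (simp add: divide_inverse mult.commute del: scaleR_add_right)
            then have "?g (x + y) = 0" by (rule eta_outside)
            ultimately show False using x \<open>0 < ?g x\<close> \<open>0 < eta x\<close> by simp
          qed
        qed
        then have "ball (0::'a) (min 1 t) \<in> null_sets lborel" by (subst (asm) AE_iff_null_sets[symmetric]) auto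
        moreover have "0 < unit_ball_vol (real DIM('a)) * (min 1 t) ^ DIM('a)" using t by (intro mult_pos_pos) auto
        ultimately show False using t by (simp add: null_sets_def emeasure_ball ennreal_eq_0_iff not_le[symmetric])
      qed
    qed
    then have "ball y0 1 \<in> null_sets lborel" by (subst (asm) AE_iff_null_sets[symmetric]) auto
    moreover have "0 < unit_ball_vol (real DIM('a)) * 1 ^ DIM('a)" by (intro mult_pos_pos) auto
    ultimately show False by (simp add: null_sets_def emeasure_ball ennreal_eq_0_iff not_le[symmetric])
  qed
  then show ?thesis using nn by simp
qed

lemma powr_inf_integral:
  assumes "e < -1" "0 < (a::real)"
  shows "integrable lborel (\<lambda>x. indicator {a..} x * x powr e)" "(LBINT x. indicator {a..} x * x powr e) = a powr (e + 1) / (- e - 1)"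
proof -
  have "has_bochner_integral lborel (\<lambda>x. indicator {a..} x * x powr e) (a powr (e + 1) / (- e - 1))"
    using nn_integral_powr_inf[OF assms] assms
    by (intro has_bochner_integral_nn_integral) (auto simp: ennreal_mult' ennreal_indicator)
  then show "integrable lborel (\<lambda>x. indicator {a..} x * x powr e)" "(LBINT x. indicator {a..} x * x powr e) = a powr (e + 1) / (- e - 1)"
    by (auto simp: has_bochner_integral_iff)
qed

lemma powr_0_integral:
  assumes "-1 < b" "0 \<le> (a::real)"
  shows "integrable lborel (\<lambda>x. indicator {0..a} x * x powr b)" "(LBINT x. indicator {0..a} x * x powr b) = a powr (b + 1) / (b + 1)"
proof -
  have "has_bochner_integral lborel (\<lambda>x. indicator {0..a} x * x powr b) (a powr (b + 1) / (b + 1))"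
    using nn_integral_powr_0[OF assms] assms
    by (intro has_bochner_integral_nn_integral) (auto simp: ennreal_mult' ennreal_indicator)
  then show "integrable lborel (\<lambda>x. indicator {0..a} x * x powr b)" "(LBINT x. indicator {0..a} x * x powr b) = a powr (b + 1) / (b + 1)"
    by (auto simp: has_bochner_integral_iff)
qed

lemma integral_dominated:
  fixes f :: "'c \<Rightarrow> real"
  assumes "integrable M g" "f \<in> borel_measurable M" "\<And>x. \<bar>f x\<bar> \<le> g x"
  shows "integrable M f" "\<bar>integral\<^sup>L M f\<bar> \<le> integral\<^sup>L M g"
proof -
  show i: "integrable M f"
    by (rule Bochner_Integration.integrable_bound[OF assms(1,2)]) (use assms(3) in \<open>auto intro!: AE_I2 order_trans[OF assms(3)]\<close>)
  have "\<bar>integral\<^sup>L M f\<bar> \<le> (LINT x|M. \<bar>f x\<bar>)" using integral_norm_bound[of M f] by simp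
  also have "\<dots> \<le> integral\<^sup>L M g" using i assms by (intro integral_mono) auto
  finally show "\<bar>integral\<^sup>L M f\<bar> \<le> integral\<^sup>L M g" .
qed

subsection \<open>Averages over scales\<close>

text \<open>The L1-normalised dilates t^(-N) theta(x/t) are integrated against the scale-invariant
  measure dt/t; A is the set of scales.\<close>

definition thI :: "real \<Rightarrow> real set \<Rightarrow> 'a::euclidean_space \<Rightarrow> real" where
  "thI s A x = (LBINT t. indicator A t * (t powr (- real DIM('a) - 1) * theta s (x /\<^sub>R t)))"

definition Theta :: "real \<Rightarrow> 'a::euclidean_space \<Rightarrow> real" where
  "Theta s = thI s {1..}"

definition dTheta :: "real \<Rightarrow> 'a::euclidean_space \<Rightarrow> 'a \<Rightarrow> real" where
  "dTheta s w z = (LBINT t. indicator {1..} t * (t powr (- real DIM('a) - 2) * dtheta s w (z /\<^sub>R t)))"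

lemma thI_measurable [measurable]:
  assumes [measurable]: "A \<in> sets borel" shows "thI s A \<in> borel_measurable borel"
  unfolding thI_def[abs_def] by (rule lborel.borel_measurable_lebesgue_integral) measurable

lemma Theta_measurable [measurable]: "Theta s \<in> borel_measurable borel"
  unfolding Theta_def by measurable

lemma dTheta_measurable [measurable]: "dTheta s w \<in> borel_measurable borel"
  unfolding dTheta_def[abs_def] by (rule lborel.borel_measurable_lebesgue_integral) measurable

lemma theta_bd:
  assumes s: "0 < s" "s < 1"
  obtains C where "0 < C" "\<And>z::'a::euclidean_space. \<bar>theta s z\<bar> \<le> C"
    "\<And>z::'a. z \<noteq> 0 \<Longrightarrow> \<bar>theta s z\<bar> \<le> C * norm z powr (- real DIM('a) - 2 * s)"
proof -
  obtain C where C: "0 < C" "\<And>z::'a. \<bar>theta s z\<bar> \<le> C * jw s z" using theta_bounds[OF s, where 'a='a] by metis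
  show ?thesis
  proof (rule that[OF C(1)])
    fix z :: 'a
    have "C * jw s z \<le> C * 1" using jw_le1[OF s(1), of z] C(1) by (intro mult_left_mono) auto
    then show "\<bar>theta s z\<bar> \<le> C" using C(2)[of z] by linarith
    assume "z \<noteq> 0"
    then have "jw s z \<le> norm z powr (- real DIM('a) - 2 * s)"
      unfolding jw_def using s by (intro powr_mono2' japanese_ge_norm) auto
    then show "\<bar>theta s z\<bar> \<le> C * norm z powr (- real DIM('a) - 2 * s)"
      using C(2)[of z] mult_left_mono[of "jw s z" _ C] C(1) by (meson less_imp_le order_trans)
  qed
qed

lemma thI_integrable:
  fixes x :: "'a::euclidean_space"
  assumes s: "0 < s" "s < 1" and a: "0 < a" and A: "A \<subseteq> {a..}" "A \<in> sets borel"
  shows "integrable lborel (\<lambda>t. indicator A t * (t powr (- real DIM('a) - 1) * theta s (x /\<^sub>R t)))"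
proof -
  let ?n = "real DIM('a)"
  note [measurable] = A(2)
  obtain C where C: "0 < C" "\<And>z::'a. \<bar>theta s z\<bar> \<le> C" using theta_bd[OF s, where 'a='a] by metis
  have i: "integrable lborel (\<lambda>t. C * (indicator {a..} t * t powr (- ?n - 1)))"
    using a by (intro integrable_mult_right powr_inf_integral(1)) auto
  show ?thesis
  proof (rule integral_dominated(1)[OF i])
    fix t :: real
    have "\<bar>t powr (- ?n - 1) * theta s (x /\<^sub>R t)\<bar> \<le> t powr (- ?n - 1) * C"
      unfolding abs_mult using C(2) by (intro mult_mono) auto
    then show "\<bar>indicator A t * (t powr (- ?n - 1) * theta s (x /\<^sub>R t))\<bar> \<le> C * (indicator {a..} t * t powr (- ?n - 1))"
      using A(1) C(1) by (auto simp: indicator_def mult.commute)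
  qed measurable
qed

text \<open>At small t the decay of \<open>theta\<close> turns t^(-N-1) into t^(2s-1), which is
  integrable at 0. The resulting bound away from the origin is the one that \<open>Theta\<close>
  inherits through \<open>thI_full_zero\<close>.\<close>

lemma thI_integrable0:
  fixes x :: "'a::euclidean_space"
  assumes s: "0 < s" "s < 1" and a: "0 < a" and x: "x \<noteq> 0"
  shows "integrable lborel (\<lambda>t. indicator {0..<a} t * (t powr (- real DIM('a) - 1) * theta s (x /\<^sub>R t)))"
    "\<exists>C>0. \<forall>x::'a. x \<noteq> 0 \<longrightarrow> \<bar>thI s {0..<a} x\<bar> \<le> C * norm x powr (- real DIM('a) - 2 * s)"
proof -
  let ?n = "real DIM('a)"
  obtain C where C: "0 < C" "\<And>z::'a. z \<noteq> 0 \<Longrightarrow> \<bar>theta s z\<bar> \<le> C * norm z powr (- ?n - 2 * s)"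
    using theta_bd[OF s, where 'a='a] by metis
  have bd: "\<bar>indicator {0..<a} t * (t powr (- ?n - 1) * theta s (x /\<^sub>R t))\<bar> \<le> C * norm x powr (- ?n - 2 * s) * (indicator {0..a} t * t powr (2 * s - 1))"
    if x: "x \<noteq> 0" for t and x :: 'a
  proof (cases "0 < t \<and> t < a")
    case True
    have "\<bar>theta s (x /\<^sub>R t)\<bar> \<le> C * norm (x /\<^sub>R t) powr (- ?n - 2 * s)" using C(2)[of "x /\<^sub>R t"] x True by simp
    also have "norm (x /\<^sub>R t) = norm x / t" using True by (simp add: divide_inverse mult.commute)
    also have "(norm x / t) powr (- ?n - 2 * s) = norm x powr (- ?n - 2 * s) * t powr (?n + 2 * s)"
      using True by (simp add: powr_divide powr_minus_divide[symmetric] divide_powr_uminus add.commute)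
    finally have "t powr (- ?n - 1) * \<bar>theta s (x /\<^sub>R t)\<bar> \<le> t powr (- ?n - 1) * (C * (norm x powr (- ?n - 2 * s) * t powr (?n + 2 * s)))"
      by (rule mult_left_mono) simp
    also have "\<dots> = C * norm x powr (- ?n - 2 * s) * (t powr (- ?n - 1) * t powr (?n + 2 * s))" by simp
    also have "t powr (- ?n - 1) * t powr (?n + 2 * s) = t powr (2 * s - 1)"
      unfolding powr_add[symmetric] by (rule arg_cong[where f="\<lambda>e. t powr e"]) simp
    finally show ?thesis using True by (simp add: abs_mult)
  next
    case False
    then have "t = 0 \<or> t \<notin> {0..<a}" by auto
    then show ?thesis using C(1) by (auto simp: indicator_def)
  qed
  have i: "integrable lborel (\<lambda>t. C * norm x powr (- ?n - 2 * s) * (indicator {0..a} t * t powr (2 * s - 1)))" for x :: 'a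
    using s a by (intro integrable_mult_right powr_0_integral(1)) auto
  show "integrable lborel (\<lambda>t. indicator {0..<a} t * (t powr (- ?n - 1) * theta s (x /\<^sub>R t)))"
    by (rule integral_dominated(1)[OF i _ bd[OF x]]) measurable
  have "\<bar>thI s {0..<a} x\<bar> \<le> (C * (a powr (2 * s) / (2 * s))) * norm x powr (- ?n - 2 * s)" if x: "x \<noteq> 0" for x :: 'a
  proof -
    have "\<bar>thI s {0..<a} x\<bar> \<le> (LBINT t. C * norm x powr (- ?n - 2 * s) * (indicator {0..a} t * t powr (2 * s - 1)))"
      unfolding thI_def by (rule integral_dominated(2)[OF i _ bd[OF x]]) measurable
    also have "\<dots> = C * norm x powr (- ?n - 2 * s) * (a powr (2 * s) / (2 * s))"
      using powr_0_integral(2)[of "2 * s - 1" a] s a by simp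
    finally show ?thesis by (simp add: mult_ac)
  qed
  moreover have "0 < C * (a powr (2 * s) / (2 * s))" using C(1) s a by simp
  ultimately show "\<exists>C>0. \<forall>x::'a. x \<noteq> 0 \<longrightarrow> \<bar>thI s {0..<a} x\<bar> \<le> C * norm x powr (- ?n - 2 * s)" by blast
qed

lemma thI_split:
  fixes x :: "'a::euclidean_space"
  assumes s: "0 < s" "s < 1" and a: "0 < a" "a \<le> b"
  shows "thI s {a..<b} x = thI s {a..} x - thI s {b..} x"
proof -
  have "thI s {a..<b} x = (LBINT t. indicator {a..} t * (t powr (- real DIM('a) - 1) * theta s (x /\<^sub>R t)) - indicator {b..} t * (t powr (- real DIM('a) - 1) * theta s (x /\<^sub>R t)))"
    unfolding thI_def using a by (intro Bochner_Integration.integral_cong) (auto simp: indicator_def)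
  also have "\<dots> = thI s {a..} x - thI s {b..} x"
    unfolding thI_def using a by (intro Bochner_Integration.integral_diff thI_integrable[OF s a(1)]) auto
  finally show ?thesis .
qed

lemma thI_scale:
  fixes x :: "'a::euclidean_space"
  assumes t: "0 < r" and A [measurable]: "A \<in> sets borel"
  shows "thI s ((\<lambda>t. r * t) -` A) (x /\<^sub>R r) = r ^ DIM('a) * thI s A x"
proof -
  let ?n = "real DIM('a)"
  have [measurable]: "(\<lambda>t. r * t) -` A \<in> sets borel"
    using measurable_sets[of "\<lambda>t. r * t" borel borel A] by simp
  have "thI s A x = \<bar>r\<bar> ^ DIM(real) *\<^sub>R (LBINT t. indicator A (0 + r *\<^sub>R t) * ((0 + r *\<^sub>R t) powr (- ?n - 1) * theta s (x /\<^sub>R (0 + r *\<^sub>R t))))"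
    unfolding thI_def using t by (intro integral_affine) auto
  also have "\<dots> = r * (LBINT t. r powr (- ?n - 1) * (indicator ((\<lambda>t. r * t) -` A) t * (t powr (- ?n - 1) * theta s ((x /\<^sub>R r) /\<^sub>R t))))"
  proof -
    have "indicator A (0 + r *\<^sub>R t) * ((0 + r *\<^sub>R t) powr (- ?n - 1) * theta s (x /\<^sub>R (0 + r *\<^sub>R t)))
      = r powr (- ?n - 1) * (indicator ((\<lambda>t. r * t) -` A) t * (t powr (- ?n - 1) * theta s ((x /\<^sub>R r) /\<^sub>R t)))" for t
      by (simp add: indicator_def powr_mult mult.commute[of "inverse r"])
    then show ?thesis using t by (simp only: abs_of_pos DIM_real power_one_right real_scaleR_def)
  qed
  also have "\<dots> = r * r powr (- ?n - 1) * thI s ((\<lambda>t. r * t) -` A) (x /\<^sub>R r)"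
    unfolding thI_def by simp
  also have "r * r powr (- ?n - 1) = r powr (- ?n)"
    using powr_add[of r 1 "- ?n - 1"] t by simp
  finally show ?thesis using t by (simp add: powr_minus powr_realpow)
qed

text \<open>All averages over large scales are normalised dilates of one function. Together with
  \<open>thI_split\<close> this turns an average over scales between a and b into the difference of
  two members of an approximate identity.\<close>

lemma thI_Theta:
  fixes x :: "'a::euclidean_space"
  assumes "0 < r" shows "thI s {r..} x = Theta s (x /\<^sub>R r) / r ^ DIM('a)"
proof -
  have "(\<lambda>t. r * t) -` {r..} = {1..}" using assms by (auto simp: mult_le_cancel_left1)
  then show ?thesis using thI_scale[OF assms, of "{r..}" s x] assms by (simp add: Theta_def)
qed

lemma thI_radial:
  fixes x y :: "'a::euclidean_space"
  assumes "norm x = norm y" shows "thI s A x = thI s A y"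
proof -
  have "theta s (x /\<^sub>R t) = theta s (y /\<^sub>R t)" for t by (rule theta_radial) (simp add: assms)
  then show ?thesis by (simp add: thI_def)
qed

text \<open>The measure dt/t is invariant under dilations, so every ray spends the same logarithmic
  time in the shell between radii 1 and 2.\<close>

lemma nn_integral_inverse_shell:
  assumes "0 < (r::real)"
  shows "(\<integral>\<^sup>+t. indicator {0<..} t * ennreal (1 / t) * indicator {1..2} (t * r) \<partial>lborel) = ennreal (ln 2)"
proof -
  have "(\<integral>\<^sup>+t. indicator {0<..} t * ennreal (1 / t) * indicator {1..2} (t * r) \<partial>lborel) = (\<integral>\<^sup>+t. ennreal (1 / t) * indicator {1 / r..2 / r} t \<partial>lborel)"
    using assms
  proof (intro nn_integral_cong)
    fix t :: real
    have "0 < t" if "1 / r \<le> t" using that assms by (meson divide_pos_pos less_le_trans zero_less_one)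
    then show "indicator {0<..} t * ennreal (1 / t) * indicator {1..2} (t * r) = ennreal (1 / t) * indicator {1 / r..2 / r} t"
      using assms by (auto simp: indicator_def divide_le_eq le_divide_eq)
  qed
  also have "\<dots> = ennreal (ln (2 / r) - ln (1 / r))"
  proof (rule nn_integral_FTC_Icc)
    fix x assume "x \<in> {1 / r..2 / r}"
    then have x: "0 < x" using assms by (meson atLeastAtMost_iff divide_pos_pos less_le_trans zero_less_one)
    show "(ln has_real_derivative 1 / x) (at x)" using x by (auto intro!: derivative_eq_intros)
    show "0 \<le> 1 / x" using x by simp
  qed (use assms in \<open>auto simp: divide_right_mono\<close>)
  also have "ln (2 / r) - ln (1 / r) = ln 2" using assms by (simp add: ln_div)
  finally show ?thesis .
qed

text \<open>By scaling and radial symmetry the left side is a constant times |x|^(-N). Integrated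
  over the shell S and substituted x = t z, it becomes the integral of \<open>theta s z\<close>
  times the time ln 2 that t z spends in S, hence 0 by \<open>theta_integral\<close>. Since |x|^(-N)
  has a positive integral over S, the constant vanishes.\<close>

lemma thI_full_zero:
  fixes x :: "'a::euclidean_space"
  assumes s: "0 < s" "s < 1" and x: "x \<noteq> 0"
  shows "thI s {0..} x = 0"
proof -
  let ?n = "real DIM('a)"
  define S where "S = {x::'a. 1 \<le> norm x \<and> norm x \<le> 2}"
  have [measurable]: "S \<in> sets borel" unfolding S_def by measurable
  have Sind: "indicator S (t *\<^sub>R z) = indicator {1..2} (t * norm z)" if "0 < t" for t and z :: 'a
    using that by (auto simp: S_def indicator_def)
  let ?F = "\<lambda>t x. indicator {0<..} t * (indicator S x * (t powr (- ?n - 1) * theta s (x /\<^sub>R t)))"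
  \<comment> \<open>This is the integrand after x = t z: the Jacobian t^N leaves exactly
    1/t.\<close>
  let ?H = "\<lambda>t z. indicator {0<..} t * ((1 / t) * (indicator S (t *\<^sub>R z) * theta s z))"
  have Hn: "(\<integral>\<^sup>+t. ennreal (norm (?H t z)) \<partial>lborel) = ennreal (ln 2 * \<bar>theta s z\<bar>)" if "z \<noteq> 0" for z
  proof -
    have "(\<integral>\<^sup>+t. ennreal (norm (?H t z)) \<partial>lborel) = (\<integral>\<^sup>+t. (indicator {0<..} t * ennreal (1 / t) * indicator {1..2} (t * norm z)) * ennreal \<bar>theta s z\<bar> \<partial>lborel)"
    proof (intro nn_integral_cong)
      fix t :: real
      show "ennreal (norm (?H t z)) = (indicator {0<..} t * ennreal (1 / t) * indicator {1..2} (t * norm z)) * ennreal \<bar>theta s z\<bar>"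
      proof (cases "0 < t")
        case True
        then have "norm (?H t z) = (1 / t) * indicator {1..2} (t * norm z) * \<bar>theta s z\<bar>" by (simp add: abs_mult Sind[OF True])
        then show ?thesis using True by (auto simp: indicator_def simp flip: ennreal_mult)
      qed simp
    qed
    also have "\<dots> = ennreal (ln 2) * ennreal \<bar>theta s z\<bar>"
      using nn_integral_inverse_shell[of "norm z"] that by (subst nn_integral_multc) auto
    finally show ?thesis by (simp add: ennreal_mult')
  qed
  have z0: "AE z in lborel. z \<noteq> (0::'a)" by (rule AE_lborel_singleton)
  have Hi: "integrable lborel (\<lambda>t. ?H t z)" "(LBINT t. norm (?H t z)) = ln 2 * \<bar>theta s z\<bar>" if "z \<noteq> 0" for z
  proof -
    show i: "integrable lborel (\<lambda>t. ?H t z)" by (rule integrableI_bounded) (measurable, simp only: Hn[OF that] ennreal_less_top infinity_ennreal_def)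
    have "ennreal (LBINT t. norm (?H t z)) = ennreal (ln 2 * \<bar>theta s z\<bar>)"
      unfolding Hn[OF that, symmetric] by (rule nn_integral_eq_integral[OF integrable_norm[OF i], symmetric]) simp
    moreover have "0 \<le> (LBINT t. norm (?H t z))" by (rule integral_nonneg_AE) simp
    moreover have "0 \<le> ln 2 * \<bar>theta s z\<bar>" by simp
    ultimately show "(LBINT t. norm (?H t z)) = ln 2 * \<bar>theta s z\<bar>" by (metis ennreal_inj)
  qed
  have Hj: "integrable lborel2 (\<lambda>(z, t). ?H t z)"
  proof (rule lborel_pair.Fubini_integrable)
    show "integrable lborel (\<lambda>z. LBINT t. norm (case (z, t) of (z, t) \<Rightarrow> ?H t z))"
    proof (rule integrable_cong_AE_imp[of _ "\<lambda>z. ln 2 * \<bar>theta s z\<bar>"])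
      show "integrable lborel (\<lambda>z::'a. ln 2 * \<bar>theta s z\<bar>)" using theta_integrable[OF s] by auto
      show "AE z in lborel. ln 2 * \<bar>theta s z\<bar> = (LBINT t. norm (case (z, t) of (z, t) \<Rightarrow> ?H t z))"
        using z0 by eventually_elim (unfold prod.case, rule Hi(2)[symmetric])
      show "(\<lambda>z. LBINT t. norm (case (z, t) of (z, t) \<Rightarrow> ?H t z)) \<in> borel_measurable lborel"
        by (rule lborel.borel_measurable_lebesgue_integral) measurable
    qed
    show "AE z in lborel. integrable lborel (\<lambda>t. case (z, t) of (z, t) \<Rightarrow> ?H t z)"
      using z0 by eventually_elim (unfold prod.case, rule Hi(1))
  qed measurable
  have Hj': "integrable lborel2 (\<lambda>(t, z). ?H t z)"
    using lborel_pair.integrable_product_swap[OF Hj] by (simp add: case_prod_beta)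
  \<comment> \<open>The substitution is stated for positively homogeneous G so that it serves both
    the integral itself and the integral of the absolute value, which Fubini requires.\<close>
  have ch: "(LBINT x. G (?F t x)) = (LBINT z. G (?H t z))" if [measurable]: "G \<in> borel_measurable borel" and G: "\<And>c x. 0 \<le> c \<Longrightarrow> G (c * x) = c * G x"
    for G :: "real \<Rightarrow> real" and t
  proof (cases "0 < t")
    case True
    have "(LBINT x. G (?F t x)) = \<bar>t\<bar> ^ DIM('a) *\<^sub>R (LBINT z. G (?F t (0 + t *\<^sub>R z)))"
      using True by (intro integral_affine) auto
    also have "\<dots> = (LBINT z. t ^ DIM('a) * G (?F t (0 + t *\<^sub>R z)))" using True by simp
    also have "\<dots> = (LBINT z. G (?H t z))"
    proof (intro Bochner_Integration.integral_cong refl)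
      fix z
      have "t ^ DIM('a) * t powr (- ?n - 1) = 1 / t"
        using True powr_add[of t ?n "- ?n - 1"] by (simp add: powr_realpow powr_minus_divide)
      then have e: "t ^ DIM('a) * ?F t (0 + t *\<^sub>R z) = ?H t z" using True by (simp add: field_simps)
      have "G (t ^ DIM('a) * ?F t (0 + t *\<^sub>R z)) = t ^ DIM('a) * G (?F t (0 + t *\<^sub>R z))"
        using True by (intro G) simp
      then show "t ^ DIM('a) * G (?F t (0 + t *\<^sub>R z)) = G (?H t z)" unfolding e by (rule sym)
    qed
    finally show ?thesis .
  qed simp
  have Fi: "AE t in lborel. integrable lborel (\<lambda>x. ?F t x)"
  proof (intro AE_I2)
    fix t
    obtain C where C: "0 < C" "\<And>z::'a. \<bar>theta s z\<bar> \<le> C" using theta_bd[OF s, where 'a='a] by metis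
    show "integrable lborel (\<lambda>x. ?F t x)"
    proof (rule integrable_cball_bounded(1)[where R=2 and M="t powr (- ?n - 1) * C"])
      fix x show "norm (?F t x) \<le> t powr (- ?n - 1) * C"
        using C(1) C(2)[of "x /\<^sub>R t"] by (auto simp: indicator_def abs_mult intro!: mult_left_mono)
    qed (auto simp: S_def)
  qed
  have Fj: "integrable lborel2 (\<lambda>(t, x). ?F t x)"
  proof (rule lborel_pair.Fubini_integrable)
    have "(\<lambda>t. LBINT x. norm (?F t x)) = (\<lambda>t. LBINT z. norm (?H t z))"
      by (intro ext ch) (auto simp: abs_mult)
    moreover have "integrable lborel2 (\<lambda>(t, z). norm (?H t z))"
      using integrable_norm[OF Hj'] by (simp only: case_prod_beta')
    note lborel_pair.integrable_fst[OF this]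
    ultimately show "integrable lborel (\<lambda>t. LBINT x. norm (case (t, x) of (t, x) \<Rightarrow> ?F t x))"
      by (simp only: prod.case)
    show "AE t in lborel. integrable lborel (\<lambda>x. case (t, x) of (t, x) \<Rightarrow> ?F t x)" using Fi by simp
  qed measurable
  have "(LBINT x. LBINT t. ?F t x) = (LBINT t. LBINT x. ?F t x)"
    by (rule lborel_pair.Fubini_integral[OF Fj])
  also have "\<dots> = (LBINT t. LBINT z. ?H t z)"
    by (intro Bochner_Integration.integral_cong refl ch[of "\<lambda>x. x"]) auto
  also have "\<dots> = (LBINT z. LBINT t. ?H t z)"
    by (rule lborel_pair.Fubini_integral[OF Hj', symmetric])
  also have "\<dots> = (LBINT z. ln 2 * theta s (z::'a))"
  proof (rule integral_cong_AE)
    show "AE z in lborel. (LBINT t. ?H t z) = ln 2 * theta s z"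
      using z0
    proof eventually_elim
      fix z :: 'a assume z: "z \<noteq> 0"
      show "(LBINT t. ?H t z) = ln 2 * theta s z"
      proof (cases "0 \<le> theta s z")
        case True
        have "(\<lambda>t. ?H t z) = (\<lambda>t. norm (?H t z))" using True by (auto simp: fun_eq_iff indicator_def)
        then show ?thesis using Hi(2)[OF z] True by simp
      next
        case False
        have "(\<lambda>t. ?H t z) = (\<lambda>t. - norm (?H t z))" using False by (auto simp: fun_eq_iff indicator_def abs_mult)
        then show ?thesis using Hi(2)[OF z] False by simp
      qed
    qed
    show "(\<lambda>z. LBINT t. ?H t z) \<in> borel_measurable lborel"
      by (rule lborel.borel_measurable_lebesgue_integral) measurable
  qed measurable
  also have "\<dots> = 0" using theta_integral[OF s, where 'a='a] by simp
  finally have zero: "(LBINT x. LBINT t. ?F t x) = 0" .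
  have F0: "(LBINT t. ?F t y) = indicator S y * thI s {0..} y" for y
  proof -
    have "(LBINT t. ?F t y) = (LBINT t. indicator S y * (indicator {0..} t * (t powr (- ?n - 1) * theta s (y /\<^sub>R t))))"
      by (intro Bochner_Integration.integral_cong) (auto simp: indicator_def)
    then show ?thesis by (simp add: thI_def)
  qed
  obtain b :: 'a where b: "b \<in> Basis" using nonempty_Basis by blast
  have hom: "thI s {0..} y = thI s {0..} b / norm y ^ DIM('a)" if "y \<noteq> 0" for y :: 'a
  proof -
    have "(\<lambda>t. norm y * t) -` {0..} = {0..}" using that by (auto simp: zero_le_mult_iff)
    then have "thI s {0..} (y /\<^sub>R norm y) = norm y ^ DIM('a) * thI s {0..} y"
      using thI_scale[of "norm y" "{0..}" s y] that by simp
    moreover have "thI s {0..} (y /\<^sub>R norm y) = thI s {0..} b" by (rule thI_radial) (use that b in simp)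
    ultimately show ?thesis using that by (simp add: field_simps)
  qed
  have "(LBINT x. LBINT t. ?F t x) = (LBINT y. thI s {0..} b * (indicator S y / norm y ^ DIM('a)))"
    unfolding F0
  proof (intro Bochner_Integration.integral_cong refl)
    fix y :: 'a
    show "indicator S y * thI s {0..} y = thI s {0..} b * (indicator S y / norm y ^ DIM('a))"
    proof (cases "y \<in> S")
      case True
      then have "y \<noteq> 0" by (auto simp: S_def)
      then show ?thesis using True by (simp add: hom)
    qed simp
  qed
  then have z2: "thI s {0..} b * (LBINT y. indicator S (y::'a) / norm y ^ DIM('a)) = 0"
    using zero by (simp only: integral_mult_right_zero)
  have Si: "integrable lborel (\<lambda>y::'a. indicator S y / norm y ^ DIM('a))"
    by (rule integrable_cball_bounded(1)[where R=2 and M=1]) (auto simp: S_def indicator_def divide_le_eq)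
  have "(LBINT y. indicator S (y::'a) / norm y ^ DIM('a)) \<noteq> 0"
  proof
    assume "(LBINT y. indicator S (y::'a) / norm y ^ DIM('a)) = 0"
    then have "AE y in lborel. indicator S (y::'a) / norm y ^ DIM('a) = 0"
      using integral_nonneg_eq_0_iff_AE[OF Si] by simp
    then have "AE y in lborel. y \<notin> ball ((3/2) *\<^sub>R b) (1/2)"
    proof eventually_elim
      fix y :: 'a assume y: "indicator S y / norm y ^ DIM('a) = 0"
      show "y \<notin> ball ((3/2) *\<^sub>R b) (1/2)"
      proof
        assume "y \<in> ball ((3/2) *\<^sub>R b) (1/2)"
        then have "norm ((3/2) *\<^sub>R b - y) < 1/2" by (simp add: dist_norm)
        moreover have "norm ((3/2) *\<^sub>R b) = 3/2" using b by simp
        ultimately have "1 \<le> norm y" "norm y \<le> 2"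
          using norm_triangle_ineq2[of "(3/2) *\<^sub>R b" y] norm_triangle_ineq2[of y "(3/2) *\<^sub>R b"] unfolding norm_minus_commute[of y] by linarith+
        then show False using y by (auto simp: S_def)
      qed
    qed
    then have "ball ((3/2) *\<^sub>R b) (1/2) \<in> null_sets lborel" by (subst (asm) AE_iff_null_sets[symmetric]) auto
    moreover have "0 < unit_ball_vol (real DIM('a)) * (1/2) ^ DIM('a)" by (intro mult_pos_pos) auto
    ultimately show False by (simp add: null_sets_def emeasure_ball ennreal_eq_0_iff not_le[symmetric])
  qed
  then have "thI s {0..} b = 0" using z2 by simp
  then show ?thesis using hom[OF x] by simp
qed

lemma jw_scale:
  assumes s: "0 < s" and t: "1 \<le> t"
  shows "jw s (z /\<^sub>R t :: 'a::euclidean_space) \<le> t powr (real DIM('a) + 2 * s) * jw s z"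
proof -
  let ?n = "real DIM('a)"
  have "japanese z \<le> t * japanese (z /\<^sub>R t)"
  proof -
    have "norm z = t * norm (z /\<^sub>R t)" using t by simp
    then have "japanese z = sqrt (1 + t\<^sup>2 * (norm (z /\<^sub>R t))\<^sup>2)" unfolding japanese_def by (simp only: power_mult_distrib)
    also have "\<dots> \<le> sqrt (t\<^sup>2 * (1 + (norm (z /\<^sub>R t))\<^sup>2))"
      using t by (intro real_sqrt_le_mono) (simp add: distrib_left one_le_power)
    finally show ?thesis using t by (simp add: japanese_def real_sqrt_mult)
  qed
  then have "(t * japanese (z /\<^sub>R t)) powr (- ?n - 2 * s) \<le> japanese z powr (- ?n - 2 * s)"
    using s by (intro powr_mono2') auto
  then have 1: "t powr (- ?n - 2 * s) * jw s (z /\<^sub>R t) \<le> jw s z"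
    by (simp add: powr_mult jw_def)
  have 2: "t powr (?n + 2 * s) * t powr (- ?n - 2 * s) = 1"
    using t by (simp add: powr_add[symmetric])
  show ?thesis
    using mult_left_mono[OF 1, of "t powr (?n + 2 * s)"] 2 by (simp add: mult.assoc[symmetric])
qed

text \<open>Near 0 the integral is bounded directly. Away from 0 the scales above 1 contribute minus
  the scales below 1, by \<open>thI_full_zero\<close>, and the latter have the full decay.\<close>

lemma Theta_le:
  assumes s: "0 < s" "s < 1"
  obtains C where "0 < C" "\<And>z::'a::euclidean_space. \<bar>Theta s z\<bar> \<le> C * jw s z"
proof -
  let ?n = "real DIM('a)"
  let ?e = "?n + 2 * s"
  obtain C where C: "0 < C" "\<And>z::'a. \<bar>theta s z\<bar> \<le> C" using theta_bd[OF s, where 'a='a] by metis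
  obtain b :: 'a where b: "b \<in> Basis" using nonempty_Basis by blast
  have b0: "b \<noteq> 0" using b by auto
  obtain D where D: "0 < D" "\<And>z::'a. z \<noteq> 0 \<Longrightarrow> \<bar>thI s {0..<1} z\<bar> \<le> D * norm z powr (- ?n - 2 * s)"
    using thI_integrable0(2)[OF s, of 1 b] b0 by auto
  have i: "integrable lborel (\<lambda>t. C * (indicator {1..} t * t powr (- ?n - 1)))"
    by (intro integrable_mult_right powr_inf_integral(1)) auto
  have near: "\<bar>Theta s z\<bar> \<le> C" for z :: 'a
  proof -
    have "\<bar>Theta s z\<bar> \<le> (LBINT t. C * (indicator {1..} t * t powr (- ?n - 1)))"
      unfolding Theta_def thI_def
    proof (rule integral_dominated(2)[OF i])
      fix t :: real
      have "\<bar>t powr (- ?n - 1) * theta s (z /\<^sub>R t)\<bar> \<le> t powr (- ?n - 1) * C"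
        unfolding abs_mult using C(2) by (intro mult_mono) auto
      then show "\<bar>indicator {1..} t * (t powr (- ?n - 1) * theta s (z /\<^sub>R t))\<bar> \<le> C * (indicator {1..} t * t powr (- ?n - 1))"
        using C(1) by (auto simp: indicator_def mult.commute)
    qed measurable
    also have "\<dots> = C * (1 / ?n)"
      using powr_inf_integral(2)[of "- ?n - 1" 1] by simp
    also have "\<dots> \<le> C * 1"
    proof (rule mult_left_mono)
      have "1 \<le> DIM('a)" using DIM_positive[where 'a='a] by linarith
      then show "1 / ?n \<le> 1" by simp
    qed (use C in simp)
    finally show ?thesis by simp
  qed
  have far: "\<bar>Theta s z\<bar> \<le> D * norm z powr (- ?n - 2 * s)" if z: "z \<noteq> 0" for z :: 'a
  proof -
    have "thI s {0..} z = (LBINT t. indicator {0..<1} t * (t powr (- ?n - 1) * theta s (z /\<^sub>R t)) + indicator {1..} t * (t powr (- ?n - 1) * theta s (z /\<^sub>R t)))"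
      unfolding thI_def by (intro Bochner_Integration.integral_cong) (auto simp: indicator_def)
    also have "\<dots> = thI s {0..<1} z + thI s {1..} z"
      unfolding thI_def by (intro Bochner_Integration.integral_add thI_integrable[OF s, of 1] thI_integrable0(1)[OF s _ z]) auto
    finally have "Theta s z = - thI s {0..<1} z" using thI_full_zero[OF s z] by (simp add: Theta_def)
    then show ?thesis using D(2)[OF z] by simp
  qed
  show ?thesis
  proof (rule that[of "(C + D) * 2 powr ?e"])
    show "0 < (C + D) * 2 powr ?e" using C D by simp
    fix z :: 'a
    have p: "2 powr ?e * 2 powr (- ?e) = 1" by (simp add: powr_add[symmetric])
    show "\<bar>Theta s z\<bar> \<le> (C + D) * 2 powr ?e * jw s z"
    proof (cases "norm z \<le> 1")
      case True
      have "2 powr (- ?n - 2 * s) \<le> jw s z"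
        unfolding jw_def using japanese_le[of z] True s by (intro powr_mono2') auto
      then have "2 powr ?e * 2 powr (- ?e) \<le> 2 powr ?e * jw s z" by (intro mult_left_mono) auto
      then have "1 \<le> 2 powr ?e * jw s z" using p by linarith
      then have "C * 1 \<le> (C + D) * (2 powr ?e * jw s z)" using C D by (intro mult_mono) auto
      then show ?thesis using near[of z] by (simp add: mult.assoc)
    next
      case False
      then have z: "z \<noteq> 0" by auto
      have "(2 * norm z) powr (- ?n - 2 * s) \<le> jw s z"
        unfolding jw_def using japanese_le[of z] False s by (intro powr_mono2') auto
      then have "2 powr (- ?e) * norm z powr (- ?n - 2 * s) \<le> jw s z" by (simp add: powr_mult)
      then have "2 powr ?e * (2 powr (- ?e) * norm z powr (- ?n - 2 * s)) \<le> 2 powr ?e * jw s z" by (rule mult_left_mono) simp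
      then have "norm z powr (- ?n - 2 * s) \<le> 2 powr ?e * jw s z" using p by (simp only: mult.assoc[symmetric])
      then have "D * norm z powr (- ?n - 2 * s) \<le> (C + D) * (2 powr ?e * jw s z)" using C D by (intro mult_mono) auto
      then show ?thesis using far[OF z] by (simp add: mult.assoc)
    qed
  qed
qed

lemma Theta_integrable:
  assumes s: "0 < s" "s < 1" shows "integrable lborel (Theta s :: 'a::euclidean_space \<Rightarrow> real)"
proof -
  obtain C where C: "0 < C" "\<And>z::'a::euclidean_space. \<bar>Theta s z\<bar> \<le> C * jw s z" using Theta_le[OF s, where 'a='a] by metis
  show ?thesis by (rule integral_dominated(1)[OF integrable_mult_right[OF jw_integrable[OF s(1)]] _ C(2)]) measurable
qed

lemma powr_combine_bound:
  fixes s :: real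
  assumes s: "0 < s" "s < 1"
  shows "integrable lborel (\<lambda>t. indicator {1..} t * t powr (2 * s - 3))" "(LBINT t. indicator {1..} t * t powr (2 * s - 3)) = 1 / (2 - 2 * s)"
  using powr_inf_integral[of "2 * s - 3" 1] s by simp_all

lemma Theta_bounds:
  assumes s: "0 < s" "s < 1"
  obtains C where "0 < C"
    "\<And>z::'a::euclidean_space. \<bar>Theta s z\<bar> \<le> C * jw s z"
    "\<And>w z::'a. norm w \<le> 1 \<Longrightarrow> \<bar>Theta s (z + w) - Theta s z - dTheta s w z\<bar> \<le> C * (norm w)\<^sup>2 * jw s z"
    "\<And>w z::'a. \<bar>dTheta s w z\<bar> \<le> C * norm w * jw s z"
    "\<And>w v z::'a. norm v \<le> 1 \<Longrightarrow> \<bar>dTheta s w (z + v) - dTheta s w z\<bar> \<le> C * norm w * norm v * jw s z"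
    "\<And>z::'a. linear (\<lambda>w. dTheta s w z)"
proof -
  let ?n = "real DIM('a)"
  obtain A where A: "0 < A" "\<And>z::'a. \<bar>theta s z\<bar> \<le> A * jw s z"
    "\<And>w z::'a. norm w \<le> 1 \<Longrightarrow> \<bar>theta s (z + w) - theta s z - dtheta s w z\<bar> \<le> A * (norm w)\<^sup>2 * jw s z"
    "\<And>w z::'a. \<bar>dtheta s w z\<bar> \<le> A * norm w * jw s z"
    "\<And>w v z::'a. norm v \<le> 1 \<Longrightarrow> \<bar>dtheta s w (z + v) - dtheta s w z\<bar> \<le> A * norm w * norm v * jw s z"
    using theta_bounds[OF s, where 'a='a] by metis
  obtain B where B: "0 < B" "\<And>z::'a. \<bar>Theta s z\<bar> \<le> B * jw s z" using Theta_le[OF s, where 'a='a] by metis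
  define k where "k = 1 / (2 - 2 * s)"
  have k: "0 < k" using s by (simp add: k_def)
  have th_i: "integrable lborel (\<lambda>t. indicator {1..} t * (t powr (- ?n - 1) * theta s (x /\<^sub>R t)))" for x :: 'a
    by (rule thI_integrable[OF s, of 1]) auto
  have dth_i: "integrable lborel (\<lambda>t. indicator {1..} t * (t powr (- ?n - 2) * dtheta s w (z /\<^sub>R t)))" for w z :: 'a
  proof (rule integral_dominated(1)[of _ "\<lambda>t. A * norm w * (indicator {1..} t * t powr (- ?n - 2))"])
    show "integrable lborel (\<lambda>t. A * norm w * (indicator {1..} t * t powr (- ?n - 2)))"
      by (intro integrable_mult_right powr_inf_integral(1)) auto
    fix t :: real
    have "\<bar>dtheta s w (z /\<^sub>R t)\<bar> \<le> A * norm w * 1"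
      using A(1) jw_le1[OF s(1)] by (intro order_trans[OF A(4)[of w "z /\<^sub>R t"]] mult_left_mono) auto
    then have "t powr (- ?n - 2) * \<bar>dtheta s w (z /\<^sub>R t)\<bar> \<le> t powr (- ?n - 2) * (A * norm w)" by (intro mult_left_mono) auto
    then show "\<bar>indicator {1..} t * (t powr (- ?n - 2) * dtheta s w (z /\<^sub>R t))\<bar> \<le> A * norm w * (indicator {1..} t * t powr (- ?n - 2))"
      by (auto simp: indicator_def abs_mult mult_ac)
  qed measurable
  \<comment> \<open>A second-order quantity at scale t carries 1/t^2, while the dilated weight grows
    at most like t^(N+2s). With t^(-N-1) this leaves t^(2s-3), integrable at infinity since s <
    1.\<close>
  have gen: "\<bar>LBINT t. indicator {1..} t * (t powr (- ?n - 1) * F t)\<bar> \<le> A * k * m * jw s z"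
    if F: "\<And>t. 1 \<le> t \<Longrightarrow> \<bar>F t\<bar> \<le> A * (m / t\<^sup>2) * jw s (z /\<^sub>R t)" and [measurable]: "F \<in> borel_measurable borel" and m: "0 \<le> m" for F :: "real \<Rightarrow> real" and m and z :: 'a
  proof -
    have "\<bar>LBINT t. indicator {1..} t * (t powr (- ?n - 1) * F t)\<bar> \<le> (LBINT t. A * m * jw s z * (indicator {1..} t * t powr (2 * s - 3)))"
    proof (rule integral_dominated(2))
      show "integrable lborel (\<lambda>t. A * m * jw s z * (indicator {1..} t * t powr (2 * s - 3)))"
        by (intro integrable_mult_right powr_combine_bound(1)[OF s])
      fix t :: real
      show "\<bar>indicator {1..} t * (t powr (- ?n - 1) * F t)\<bar> \<le> A * m * jw s z * (indicator {1..} t * t powr (2 * s - 3))"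
      proof (cases "1 \<le> t")
        case True
        have "\<bar>F t\<bar> \<le> A * (m / t\<^sup>2) * (t powr (?n + 2 * s) * jw s z)"
          using A(1) m by (intro order_trans[OF F[OF True]] mult_left_mono jw_scale[OF s(1) True]) auto
        then have "t powr (- ?n - 1) * \<bar>F t\<bar> \<le> t powr (- ?n - 1) * (A * (m / t\<^sup>2) * (t powr (?n + 2 * s) * jw s z))"
          by (rule mult_left_mono) simp
        also have "\<dots> = A * m * jw s z * (t powr (- ?n - 1) * t powr (?n + 2 * s) * (1 / t\<^sup>2))" by simp
        also have "1 / t\<^sup>2 = t powr (- 2)" using True by (simp add: powr_minus_divide powr_numeral)
        also have "t powr (- ?n - 1) * t powr (?n + 2 * s) * t powr (- 2) = t powr (2 * s - 3)"
          unfolding powr_add[symmetric] by (rule arg_cong[where f="\<lambda>e. t powr e"]) simp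
        finally show ?thesis using True by (simp add: abs_mult)
      qed simp
    qed measurable
    also have "\<dots> = A * m * jw s z * k" using powr_combine_bound(2)[OF s] by (simp add: k_def)
    finally show ?thesis by (simp add: mult_ac)
  qed
  have dl: "dtheta s (w /\<^sub>R t) z = dtheta s w z / t" for w z :: 'a and t
    using linear_scale[OF dtheta_linear[OF s, of z], of "inverse t" w] by (simp add: divide_inverse mult.commute)
  have pw: "t powr (- ?n - 2) = t powr (- ?n - 1) / t" if "1 \<le> t" for t :: real
  proof -
    have e: "(- ?n - 1) + (- 1) = - ?n - 2" by simp
    have "t powr (- 1) = 1 / t" using that by (simp add: powr_minus_divide)
    then show ?thesis using powr_add[of t "- ?n - 1" "- 1"] unfolding e by simp
  qed
  have T1: "\<bar>Theta s (z + w) - Theta s z - dTheta s w z\<bar> \<le> A * k * (norm w)\<^sup>2 * jw s z" if w: "norm w \<le> 1" for w z :: 'a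
  proof -
    have "Theta s (z + w) - Theta s z - dTheta s w z = (LBINT t. indicator {1..} t * (t powr (- ?n - 1) * theta s ((z + w) /\<^sub>R t))
       - indicator {1..} t * (t powr (- ?n - 1) * theta s (z /\<^sub>R t)) - indicator {1..} t * (t powr (- ?n - 2) * dtheta s w (z /\<^sub>R t)))"
      unfolding Theta_def thI_def dTheta_def using th_i dth_i by (simp del: scaleR_add_right)
    also have "\<dots> = (LBINT t. indicator {1..} t * (t powr (- ?n - 1) * (theta s (z /\<^sub>R t + w /\<^sub>R t) - theta s (z /\<^sub>R t) - dtheta s w (z /\<^sub>R t) / t)))"
      by (intro Bochner_Integration.integral_cong refl) (auto simp: indicator_def pw scaleR_add_right field_simps)
    also have "\<bar>\<dots>\<bar> \<le> A * k * (norm w)\<^sup>2 * jw s z"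
    proof (rule gen)
      fix t :: real assume t: "1 \<le> t"
      have n: "norm (w /\<^sub>R t) = norm w / t" using t by (simp add: divide_inverse mult.commute)
      have "norm (w /\<^sub>R t) \<le> 1" unfolding n using t w by (simp add: divide_le_eq)
      from A(3)[OF this, of "z /\<^sub>R t"]
      show "\<bar>theta s (z /\<^sub>R t + w /\<^sub>R t) - theta s (z /\<^sub>R t) - dtheta s w (z /\<^sub>R t) / t\<bar> \<le> A * ((norm w)\<^sup>2 / t\<^sup>2) * jw s (z /\<^sub>R t)"
        unfolding dl n by (simp add: power_divide)
    qed auto
    finally show ?thesis .
  qed
  have T3: "\<bar>dTheta s w (z + v) - dTheta s w z\<bar> \<le> A * k * (norm w * norm v) * jw s z" if v: "norm v \<le> 1" for w v z :: 'a
  proof -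
    have "dTheta s w (z + v) - dTheta s w z = (LBINT t. indicator {1..} t * (t powr (- ?n - 2) * dtheta s w ((z + v) /\<^sub>R t)) - indicator {1..} t * (t powr (- ?n - 2) * dtheta s w (z /\<^sub>R t)))"
      unfolding dTheta_def using dth_i by (simp del: scaleR_add_right)
    also have "\<dots> = (LBINT t. indicator {1..} t * (t powr (- ?n - 1) * ((dtheta s w (z /\<^sub>R t + v /\<^sub>R t) - dtheta s w (z /\<^sub>R t)) / t)))"
      by (intro Bochner_Integration.integral_cong refl) (auto simp: indicator_def pw scaleR_add_right field_simps)
    also have "\<bar>\<dots>\<bar> \<le> A * k * (norm w * norm v) * jw s z"
    proof (rule gen)
      fix t :: real assume t: "1 \<le> t"
      have n: "norm (v /\<^sub>R t) = norm v / t" using t by (simp add: divide_inverse mult.commute)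
      have "norm (v /\<^sub>R t) \<le> 1" unfolding n using t v by (simp add: divide_le_eq)
      from A(5)[OF this, of w "z /\<^sub>R t"]
      have "\<bar>dtheta s w (z /\<^sub>R t + v /\<^sub>R t) - dtheta s w (z /\<^sub>R t)\<bar> / t \<le> A * norm w * (norm v / t) * jw s (z /\<^sub>R t) / t"
        unfolding n using t by (intro divide_right_mono) auto
      then show "\<bar>(dtheta s w (z /\<^sub>R t + v /\<^sub>R t) - dtheta s w (z /\<^sub>R t)) / t\<bar> \<le> A * (norm w * norm v / t\<^sup>2) * jw s (z /\<^sub>R t)"
        using t by (simp add: power2_eq_square mult_ac)
    qed auto
    finally show ?thesis .
  qed
  have lin: "linear (\<lambda>w. dTheta s w z)" for z :: 'a
  proof (rule linearI)
    fix u v :: 'a and c :: real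
    show "dTheta s (u + v) z = dTheta s u z + dTheta s v z"
      unfolding dTheta_def by (subst Bochner_Integration.integral_add[OF dth_i dth_i, symmetric])
        (simp add: linear_add[OF dtheta_linear[OF s]] distrib_left)
    show "dTheta s (c *\<^sub>R u) z = c *\<^sub>R dTheta s u z"
      unfolding dTheta_def by (subst integral_scaleR_right[symmetric]) (simp add: linear_scale[OF dtheta_linear[OF s]] mult_ac)
  qed
  define E where "E = B * (2 powr (?n + 2 * s)) + B + A * k"
  have E0: "0 < E" using A B k by (simp add: E_def add_pos_pos)
  \<comment> \<open>Bounding the integrand directly would leave t^(2s-2), which is not integrable
    for s \<ge> 1/2. The bound for unit vectors comes instead from the Taylor remainder
    \<open>T1\<close> and the bounds on \<open>Theta\<close> at both points; linearity extends it to
    all w.\<close>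
  have unit: "\<bar>dTheta s w z\<bar> \<le> E * jw s z" if w: "norm w = 1" for w z :: 'a
  proof -
    have "\<bar>Theta s (z + w)\<bar> \<le> B * (2 powr (?n + 2 * s) * jw s z)"
      using B(1) jw_add[OF s(1), of z w] w by (intro order_trans[OF B(2)] mult_left_mono) auto
    then show ?thesis using T1[of w z] B(2)[of z] w unfolding E_def by (simp add: distrib_right)
  qed
  have T2: "\<bar>dTheta s w z\<bar> \<le> E * norm w * jw s z" for w z :: 'a
  proof (cases "w = 0")
    case True then show ?thesis using linear_0[OF lin[of z]] by simp
  next
    case False
    have "dTheta s w z = dTheta s (norm w *\<^sub>R (w /\<^sub>R norm w)) z" using False by simp
    also have "\<dots> = norm w * dTheta s (w /\<^sub>R norm w) z" using linear_scale[OF lin[of z]] by simp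
    also have "\<bar>\<dots>\<bar> \<le> norm w * (E * jw s z)"
      unfolding abs_mult using unit[of "w /\<^sub>R norm w" z] False by (intro mult_mono) auto
    finally show ?thesis by (simp add: mult_ac)
  qed
  have AkE: "A * k \<le> E" "B \<le> E" using A B k by (auto simp: E_def)
  show ?thesis
  proof (rule that[OF E0])
    fix w v z :: 'a
    show "\<bar>Theta s z\<bar> \<le> E * jw s z" by (intro order_trans[OF B(2)] mult_right_mono AkE) simp
    show "\<bar>dTheta s w z\<bar> \<le> E * norm w * jw s z" by (rule T2)
    show "linear (\<lambda>w. dTheta s w z)" by (rule lin)
    show "\<bar>Theta s (z + w) - Theta s z - dTheta s w z\<bar> \<le> E * (norm w)\<^sup>2 * jw s z" if "norm w \<le> 1"
      using AkE by (intro order_trans[OF T1[OF that]] mult_right_mono) auto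
    show "\<bar>dTheta s w (z + v) - dTheta s w z\<bar> \<le> E * norm w * norm v * jw s z" if "norm v \<le> 1"
      using order_trans[OF T3[OF that, of w z] mult_right_mono[OF mult_right_mono[OF AkE(1), of "norm w * norm v"], of "jw s z"]]
      by (simp add: mult_ac)
  qed
qed

definition kappa :: "real \<Rightarrow> 'a::euclidean_space itself \<Rightarrow> real" where
  "kappa s _ = (LBINT x. Theta s (x::'a))"

text \<open>The average over scales is paired with the bump. By scales it is an integral of the
  positive quantities \<open>E t\<close>; by \<open>thI_split\<close> and \<open>thI_Theta\<close>
  it is a difference of two dilates of \<open>Theta\<close> tested against the bump. For scales
  between e and 1/e with e tending to 0, the first dilate gives \<open>eta 0\<close> times the mass
  and the second gives 0, while the integral never falls below its part q over scales between 1 and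
  2.\<close>

lemma kappa_pos:
  assumes s: "0 < s" "s < 1"
  shows "0 < kappa s TYPE('a::euclidean_space)"
proof -
  let ?n = "real DIM('a)"
  let ?p = "\<lambda>t x. t powr (- ?n - 1) * (eta x * theta s (x /\<^sub>R t :: 'a))"
  let ?J = "\<lambda>t. LBINT x. \<bar>eta x * theta s (x /\<^sub>R t :: 'a)\<bar>" and ?I = "LBINT x. eta (x::'a)"
  obtain C where C: "0 < C" "\<And>z::'a. \<bar>theta s z\<bar> \<le> C" using theta_bd[OF s, where 'a='a] by metis
  obtain B where B: "0 < B" "\<And>z::'a. \<bar>Theta s z\<bar> \<le> B * jw s z" using Theta_le[OF s, where 'a='a] by metis
  have B1: "\<bar>Theta s z\<bar> \<le> B" for z :: 'a
  proof -
    have "B * jw s z \<le> B * 1" using jw_le1[OF s(1), of z] B(1) by (intro mult_left_mono) auto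
    then show ?thesis using B(2)[of z] by linarith
  qed
  have eta_i: "integrable lborel (eta :: 'a \<Rightarrow> real)" using c2bd_eta c2bd_L1 zero_le_one by metis
  define E where "E t = (LBINT x. eta x * theta s (x /\<^sub>R t :: 'a))" for t
  have [measurable]: "E \<in> borel_measurable borel"
    unfolding E_def by (rule lborel.borel_measurable_lebesgue_integral) measurable
  have E_pos: "0 < E t" if t: "0 < t" for t
  proof -
    have "E t = \<bar>t\<bar> ^ DIM('a) *\<^sub>R (LBINT x. eta (0 + t *\<^sub>R x) * theta s ((0 + t *\<^sub>R x) /\<^sub>R t :: 'a))"
      unfolding E_def using t by (intro integral_affine) auto
    also have "\<dots> = t ^ DIM('a) * etaform s TYPE('a) (1 / t)"
      using t by (simp add: etaform_def)
    finally show ?thesis using etaform_pos[OF s, of "1 / t", where 'a='a] t by simp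
  qed
  define q where "q = (LBINT t. indicator {1..<2} t * (t powr (- ?n - 1) * E t))"
  have joint: "integrable lborel2 (\<lambda>(t, x). indicator {a..<b} t * ?p t x)"
    if a: "0 < a" for a b :: real
  proof (rule lborel_pair.Fubini_integrable)
    have i1: "integrable lborel (\<lambda>x. eta x * theta s (x /\<^sub>R t :: 'a))" "?J t \<le> C * ?I" for t
    proof -
      have b: "\<bar>eta x * theta s (x /\<^sub>R t :: 'a)\<bar> \<le> C * eta x" for x
        using mult_left_mono[OF C(2)[of "x /\<^sub>R t"] eta_nonneg[of x]] by (simp add: abs_mult mult.commute)
      show i: "integrable lborel (\<lambda>x. eta x * theta s (x /\<^sub>R t :: 'a))"
        by (rule integral_dominated(1)[OF integrable_mult_right[OF eta_i] _ b]) measurable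
      have "?J t \<le> (LBINT x. C * eta (x::'a))"
        using i eta_i b by (intro integral_mono) auto
      then show "?J t \<le> C * ?I" by simp
    qed
    show "AE t in lborel. integrable lborel (\<lambda>x. case (t, x) of (t, x) \<Rightarrow> indicator {a..<b} t * ?p t x)"
      using i1 by (intro AE_I2) (simp only: prod.case, intro integrable_mult_right i1)
    show "integrable lborel (\<lambda>t. LBINT x. norm (case (t, x) of (t, x) \<Rightarrow> indicator {a..<b} t * ?p t x))"
    proof (rule integral_dominated(1))
      show "integrable lborel (\<lambda>t. C * ?I * (indicator {a..} t * t powr (- ?n - 1)))"
        using a by (intro integrable_mult_right powr_inf_integral(1)) auto
      show "(\<lambda>t. LBINT x. norm (case (t, x) of (t, x) \<Rightarrow> indicator {a..<b} t * ?p t x)) \<in> borel_measurable lborel"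
        by (rule lborel.borel_measurable_lebesgue_integral) measurable
      fix t :: real
      have e: "(LBINT x. norm (indicator {a..<b} t * ?p t x)) = indicator {a..<b} t * t powr (- ?n - 1) * ?J t"
        by (simp add: abs_mult mult.assoc)
      have "0 \<le> ?J t" by (intro integral_nonneg_AE) auto
      then have "\<bar>indicator {a..<b} t * t powr (- ?n - 1) * ?J t\<bar> \<le> indicator {a..<b} t * t powr (- ?n - 1) * (C * ?I)"
        using i1(2)[of t] by (simp add: abs_mult mult_left_mono)
      also have "\<dots> \<le> indicator {a..} t * t powr (- ?n - 1) * (C * ?I)"
        using C(1) by (intro mult_right_mono mult_nonneg_nonneg integral_nonneg_AE) (auto simp: indicator_def)
      finally show "\<bar>LBINT x. norm (case (t, x) of (t, x) \<Rightarrow> indicator {a..<b} t * ?p t x)\<bar> \<le> C * ?I * (indicator {a..} t * t powr (- ?n - 1))"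
        by (simp only: prod.case e) (simp add: mult_ac)
    qed
  qed measurable
  have Ei: "integrable lborel (\<lambda>t. indicator {a..<b} t * (t powr (- ?n - 1) * E t))" if a: "0 < a" for a b
    using lborel_pair.integrable_fst[OF joint[OF a, of b]] by (simp add: E_def)
  have swap: "(LBINT t. indicator {a..<b} t * (t powr (- ?n - 1) * E t)) = (LBINT x. eta x * (Theta s (x /\<^sub>R a) / a ^ DIM('a) - Theta s (x /\<^sub>R b :: 'a) / b ^ DIM('a)))"
    if a: "0 < a" "a \<le> b" for a b
  proof -
    have "(LBINT t. indicator {a..<b} t * (t powr (- ?n - 1) * E t)) = (LBINT t. LBINT x. indicator {a..<b} t * ?p t x)"
      by (simp add: E_def)
    also have "\<dots> = (LBINT x. LBINT t. indicator {a..<b} t * ?p t x)"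
      by (rule lborel_pair.Fubini_integral[OF joint[OF a(1)], symmetric])
    also have "\<dots> = (LBINT x. eta x * thI s {a..<b} (x::'a))"
    proof (intro Bochner_Integration.integral_cong refl)
      fix x :: 'a
      have "(\<lambda>t. indicator {a..<b} t * (t powr (- ?n - 1) * (eta x * theta s (x /\<^sub>R t)))) = (\<lambda>t. eta x * (indicator {a..<b} t * (t powr (- ?n - 1) * theta s (x /\<^sub>R t))))"
        by (simp add: mult_ac)
      then show "(LBINT t. indicator {a..<b} t * (t powr (- ?n - 1) * (eta x * theta s (x /\<^sub>R t)))) = eta x * thI s {a..<b} x"
        by (simp add: thI_def)
    qed
    finally show ?thesis using a by (simp add: thI_split[OF s a] thI_Theta)
  qed
  have q0: "0 < q"
  proof -
    have i: "integrable lborel (\<lambda>t. indicator {1..<2} t * (t powr (- ?n - 1) * E t))" by (rule Ei) simp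
    have nn: "0 \<le> indicator {1..<2} t * (t powr (- ?n - 1) * E t)" for t using E_pos[of t] by (auto simp: indicator_def less_imp_le)
    have "q \<noteq> 0"
    proof
      assume "q = 0"
      then have "AE t in lborel. indicator {1..<2} t * (t powr (- ?n - 1) * E t) = 0"
        unfolding q_def using integral_nonneg_eq_0_iff_AE[OF i] nn by auto
      then have "AE t in lborel. t \<notin> {1..<2::real}"
      proof eventually_elim
        fix t :: real assume "indicator {1..<2} t * (t powr (- ?n - 1) * E t) = 0"
        then show "t \<notin> {1..<2}" using E_pos[of t] by (auto simp: indicator_def)
      qed
      then have "{1..<2::real} \<in> null_sets lborel" by (subst (asm) AE_iff_null_sets[symmetric]) auto
      then show False by (simp add: null_sets_def)
    qed
    moreover have "0 \<le> q" unfolding q_def using nn by (intro integral_nonneg_AE) auto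
    ultimately show ?thesis by simp
  qed
  \<comment> \<open>Starting at 1/2 keeps \<open>{1..<2}\<close> inside
    \<open>{e k..<1 / e k}\<close> for every k.\<close>
  define e where "e k = 1 / real (Suc (Suc k))" for k
  have e: "0 < e k" "e k \<le> 1" "2 \<le> 1 / e k" for k by (auto simp: e_def)
  have e0: "e \<longlonglongrightarrow> 0" unfolding e_def using LIMSEQ_Suc[OF LIMSEQ_Suc[OF lim_1_over_n]] by simp
  have TD: "integrable lborel (\<lambda>x::'a. eta x * Theta s (x /\<^sub>R r))" for r
  proof (rule integral_dominated(1)[OF integrable_mult_right[OF eta_i, of B]])
    fix x :: 'a show "\<bar>eta x * Theta s (x /\<^sub>R r)\<bar> \<le> B * eta x"
      using mult_left_mono[OF B1[of "x /\<^sub>R r"] eta_nonneg[of x]] by (simp add: abs_mult mult.commute)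
  qed measurable
  have main: "q \<le> (LBINT z. eta (e k *\<^sub>R z) * Theta s (z::'a)) - e k ^ DIM('a) * (LBINT x. eta x * Theta s (e k *\<^sub>R x::'a))" for k
  proof -
    have "q \<le> (LBINT t. indicator {e k..<1 / e k} t * (t powr (- ?n - 1) * E t))"
      unfolding q_def
    proof (rule integral_mono[OF Ei Ei])
      fix t :: real
      show "indicator {1..<2} t * (t powr (- ?n - 1) * E t) \<le> indicator {e k..<1 / e k} t * (t powr (- ?n - 1) * E t)"
      proof (cases "0 < t")
        case True
        have "indicator {1..<2} t \<le> (indicator {e k..<1 / e k} t :: real)" using e[of k] by (auto simp: indicator_def)
        then show ?thesis using E_pos[OF True] by (intro mult_right_mono) auto
      next
        case False then show ?thesis using e[of k] by (auto simp: indicator_def)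
      qed
    qed (use e in auto)
    also have "\<dots> = (LBINT x. eta x * (Theta s (x /\<^sub>R e k) / e k ^ DIM('a) - Theta s (x /\<^sub>R (1 / e k) :: 'a) / (1 / e k) ^ DIM('a)))"
      using e[of k] by (intro swap) auto
    also have "\<dots> = (LBINT x. (1 / e k ^ DIM('a)) * (eta x * Theta s (x /\<^sub>R e k)) - e k ^ DIM('a) * (eta x * Theta s (x /\<^sub>R (1 / e k) :: 'a)))"
      using e[of k] by (intro Bochner_Integration.integral_cong refl) (simp add: field_simps power_divide)
    also have "\<dots> = (1 / e k ^ DIM('a)) * (LBINT x. eta x * Theta s (x /\<^sub>R e k :: 'a)) - e k ^ DIM('a) * (LBINT x. eta x * Theta s (x /\<^sub>R (1 / e k) :: 'a))"
      using TD[of "e k"] TD[of "1 / e k"] by simp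
    also have "(LBINT x. eta x * Theta s (x /\<^sub>R e k :: 'a)) = \<bar>e k\<bar> ^ DIM('a) *\<^sub>R (LBINT x. eta (0 + e k *\<^sub>R x) * Theta s ((0 + e k *\<^sub>R x) /\<^sub>R e k :: 'a))"
      using e[of k] by (intro integral_affine) auto
    also have "(1 / e k ^ DIM('a)) * (\<bar>e k\<bar> ^ DIM('a) *\<^sub>R (LBINT x. eta (0 + e k *\<^sub>R x) * Theta s ((0 + e k *\<^sub>R x) /\<^sub>R e k :: 'a))) = (LBINT x. eta (e k *\<^sub>R x) * Theta s (x :: 'a))"
      using e(1)[of k] by simp
    finally show ?thesis using e(1)[of k] by simp
  qed
  have lim1: "(\<lambda>k. LBINT z. eta (e k *\<^sub>R z) * Theta s (z::'a)) \<longlonglongrightarrow> (LBINT z. eta (0::'a) * Theta s (z::'a))"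
  proof (rule integral_dominated_convergence[where w="\<lambda>z. B * jw s z"])
    show "integrable lborel (\<lambda>z::'a. B * jw s z)" by (intro integrable_mult_right jw_integrable s)
    show "AE z in lborel. (\<lambda>k. eta (e k *\<^sub>R z) * Theta s z) \<longlonglongrightarrow> eta (0::'a) * Theta s (z::'a)"
    proof (intro AE_I2 tendsto_mult_right)
      fix z :: 'a
      have c: "continuous_on UNIV (\<lambda>x. Re (ceta (x::'a)))" by (intro continuous_intros smc_cont[OF smc_ceta])
      have "(\<lambda>k. e k *\<^sub>R z) \<longlonglongrightarrow> 0 *\<^sub>R z" by (intro tendsto_intros e0)
      then have "(\<lambda>k. e k *\<^sub>R z) \<longlonglongrightarrow> 0" by simp
      from continuous_on_tendsto_compose[OF c this] show "(\<lambda>k. eta (e k *\<^sub>R z)) \<longlonglongrightarrow> eta (0::'a)" by (simp add: ceta_def)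
    qed
    show "AE z in lborel. norm (eta (e k *\<^sub>R z) * Theta s z) \<le> B * jw s (z::'a)" for k
    proof (intro AE_I2)
      fix z :: 'a
      have "eta (e k *\<^sub>R z) * \<bar>Theta s z\<bar> \<le> 1 * (B * jw s z)" using B(2)[of z] B(1) eta_le1 by (intro mult_mono) auto
      then show "norm (eta (e k *\<^sub>R z) * Theta s z) \<le> B * jw s z" by (simp add: abs_mult)
    qed
  qed measurable
  have lim2: "(\<lambda>k. e k ^ DIM('a) * (LBINT x. eta x * Theta s (e k *\<^sub>R x::'a))) \<longlonglongrightarrow> 0"
  proof (rule Lim_null_comparison)
    define I where "I = ?I"
    have I0: "0 \<le> I" unfolding I_def by (intro integral_nonneg_AE) auto
    show "(\<lambda>k. e k * (B * I)) \<longlonglongrightarrow> 0" using tendsto_mult_right[OF e0, of "B * I"] by simp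
    show "\<forall>\<^sub>F k in sequentially. norm (e k ^ DIM('a) * (LBINT x. eta x * Theta s (e k *\<^sub>R x::'a))) \<le> e k * (B * I)"
    proof (intro always_eventually allI)
      fix k
      have "\<bar>LBINT x. eta x * Theta s (e k *\<^sub>R x::'a)\<bar> \<le> (LBINT x. B * eta (x::'a))"
      proof (rule integral_dominated(2)[OF integrable_mult_right[OF eta_i, of B]])
        fix x :: 'a show "\<bar>eta x * Theta s (e k *\<^sub>R x)\<bar> \<le> B * eta x"
          using mult_left_mono[OF B1[of "e k *\<^sub>R x"] eta_nonneg[of x]] by (simp add: abs_mult mult.commute)
      qed measurable
      then have 1: "\<bar>LBINT x. eta x * Theta s (e k *\<^sub>R x::'a)\<bar> \<le> B * I" by (simp add: I_def)
      have "e k ^ DIM('a) \<le> e k ^ 1" using e[of k] DIM_positive[where 'a='a] by (intro power_decreasing) auto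
      then show "norm (e k ^ DIM('a) * (LBINT x. eta x * Theta s (e k *\<^sub>R x::'a))) \<le> e k * (B * I)"
        using 1 e[of k] B(1) I0 unfolding real_norm_def abs_mult by (intro mult_mono) auto
    qed
  qed
  have "q \<le> eta (0::'a) * kappa s TYPE('a) - 0"
  proof (rule LIMSEQ_le_const)
    show "(\<lambda>k. (LBINT z. eta (e k *\<^sub>R z) * Theta s (z::'a)) - e k ^ DIM('a) * (LBINT x. eta x * Theta s (e k *\<^sub>R x::'a))) \<longlonglongrightarrow> eta (0::'a) * kappa s TYPE('a) - 0"
      using tendsto_diff[OF lim1 lim2] by (simp add: kappa_def)
  qed (use main in auto)
  then have "0 < eta (0::'a) * kappa s TYPE('a)" using q0 by simp
  then show ?thesis using eta_pos[of "0::'a"] by (simp add: zero_less_mult_iff)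
qed

text \<open>The positive and negative parts are densities of finite measures that agree on boxes, an
  intersection-stable generator of the Borel sets. Equal finite measures have almost everywhere
  equal densities.\<close>

lemma AE_zero_real_boxes:
  fixes g :: "'a::euclidean_space \<Rightarrow> real"
  assumes g: "integrable lborel g" and z: "\<And>a b. (LBINT x. indicator (box a b) x * g x) = 0"
  shows "AE x in lborel. g x = 0"
proof -
  have [measurable]: "g \<in> borel_measurable borel" using g by auto
  let ?p = "\<lambda>x. ennreal (g x)" and ?m = "\<lambda>x. ennreal (- g x)"
  have fin: "(\<integral>\<^sup>+x. ?p x \<partial>lborel) < \<infinity>" "(\<integral>\<^sup>+x. ?m x \<partial>lborel) < \<infinity>"
    using g unfolding real_integrable_def by (auto simp: less_top)
  have eq: "density lborel ?p = density lborel ?m"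
  proof (rule measure_eqI_generator_eq[where E="range (\<lambda>(a, b). box a b)" and \<Omega>=UNIV and A="\<lambda>n::nat. box (- real n *\<^sub>R One) (real n *\<^sub>R One)"])
    show "Int_stable (range (\<lambda>(a, b). box a b :: 'a set))"
      by (auto simp: Int_stable_def box_Int_box)
    show "range (\<lambda>(a, b). box a b) \<subseteq> Pow (UNIV :: 'a set)" by simp
    show "sets (density lborel ?p) = sigma_sets UNIV (range (\<lambda>(a, b). box a b))" "sets (density lborel ?m) = sigma_sets UNIV (range (\<lambda>(a, b). box a b))"
      by (simp_all add: borel_eq_box)
    show "range (\<lambda>n::nat. box (- real n *\<^sub>R One) (real n *\<^sub>R One)) \<subseteq> range (\<lambda>(a, b). box a b :: 'a set)" by auto
    show "(\<Union>n::nat. box (- real n *\<^sub>R One) (real n *\<^sub>R One)) = (UNIV :: 'a set)" using UN_box_eq_UNIV by simp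
    show "emeasure (density lborel ?p) (box (- real n *\<^sub>R One) (real n *\<^sub>R One)) \<noteq> \<infinity>" for n :: nat
    proof -
      have "emeasure (density lborel ?p) (box (- real n *\<^sub>R One) (real n *\<^sub>R One)) \<le> emeasure (density lborel ?p) UNIV"
        by (rule emeasure_mono) auto
      also have "\<dots> < \<infinity>" using fin by (simp add: emeasure_density)
      finally show ?thesis by simp
    qed
    fix X :: "'a set" assume "X \<in> range (\<lambda>(a, b). box a b)"
    then obtain a b where X: "X = box a b" by auto
    let ?P = "\<integral>\<^sup>+x. ennreal (indicator X x * g x) \<partial>lborel"
    let ?M = "\<integral>\<^sup>+x. ennreal (- (indicator X x * g x)) \<partial>lborel"
    have i: "integrable lborel (\<lambda>x. indicator X x * g x)"
      unfolding X by (rule Bochner_Integration.integrable_bound[OF g]) (auto simp: indicator_def)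
    have e: "?P = ?M"
    proof -
      have f1: "?P \<noteq> \<infinity>" "?M \<noteq> \<infinity>"
        using i unfolding real_integrable_def by auto
      have ee: "enn2real ?P = enn2real ?M"
        using real_lebesgue_integral_def[OF i] z[of a b] unfolding X by linarith
      have a: "ennreal (enn2real ?P) = ?P"
        by (rule ennreal_enn2real) (use f1(1) in \<open>simp add: less_top\<close>)
      have b: "ennreal (enn2real ?M) = ?M"
        by (rule ennreal_enn2real) (use f1(2) in \<open>simp add: less_top\<close>)
      show ?thesis by (subst a[symmetric], subst ee, rule b)
    qed
    have "emeasure (density lborel ?p) X = ?P"
      unfolding X by (subst emeasure_density) (auto intro!: nn_integral_cong simp: indicator_def)
    moreover have "emeasure (density lborel ?m) X = ?M"
      unfolding X by (subst emeasure_density) (auto intro!: nn_integral_cong simp: indicator_def)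
    ultimately show "emeasure (density lborel ?p) X = emeasure (density lborel ?m) X" using e by simp
  qed
  have "AE x in lborel. ?p x = ?m x"
    using finite_density_unique[of ?p lborel ?m] eq fin by auto
  then show ?thesis
  proof eventually_elim
    fix x assume "?p x = ?m x"
    then show "g x = 0" by (cases "0 \<le> g x") (auto simp: ennreal_neg)
  qed
qed

lemma AE_zero_boxes:
  fixes F :: "'a::euclidean_space \<Rightarrow> complex"
  assumes U: "open U" and i: "\<And>a b. integrable lborel (\<lambda>x. indicator (box a b) x *\<^sub>R F x)"
    and z: "\<And>a b. box a b \<subseteq> U \<Longrightarrow> (LBINT x. indicator (box a b) x *\<^sub>R F x) = 0"
  shows "AE x in lborel. x \<in> U \<longrightarrow> F x = 0"
proof -
  obtain D where D: "countable D" "D \<subseteq> Pow U" "\<And>X. X \<in> D \<Longrightarrow> \<exists>a b. X = box a b" "\<Union>D = U"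
    using open_countable_Union_open_box[OF U] by metis
  have "AE x in lborel. x \<in> X \<longrightarrow> F x = 0" if X: "X \<in> D" for X
  proof -
    obtain a b where ab: "X = box a b" using D(3)[OF X] by blast
    have XU: "box a b \<subseteq> U" using D(2) X ab by auto
    have gen: "(LBINT x. indicator (box c d) x *\<^sub>R (indicator (box a b) x *\<^sub>R F x)) = 0" for c d
    proof -
      obtain p q where pq: "box c d \<inter> box a b = box p q" using box_Int_box[of c d a b] by blast
      have "(\<lambda>x. indicator (box c d) x *\<^sub>R (indicator (box a b) x *\<^sub>R F x)) = (\<lambda>x. indicator (box p q) x *\<^sub>R F x)"
        unfolding pq[symmetric] by (auto simp: fun_eq_iff indicator_def)
      moreover have "box p q \<subseteq> U" using pq XU by blast
      ultimately show ?thesis using z by simp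
    qed
    have gi: "integrable lborel (\<lambda>x. indicator (box c d) x *\<^sub>R (indicator (box a b) x *\<^sub>R F x))" for c d
    proof -
      have "integrable lborel (\<lambda>x. indicator (box c d) x *\<^sub>R (\<lambda>x. indicator (box a b) x *\<^sub>R F x) x)"
        by (rule integrable_mult_indicator[OF _ i]) simp
      then show ?thesis by simp
    qed
    have "AE x in lborel. Re (indicator (box a b) x *\<^sub>R F x) = 0"
    proof (rule AE_zero_real_boxes)
      show "integrable lborel (\<lambda>x. Re (indicator (box a b) x *\<^sub>R F x))" using i[of a b] by (rule integrable_Re)
      show "(LBINT x. indicator (box c d) x * Re (indicator (box a b) x *\<^sub>R F x)) = 0" for c d
        using integral_Re[OF gi[of c d]] gen[of c d] by (simp add: mult.assoc)
    qed
    moreover have "AE x in lborel. Im (indicator (box a b) x *\<^sub>R F x) = 0"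
    proof (rule AE_zero_real_boxes)
      show "integrable lborel (\<lambda>x. Im (indicator (box a b) x *\<^sub>R F x))" using i[of a b] by (rule integrable_Im)
      show "(LBINT x. indicator (box c d) x * Im (indicator (box a b) x *\<^sub>R F x)) = 0" for c d
        using integral_Im[OF gi[of c d]] gen[of c d] by (simp add: mult.assoc)
    qed
    ultimately show ?thesis
      by eventually_elim (auto simp: ab complex_eq_iff)
  qed
  then have "AE x in lborel. \<forall>X\<in>D. x \<in> X \<longrightarrow> F x = 0" using D(1) by (simp only: AE_ball_countable) blast
  then show ?thesis by eventually_elim (use D(4) in blast)
qed

text \<open>For \<open>A = {0<..}\<close> this is a multiple of the Riesz kernel \<open>norm z powr (2 s - N)\<close>, split into layers by scale.\<close>
definition Gk :: "real \<Rightarrow> real set \<Rightarrow> 'a::euclidean_space \<Rightarrow> real" where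
  "Gk s A z = (LBINT t. indicator A t * (t powr (2 * s - real DIM('a) - 1) * eta (z /\<^sub>R t)))"

lemma Gk_measurable [measurable]:
  assumes [measurable]: "A \<in> sets borel" shows "Gk s A \<in> borel_measurable borel"
  unfolding Gk_def[abs_def] by (rule lborel.borel_measurable_lebesgue_integral) measurable

lemma Gk_nonneg [simp]: "0 \<le> Gk s A z"
  unfolding Gk_def by (intro integral_nonneg_AE AE_I2) simp

lemma eta_scaled_zero: "t \<le> norm z \<Longrightarrow> 0 < t \<Longrightarrow> eta (z /\<^sub>R t) = 0"
  by (rule eta_outside) (simp add: field_simps)

lemma Gk_integrand:
  fixes z :: "'a::euclidean_space"
  assumes s: "0 < s" and z: "z \<noteq> 0" and a: "0 \<le> a"
  shows "integrable lborel (\<lambda>t. indicator {a..<b} t * (t powr (2 * s - real DIM('a) - 1) * eta (z /\<^sub>R t)))"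
proof (rule integral_dominated(1))
  show "integrable lborel (\<lambda>t. b powr (2 * s) * (indicator {norm z..} t * t powr (- real DIM('a) - 1)))"
    using z by (intro integrable_mult_right powr_inf_integral(1)) auto
  fix t :: real
  show "\<bar>indicator {a..<b} t * (t powr (2 * s - real DIM('a) - 1) * eta (z /\<^sub>R t))\<bar> \<le> b powr (2 * s) * (indicator {norm z..} t * t powr (- real DIM('a) - 1))"
  proof (cases "norm z \<le> t \<and> t \<in> {a..<b}")
    case True
    have t0: "0 < t" using z True by (meson less_le_trans zero_less_norm_iff)
    have "t powr (2 * s - real DIM('a) - 1) = t powr (2 * s) * t powr (- real DIM('a) - 1)"
      unfolding powr_add[symmetric] by (rule arg_cong[where f="\<lambda>e. t powr e"]) simp
    also have "\<dots> \<le> b powr (2 * s) * t powr (- real DIM('a) - 1)"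
      using True t0 s by (intro mult_right_mono powr_mono2) auto
    finally have "t powr (2 * s - real DIM('a) - 1) * eta (z /\<^sub>R t) \<le> b powr (2 * s) * t powr (- real DIM('a) - 1) * 1"
      using eta_le1 by (intro mult_mono) auto
    then show ?thesis using True by simp
  next
    case False
    have "indicator {a..<b} t * (t powr (2 * s - real DIM('a) - 1) * eta (z /\<^sub>R t)) = 0"
    proof (cases "0 < t \<and> t < norm z")
      case True then show ?thesis using eta_scaled_zero[of t z] by simp
    next
      case F: False
      then show ?thesis using False a by (cases "t = 0") (auto simp: indicator_def)
    qed
    moreover have "0 \<le> b powr (2 * s) * (indicator {norm z..} t * t powr (- real DIM('a) - 1))" by simp
    ultimately show ?thesis by (simp only: abs_zero)
  qed
qed measurable

text \<open>The bump at scale t vanishes at z when t \<le> |z|. A lower cut therefore stops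
  mattering as soon as it is below |z|, and truncated kernels converge by becoming equal.\<close>

lemma Gk_cut:
  fixes z :: "'a::euclidean_space"
  assumes "0 \<le> a" "a \<le> norm z" "0 \<le> b"
  shows "Gk s {a..<b} z = Gk s {0..<b} z"
  unfolding Gk_def
proof (intro Bochner_Integration.integral_cong refl)
  fix t :: real
  show "indicator {a..<b} t * (t powr (2 * s - real DIM('a) - 1) * eta (z /\<^sub>R t)) = indicator {0..<b} t * (t powr (2 * s - real DIM('a) - 1) * eta (z /\<^sub>R t))"
  proof (cases "0 < t \<and> t < a")
    case True then show ?thesis using eta_scaled_zero[of t z] assms by simp
  next
    case False then show ?thesis using assms by (cases "t = 0") (auto simp: indicator_def)
  qed
qed

lemma Gk_mono:
  fixes z :: "'a::euclidean_space"
  assumes s: "0 < s" and "0 \<le> a" "z \<noteq> 0"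
  shows "Gk s {a..<b} z \<le> Gk s {0..<b} z"
  unfolding Gk_def
  by (rule integral_mono[OF Gk_integrand[OF s assms(3,2)] Gk_integrand[OF s assms(3) order_refl]])
     (use assms in \<open>auto simp: indicator_def\<close>)

lemma eta_integrable: "integrable lborel (eta :: 'a::euclidean_space \<Rightarrow> real)"
  using c2bd_eta c2bd_L1 zero_le_one by metis

lemma nn_eta_scaled:
  assumes t: "0 < t"
  shows "(\<integral>\<^sup>+z. ennreal (eta (z /\<^sub>R t :: 'a::euclidean_space)) \<partial>lborel) = ennreal (t ^ DIM('a) * integral\<^sup>L lborel (eta :: 'a \<Rightarrow> real))"
proof -
  have "(\<integral>\<^sup>+z. ennreal (eta (z /\<^sub>R t :: 'a)) \<partial>lborel) = ennreal (\<bar>t\<bar> ^ DIM('a)) * (\<integral>\<^sup>+z. ennreal (eta ((0 + t *\<^sub>R z) /\<^sub>R t :: 'a)) \<partial>lborel)"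
    using t by (intro nn_integral_affine) auto
  also have "(\<integral>\<^sup>+z. ennreal (eta ((0 + t *\<^sub>R z) /\<^sub>R t :: 'a)) \<partial>lborel) = ennreal (integral\<^sup>L lborel (eta :: 'a \<Rightarrow> real))"
    using t by (simp add: nn_integral_eq_integral[OF eta_integrable])
  finally show ?thesis using t by (simp add: ennreal_mult')
qed

lemma Gk_nn:
  fixes z :: "'a::euclidean_space"
  assumes s: "0 < s" and "z \<noteq> 0" "0 \<le> a"
  shows "ennreal (Gk s {a..<b} z) = (\<integral>\<^sup>+t. indicator {a..<b} t * (ennreal (t powr (2 * s - real DIM('a) - 1)) * ennreal (eta (z /\<^sub>R t))) \<partial>lborel)"
  unfolding Gk_def
  by (subst nn_integral_eq_integral[OF Gk_integrand[OF assms], symmetric])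
     (auto intro!: nn_integral_cong simp: ennreal_mult' ennreal_indicator)

text \<open>The layer at scale t has L1 norm t^(2s-N-1) t^N = t^(2s-1) up to a constant, integrable
  at 0. Hence the potential of an integrable function is finite almost everywhere.\<close>

lemma Gk_integrable:
  assumes s: "0 < s" and b: "0 \<le> b"
  shows "integrable lborel (Gk s {0..<b} :: 'a::euclidean_space \<Rightarrow> real)"
proof (rule integrableI_bounded)
  let ?I = "integral\<^sup>L lborel (eta :: 'a \<Rightarrow> real)"
  have I0: "0 \<le> ?I" by (intro integral_nonneg_AE) auto
  have "(\<integral>\<^sup>+z. ennreal (norm (Gk s {0..<b} (z::'a))) \<partial>lborel) = (\<integral>\<^sup>+z. (\<integral>\<^sup>+t. indicator {0..<b} t * (ennreal (t powr (2 * s - real DIM('a) - 1)) * ennreal (eta (z /\<^sub>R t :: 'a))) \<partial>lborel) \<partial>lborel)"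
  proof (rule nn_integral_cong_AE)
    show "AE z::'a in lborel. ennreal (norm (Gk s {0..<b} z)) = (\<integral>\<^sup>+t. indicator {0..<b} t * (ennreal (t powr (2 * s - real DIM('a) - 1)) * ennreal (eta (z /\<^sub>R t :: 'a))) \<partial>lborel)"
      using AE_lborel_singleton[of "0::'a"] by eventually_elim (simp add: Gk_nn[OF s])
  qed
  also have "\<dots> = (\<integral>\<^sup>+t. (\<integral>\<^sup>+z. indicator {0..<b} t * (ennreal (t powr (2 * s - real DIM('a) - 1)) * ennreal (eta (z /\<^sub>R t :: 'a))) \<partial>lborel) \<partial>lborel)"
    by (rule lborel_pair.Fubini') measurable
  also have "\<dots> \<le> (\<integral>\<^sup>+t. ennreal ?I * (indicator {0..b} t * ennreal (t powr (2 * s - 1))) \<partial>lborel)"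
  proof (rule nn_integral_mono)
    fix t :: real
    show "(\<integral>\<^sup>+z. indicator {0..<b} t * (ennreal (t powr (2 * s - real DIM('a) - 1)) * ennreal (eta (z /\<^sub>R t :: 'a))) \<partial>lborel) \<le> ennreal ?I * (indicator {0..b} t * ennreal (t powr (2 * s - 1)))"
    proof (cases "0 < t \<and> t < b")
      case True
      have e: "t powr (2 * s - real DIM('a) - 1) * t ^ DIM('a) = t powr (2 * s - 1)"
        using True by (simp add: powr_realpow[symmetric] powr_add[symmetric])
      have "(\<integral>\<^sup>+z. indicator {0..<b} t * (ennreal (t powr (2 * s - real DIM('a) - 1)) * ennreal (eta (z /\<^sub>R t :: 'a))) \<partial>lborel) = ennreal (t powr (2 * s - real DIM('a) - 1)) * ennreal (t ^ DIM('a) * ?I)"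
        using True by (simp add: nn_integral_cmult nn_eta_scaled)
      also have "\<dots> = ennreal (t powr (2 * s - 1) * ?I)"
        using I0 True by (subst ennreal_mult[symmetric]) (auto simp: e[symmetric] mult.assoc)
      finally show ?thesis using True I0 by (simp add: ennreal_mult' mult.commute)
    next
      case False
      then have "t = 0 \<or> t \<notin> {0..<b}" by auto
      then show ?thesis by auto
    qed
  qed
  also have "\<dots> = ennreal ?I * ennreal (b powr (2 * s) / (2 * s))"
    using nn_integral_powr_0[of "2 * s - 1" b] s b by (subst nn_integral_cmult) auto
  also have "\<dots> < \<infinity>" by (simp add: ennreal_mult_less_top)
  finally show "(\<integral>\<^sup>+z. ennreal (norm (Gk s {0..<b} (z::'a))) \<partial>lborel) < \<infinity>" .
qed measurable

lemma jw_shrink: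
  assumes "0 < s" "0 < t" "t \<le> 1" shows "jw s (z /\<^sub>R t :: 'a::euclidean_space) \<le> jw s z"
proof -
  have "norm z \<le> norm (z /\<^sub>R t)" using assms by (simp add: field_simps mult_left_le_one_le)
  then have "(norm z)\<^sup>2 \<le> (norm (z /\<^sub>R t))\<^sup>2" by (intro power_mono) auto
  then have "japanese z \<le> japanese (z /\<^sub>R t)" unfolding japanese_def by simp
  then show ?thesis unfolding jw_def using assms by (intro powr_mono2') auto
qed

lemma jw_minus [simp]: "jw s (- x) = jw s x"
  by (simp add: jw_def japanese_def)

lemma jw_convolve:
  assumes "0 < s" "0 < t" "t \<le> 1" "norm x \<le> R"
  shows "jw s ((x - y) /\<^sub>R t :: 'a::euclidean_space) \<le> (1 + R) powr (real DIM('a) + 2 * s) * jw s y"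
proof -
  have "jw s ((x - y) /\<^sub>R t) \<le> jw s (- y + x)" using jw_shrink[OF assms(1-3), of "x - y"] by simp
  also have "\<dots> \<le> (1 + norm x) powr (real DIM('a) + 2 * s) * jw s (- y)" by (rule jw_add[OF assms(1)])
  also have "\<dots> \<le> (1 + R) powr (real DIM('a) + 2 * s) * jw s y"
    using assms by (auto intro!: mult_right_mono powr_mono2)
  finally show ?thesis .
qed

lemma integrable_prod_dom:
  fixes F :: "'c::euclidean_space \<times> 'd::euclidean_space \<Rightarrow> 'b::{banach, second_countable_topology}"
  assumes f: "integrable lborel f" and g: "integrable lborel g"
    and [measurable]: "F \<in> borel_measurable lborel2"
    and b: "\<And>t y. norm (F (t, y)) \<le> f t * g y" and f0: "\<And>t. 0 \<le> f t" and g0: "\<And>y. 0 \<le> g y"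
  shows "integrable lborel2 F"
proof (rule integrableI_bounded)
  have [measurable]: "f \<in> borel_measurable borel" "g \<in> borel_measurable borel" using f g by auto
  have "(\<integral>\<^sup>+p. ennreal (norm (F p)) \<partial>lborel2) = (\<integral>\<^sup>+t. (\<integral>\<^sup>+y. ennreal (norm (F (t, y))) \<partial>lborel) \<partial>lborel)"
    by (rule lborel.nn_integral_fst[symmetric]) measurable
  also have "\<dots> \<le> (\<integral>\<^sup>+t. (\<integral>\<^sup>+y. ennreal (f t) * ennreal (g y) \<partial>lborel) \<partial>lborel)"
    using b f0 g0 by (intro nn_integral_mono) (simp add: ennreal_mult[symmetric] ennreal_leI)
  also have "\<dots> = (\<integral>\<^sup>+t. ennreal (f t) \<partial>lborel) * (\<integral>\<^sup>+y. ennreal (g y) \<partial>lborel)"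
    by (simp add: nn_integral_cmult nn_integral_multc)
  also have "\<dots> < \<infinity>"
    using f g f0 g0 by (simp add: nn_integral_eq_integral ennreal_mult_less_top)
  finally show "(\<integral>\<^sup>+p. ennreal (norm (F p)) \<partial>lborel2) < \<infinity>" .
qed measurable

section \<open>The representation formula\<close>

definition Tht :: "real \<Rightarrow> real \<Rightarrow> 'a::euclidean_space \<Rightarrow> real" where
  "Tht s r z = Theta s (z /\<^sub>R r) / r ^ DIM('a)"

lemma Tht_measurable [measurable]: "Tht s r \<in> borel_measurable borel"
  unfolding Tht_def[abs_def] by measurable

text \<open>The first bound blows up as r tends to 0 and is meant for a fixed r. The second is
  uniform in r, because dilation gains r^(2s) \<le> 1 over the normalisation; it dominates the tails
  in the limit.\<close>

lemma Tht_bound: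
  fixes s :: real
  assumes s: "0 < s" "s < 1"
  obtains C where "0 < C" "\<And>r (x::'a::euclidean_space) y R. 0 < r \<Longrightarrow> r \<le> 1 \<Longrightarrow> norm x \<le> R \<Longrightarrow>
    \<bar>Tht s r (x - y)\<bar> \<le> C / r ^ DIM('a) * (1 + R) powr (real DIM('a) + 2 * s) * jw s y"
    "\<And>r (z::'a). 0 < r \<Longrightarrow> r \<le> 1 \<Longrightarrow> z \<noteq> 0 \<Longrightarrow> \<bar>Tht s r z\<bar> \<le> C * norm z powr (- real DIM('a) - 2 * s)"
proof -
  let ?n = "real DIM('a)"
  obtain C where C: "0 < C" "\<And>z::'a. \<bar>Theta s z\<bar> \<le> C * jw s z" using Theta_le[OF s, where 'a='a] by metis
  show ?thesis
  proof (rule that[OF C(1)])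
    fix r R :: real and x y :: 'a assume r: "0 < r" "r \<le> 1" and x: "norm x \<le> R"
    have "\<bar>Tht s r (x - y)\<bar> = \<bar>Theta s ((x - y) /\<^sub>R r)\<bar> / r ^ DIM('a)" using r by (simp add: Tht_def)
    also have "\<dots> \<le> C * ((1 + R) powr (?n + 2 * s) * jw s y) / r ^ DIM('a)"
      using r C(1) by (intro divide_right_mono order_trans[OF C(2)] mult_left_mono jw_convolve[OF s(1) r x]) auto
    finally show "\<bar>Tht s r (x - y)\<bar> \<le> C / r ^ DIM('a) * (1 + R) powr (?n + 2 * s) * jw s y" by simp
  next
    fix r :: real and z :: 'a assume r: "0 < r" "r \<le> 1" and z: "z \<noteq> 0"
    have n: "norm (z /\<^sub>R r) = norm z / r" using r by (simp add: divide_inverse mult.commute)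
    have "jw s (z /\<^sub>R r) \<le> norm (z /\<^sub>R r) powr (- ?n - 2 * s)"
      unfolding jw_def using s z r by (intro powr_mono2' japanese_ge_norm) auto
    also have "\<dots> = norm z powr (- ?n - 2 * s) * r powr (?n + 2 * s)"
      unfolding n using r by (simp add: powr_divide powr_minus_divide[symmetric] divide_powr_uminus add.commute)
    also have "\<dots> = norm z powr (- ?n - 2 * s) * (r powr (2 * s) * r ^ DIM('a))"
      using r by (simp add: powr_add powr_realpow)
    also have "\<dots> \<le> norm z powr (- ?n - 2 * s) * (1 * r ^ DIM('a))"
      using r s by (intro mult_left_mono mult_right_mono) (auto intro: powr_le1)
    finally have "C * jw s (z /\<^sub>R r) / r ^ DIM('a) \<le> C * norm z powr (- ?n - 2 * s)"
      using r C(1) by (simp add: divide_le_eq mult.assoc)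
    moreover have "\<bar>Tht s r z\<bar> \<le> C * jw s (z /\<^sub>R r) / r ^ DIM('a)"
      unfolding Tht_def using C(2)[of "z /\<^sub>R r"] r by (simp add: divide_right_mono)
    ultimately show "\<bar>Tht s r z\<bar> \<le> C * norm z powr (- ?n - 2 * s)" by linarith
  qed
qed

text \<open>The tested equation E is integrated against t^(-N-1) dt from a to b, with Fubini on both
  sides. The cut a > 0 makes both double integrals absolutely convergent although h is merely
  integrable.\<close>

lemma repr_pointwise:
  fixes \<psi> h :: "'a::euclidean_space \<Rightarrow> complex"
  assumes s: "0 < s" "s < 1" and \<psi>m: "\<psi> \<in> borel_measurable borel"
    and \<psi>i: "integrable lborel (\<lambda>y. jw s y *\<^sub>R \<psi> y)" and hi: "integrable lborel h"
    and ab: "0 < a" "a \<le> b" "b \<le> 1"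
    and E: "\<And>t. a \<le> t \<Longrightarrow> t < b \<Longrightarrow> (LBINT y. theta s ((x - y) /\<^sub>R t) *\<^sub>R \<psi> y) = (k * t powr (2 * s)) *\<^sub>R (LBINT y. eta ((x - y) /\<^sub>R t) *\<^sub>R h y)"
  shows "(LBINT y. (Tht s a (x - y) - Tht s b (x - y)) *\<^sub>R \<psi> y) = k *\<^sub>R (LBINT y. Gk s {a..<b} (x - y) *\<^sub>R h y)"
proof -
  let ?n = "real DIM('a)" and ?I = "\<lambda>t. indicator {a..<b} t :: real"
  let ?g = "\<lambda>t y. ?I t * (t powr (2 * s - ?n - 1) * eta ((x - y) /\<^sub>R t))"
  let ?h = "\<lambda>t y. ?I t * (t powr (- ?n - 1) * theta s ((x - y) /\<^sub>R t))"
  note [measurable] = \<psi>m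
  have hm [measurable]: "h \<in> borel_measurable borel" using hi by auto
  obtain C where C: "0 < C" "\<And>z::'a. \<bar>theta s z\<bar> \<le> C * jw s z" using theta_bounds[OF s, where 'a='a] by metis
  define L where "L = (1 + norm x) powr (?n + 2 * s)"
  have L: "0 \<le> L" by (simp add: L_def)
  have fin: "emeasure lborel {a..<b} < \<infinity>" using ab by simp
  have ii: "integrable lborel ?I" using fin by (intro integrable_real_indicator) auto
  have J1: "integrable lborel2 (\<lambda>(t, y). ?h t y *\<^sub>R \<psi> y)"
  proof (rule integrable_prod_dom[where f="\<lambda>t. a powr (- ?n - 1) * C * L * ?I t" and g="\<lambda>y. norm (jw s y *\<^sub>R \<psi> y)"])
    fix t y
    show "norm (case (t, y) of (t, y) \<Rightarrow> ?h t y *\<^sub>R \<psi> y) \<le> a powr (- ?n - 1) * C * L * ?I t * norm (jw s y *\<^sub>R \<psi> y)"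
    proof (cases "t \<in> {a..<b}")
      case True
      have "\<bar>theta s ((x - y) /\<^sub>R t)\<bar> \<le> C * (L * jw s y)"
        unfolding L_def using True ab C(1) by (intro order_trans[OF C(2)] mult_left_mono jw_convolve[OF s(1)]) auto
      moreover have "t powr (- ?n - 1) \<le> a powr (- ?n - 1)" using True ab by (intro powr_mono2') auto
      ultimately have "t powr (- ?n - 1) * \<bar>theta s ((x - y) /\<^sub>R t)\<bar> \<le> a powr (- ?n - 1) * (C * (L * jw s y))" by (intro mult_mono) auto
      then have "t powr (- ?n - 1) * \<bar>theta s ((x - y) /\<^sub>R t)\<bar> * norm (\<psi> y) \<le> a powr (- ?n - 1) * (C * (L * jw s y)) * norm (\<psi> y)" by (rule mult_right_mono) simp
      then show ?thesis using True by (simp add: abs_mult mult_ac)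
    qed simp
  qed (use integrable_norm[OF \<psi>i] ii C(1) L in \<open>auto intro!: integrable_mult_right\<close>)
  have J2: "integrable lborel2 (\<lambda>(t, y). ?g t y *\<^sub>R h y)"
  proof (rule integrable_prod_dom[where f="\<lambda>t. a powr (- ?n - 1) * ?I t" and g="\<lambda>y. norm (h y)"])
    fix t y
    show "norm (case (t, y) of (t, y) \<Rightarrow> ?g t y *\<^sub>R h y) \<le> a powr (- ?n - 1) * ?I t * norm (h y)"
    proof (cases "t \<in> {a..<b}")
      case True
      have "t powr (2 * s - ?n - 1) = t powr (2 * s) * t powr (- ?n - 1)"
        unfolding powr_add[symmetric] by (rule arg_cong[where f="\<lambda>e. t powr e"]) simp
      also have "\<dots> \<le> 1 * a powr (- ?n - 1)" using True ab s by (intro mult_mono powr_le1 powr_mono2') auto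
      finally have "t powr (2 * s - ?n - 1) * eta ((x - y) /\<^sub>R t) \<le> a powr (- ?n - 1) * 1" using eta_le1 by (intro mult_mono) auto
      then have "t powr (2 * s - ?n - 1) * eta ((x - y) /\<^sub>R t) * norm (h y) \<le> a powr (- ?n - 1) * norm (h y)" by (intro mult_right_mono) auto
      then show ?thesis using True by simp
    qed simp
  qed (use hi ii in \<open>auto intro!: integrable_mult_right\<close>)
  have "(LBINT y. (Tht s a (x - y) - Tht s b (x - y)) *\<^sub>R \<psi> y) = (LBINT y. thI s {a..<b} (x - y) *\<^sub>R \<psi> y)"
    using ab by (simp add: Tht_def thI_split[OF s ab(1,2)] thI_Theta)
  also have "\<dots> = (LBINT y. LBINT t. ?h t y *\<^sub>R \<psi> y)"
    unfolding thI_def using ab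
    by (intro Bochner_Integration.integral_cong refl integral_scaleR_left[symmetric] thI_integrable[OF s ab(1)]) auto
  also have "\<dots> = (LBINT t. LBINT y. ?h t y *\<^sub>R \<psi> y)"
    by (rule lborel_pair.Fubini_integral[OF J1])
  also have "\<dots> = (LBINT t. k *\<^sub>R (LBINT y. ?g t y *\<^sub>R h y))"
  proof (intro Bochner_Integration.integral_cong refl)
    fix t :: real
    show "(LBINT y. ?h t y *\<^sub>R \<psi> y) = k *\<^sub>R (LBINT y. ?g t y *\<^sub>R h y)"
    proof (cases "t \<in> {a..<b}")
      case True
      have "t powr (- ?n - 1) * t powr (2 * s) = t powr (2 * s - ?n - 1)"
        unfolding powr_add[symmetric] by (rule arg_cong[where f="\<lambda>e. t powr e"]) simp
      then have pw: "t powr (- ?n - 1) * (k * t powr (2 * s)) = k * t powr (2 * s - ?n - 1)" by (simp add: mult_ac)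
      have "(LBINT y. ?h t y *\<^sub>R \<psi> y) = t powr (- ?n - 1) *\<^sub>R (LBINT y. theta s ((x - y) /\<^sub>R t) *\<^sub>R \<psi> y)"
        using True by (subst integral_scaleR_right[symmetric]) simp
      also have "\<dots> = (k * t powr (2 * s - ?n - 1)) *\<^sub>R (LBINT y. eta ((x - y) /\<^sub>R t) *\<^sub>R h y)"
        using E[of t] True by (simp add: pw)
      also have "\<dots> = k *\<^sub>R (LBINT y. (t powr (2 * s - ?n - 1)) *\<^sub>R (eta ((x - y) /\<^sub>R t) *\<^sub>R h y))"
        by (subst integral_scaleR_right) simp
      finally show ?thesis using True by simp
    qed simp
  qed
  also have "\<dots> = k *\<^sub>R (LBINT t. (LBINT y. ?g t y *\<^sub>R h y))"
    by (rule integral_scaleR_right)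
  also have "(LBINT t. (LBINT y. ?g t y *\<^sub>R h y)) = (LBINT y. (LBINT t. ?g t y *\<^sub>R h y))"
    by (rule lborel_pair.Fubini_integral[OF J2, symmetric])
  also have "\<dots> = (LBINT y. Gk s {a..<b} (x - y) *\<^sub>R h y)"
  proof (rule integral_cong_AE)
    show "AE y in lborel. (LBINT t. ?g t y *\<^sub>R h y) = Gk s {a..<b} (x - y) *\<^sub>R h y"
      using AE_lborel_singleton[of x]
    proof eventually_elim
      fix y assume "y \<noteq> x"
      then show "(LBINT t. ?g t y *\<^sub>R h y) = Gk s {a..<b} (x - y) *\<^sub>R h y"
        unfolding Gk_def using ab by (intro integral_scaleR_left Gk_integrand[OF s(1)]) auto
    qed
    show "(\<lambda>y. LBINT t. ?g t y *\<^sub>R h y) \<in> borel_measurable lborel"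
      by (rule lborel.borel_measurable_lebesgue_integral) measurable
  qed measurable
  finally show ?thesis .
qed

lemma Gk_conv_joint:
  fixes h :: "'a::euclidean_space \<Rightarrow> complex"
  assumes s: "0 < s" and b: "0 \<le> b" and hi: "integrable lborel h"
  shows "integrable lborel2 (\<lambda>(x, y). Gk s {0..<b} (x - y) *\<^sub>R h y)"
proof -
  have hm [measurable]: "h \<in> borel_measurable borel" using hi by auto
  note G = Gk_integrable[OF s b, where 'a='a]
  have "integrable lborel2 (\<lambda>(y, x). Gk s {0..<b} (x - y) *\<^sub>R h y)"
  proof (rule lborel_pair.Fubini_integrable)
    have "(\<lambda>y. LBINT x. norm (Gk s {0..<b} (x - y) *\<^sub>R h y)) = (\<lambda>y. norm (h y) * integral\<^sup>L lborel (Gk s {0..<b} :: 'a \<Rightarrow> real))"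
      using integral_translate(3)[of "Gk s {0..<b} :: 'a \<Rightarrow> real"] by (simp add: fun_eq_iff mult.commute)
    then show "integrable lborel (\<lambda>y. LBINT x. norm (case (y, x) of (y, x) \<Rightarrow> Gk s {0..<b} (x - y) *\<^sub>R h y))"
      using hi by simp
    show "AE y in lborel. integrable lborel (\<lambda>x. case (y, x) of (y, x) \<Rightarrow> Gk s {0..<b} (x - y) *\<^sub>R h y)"
      using integrable_translate(3)[OF G] by (intro AE_I2) simp
  qed measurable
  then show ?thesis using lborel_pair.integrable_product_swap[of "\<lambda>(y, x). Gk s {0..<b} (x - y) *\<^sub>R h y"] by (simp add: case_prod_beta)
qed

lemma frontier_box_null: "AE y in lborel. y \<notin> cbox a b - box a (b::'a::euclidean_space)"
proof -
  have "cbox a b - box a b \<in> null_sets lborel"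
    using negligible_frontier_interval[of a b] by (simp add: negligible_iff_null_sets null_sets_completion_iff)
  then show ?thesis by (rule AE_not_in)
qed

lemma jw_integral_bound:
  fixes \<psi> :: "'a::euclidean_space \<Rightarrow> complex"
  assumes [measurable]: "\<psi> \<in> borel_measurable borel" "F \<in> borel_measurable borel"
    and i: "integrable lborel (\<lambda>y. jw s y *\<^sub>R \<psi> y)" and F: "\<And>y. \<bar>F y\<bar> \<le> B * jw s y"
  shows "integrable lborel (\<lambda>y. F y *\<^sub>R \<psi> y)"
    "norm (LBINT y. F y *\<^sub>R \<psi> y) \<le> B * (LBINT y. jw s y * norm (\<psi> y))"
proof -
  have iN: "integrable lborel (\<lambda>y. B * (jw s y * norm (\<psi> y)))"
    using integrable_norm[OF i] by (intro integrable_mult_right) simp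
  have n: "norm (F y *\<^sub>R \<psi> y) \<le> B * (jw s y * norm (\<psi> y))" for y
    using mult_right_mono[OF F[of y], of "norm (\<psi> y)"] by (simp add: mult.assoc)
  show 1: "integrable lborel (\<lambda>y. F y *\<^sub>R \<psi> y)"
    by (rule Bochner_Integration.integrable_bound[OF iN]) (measurable, intro AE_I2 order_trans[OF n], simp)
  have "norm (LBINT y. F y *\<^sub>R \<psi> y) \<le> (LBINT y. norm (F y *\<^sub>R \<psi> y))" by (rule integral_norm_bound)
  also have "\<dots> \<le> (LBINT y. B * (jw s y * norm (\<psi> y)))" by (intro integral_mono integrable_norm 1 iN n)
  also have "\<dots> = B * (LBINT y. jw s y * norm (\<psi> y))" by (rule integral_mult_right_zero)
  finally show "norm (LBINT y. F y *\<^sub>R \<psi> y) \<le> B * (LBINT y. jw s y * norm (\<psi> y))" .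
qed

lemma jw_ge:
  fixes x :: "'a::euclidean_space"
  assumes "0 < s" "norm x \<le> R" "0 \<le> R" shows "1 \<le> (1 + R) powr (real DIM('a) + 2 * s) * jw s x"
proof -
  let ?n = "real DIM('a)"
  have "(1 + R) powr (- ?n - 2 * s) \<le> jw s x"
    unfolding jw_def using assms japanese_le[of x] by (intro powr_mono2') auto
  then have "(1 + R) powr (?n + 2 * s) * (1 + R) powr (- ?n - 2 * s) \<le> (1 + R) powr (?n + 2 * s) * jw s x"
    by (rule mult_left_mono) simp
  then show ?thesis using assms by (simp add: powr_add[symmetric])
qed

text \<open>The limit of \<open>repr_pointwise\<close> as the lower scale tends to 0. It is taken
  weakly: after integration over a box the approximate identity acts on the indicator of the box,
  which converges off the boundary, so no regularity of \<open>\<psi>\<close> is required. Since the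
  two sides have equal integrals over all boxes in U, they agree almost everywhere there.\<close>

lemma repr_AE:
  fixes \<psi> h :: "'a::euclidean_space \<Rightarrow> complex"
  assumes s: "0 < s" "s < 1" and \<psi>m: "\<psi> \<in> borel_measurable borel"
    and \<psi>i: "integrable lborel (\<lambda>y. jw s y *\<^sub>R \<psi> y)" and hi: "integrable lborel h"
    and b: "0 < b" "b \<le> 1" and U: "open U"
    and E: "\<And>t x. x \<in> U \<Longrightarrow> 0 < t \<Longrightarrow> t < b \<Longrightarrow> (LBINT y. theta s ((x - y) /\<^sub>R t) *\<^sub>R \<psi> y) = (k * t powr (2 * s)) *\<^sub>R (LBINT y. eta ((x - y) /\<^sub>R t) *\<^sub>R h y)"
  shows "AE x in lborel. x \<in> U \<longrightarrow> integrable lborel (\<lambda>y. Gk s {0..<b} (x - y) *\<^sub>R h y) \<and>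
    kappa s TYPE('a) *\<^sub>R \<psi> x = (LBINT y. Tht s b (x - y) *\<^sub>R \<psi> y) + k *\<^sub>R (LBINT y. Gk s {0..<b} (x - y) *\<^sub>R h y)"
proof -
  let ?n = "real DIM('a)"
  note [measurable] = \<psi>m
  have hm [measurable]: "h \<in> borel_measurable borel" using hi by auto
  note J = Gk_conv_joint[OF s(1) less_imp_le[OF b(1)] hi]
  have Jint: "AE x in lborel. integrable lborel (\<lambda>y. Gk s {0..<b} (x - y) *\<^sub>R h y)"
    using lborel_pair.AE_integrable_fst[OF J] by simp
  define G where "G x = (LBINT y. Gk s {0..<b} (x - y) *\<^sub>R h y)" for x
  have Gi: "integrable lborel G" unfolding G_def using lborel_pair.integrable_fst[OF J] by simp
  define P where "P r x = (LBINT y. Tht s r (x - y) *\<^sub>R \<psi> y)" for r x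
  obtain C where C: "0 < C" "\<And>r (x::'a) y R. 0 < r \<Longrightarrow> r \<le> 1 \<Longrightarrow> norm x \<le> R \<Longrightarrow>
    \<bar>Tht s r (x - y)\<bar> \<le> C / r ^ DIM('a) * (1 + R) powr (?n + 2 * s) * jw s y"
    "\<And>r (z::'a). 0 < r \<Longrightarrow> r \<le> 1 \<Longrightarrow> z \<noteq> 0 \<Longrightarrow> \<bar>Tht s r z\<bar> \<le> C * norm z powr (- ?n - 2 * s)"
    using Tht_bound[OF s, where 'a='a] by metis
  have Pi: "integrable lborel (\<lambda>y. Tht s r (x - y) *\<^sub>R \<psi> y)" if r: "0 < r" "r \<le> 1" for r x
    by (rule jw_integral_bound(1)[OF \<psi>m _ \<psi>i C(2)[OF r order_refl]]) measurable
  have box_bd: "\<exists>R\<ge>1. \<forall>x\<in>box p q. norm x \<le> R" for p q :: 'a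
  proof -
    obtain R where "\<forall>x\<in>box p q. norm x \<le> R" using bounded_box[of p q] unfolding bounded_iff by blast
    then show ?thesis by (intro exI[of _ "max 1 R"]) auto
  qed
  have PJ: "integrable lborel2 (\<lambda>(x, y). (indicator (box p q) x * Tht s r (x - y)) *\<^sub>R \<psi> y)"
    if r: "0 < r" "r \<le> 1" for p q r
  proof -
    obtain R where R: "1 \<le> R" "\<And>x. x \<in> box p q \<Longrightarrow> norm x \<le> R" using box_bd[of p q] by blast
    define K where "K = C / r ^ DIM('a) * (1 + R) powr (?n + 2 * s)"
    have K: "0 \<le> K" using C(1) r by (simp add: K_def)
    show ?thesis
    proof (rule integrable_prod_dom[where f="\<lambda>x. K * indicator (box p q) x" and g="\<lambda>y. norm (jw s y *\<^sub>R \<psi> y)"])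
      show "integrable lborel (\<lambda>x. K * indicator (box p q) x)"
        by (intro integrable_mult_right integrable_real_indicator) (simp, rule emeasure_lborel_box_finite)
      fix x y
      show "norm (case (x, y) of (x, y) \<Rightarrow> (indicator (box p q) x * Tht s r (x - y)) *\<^sub>R \<psi> y) \<le> K * indicator (box p q) x * norm (jw s y *\<^sub>R \<psi> y)"
      proof (cases "x \<in> box p q")
        case True
        have "\<bar>Tht s r (x - y)\<bar> * norm (\<psi> y) \<le> K * jw s y * norm (\<psi> y)"
          unfolding K_def using C(2)[OF r R(2)[OF True], of y] by (rule mult_right_mono) simp
        then show ?thesis using True by (simp add: mult.assoc)
      qed simp
    qed (use integrable_norm[OF \<psi>i] K in auto)
  qed
  have PQi: "integrable lborel (\<lambda>x. indicator (box p q) x *\<^sub>R P r x)" if r: "0 < r" "r \<le> 1" for p q r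
    using lborel_pair.integrable_fst[OF PJ[OF r, of p q]] by (simp add: P_def flip: scaleR_scaleR)
  have \<psi>Qi: "integrable lborel (\<lambda>x. indicator (box p q) x *\<^sub>R \<psi> x)" for p q
  proof -
    obtain R where R: "1 \<le> R" "\<And>x. x \<in> box p q \<Longrightarrow> norm x \<le> R" using box_bd[of p q] by blast
    show ?thesis
    proof (rule Bochner_Integration.integrable_bound[OF integrable_scaleR_right[OF \<psi>i, of "(1 + R) powr (?n + 2 * s)"]])
      show "AE x in lborel. norm (indicator (box p q) x *\<^sub>R \<psi> x) \<le> norm ((1 + R) powr (?n + 2 * s) *\<^sub>R (jw s x *\<^sub>R \<psi> x))"
      proof (intro AE_I2)
        fix x
        show "norm (indicator (box p q) x *\<^sub>R \<psi> x) \<le> norm ((1 + R) powr (?n + 2 * s) *\<^sub>R (jw s x *\<^sub>R \<psi> x))"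
        proof (cases "x \<in> box p q")
          case True
          have "1 \<le> (1 + R) powr (?n + 2 * s) * jw s x" using R(1) by (intro jw_ge s R(2)[OF True]) simp
          then have "1 * norm (\<psi> x) \<le> (1 + R) powr (?n + 2 * s) * jw s x * norm (\<psi> x)" by (rule mult_right_mono) simp
          then show ?thesis using True by (simp add: mult.assoc)
        qed simp
      qed
    qed measurable
  qed
  define F where "F x = kappa s TYPE('a) *\<^sub>R \<psi> x - P b x - k *\<^sub>R G x" for x
  have GQi: "integrable lborel (\<lambda>x. indicator (box p q) x *\<^sub>R G x)" for p q
    by (rule integrable_mult_indicator[OF _ Gi]) simp
  have Fexp: "indicator (box p q) x *\<^sub>R F x = kappa s TYPE('a) *\<^sub>R (indicator (box p q) x *\<^sub>R \<psi> x) - indicator (box p q) x *\<^sub>R P b x - k *\<^sub>R (indicator (box p q) x *\<^sub>R G x)" for p q x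
    by (simp add: F_def algebra_simps)
  have FQi: "integrable lborel (\<lambda>x. indicator (box p q) x *\<^sub>R F x)" for p q
    unfolding Fexp using \<psi>Qi PQi[OF b] GQi by (intro Bochner_Integration.integrable_diff integrable_scaleR_right) auto
  have zero: "(LBINT x. indicator (box p q) x *\<^sub>R F x) = 0" if Q: "box p q \<subseteq> U" for p q
  proof -
    let ?Q = "\<lambda>x. indicator (box p q) x :: real"
    obtain R where R: "1 \<le> R" "\<And>x. x \<in> box p q \<Longrightarrow> norm x \<le> R" using box_bd[of p q] by blast
    define a where "a n = b / real (Suc n)" for n
    have a: "0 < a n" "a n \<le> b" "a n \<le> 1" for n
    proof -
      show "0 < a n" "a n \<le> b" using b by (auto simp: a_def divide_le_eq)
      then show "a n \<le> 1" using b by linarith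
    qed
    have a0: "a \<longlonglongrightarrow> 0"
      unfolding a_def using tendsto_mult_right[OF LIMSEQ_Suc[OF lim_1_over_n], of b] tendsto_mult[OF tendsto_const[of b] LIMSEQ_Suc[OF lim_1_over_n]] by simp
    define Gn where "Gn n x = (LBINT y. Gk s {a n..<b} (x - y) *\<^sub>R h y)" for n x
    have eqn: "?Q x *\<^sub>R P (a n) x - ?Q x *\<^sub>R P b x = k *\<^sub>R (?Q x *\<^sub>R Gn n x)" for n x
    proof (cases "x \<in> box p q")
      case True
      have "P (a n) x - P b x = (LBINT y. (Tht s (a n) (x - y) - Tht s b (x - y)) *\<^sub>R \<psi> y)"
        unfolding P_def using Pi[OF a(1,3)] Pi[OF b] by (simp add: scaleR_diff_left)
      also have "\<dots> = k *\<^sub>R Gn n x"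
        unfolding Gn_def using True Q a(1)[of n] by (intro repr_pointwise[OF s \<psi>m \<psi>i hi a(1,2) b(2)] E) auto
      finally show ?thesis using True by simp
    qed simp
    \<comment> \<open>The mollified indicator of the box: by Fubini the kernel is moved from
      \<open>\<psi>\<close> to the indicator.\<close>
    define m where "m n y = (LBINT x. ?Q x * Tht s (a n) (x - y))" for n y
    have m_eq: "m n y = (LBINT z. ?Q (y + a n *\<^sub>R z) * Theta s z)" for n y
    proof -
      have "m n y = \<bar>a n\<bar> ^ DIM('a) *\<^sub>R (LBINT z. ?Q (y + a n *\<^sub>R z) * Tht s (a n) (y + a n *\<^sub>R z - y))"
        unfolding m_def using a(1)[of n] by (intro integral_affine) auto
      also have "\<dots> = (LBINT z. a n ^ DIM('a) * (?Q (y + a n *\<^sub>R z) * Tht s (a n) (y + a n *\<^sub>R z - y)))" using a(1)[of n] by simp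
      also have "\<dots> = (LBINT z. ?Q (y + a n *\<^sub>R z) * Theta s z)"
        using a(1)[of n] by (intro Bochner_Integration.integral_cong refl) (simp add: Tht_def)
      finally show ?thesis .
    qed
    have mm [measurable]: "m n \<in> borel_measurable borel" for n
      unfolding m_def[abs_def] by (rule lborel.borel_measurable_lebesgue_integral) measurable
    note Ti = Theta_integrable[OF s, where 'a='a]
    define T1 where "T1 = (LBINT z. \<bar>Theta s (z::'a)\<bar>)"
    have T1: "0 \<le> T1" unfolding T1_def by (intro integral_nonneg_AE) auto
    have m_T1: "\<bar>m n y\<bar> \<le> T1" for n y
      unfolding m_eq T1_def
      by (rule integral_dominated(2)) (use Ti in \<open>auto simp: indicator_def abs_mult\<close>)
    \<comment> \<open>One bound by the weight for all n, as dominated convergence against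
      \<open>jw s y *\<^sub>R \<psi> y\<close> requires. Near the box the L1 norm of
      \<open>Theta\<close> suffices because the weight is bounded below there; far from it the decay
      of \<open>Tht\<close>, uniform in the scale, is used.\<close>
    define D where "D = T1 * (1 + 2 * R) powr (?n + 2 * s) + measure lborel (box p q) * C * 4 powr (?n + 2 * s)"
    have D: "\<bar>m n y\<bar> \<le> D * jw s y" for n y
    proof (cases "norm y \<le> 2 * R")
      case True
      have "1 \<le> (1 + 2 * R) powr (?n + 2 * s) * jw s y" using R(1) by (intro jw_ge s True) simp
      then have "T1 * 1 \<le> T1 * ((1 + 2 * R) powr (?n + 2 * s) * jw s y)" using T1 by (rule mult_left_mono)
      moreover have "0 \<le> measure lborel (box p q) * C * 4 powr (?n + 2 * s) * jw s y" using C(1) by simp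
      ultimately show ?thesis using m_T1[of n y] unfolding D_def distrib_right by (simp only: mult.assoc)
    next
      case False
      have pw: "\<bar>?Q x * Tht s (a n) (x - y)\<bar> \<le> C * (4 powr (?n + 2 * s) * jw s y) * ?Q x" for x
      proof (cases "x \<in> box p q")
        case True
        have "norm y - norm x \<le> norm (x - y)" by (metis norm_minus_commute norm_triangle_ineq2)
        then have d: "norm y / 2 \<le> norm (x - y)" using R(2)[OF True] False by linarith
        then have ne: "x - y \<noteq> 0" using False R(1) by auto
        have "japanese y / 4 \<le> norm (x - y)" using d japanese_le[of y] False R(1) by linarith
        then have "norm (x - y) powr (- ?n - 2 * s) \<le> (japanese y / 4) powr (- ?n - 2 * s)" using s by (intro powr_mono2') auto
        also have "\<dots> = 4 powr (?n + 2 * s) * jw s y"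
        proof -
          have "4 powr (?n + 2 * s) * 4 powr (- ?n - 2 * s) = (1::real)" by (simp add: powr_add[symmetric])
          then have e: "1 / 4 powr (- ?n - 2 * s) = (4::real) powr (?n + 2 * s)" by (simp add: divide_eq_eq)
          have "(japanese y / 4) powr (- ?n - 2 * s) = 1 / 4 powr (- ?n - 2 * s) * jw s y" by (simp add: powr_divide jw_def)
          then show ?thesis by (simp only: e)
        qed
        finally have "C * norm (x - y) powr (- ?n - 2 * s) \<le> C * (4 powr (?n + 2 * s) * jw s y)" using C(1) by (intro mult_left_mono) auto
        then have "\<bar>Tht s (a n) (x - y)\<bar> \<le> C * (4 powr (?n + 2 * s) * jw s y)"
          by (rule order_trans[OF C(3)[OF a(1,3) ne]])
        then show ?thesis using True by simp
      qed simp
      have "\<bar>m n y\<bar> \<le> (LBINT x. C * (4 powr (?n + 2 * s) * jw s y) * ?Q x)"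
        unfolding m_def
      proof (rule integral_dominated(2)[OF _ _ pw])
        show "integrable lborel (\<lambda>x. C * (4 powr (?n + 2 * s) * jw s y) * ?Q x)"
          by (intro integrable_mult_right integrable_real_indicator) (simp, rule emeasure_lborel_box_finite)
      qed measurable
      also have "\<dots> = measure lborel (box p q) * C * 4 powr (?n + 2 * s) * jw s y" by simp
      finally show ?thesis using T1 unfolding D_def distrib_right by (simp add: add_increasing)
    qed
    have An: "(LBINT x. ?Q x *\<^sub>R P (a n) x) = (LBINT y. m n y *\<^sub>R \<psi> y)" for n
    proof -
      have "(LBINT x. ?Q x *\<^sub>R P (a n) x) = (LBINT x. LBINT y. (?Q x * Tht s (a n) (x - y)) *\<^sub>R \<psi> y)"
        by (simp add: P_def flip: scaleR_scaleR)
      also have "\<dots> = (LBINT y. LBINT x. (?Q x * Tht s (a n) (x - y)) *\<^sub>R \<psi> y)"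
        by (rule lborel_pair.Fubini_integral[OF PJ[OF a(1,3)], symmetric])
      also have "\<dots> = (LBINT y. m n y *\<^sub>R \<psi> y)"
        unfolding m_def
      proof (intro Bochner_Integration.integral_cong refl integral_scaleR_left)
        fix y
        show "integrable lborel (\<lambda>x. ?Q x * Tht s (a n) (x - y))"
        proof (rule integral_dominated(1))
          show "integrable lborel (\<lambda>x. C / a n ^ DIM('a) * (1 + R) powr (?n + 2 * s) * jw s y * ?Q x)"
            by (intro integrable_mult_right integrable_real_indicator) (simp, rule emeasure_lborel_box_finite)
          fix x show "\<bar>?Q x * Tht s (a n) (x - y)\<bar> \<le> C / a n ^ DIM('a) * (1 + R) powr (?n + 2 * s) * jw s y * ?Q x"
            using C(2)[OF a(1,3) R(2), of x] by (cases "x \<in> box p q") auto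
        qed measurable
      qed
      finally show ?thesis .
    qed
    \<comment> \<open>Off the boundary of the box the indicator is locally constant, so its values
      at \<open>y + a n *\<^sub>R z\<close> are eventually equal to that at y.\<close>
    have lim_m: "(\<lambda>n. m n y) \<longlonglongrightarrow> ?Q y * kappa s TYPE('a)" if y: "y \<notin> cbox p q - box p q" for y
      unfolding m_eq kappa_def integral_mult_right_zero[symmetric]
    proof (rule integral_dominated_convergence[where w="\<lambda>z. \<bar>Theta s (z::'a)\<bar>"])
      show "AE z in lborel. (\<lambda>n. ?Q (y + a n *\<^sub>R z) * Theta s z) \<longlonglongrightarrow> ?Q y * Theta s z"
      proof (intro AE_I2 tendsto_mult_right)
        fix z :: 'a
        have "(\<lambda>n. y + a n *\<^sub>R z) \<longlonglongrightarrow> y + 0 *\<^sub>R z" by (intro tendsto_intros a0)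
        then have l: "(\<lambda>n. y + a n *\<^sub>R z) \<longlonglongrightarrow> y" by simp
        show "(\<lambda>n. ?Q (y + a n *\<^sub>R z)) \<longlonglongrightarrow> ?Q y"
        proof (cases "y \<in> box p q")
          case True
          have "\<forall>\<^sub>F n in sequentially. y + a n *\<^sub>R z \<in> box p q" by (rule topological_tendstoD[OF l open_box True])
          then have "\<forall>\<^sub>F n in sequentially. ?Q y = ?Q (y + a n *\<^sub>R z)" by eventually_elim (use True in simp)
          then show ?thesis by (rule Lim_transform_eventually[OF tendsto_const])
        next
          case False
          then have "y \<in> - cbox p q" using y by auto
          moreover have "open (- cbox p q)" by (simp add: open_Compl closed_cbox)
          ultimately have "\<forall>\<^sub>F n in sequentially. y + a n *\<^sub>R z \<in> - cbox p q" using topological_tendstoD[OF l] by blast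
          then have "\<forall>\<^sub>F n in sequentially. ?Q y = ?Q (y + a n *\<^sub>R z)"
          proof eventually_elim
            fix n assume "y + a n *\<^sub>R z \<in> - cbox p q"
            then have "y + a n *\<^sub>R z \<notin> box p q" using box_subset_cbox by blast
            then show "?Q y = ?Q (y + a n *\<^sub>R z)" using False by simp
          qed
          then show ?thesis by (rule Lim_transform_eventually[OF tendsto_const])
        qed
      qed
      show "AE z in lborel. norm (?Q (y + a n *\<^sub>R z) * Theta s z) \<le> \<bar>Theta s z\<bar>" for n
        by (intro AE_I2) (simp add: indicator_def abs_mult)
    qed (use Ti in auto)
    have lim1: "(\<lambda>n. LBINT y. m n y *\<^sub>R \<psi> y) \<longlonglongrightarrow> (LBINT y. (?Q y * kappa s TYPE('a)) *\<^sub>R \<psi> y)"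
    proof (rule integral_dominated_convergence[where w="\<lambda>y. D * norm (jw s y *\<^sub>R \<psi> y)"])
      show "integrable lborel (\<lambda>y. D * norm (jw s y *\<^sub>R \<psi> y))" by (intro integrable_mult_right integrable_norm \<psi>i)
      show "AE y in lborel. (\<lambda>n. m n y *\<^sub>R \<psi> y) \<longlonglongrightarrow> (?Q y * kappa s TYPE('a)) *\<^sub>R \<psi> y"
        using frontier_box_null[of p q] by eventually_elim (intro tendsto_scaleR lim_m tendsto_const)
      show "AE y in lborel. norm (m n y *\<^sub>R \<psi> y) \<le> D * norm (jw s y *\<^sub>R \<psi> y)" for n
        using D[of n] by (intro AE_I2) (simp add: mult_right_mono flip: mult.assoc)
    qed measurable
    \<comment> \<open>Domination is used twice: in y at almost every fixed x, where the full
      potential converges absolutely, and then in x by the absolute potential itself.\<close>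
    have lim2: "(\<lambda>n. LBINT x. ?Q x *\<^sub>R Gn n x) \<longlonglongrightarrow> (LBINT x. ?Q x *\<^sub>R G x)"
    proof (rule integral_dominated_convergence[where w="\<lambda>x. LBINT y. norm (Gk s {0..<b} (x - y) *\<^sub>R h y)"])
      have Jn: "integrable lborel2 (\<lambda>(x, y). norm (Gk s {0..<b} (x - y) *\<^sub>R h y))"
        using integrable_norm[OF J] by (simp only: case_prod_beta')
      show "integrable lborel (\<lambda>x. LBINT y. norm (Gk s {0..<b} (x - y) *\<^sub>R h y))"
        by (rule lborel_pair.integrable_fst[OF Jn])
      have le: "norm (Gk s {a n..<b} (x - y) *\<^sub>R h y) \<le> norm (Gk s {0..<b} (x - y) *\<^sub>R h y)" if "y \<noteq> x" for n x y
        using Gk_mono[OF s(1) less_imp_le[OF a(1)], of "x - y" n b] that by (simp add: mult_right_mono)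
      show "AE x in lborel. (\<lambda>n. ?Q x *\<^sub>R Gn n x) \<longlonglongrightarrow> ?Q x *\<^sub>R G x"
        using Jint
      proof eventually_elim
        fix x assume i: "integrable lborel (\<lambda>y. Gk s {0..<b} (x - y) *\<^sub>R h y)"
        have "(\<lambda>n. Gn n x) \<longlonglongrightarrow> G x"
          unfolding Gn_def G_def
        proof (rule integral_dominated_convergence[where w="\<lambda>y. norm (Gk s {0..<b} (x - y) *\<^sub>R h y)"])
          show "integrable lborel (\<lambda>y. norm (Gk s {0..<b} (x - y) *\<^sub>R h y))" using i by (rule integrable_norm)
          show "AE y in lborel. (\<lambda>n. Gk s {a n..<b} (x - y) *\<^sub>R h y) \<longlonglongrightarrow> Gk s {0..<b} (x - y) *\<^sub>R h y"
            using AE_lborel_singleton[of x]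
          proof eventually_elim
            fix y assume "y \<noteq> x"
            then have "0 < norm (x - y)" by simp
            then have "\<forall>\<^sub>F n in sequentially. a n < norm (x - y)" using order_tendstoD(2)[OF a0] by blast
            then have "\<forall>\<^sub>F n in sequentially. Gk s {0..<b} (x - y) *\<^sub>R h y = Gk s {a n..<b} (x - y) *\<^sub>R h y"
            proof eventually_elim
              fix n assume n: "a n < norm (x - y)"
              show "Gk s {0..<b} (x - y) *\<^sub>R h y = Gk s {a n..<b} (x - y) *\<^sub>R h y"
                by (subst Gk_cut[OF less_imp_le[OF a(1)] less_imp_le[OF n] less_imp_le[OF b(1)]]) (rule refl)
            qed
            then show "(\<lambda>n. Gk s {a n..<b} (x - y) *\<^sub>R h y) \<longlonglongrightarrow> Gk s {0..<b} (x - y) *\<^sub>R h y"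
              by (rule Lim_transform_eventually[OF tendsto_const])
          qed
          show "AE y in lborel. norm (Gk s {a n..<b} (x - y) *\<^sub>R h y) \<le> norm (Gk s {0..<b} (x - y) *\<^sub>R h y)" for n
            using AE_lborel_singleton[of x] by eventually_elim (rule le)
        qed measurable
        then show "(\<lambda>n. ?Q x *\<^sub>R Gn n x) \<longlonglongrightarrow> ?Q x *\<^sub>R G x" by (intro tendsto_intros)
      qed
      show "AE x in lborel. norm (?Q x *\<^sub>R Gn n x) \<le> (LBINT y. norm (Gk s {0..<b} (x - y) *\<^sub>R h y))" for n
        using Jint
      proof eventually_elim
        fix x assume i: "integrable lborel (\<lambda>y. Gk s {0..<b} (x - y) *\<^sub>R h y)"
        have ae: "AE y in lborel. norm (Gk s {a n..<b} (x - y) *\<^sub>R h y) \<le> norm (Gk s {0..<b} (x - y) *\<^sub>R h y)"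
          using AE_lborel_singleton[of x] by eventually_elim (rule le)
        have i2: "integrable lborel (\<lambda>y. Gk s {a n..<b} (x - y) *\<^sub>R h y)"
          by (rule Bochner_Integration.integrable_bound[OF i _ ae]) measurable
        have "norm (?Q x *\<^sub>R Gn n x) \<le> norm (Gn n x)" by (simp add: indicator_def)
        also have "\<dots> \<le> (LBINT y. norm (Gk s {a n..<b} (x - y) *\<^sub>R h y))" unfolding Gn_def by (rule integral_norm_bound)
        also have "\<dots> \<le> (LBINT y. norm (Gk s {0..<b} (x - y) *\<^sub>R h y))"
          by (rule integral_mono_AE[OF integrable_norm[OF i2] integrable_norm[OF i] ae])
        finally show "norm (?Q x *\<^sub>R Gn n x) \<le> (LBINT y. norm (Gk s {0..<b} (x - y) *\<^sub>R h y))" .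
      qed
      show "(\<lambda>x. ?Q x *\<^sub>R Gn n x) \<in> borel_measurable lborel" for n
      proof -
        have "Gn n \<in> borel_measurable lborel" unfolding Gn_def[abs_def] by (rule lborel.borel_measurable_lebesgue_integral) measurable
        then show ?thesis by measurable
      qed
      show "(\<lambda>x. ?Q x *\<^sub>R G x) \<in> borel_measurable lborel" using GQi[of p q] by auto
    qed
    have rel: "(LBINT y. m n y *\<^sub>R \<psi> y) - (LBINT x. ?Q x *\<^sub>R P b x) = k *\<^sub>R (LBINT x. ?Q x *\<^sub>R Gn n x)" for n
    proof -
      have "(LBINT x. ?Q x *\<^sub>R P (a n) x) - (LBINT x. ?Q x *\<^sub>R P b x) = (LBINT x. ?Q x *\<^sub>R P (a n) x - ?Q x *\<^sub>R P b x)"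
        by (rule Bochner_Integration.integral_diff[OF PQi[OF a(1,3)] PQi[OF b], symmetric])
      then show ?thesis unfolding eqn An by (simp only: integral_scaleR_right)
    qed
    have "(\<lambda>n. (LBINT y. m n y *\<^sub>R \<psi> y) - (LBINT x. ?Q x *\<^sub>R P b x)) \<longlonglongrightarrow> k *\<^sub>R (LBINT x. ?Q x *\<^sub>R G x)"
      unfolding rel by (intro tendsto_intros lim2)
    moreover have "(\<lambda>n. (LBINT y. m n y *\<^sub>R \<psi> y) - (LBINT x. ?Q x *\<^sub>R P b x)) \<longlonglongrightarrow> (LBINT y. (?Q y * kappa s TYPE('a)) *\<^sub>R \<psi> y) - (LBINT x. ?Q x *\<^sub>R P b x)"
      by (intro tendsto_intros lim1)
    ultimately have "(LBINT y. (?Q y * kappa s TYPE('a)) *\<^sub>R \<psi> y) - (LBINT x. ?Q x *\<^sub>R P b x) = k *\<^sub>R (LBINT x. ?Q x *\<^sub>R G x)"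
      using LIMSEQ_unique by blast
    moreover have "(LBINT y. (?Q y * kappa s TYPE('a)) *\<^sub>R \<psi> y) = kappa s TYPE('a) *\<^sub>R (LBINT y. ?Q y *\<^sub>R \<psi> y)"
      by (subst integral_scaleR_right[symmetric]) (simp add: mult.commute)
    ultimately show ?thesis
    proof -
      assume 1: "(LBINT y. (?Q y * kappa s TYPE('a)) *\<^sub>R \<psi> y) - (LBINT x. ?Q x *\<^sub>R P b x) = k *\<^sub>R (LBINT x. ?Q x *\<^sub>R G x)"
        and 2: "(LBINT y. (?Q y * kappa s TYPE('a)) *\<^sub>R \<psi> y) = kappa s TYPE('a) *\<^sub>R (LBINT y. ?Q y *\<^sub>R \<psi> y)"
      have "(LBINT x. ?Q x *\<^sub>R F x) = kappa s TYPE('a) *\<^sub>R (LBINT y. ?Q y *\<^sub>R \<psi> y) - (LBINT x. ?Q x *\<^sub>R P b x) - k *\<^sub>R (LBINT x. ?Q x *\<^sub>R G x)"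
        unfolding Fexp
        by (simp only: Bochner_Integration.integral_diff integral_scaleR_right Bochner_Integration.integrable_diff integrable_scaleR_right \<psi>Qi[of p q] PQi[OF b, of p q] GQi[of p q])
      then show ?thesis using 1 2 by (simp only: diff_self)
    qed
  qed
  have "AE x in lborel. x \<in> U \<longrightarrow> F x = 0" by (rule AE_zero_boxes[OF U FQi zero])
  with Jint show ?thesis
    by eventually_elim (auto simp: F_def P_def G_def algebra_simps)
qed

subsection \<open>Morrey densities\<close>

text \<open>The exponent is normalised by its effect on potentials: the layer of the kernel at scale
  t carries t^(2s-N-1), which together with t^(N-2s+\<alpha>) leaves t^(\<alpha>-1). Positivity of C
  is included because the choice of the initial scale later divides by it.\<close>

definition morrey :: "real \<Rightarrow> real \<Rightarrow> real \<Rightarrow> ('a::euclidean_space \<Rightarrow> real) \<Rightarrow> bool" where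
  "morrey s \<alpha> C u \<longleftrightarrow> 0 < C \<and> integrable lborel u \<and> (\<forall>x. 0 \<le> u x) \<and>
     (\<forall>x t. 0 < t \<longrightarrow> t \<le> 1 \<longrightarrow> (LBINT y. indicator (ball x t) y * u y) \<le> C * t powr (real DIM('a) - 2 * s + \<alpha>))"

lemma morreyD:
  assumes "morrey s \<alpha> C (u :: 'a::euclidean_space \<Rightarrow> real)"
  shows "0 < C" "integrable lborel u" "0 \<le> u x" "u \<in> borel_measurable borel"
    "0 < t \<Longrightarrow> t \<le> 1 \<Longrightarrow> (\<integral>\<^sup>+y. indicator (ball x t) y * ennreal (u y) \<partial>lborel) \<le> ennreal (C * t powr (real DIM('a) - 2 * s + \<alpha>))"
proof -
  show 0: "0 < C" and i: "integrable lborel u" and p: "0 \<le> u x" for x using assms by (auto simp: morrey_def)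
  then show [measurable]: "u \<in> borel_measurable borel" by auto
  assume t: "0 < t" "t \<le> 1"
  have i2: "integrable lborel (\<lambda>y. indicator (ball x t) y * u y)"
    using integrable_mult_indicator[OF _ i, of "ball x t"] by simp
  have "(\<integral>\<^sup>+y. indicator (ball x t) y * ennreal (u y) \<partial>lborel) = (\<integral>\<^sup>+y. ennreal (indicator (ball x t) y * u y) \<partial>lborel)"
    by (intro nn_integral_cong) (auto simp: indicator_def)
  also have "\<dots> = ennreal (LBINT y. indicator (ball x t) y * u y)"
    by (rule nn_integral_eq_integral[OF i2]) (use p in \<open>auto intro!: AE_I2\<close>)
  also have "\<dots> \<le> ennreal (C * t powr (real DIM('a) - 2 * s + \<alpha>))"
    using assms t by (intro ennreal_leI) (auto simp: morrey_def)
  finally show "(\<integral>\<^sup>+y. indicator (ball x t) y * ennreal (u y) \<partial>lborel) \<le> ennreal (C * t powr (real DIM('a) - 2 * s + \<alpha>))" .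
qed

lemma eta_le_ball:
  assumes "0 < t" shows "eta ((x - y) /\<^sub>R t :: 'a::euclidean_space) \<le> indicator (ball x t) y"
proof (cases "y \<in> ball x t")
  case False
  then have "t \<le> norm (x - y)" by (simp add: dist_norm)
  then show ?thesis using eta_scaled_zero[of t "x - y"] assms by simp
qed (simp add: eta_le1)

lemma Gk_minus [simp]: "Gk s A (- z) = Gk s A z"
  by (simp add: Gk_def)

lemma Gk_zero:
  fixes z :: "'a::euclidean_space"
  assumes "0 \<le> a" "b \<le> norm z" shows "Gk s {a..<b} z = 0"
proof -
  have "indicator {a..<b} t * (t powr (2 * s - real DIM('a) - 1) * eta (z /\<^sub>R t)) = 0" for t
  proof (cases "0 < t \<and> t < b")
    case True then show ?thesis using eta_scaled_zero[of t z] assms by simp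
  next
    case False then show ?thesis using assms by (cases "t = 0") (auto simp: indicator_def)
  qed
  then show ?thesis unfolding Gk_def by (simp only: integral_zero)
qed

lemma Gk_layers:
  fixes u :: "'a::euclidean_space \<Rightarrow> ennreal"
  assumes s: "0 < s" and [measurable]: "u \<in> borel_measurable borel"
  shows "(\<integral>\<^sup>+y. ennreal (Gk s {0..<b} (x - y)) * u y \<partial>lborel) =
    (\<integral>\<^sup>+t. indicator {0..<b} t * ennreal (t powr (2 * s - real DIM('a) - 1)) * (\<integral>\<^sup>+y. ennreal (eta ((x - y) /\<^sub>R t)) * u y \<partial>lborel) \<partial>lborel)"
proof -
  let ?n = "real DIM('a)"
  have "(\<integral>\<^sup>+y. ennreal (Gk s {0..<b} (x - y)) * u y \<partial>lborel) = (\<integral>\<^sup>+y. (\<integral>\<^sup>+t. indicator {0..<b} t * (ennreal (t powr (2 * s - ?n - 1)) * ennreal (eta ((x - y) /\<^sub>R t))) * u y \<partial>lborel) \<partial>lborel)"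
  proof (rule nn_integral_cong_AE)
    show "AE y in lborel. ennreal (Gk s {0..<b} (x - y)) * u y = (\<integral>\<^sup>+t. indicator {0..<b} t * (ennreal (t powr (2 * s - ?n - 1)) * ennreal (eta ((x - y) /\<^sub>R t))) * u y \<partial>lborel)"
      using AE_lborel_singleton[of x]
    proof eventually_elim
      fix y assume "y \<noteq> x"
      then have "x - y \<noteq> 0" by simp
      show "ennreal (Gk s {0..<b} (x - y)) * u y = (\<integral>\<^sup>+t. indicator {0..<b} t * (ennreal (t powr (2 * s - ?n - 1)) * ennreal (eta ((x - y) /\<^sub>R t))) * u y \<partial>lborel)"
        unfolding Gk_nn[OF s \<open>x - y \<noteq> 0\<close> order_refl] by (rule nn_integral_multc[symmetric]) measurable
    qed
  qed
  also have "\<dots> = (\<integral>\<^sup>+t. (\<integral>\<^sup>+y. indicator {0..<b} t * (ennreal (t powr (2 * s - ?n - 1)) * ennreal (eta ((x - y) /\<^sub>R t))) * u y \<partial>lborel) \<partial>lborel)"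
    by (rule lborel_pair.Fubini') measurable
  also have "\<dots> = (\<integral>\<^sup>+t. indicator {0..<b} t * ennreal (t powr (2 * s - ?n - 1)) * (\<integral>\<^sup>+y. ennreal (eta ((x - y) /\<^sub>R t)) * u y \<partial>lborel) \<partial>lborel)"
  proof (intro nn_integral_cong)
    fix t :: real
    show "(\<integral>\<^sup>+y. indicator {0..<b} t * (ennreal (t powr (2 * s - ?n - 1)) * ennreal (eta ((x - y) /\<^sub>R t))) * u y \<partial>lborel) = indicator {0..<b} t * ennreal (t powr (2 * s - ?n - 1)) * (\<integral>\<^sup>+y. ennreal (eta ((x - y) /\<^sub>R t)) * u y \<partial>lborel)"
      by (subst nn_integral_cmult[symmetric]) (auto simp: mult.assoc)
  qed
  finally show ?thesis .
qed

text \<open>The layer at scale t lives in a ball of radius t and contributes at most C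
  t^(\<alpha>-1); integrating up to b gives a bound that is small with b. The second form integrates
  in the other variable, as needed when the potential is transposed.\<close>

lemma Gk_morrey:
  fixes u :: "'a::euclidean_space \<Rightarrow> real"
  assumes s: "0 < s" and u: "morrey s \<alpha> C u" and \<alpha>: "0 < \<alpha>" and b: "0 < b" "b \<le> 1"
  shows "(\<integral>\<^sup>+y. ennreal (Gk s {0..<b} (x - y)) * ennreal (u y) \<partial>lborel) \<le> ennreal (C * b powr \<alpha> / \<alpha>)"
    "(\<integral>\<^sup>+y. ennreal (Gk s {0..<b} (y - x)) * ennreal (u y) \<partial>lborel) \<le> ennreal (C * b powr \<alpha> / \<alpha>)"
proof -
  let ?n = "real DIM('a)"
  note [measurable] = morreyD(4)[OF u]
  note C = morreyD(1)[OF u]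
  have "(\<integral>\<^sup>+y. ennreal (Gk s {0..<b} (x - y)) * ennreal (u y) \<partial>lborel) \<le> (\<integral>\<^sup>+t. ennreal C * (indicator {0..b} t * ennreal (t powr (\<alpha> - 1))) \<partial>lborel)"
    unfolding Gk_layers[OF s measurable_compose[OF morreyD(4)[OF u] measurable_ennreal]]
  proof (intro nn_integral_mono)
    fix t :: real
    show "indicator {0..<b} t * ennreal (t powr (2 * s - ?n - 1)) * (\<integral>\<^sup>+y. ennreal (eta ((x - y) /\<^sub>R t)) * ennreal (u y) \<partial>lborel) \<le> ennreal C * (indicator {0..b} t * ennreal (t powr (\<alpha> - 1)))"
    proof (cases "0 < t \<and> t < b")
      case True
      have "(\<integral>\<^sup>+y. ennreal (eta ((x - y) /\<^sub>R t)) * ennreal (u y) \<partial>lborel) \<le> (\<integral>\<^sup>+y. indicator (ball x t) y * ennreal (u y) \<partial>lborel)"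
      proof (intro nn_integral_mono mult_right_mono)
        fix y
        have "ennreal (eta ((x - y) /\<^sub>R t)) \<le> ennreal (indicator (ball x t) y)" using True by (intro ennreal_leI eta_le_ball) simp
        then show "ennreal (eta ((x - y) /\<^sub>R t)) \<le> indicator (ball x t) y" by (simp add: ennreal_indicator)
      qed auto
      also have "\<dots> \<le> ennreal (C * t powr (?n - 2 * s + \<alpha>))" using True b by (intro morreyD(5)[OF u]) auto
      finally have "ennreal (t powr (2 * s - ?n - 1)) * (\<integral>\<^sup>+y. ennreal (eta ((x - y) /\<^sub>R t)) * ennreal (u y) \<partial>lborel) \<le> ennreal (t powr (2 * s - ?n - 1)) * ennreal (C * t powr (?n - 2 * s + \<alpha>))"
        by (rule mult_left_mono) simp
      also have "\<dots> = ennreal (C * (t powr (2 * s - ?n - 1) * t powr (?n - 2 * s + \<alpha>)))" by (simp add: ennreal_mult'[symmetric] mult_ac)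
      also have "t powr (2 * s - ?n - 1) * t powr (?n - 2 * s + \<alpha>) = t powr (\<alpha> - 1)"
        unfolding powr_add[symmetric] by (rule arg_cong[where f="\<lambda>e. t powr e"]) simp
      finally show ?thesis using True C by (simp add: ennreal_mult')
    next
      case False
      then have "t = 0 \<or> t \<notin> {0..<b}" by auto
      then show ?thesis by auto
    qed
  qed
  also have "\<dots> = ennreal C * ennreal (b powr \<alpha> / \<alpha>)"
    using nn_integral_powr_0[of "\<alpha> - 1" b] \<alpha> b by (subst nn_integral_cmult) auto
  also have "\<dots> = ennreal (C * b powr \<alpha> / \<alpha>)" using C by (simp add: ennreal_mult'[symmetric])
  finally show 1: "(\<integral>\<^sup>+y. ennreal (Gk s {0..<b} (x - y)) * ennreal (u y) \<partial>lborel) \<le> ennreal (C * b powr \<alpha> / \<alpha>)" .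
  have "Gk s {0..<b} (y - x) = Gk s {0..<b} (x - y)" for y using Gk_minus[of s "{0..<b}" "x - y"] by simp
  then show "(\<integral>\<^sup>+y. ennreal (Gk s {0..<b} (y - x)) * ennreal (u y) \<partial>lborel) \<le> ennreal (C * b powr \<alpha> / \<alpha>)" using 1 by simp
qed

text \<open>Applying the inequality for \<open>g\<close> repeatedly, at scales shrinking geometrically, gains a factor
  \<open>\<le> 2 powr (- n - 1)\<close> per step against a loss of \<open>2 powr n\<close> in the constant term (\<open>n\<close> the dimension); the remainder
  tends to 0 because it is controlled by the integral of \<open>u g\<close> alone.\<close>

lemma morrey_iteration_step:
  fixes u g :: "'a::euclidean_space \<Rightarrow> real" and w :: "'a \<Rightarrow> ennreal"
  assumes s: "0 < s" and u: "morrey s \<alpha> C u" and \<alpha>: "0 < \<alpha>" and b0: "0 < b0" "b0 \<le> 1"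
    and [measurable]: "g \<in> borel_measurable borel" and g0: "\<And>x. 0 \<le> g x"
    and K: "0 \<le> K" "K * (C * b0 powr \<alpha> / \<alpha>) \<le> (1/2) ^ (DIM('a) + 1)" and A: "0 \<le> A"
    and ineq: "\<And>j. AE x in lborel. x \<in> ball c (R0 + 2 * b0 * (1 - (1/2) ^ j)) \<longrightarrow>
      ennreal (g x) \<le> ennreal (A * 2 ^ (j * DIM('a))) + ennreal K * (\<integral>\<^sup>+y. ennreal (Gk s {0..<b0 * (1/2) ^ j} (x - y)) * ennreal (u y * g y) \<partial>lborel)"
    and [measurable]: "w \<in> borel_measurable borel" and M: "\<And>x. w x \<le> ennreal M" "0 \<le> M"
    and w0: "\<And>x. x \<notin> ball c (R0 + 2 * b0 * (1 - (1/2) ^ j)) \<Longrightarrow> w x = 0"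
  shows "(\<integral>\<^sup>+x. w x * ennreal (u x * g x) \<partial>lborel) \<le> ennreal (2 * A * 2 ^ (j * DIM('a))) * (\<integral>\<^sup>+x. w x * ennreal (u x) \<partial>lborel)
    + ennreal (M * (1/2) ^ n) * (\<integral>\<^sup>+x. ennreal (u x * g x) \<partial>lborel)"
  using \<open>w \<in> borel_measurable borel\<close> M w0
proof (induction n arbitrary: w M j)
  case 0
  note [measurable] = 0(1) morreyD(4)[OF u]
  have "(\<integral>\<^sup>+x. w x * ennreal (u x * g x) \<partial>lborel) \<le> (\<integral>\<^sup>+x. ennreal M * ennreal (u x * g x) \<partial>lborel)"
    by (intro nn_integral_mono mult_right_mono 0) auto
  also have "\<dots> = ennreal M * (\<integral>\<^sup>+x. ennreal (u x * g x) \<partial>lborel)" by (rule nn_integral_cmult) measurable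
  finally show ?case by (simp add: add_increasing)
next
  case (Suc n)
  note [measurable] = Suc.prems(1) morreyD(4)[OF u]
  note C = morreyD(1)[OF u] and u0 = morreyD(3)[OF u]
  define b where "b = b0 * (1/2) ^ j"
  have b: "0 < b" "b \<le> b0" "b \<le> 1"
  proof -
    show "0 < b" using b0 by (simp add: b_def)
    show "b \<le> b0" using b0 by (simp add: b_def power_le_one)
    then show "b \<le> 1" using b0 by simp
  qed
  define \<tau> where "\<tau> = K * (C * b powr \<alpha> / \<alpha>)"
  have \<tau>0: "0 \<le> \<tau>" using K C \<alpha> by (simp add: \<tau>_def)
  have "\<tau> \<le> K * (C * b0 powr \<alpha> / \<alpha>)"
    unfolding \<tau>_def using K C \<alpha> b by (intro mult_left_mono divide_right_mono powr_mono2) auto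
  then have \<tau>: "\<tau> \<le> (1/2) ^ (DIM('a) + 1)" using K(2) by linarith
  \<comment> \<open>The potential transposed onto the weight: Fubini moves the kernel from g to w.
    The new weight is smaller by the factor \<tau>, and its support is larger by the scale
    b.\<close>
  define w' where "w' y = ennreal K * (\<integral>\<^sup>+x. w x * ennreal (u x) * ennreal (Gk s {0..<b} (x - y)) \<partial>lborel)" for y
  have wm [measurable]: "w' \<in> borel_measurable borel" unfolding w'_def by measurable
  have w'M: "w' y \<le> ennreal (M * \<tau>)" for y
  proof -
    have "(\<integral>\<^sup>+x. w x * ennreal (u x) * ennreal (Gk s {0..<b} (x - y)) \<partial>lborel) \<le> (\<integral>\<^sup>+x. ennreal M * (ennreal (Gk s {0..<b} (x - y)) * ennreal (u x)) \<partial>lborel)"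
    proof (intro nn_integral_mono)
      fix x
      have "w x * (ennreal (u x) * ennreal (Gk s {0..<b} (x - y))) \<le> ennreal M * (ennreal (u x) * ennreal (Gk s {0..<b} (x - y)))"
        by (intro mult_right_mono Suc.prems(2)) auto
      then show "w x * ennreal (u x) * ennreal (Gk s {0..<b} (x - y)) \<le> ennreal M * (ennreal (Gk s {0..<b} (x - y)) * ennreal (u x))"
        by (simp add: mult_ac)
    qed
    also have "\<dots> = ennreal M * (\<integral>\<^sup>+x. ennreal (Gk s {0..<b} (x - y)) * ennreal (u x) \<partial>lborel)" by (rule nn_integral_cmult) measurable
    also have "\<dots> \<le> ennreal M * ennreal (C * b powr \<alpha> / \<alpha>)" by (intro mult_left_mono Gk_morrey(2)[OF s u \<alpha> b(1,3)]) simp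
    finally have "w' y \<le> ennreal K * (ennreal M * ennreal (C * b powr \<alpha> / \<alpha>))" unfolding w'_def by (intro mult_left_mono) auto
    also have "\<dots> = ennreal (M * \<tau>)" using K(1) Suc.prems(3) C \<alpha> by (simp add: \<tau>_def ennreal_mult'[symmetric] mult_ac)
    finally show ?thesis .
  qed
  \<comment> \<open>The radius grows in step j by exactly the scale \<open>b0 * (1/2) ^ j\<close>
    used there. All supports stay within radius R0 + 2 b0.\<close>
  have radius: "R0 + 2 * b0 * (1 - (1/2) ^ j) + b = R0 + 2 * b0 * (1 - (1/2) ^ Suc j)" by (simp add: b_def algebra_simps)
  have w'0: "w' y = 0" if y: "y \<notin> ball c (R0 + 2 * b0 * (1 - (1/2) ^ Suc j))" for y
  proof -
    have z: "w x * ennreal (u x) * ennreal (Gk s {0..<b} (x - y)) = 0" for x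
    proof (cases "x \<in> ball c (R0 + 2 * b0 * (1 - (1/2) ^ j))")
      case True
      have "R0 + 2 * b0 * (1 - (1/2) ^ j) + b \<le> dist c y" using y unfolding radius by (simp del: power_Suc)
      moreover have "dist c y \<le> dist c x + dist x y" by (rule dist_triangle)
      moreover have "dist c x < R0 + 2 * b0 * (1 - (1/2) ^ j)" using True by simp
      ultimately have "b \<le> norm (x - y)" by (simp add: dist_norm)
      then show ?thesis by (simp add: Gk_zero)
    next
      case False then show ?thesis using Suc.prems(4) by simp
    qed
    show ?thesis unfolding w'_def z by simp
  qed
  have w'u: "(\<integral>\<^sup>+y. w' y * ennreal (u y) \<partial>lborel) \<le> ennreal \<tau> * (\<integral>\<^sup>+x. w x * ennreal (u x) \<partial>lborel)"
  proof -
    have "(\<integral>\<^sup>+y. w' y * ennreal (u y) \<partial>lborel) = (\<integral>\<^sup>+y. (\<integral>\<^sup>+x. ennreal K * (w x * ennreal (u x) * ennreal (Gk s {0..<b} (x - y))) * ennreal (u y) \<partial>lborel) \<partial>lborel)"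
      unfolding w'_def by (intro nn_integral_cong) (simp add: nn_integral_cmult nn_integral_multc)
    also have "\<dots> = (\<integral>\<^sup>+x. (\<integral>\<^sup>+y. ennreal K * (w x * ennreal (u x) * ennreal (Gk s {0..<b} (x - y))) * ennreal (u y) \<partial>lborel) \<partial>lborel)"
      by (rule lborel_pair.Fubini') measurable
    also have "\<dots> = (\<integral>\<^sup>+x. ennreal K * (w x * ennreal (u x)) * (\<integral>\<^sup>+y. ennreal (Gk s {0..<b} (x - y)) * ennreal (u y) \<partial>lborel) \<partial>lborel)"
      by (intro nn_integral_cong, subst nn_integral_cmult[symmetric]) (auto simp: mult_ac)
    also have "\<dots> \<le> (\<integral>\<^sup>+x. ennreal K * (w x * ennreal (u x)) * ennreal (C * b powr \<alpha> / \<alpha>) \<partial>lborel)"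
      by (intro nn_integral_mono mult_left_mono Gk_morrey(1)[OF s u \<alpha> b(1,3)]) auto
    also have "\<dots> = (\<integral>\<^sup>+x. ennreal \<tau> * (w x * ennreal (u x)) \<partial>lborel)"
    proof (intro nn_integral_cong)
      fix x
      have "ennreal K * ennreal (C * b powr \<alpha> / \<alpha>) = ennreal \<tau>" unfolding \<tau>_def using K(1) by (rule ennreal_mult'[symmetric])
      moreover have "ennreal K * (w x * ennreal (u x)) * ennreal (C * b powr \<alpha> / \<alpha>) = (ennreal K * ennreal (C * b powr \<alpha> / \<alpha>)) * (w x * ennreal (u x))"
        by (simp only: mult_ac)
      ultimately show "ennreal K * (w x * ennreal (u x)) * ennreal (C * b powr \<alpha> / \<alpha>) = ennreal \<tau> * (w x * ennreal (u x))" by simp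
    qed
    also have "\<dots> = ennreal \<tau> * (\<integral>\<^sup>+x. w x * ennreal (u x) \<partial>lborel)" by (rule nn_integral_cmult) measurable
    finally show ?thesis .
  qed
  have step: "(\<integral>\<^sup>+x. w x * ennreal (u x * g x) \<partial>lborel) \<le> ennreal (A * 2 ^ (j * DIM('a))) * (\<integral>\<^sup>+x. w x * ennreal (u x) \<partial>lborel) + (\<integral>\<^sup>+y. w' y * ennreal (u y * g y) \<partial>lborel)"
  proof -
    let ?H = "\<lambda>x. (\<integral>\<^sup>+y. ennreal (Gk s {0..<b} (x - y)) * ennreal (u y * g y) \<partial>lborel)"
    have "(\<integral>\<^sup>+x. w x * ennreal (u x * g x) \<partial>lborel) \<le> (\<integral>\<^sup>+x. ennreal (A * 2 ^ (j * DIM('a))) * (w x * ennreal (u x)) + ennreal K * (w x * ennreal (u x)) * ?H x \<partial>lborel)"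
    proof (rule nn_integral_mono_AE)
      show "AE x in lborel. w x * ennreal (u x * g x) \<le> ennreal (A * 2 ^ (j * DIM('a))) * (w x * ennreal (u x)) + ennreal K * (w x * ennreal (u x)) * ?H x"
        using ineq[of j]
      proof eventually_elim
        fix x assume x: "x \<in> ball c (R0 + 2 * b0 * (1 - (1/2) ^ j)) \<longrightarrow>
          ennreal (g x) \<le> ennreal (A * 2 ^ (j * DIM('a))) + ennreal K * (\<integral>\<^sup>+y. ennreal (Gk s {0..<b0 * (1/2) ^ j} (x - y)) * ennreal (u y * g y) \<partial>lborel)"
        show "w x * ennreal (u x * g x) \<le> ennreal (A * 2 ^ (j * DIM('a))) * (w x * ennreal (u x)) + ennreal K * (w x * ennreal (u x)) * ?H x"
        proof (cases "x \<in> ball c (R0 + 2 * b0 * (1 - (1/2) ^ j))")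
          case True
          have "w x * ennreal (u x * g x) = (w x * ennreal (u x)) * ennreal (g x)" using u0 g0 by (simp add: ennreal_mult mult.assoc)
          also have "\<dots> \<le> (w x * ennreal (u x)) * (ennreal (A * 2 ^ (j * DIM('a))) + ennreal K * ?H x)"
            using x True unfolding b_def by (intro mult_left_mono) auto
          also have "\<dots> = ennreal (A * 2 ^ (j * DIM('a))) * (w x * ennreal (u x)) + ennreal K * (w x * ennreal (u x)) * ?H x"
            by (simp add: distrib_left mult_ac)
          finally show ?thesis .
        next
          case False then show ?thesis using Suc.prems(4) by simp
        qed
      qed
    qed
    also have "\<dots> = ennreal (A * 2 ^ (j * DIM('a))) * (\<integral>\<^sup>+x. w x * ennreal (u x) \<partial>lborel) + (\<integral>\<^sup>+x. ennreal K * (w x * ennreal (u x)) * ?H x \<partial>lborel)"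
      by (simp add: nn_integral_add nn_integral_cmult)
    also have "(\<integral>\<^sup>+x. ennreal K * (w x * ennreal (u x)) * ?H x \<partial>lborel) = (\<integral>\<^sup>+x. (\<integral>\<^sup>+y. ennreal K * (w x * ennreal (u x)) * (ennreal (Gk s {0..<b} (x - y)) * ennreal (u y * g y)) \<partial>lborel) \<partial>lborel)"
      by (intro nn_integral_cong, subst nn_integral_cmult[symmetric]) auto
    also have "\<dots> = (\<integral>\<^sup>+y. (\<integral>\<^sup>+x. ennreal K * (w x * ennreal (u x)) * (ennreal (Gk s {0..<b} (x - y)) * ennreal (u y * g y)) \<partial>lborel) \<partial>lborel)"
      by (rule lborel_pair.Fubini') measurable
    also have "\<dots> = (\<integral>\<^sup>+y. w' y * ennreal (u y * g y) \<partial>lborel)"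
    proof (intro nn_integral_cong)
      fix y
      have "w' y * ennreal (u y * g y) = (\<integral>\<^sup>+x. (ennreal K * (w x * ennreal (u x) * ennreal (Gk s {0..<b} (x - y)))) * ennreal (u y * g y) \<partial>lborel)"
        unfolding w'_def by (simp add: nn_integral_cmult nn_integral_multc)
      then show "(\<integral>\<^sup>+x. ennreal K * (w x * ennreal (u x)) * (ennreal (Gk s {0..<b} (x - y)) * ennreal (u y * g y)) \<partial>lborel) = w' y * ennreal (u y * g y)"
        by (simp add: mult.assoc)
    qed
    finally show ?thesis .
  qed
  let ?W = "\<integral>\<^sup>+x. w x * ennreal (u x) \<partial>lborel" and ?Z = "\<integral>\<^sup>+x. ennreal (u x * g x) \<partial>lborel"
  have "(\<integral>\<^sup>+y. w' y * ennreal (u y * g y) \<partial>lborel) \<le> ennreal (2 * A * 2 ^ (Suc j * DIM('a))) * (\<integral>\<^sup>+x. w' x * ennreal (u x) \<partial>lborel) + ennreal (M * \<tau> * (1/2) ^ n) * ?Z"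
    by (rule Suc.IH[OF wm w'M _ w'0]) (use Suc.prems(3) \<tau>0 in auto)
  also have "\<dots> \<le> ennreal (2 * A * 2 ^ (Suc j * DIM('a))) * (ennreal \<tau> * ?W) + ennreal (M * (1/2) ^ Suc n) * ?Z"
  proof (intro add_mono mult_left_mono mult_right_mono w'u ennreal_leI)
    have "\<tau> \<le> (1/2) ^ 1" using \<tau> power_decreasing[of 1 "DIM('a) + 1" "1/2::real"] by simp
    then have "M * \<tau> * (1/2) ^ n \<le> M * (1/2) * (1/2) ^ n" using Suc.prems(3) by (intro mult_right_mono mult_left_mono) auto
    then show "M * \<tau> * (1/2) ^ n \<le> M * (1/2) ^ Suc n" by simp
  qed auto
  \<comment> \<open>Here the smallness of \<tau> is spent: 2^N pays for passing from j to j + 1 in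
    the constant term, and the remaining factor 2 turns 2 A into A, so that the term of this step
    restores 2 A.\<close>
  also have "ennreal (2 * A * 2 ^ (Suc j * DIM('a))) * (ennreal \<tau> * ?W) \<le> ennreal (A * 2 ^ (j * DIM('a))) * ?W"
  proof -
    have "2 * A * 2 ^ (Suc j * DIM('a)) * \<tau> \<le> 2 * A * 2 ^ (Suc j * DIM('a)) * (1/2) ^ (DIM('a) + 1)"
      using \<tau> A by (intro mult_left_mono) auto
    also have "\<dots> = A * 2 ^ (j * DIM('a))" by (simp add: power_add power_one_over)
    finally have "ennreal (2 * A * 2 ^ (Suc j * DIM('a)) * \<tau>) * ?W \<le> ennreal (A * 2 ^ (j * DIM('a))) * ?W"
      by (intro mult_right_mono ennreal_leI) auto
    then show ?thesis using A \<tau>0 by (simp add: ennreal_mult' mult.assoc)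
  qed
  finally have "(\<integral>\<^sup>+y. w' y * ennreal (u y * g y) \<partial>lborel) \<le> ennreal (A * 2 ^ (j * DIM('a))) * ?W + ennreal (M * (1/2) ^ Suc n) * ?Z"
    by (simp add: add_right_mono)
  with step have "(\<integral>\<^sup>+x. w x * ennreal (u x * g x) \<partial>lborel) \<le> ennreal (A * 2 ^ (j * DIM('a))) * ?W + (ennreal (A * 2 ^ (j * DIM('a))) * ?W + ennreal (M * (1/2) ^ Suc n) * ?Z)"
    by (meson add_left_mono order_trans)
  also have "\<dots> = ennreal (2 * A * 2 ^ (j * DIM('a))) * ?W + ennreal (M * (1/2) ^ Suc n) * ?Z"
  proof -
    have "ennreal (2 * A * 2 ^ (j * DIM('a))) = ennreal (A * 2 ^ (j * DIM('a))) + ennreal (A * 2 ^ (j * DIM('a)))"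
      using A by (subst ennreal_plus[symmetric]) auto
    then show ?thesis by (simp add: distrib_right add.assoc)
  qed
  finally show ?case .
qed

text \<open>The weight is the indicator of the part of the ball where the claim fails. Since u g is
  integrable, the remainder disappears as n grows, and the integral of u g over that set is at most
  2 A times that of u. As the pointwise inequality there is strictly the other way, the set is
  null.\<close>

lemma morrey_iteration:
  fixes u g :: "'a::euclidean_space \<Rightarrow> real"
  assumes s: "0 < s" and u: "morrey s \<alpha> C u" and \<alpha>: "0 < \<alpha>" and b0: "0 < b0" "b0 \<le> 1"
    and gm [measurable]: "g \<in> borel_measurable borel" and g0: "\<And>x. 0 \<le> g x" and ug: "integrable lborel (\<lambda>x. u x * g x)"
    and K: "0 \<le> K" "K * (C * b0 powr \<alpha> / \<alpha>) \<le> (1/2) ^ (DIM('a) + 1)" and A: "0 \<le> A"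
    and ineq: "\<And>j. AE x in lborel. x \<in> ball c (R0 + 2 * b0 * (1 - (1/2) ^ j)) \<longrightarrow>
      ennreal (g x) \<le> ennreal (A * 2 ^ (j * DIM('a))) + ennreal K * (\<integral>\<^sup>+y. ennreal (Gk s {0..<b0 * (1/2) ^ j} (x - y)) * ennreal (u y * g y) \<partial>lborel)"
  shows "AE x in lborel. x \<in> ball c R0 \<longrightarrow> u x * g x \<le> 2 * A * u x"
proof -
  note [measurable] = morreyD(4)[OF u]
  note u0 = morreyD(3)[OF u]
  define w where "w = (indicator {x \<in> ball c R0. 2 * A * u x < u x * g x} :: 'a \<Rightarrow> ennreal)"
  have S: "{x \<in> ball c R0. 2 * A * u x < u x * g x} \<in> sets borel" by measurable
  have wm [measurable]: "w \<in> borel_measurable borel" unfolding w_def using S by measurable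
  let ?Z = "\<integral>\<^sup>+x. ennreal (u x * g x) \<partial>lborel"
  have Zfin: "?Z < \<infinity>" using ug u0 g0 by (simp add: nn_integral_eq_integral)
  have "(\<integral>\<^sup>+x. w x * ennreal (u x * g x) \<partial>lborel) \<le> ennreal (2 * A) * (\<integral>\<^sup>+x. w x * ennreal (u x) \<partial>lborel) + ennreal ((1/2) ^ n) * ?Z" for n
    using morrey_iteration_step[OF s u \<alpha> b0 gm g0 K A ineq wm, of 1 0 n] by (simp add: w_def indicator_def)
  moreover have "(\<lambda>n. ennreal (2 * A) * (\<integral>\<^sup>+x. w x * ennreal (u x) \<partial>lborel) + ennreal ((1/2) ^ n) * ?Z) \<longlonglongrightarrow> ennreal (2 * A) * (\<integral>\<^sup>+x. w x * ennreal (u x) \<partial>lborel) + 0 * ?Z"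
  proof (intro tendsto_add tendsto_const)
    have "(\<lambda>n. ennreal ((1/2) ^ n)) \<longlonglongrightarrow> ennreal 0" by (intro tendsto_ennrealI LIMSEQ_power_zero) simp
    then have "(\<lambda>n. ?Z * ennreal ((1/2) ^ n)) \<longlonglongrightarrow> ?Z * ennreal 0"
      using Zfin by (intro ennreal_tendsto_cmult) auto
    then show "(\<lambda>n. ennreal ((1/2) ^ n) * ?Z) \<longlonglongrightarrow> 0 * ?Z" by (simp add: mult.commute)
  qed
  ultimately have "(\<integral>\<^sup>+x. w x * ennreal (u x * g x) \<partial>lborel) \<le> ennreal (2 * A) * (\<integral>\<^sup>+x. w x * ennreal (u x) \<partial>lborel) + 0 * ?Z"
    by (intro LIMSEQ_le_const) auto
  then have le: "(\<integral>\<^sup>+x. w x * ennreal (u x * g x) \<partial>lborel) \<le> ennreal (2 * A) * (\<integral>\<^sup>+x. w x * ennreal (u x) \<partial>lborel)" by simp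
  let ?w = "\<lambda>x. indicator {x \<in> ball c R0. 2 * A * u x < u x * g x} x :: real"
  have i1: "integrable lborel (\<lambda>x. ?w x * (u x * g x))" using integrable_mult_indicator[OF _ ug, of "{x \<in> ball c R0. 2 * A * u x < u x * g x}"] S by simp
  have i2: "integrable lborel (\<lambda>x. ?w x * u x)" using integrable_mult_indicator[OF _ morreyD(2)[OF u], of "{x \<in> ball c R0. 2 * A * u x < u x * g x}"] S by simp
  have e1: "(\<integral>\<^sup>+x. w x * ennreal (u x * g x) \<partial>lborel) = ennreal (LBINT x. ?w x * (u x * g x))"
    using u0 g0 by (subst nn_integral_eq_integral[OF i1, symmetric]) (auto intro!: nn_integral_cong simp: w_def indicator_def)
  have e2: "(\<integral>\<^sup>+x. w x * ennreal (u x) \<partial>lborel) = ennreal (LBINT x. ?w x * u x)"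
    using u0 by (subst nn_integral_eq_integral[OF i2, symmetric]) (auto intro!: nn_integral_cong simp: w_def indicator_def)
  have n2: "0 \<le> (LBINT x. ?w x * u x)" using u0 by (intro integral_nonneg_AE) auto
  have "(LBINT x. ?w x * (u x * g x)) \<le> 2 * A * (LBINT x. ?w x * u x)"
    using le A n2 unfolding e1 e2 by (simp add: ennreal_mult'[symmetric])
  then have le0: "(LBINT x. ?w x * (u x * g x) - 2 * A * (?w x * u x)) \<le> 0" using i1 i2 by simp
  have i3: "integrable lborel (\<lambda>x. ?w x * (u x * g x) - 2 * A * (?w x * u x))" using i1 i2 by simp
  have nn: "0 \<le> ?w x * (u x * g x) - 2 * A * (?w x * u x)" for x by (auto simp: indicator_def)
  have "0 \<le> (LBINT x. ?w x * (u x * g x) - 2 * A * (?w x * u x))" using nn by (intro integral_nonneg_AE) auto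
  then have "(LBINT x. ?w x * (u x * g x) - 2 * A * (?w x * u x)) = 0" using le0 by linarith
  then have "AE x in lborel. ?w x * (u x * g x) - 2 * A * (?w x * u x) = 0"
    using integral_nonneg_eq_0_iff_AE[OF i3] nn by auto
  then show ?thesis by eventually_elim (auto simp: indicator_def split: if_splits)
qed

subsection \<open>Regularity of truncated Riesz potentials\<close>

definition Deta :: "'a::euclidean_space \<Rightarrow> 'a \<Rightarrow> real" where
  "Deta w z = Re (dd w ceta z)"

lemma Deta_measurable [measurable]: "Deta w \<in> borel_measurable borel"
proof -
  have [measurable]: "dd w ceta \<in> borel_measurable (borel :: 'a measure)" by (rule smc_measurable[OF smc_dd[OF smc_ceta]])
  show ?thesis unfolding Deta_def[abs_def] by measurable
qed

lemma eta_has_derivative: "(eta has_derivative (\<lambda>w. Deta w z)) (at z)"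
proof -
  have "((\<lambda>x. Re (ceta x)) has_derivative (\<lambda>w. Re (dd w ceta z))) (at z)"
    by (rule has_derivative_Re[OF smc_diff[OF smc_ceta]])
  then show ?thesis by (simp add: Deta_def ceta_def)
qed

lemma Deta_linear: "linear (\<lambda>w. Deta w z)"
  using eta_has_derivative by (rule has_derivative_linear)

lemma Deta_outside: "1 \<le> norm z \<Longrightarrow> Deta w z = 0"
proof -
  assume "1 \<le> norm z"
  \<comment> \<open>Such a point is a global minimum of the bump, so the derivative vanishes; this
    covers the unit sphere, where the bump meets the constant 0.\<close>
  then have "\<forall>y\<in>UNIV. eta z \<le> eta y" by (simp add: eta_outside)
  from differential_zero_maxmin[OF UNIV_I open_UNIV eta_has_derivative] this show ?thesis by meson
qed

lemma eta_taylor: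
  obtains L where "1 \<le> L" "\<And>v z::'a::euclidean_space. \<bar>eta (z + v) - eta z\<bar> \<le> L * norm v"
    "\<And>v z::'a. \<bar>Deta v z\<bar> \<le> L * norm v"
    "\<And>w v z::'a. \<bar>Deta w (z + v) - Deta w z\<bar> \<le> L * norm w * norm v"
    "\<And>v z::'a. \<bar>eta (z + v) - eta z - Deta v z\<bar> \<le> L * (norm v)\<^sup>2"
proof -
  obtain B where B: "0 < B" "\<And>w x::'a. norm (dd w ceta x) \<le> B * norm w" using smc_dd_le[OF smc_ceta] by blast
  obtain M where M: "0 < M" "\<And>u w. c2bd 1 (M * norm u * norm w) (dd u (dd w (ceta :: 'a \<Rightarrow> complex)))" using smc_c2bd_dd2[OF smc_ceta] by blast
  define L where "L = 1 + B + M"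
  have L: "1 \<le> L" "B \<le> L" "M \<le> L" using B(1) M(1) by (auto simp: L_def)
  have Dl: "norm (dd w ceta (z + v) - dd w ceta z) \<le> M * norm w * norm v" for w v z :: 'a
  proof (rule smc_lip[OF smc_dd[OF smc_ceta]])
    fix u x :: 'a show "norm (dd u (dd w ceta) x) \<le> M * norm w * norm u" using c2bdD(3)[OF M(2)[of u w], of x] by (simp add: mult_ac)
  qed
  show ?thesis
  proof (rule that[OF L(1)])
    fix v w z :: 'a
    have "\<bar>eta (z + v) - eta z\<bar> = norm (ceta (z + v) - ceta z)" by (simp add: ceta_def flip: of_real_diff)
    also have "\<dots> \<le> B * norm v" by (rule smc_lip[OF smc_ceta B(2)])
    also have "\<dots> \<le> L * norm v" using L by (intro mult_right_mono) auto
    finally show "\<bar>eta (z + v) - eta z\<bar> \<le> L * norm v" .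
    have "\<bar>Deta v z\<bar> \<le> norm (dd v ceta z)" unfolding Deta_def by (rule abs_Re_le_cmod)
    also have "\<dots> \<le> B * norm v" by (rule B(2))
    also have "\<dots> \<le> L * norm v" using L by (intro mult_right_mono) auto
    finally show "\<bar>Deta v z\<bar> \<le> L * norm v" .
    have "\<bar>Deta w (z + v) - Deta w z\<bar> \<le> norm (dd w ceta (z + v) - dd w ceta z)" unfolding Deta_def using abs_Re_le_cmod by (metis minus_complex.simps(1))
    also have "\<dots> \<le> M * norm w * norm v" by (rule Dl)
    also have "\<dots> \<le> L * norm w * norm v" using L by (intro mult_right_mono) auto
    finally show "\<bar>Deta w (z + v) - Deta w z\<bar> \<le> L * norm w * norm v" .
    have "norm ((ceta (z + 1 *\<^sub>R v) - 1 *\<^sub>R dd v ceta z) - (ceta (z + 0 *\<^sub>R v) - 0 *\<^sub>R dd v ceta z)) \<le> M * (norm v)\<^sup>2"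
    proof (rule line_bound[where u="\<lambda>\<tau>. ceta (z + \<tau> *\<^sub>R v) - \<tau> *\<^sub>R dd v ceta z" and u'="\<lambda>\<tau>. dd v ceta (z + \<tau> *\<^sub>R v) - dd v ceta z"])
      fix \<tau> :: real assume \<tau>: "0 \<le> \<tau>" "\<tau> \<le> 1"
      show "((\<lambda>\<tau>. ceta (z + \<tau> *\<^sub>R v) - \<tau> *\<^sub>R dd v ceta z) has_vector_derivative dd v ceta (z + \<tau> *\<^sub>R v) - dd v ceta z) (at \<tau>)"
        by (intro has_vector_derivative_diff smc_line[OF smc_ceta]) (auto intro!: derivative_eq_intros)
      have "norm (dd v ceta (z + \<tau> *\<^sub>R v) - dd v ceta z) \<le> M * norm v * norm (\<tau> *\<^sub>R v)" by (rule Dl)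
      also have "\<dots> \<le> M * norm v * norm v" using \<tau> M(1) by (intro mult_left_mono) (auto simp: mult_left_le_one_le)
      finally show "norm (dd v ceta (z + \<tau> *\<^sub>R v) - dd v ceta z) \<le> M * (norm v)\<^sup>2" by (simp add: power2_eq_square mult.assoc)
    qed
    then have n: "norm (ceta (z + v) - ceta z - dd v ceta z) \<le> M * (norm v)\<^sup>2" by (simp add: algebra_simps)
    have "eta (z + v) - eta z - Deta v z = Re (ceta (z + v) - ceta z - dd v ceta z)" by (simp add: ceta_def Deta_def)
    also have "\<bar>\<dots>\<bar> \<le> norm (ceta (z + v) - ceta z - dd v ceta z)" by (rule abs_Re_le_cmod)
    also have "\<dots> \<le> M * (norm v)\<^sup>2" by (rule n)
    also have "\<dots> \<le> L * (norm v)\<^sup>2" using L by (intro mult_right_mono) auto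
    finally show "\<bar>eta (z + v) - eta z - Deta v z\<bar> \<le> L * (norm v)\<^sup>2" .
  qed
qed

text \<open>A potential written as one integral over scale and space. \<Phi> will be the bump, its
  derivative, differences of these or a Taylor remainder, so that a single estimate serves them
  all.\<close>

definition LPf :: "real \<Rightarrow> real \<Rightarrow> ('a::euclidean_space \<Rightarrow> complex) \<Rightarrow> (real \<Rightarrow> 'a \<Rightarrow> real) \<Rightarrow> real \<times> 'a \<Rightarrow> complex" where
  "LPf s b h \<Phi> = (\<lambda>(t, y). (indicator {0..<b} t * (t powr (2 * s - real DIM('a) - 1) * \<Phi> t y)) *\<^sub>R h y)"

text \<open>The regularity estimates reduce to this one. The Morrey condition bounds the layer at
  scale t by 2 C t^(\<alpha>-1) m(t), and only the scale integral of m is left. Two balls are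
  allowed because differences compare the potential at two points.\<close>

lemma LPf_bound:
  fixes h :: "'a::euclidean_space \<Rightarrow> complex"
  assumes h: "morrey s \<alpha> C (\<lambda>y. norm (h y))" and hm [measurable]: "h \<in> borel_measurable borel" and b: "0 < b" "b \<le> 1"
    and m\<Phi>: "(\<lambda>(t, y). \<Phi> t y) \<in> borel_measurable lborel2"
    and \<Phi>: "\<And>t y. 0 < t \<Longrightarrow> t < b \<Longrightarrow> \<bar>\<Phi> t y\<bar> \<le> m t * (indicator (ball x t) y + indicator (ball x' t) y)"
    and m0: "\<And>t. 0 < t \<Longrightarrow> 0 \<le> m t" and mi: "integrable lborel (\<lambda>t. indicator {0<..<b} t * (t powr (\<alpha> - 1) * m t))"
    and mI: "(LBINT t. indicator {0<..<b} t * (t powr (\<alpha> - 1) * m t)) \<le> J"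
  shows "integrable lborel2 (LPf s b h \<Phi>)" "norm (integral\<^sup>L lborel2 (LPf s b h \<Phi>)) \<le> 2 * C * J"
proof -
  let ?n = "real DIM('a)"
  note C = morreyD(1)[OF h]
  have J0: "0 \<le> J"
  proof -
    have "0 \<le> (LBINT t. indicator {0<..<b} t * (t powr (\<alpha> - 1) * m t))" using m0 by (intro integral_nonneg_AE AE_I2) (auto simp: indicator_def)
    then show ?thesis using mI by simp
  qed
  have [measurable]: "LPf s b h \<Phi> \<in> borel_measurable lborel2"
  proof -
    have [measurable]: "(\<lambda>p. \<Phi> (fst p) (snd p)) \<in> borel_measurable lborel2" using m\<Phi> by (simp only: case_prod_beta')
    show ?thesis unfolding LPf_def case_prod_beta' by measurable
  qed
  have balls: "(\<integral>\<^sup>+y. (indicator (ball x t) y + indicator (ball x' t) y) * ennreal (norm (h y)) \<partial>lborel) \<le> ennreal (2 * C * t powr (?n - 2 * s + \<alpha>))" if t: "0 < t" "t < b" for t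
  proof -
    have "(\<integral>\<^sup>+y. (indicator (ball x t) y + indicator (ball x' t) y) * ennreal (norm (h y)) \<partial>lborel) = (\<integral>\<^sup>+y. indicator (ball x t) y * ennreal (norm (h y)) \<partial>lborel) + (\<integral>\<^sup>+y. indicator (ball x' t) y * ennreal (norm (h y)) \<partial>lborel)"
      unfolding distrib_right by (rule nn_integral_add) (intro borel_measurable_times_ennreal borel_measurable_indicator; simp)+
    also have "\<dots> \<le> ennreal (C * t powr (?n - 2 * s + \<alpha>)) + ennreal (C * t powr (?n - 2 * s + \<alpha>))"
      using t b by (intro add_mono morreyD(5)[OF h]) auto
    also have "\<dots> = ennreal (2 * C * t powr (?n - 2 * s + \<alpha>))" using C by (subst ennreal_plus[symmetric]) auto
    finally show ?thesis .
  qed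
  have "(\<integral>\<^sup>+p. ennreal (norm (LPf s b h \<Phi> p)) \<partial>lborel2) = (\<integral>\<^sup>+t. (\<integral>\<^sup>+y. ennreal (norm (LPf s b h \<Phi> (t, y))) \<partial>lborel) \<partial>lborel)"
    by (rule lborel.nn_integral_fst[symmetric]) measurable
  also have "\<dots> \<le> (\<integral>\<^sup>+t. ennreal (2 * C) * ennreal (indicator {0<..<b} t * (t powr (\<alpha> - 1) * m t)) \<partial>lborel)"
  proof (intro nn_integral_mono)
    fix t :: real
    show "(\<integral>\<^sup>+y. ennreal (norm (LPf s b h \<Phi> (t, y))) \<partial>lborel) \<le> ennreal (2 * C) * ennreal (indicator {0<..<b} t * (t powr (\<alpha> - 1) * m t))"
    proof (cases "0 < t \<and> t < b")
      case True
      let ?q = "t powr (2 * s - ?n - 1) * m t"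
      have q0: "0 \<le> ?q" using m0 True by simp
      have "(\<integral>\<^sup>+y. ennreal (norm (LPf s b h \<Phi> (t, y))) \<partial>lborel) \<le> (\<integral>\<^sup>+y. ennreal ?q * ((indicator (ball x t) y + indicator (ball x' t) y) * ennreal (norm (h y))) \<partial>lborel)"
      proof (intro nn_integral_mono)
        fix y
        have "norm (LPf s b h \<Phi> (t, y)) = t powr (2 * s - ?n - 1) * \<bar>\<Phi> t y\<bar> * norm (h y)" using True by (simp add: LPf_def abs_mult)
        also have "\<dots> \<le> t powr (2 * s - ?n - 1) * (m t * (indicator (ball x t) y + indicator (ball x' t) y)) * norm (h y)"
          using True by (intro mult_right_mono mult_left_mono \<Phi>) auto
        also have "\<dots> = ?q * ((indicator (ball x t) y + indicator (ball x' t) y) * norm (h y))" by (simp only: mult_ac)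
        finally have "ennreal (norm (LPf s b h \<Phi> (t, y))) \<le> ennreal (?q * ((indicator (ball x t) y + indicator (ball x' t) y) * norm (h y)))" by (rule ennreal_leI)
        also have "\<dots> = ennreal ?q * ((indicator (ball x t) y + indicator (ball x' t) y) * ennreal (norm (h y)))"
        proof -
          have "ennreal (indicator (ball x t) y + indicator (ball x' t) y) = indicator (ball x t) y + indicator (ball x' t) y"
            by (subst ennreal_plus) (auto simp: ennreal_indicator)
          then show ?thesis using q0 by (simp only: ennreal_mult' norm_ge_zero ennreal_mult'')
        qed
        finally show "ennreal (norm (LPf s b h \<Phi> (t, y))) \<le> ennreal ?q * ((indicator (ball x t) y + indicator (ball x' t) y) * ennreal (norm (h y)))" .
      qed
      also have "\<dots> = ennreal ?q * (\<integral>\<^sup>+y. ((indicator (ball x t) y + indicator (ball x' t) y) * ennreal (norm (h y))) \<partial>lborel)"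
        by (rule nn_integral_cmult) (intro borel_measurable_times_ennreal borel_measurable_add borel_measurable_indicator; simp)
      also have "\<dots> \<le> ennreal ?q * ennreal (2 * C * t powr (?n - 2 * s + \<alpha>))" using True by (intro mult_left_mono balls) auto
      also have "\<dots> = ennreal (2 * C * ((t powr (2 * s - ?n - 1) * t powr (?n - 2 * s + \<alpha>)) * m t))"
        using q0 by (subst ennreal_mult'[symmetric]) (auto simp: mult_ac)
      also have "t powr (2 * s - ?n - 1) * t powr (?n - 2 * s + \<alpha>) = t powr (\<alpha> - 1)"
        unfolding powr_add[symmetric] by (rule arg_cong[where f="\<lambda>e. t powr e"]) simp
      finally show ?thesis using True C by (simp add: ennreal_mult'[symmetric])
    next
      case False
      then have "t = 0 \<or> t \<notin> {0..<b}" by auto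
      then show ?thesis by (auto simp: LPf_def)
    qed
  qed
  also have "\<dots> = ennreal (2 * C) * ennreal (LBINT t. indicator {0<..<b} t * (t powr (\<alpha> - 1) * m t))"
    using mi m0 by (subst nn_integral_cmult) (auto intro!: nn_integral_eq_integral AE_I2 arg_cong2[where f="(*)"] simp: indicator_def)
  also have "\<dots> \<le> ennreal (2 * C) * ennreal J" by (intro mult_left_mono ennreal_leI mI) auto
  also have "\<dots> = ennreal (2 * C * J)" using C by (simp add: ennreal_mult'[symmetric])
  finally have le: "(\<integral>\<^sup>+p. ennreal (norm (LPf s b h \<Phi> p)) \<partial>lborel2) \<le> ennreal (2 * C * J)" .
  show i: "integrable lborel2 (LPf s b h \<Phi>)"
    by (rule integrableI_bounded) (measurable, use le in \<open>simp add: le_less_trans\<close>)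
  have "ennreal (norm (integral\<^sup>L lborel2 (LPf s b h \<Phi>))) \<le> (\<integral>\<^sup>+p. ennreal (norm (LPf s b h \<Phi> p)) \<partial>lborel2)"
    by (rule integral_norm_bound_ennreal[OF i])
  then have "ennreal (norm (integral\<^sup>L lborel2 (LPf s b h \<Phi>))) \<le> ennreal (2 * C * J)" using le by (rule order_trans)
  then show "norm (integral\<^sup>L lborel2 (LPf s b h \<Phi>)) \<le> 2 * C * J"
    using C J0 by (subst (asm) ennreal_le_iff) auto
qed

lemma LPf_diff: "LPf s b h (\<lambda>t y. \<Phi> t y - \<Psi> t y) p = LPf s b h \<Phi> p - LPf s b h \<Psi> p"
  by (simp add: LPf_def case_prod_beta algebra_simps)

text \<open>The scale integral is split at t = d, the distance of the two points. Below d the two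
  values are bounded separately, above d their difference gains d/t; \<gamma> > 0 gives convergence
  at 0 and \<gamma> < 1 at infinity, uniformly in b.\<close>

lemma layer_power:
  assumes \<gamma>: "0 < \<gamma>" "\<gamma> < 1" and d: "0 < (d::real)"
  shows "integrable lborel (\<lambda>t. indicator {0<..<b} t * (t powr (\<gamma> - 1) * min 1 (d / t)))"
    "(LBINT t. indicator {0<..<b} t * (t powr (\<gamma> - 1) * min 1 (d / t))) \<le> d powr \<gamma> * (1 / \<gamma> + 1 / (1 - \<gamma>))"
proof -
  let ?g = "\<lambda>t. indicator {0..d} t * t powr (\<gamma> - 1) + d * (indicator {d..} t * t powr (\<gamma> - 2))"
  have i1: "integrable lborel (\<lambda>t. indicator {0..d} t * t powr (\<gamma> - 1))" using \<gamma> d by (intro powr_0_integral(1)) auto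
  have i2: "integrable lborel (\<lambda>t. d * (indicator {d..} t * t powr (\<gamma> - 2)))" using \<gamma> d by (intro integrable_mult_right powr_inf_integral(1)) auto
  have gi: "integrable lborel ?g" using i1 i2 by (rule Bochner_Integration.integrable_add)
  have I: "integral\<^sup>L lborel ?g = d powr \<gamma> * (1 / \<gamma> + 1 / (1 - \<gamma>))"
  proof -
    have "integral\<^sup>L lborel ?g = d powr \<gamma> / \<gamma> + d * (d powr (\<gamma> - 1) / (1 - \<gamma>))"
      using powr_0_integral(2)[of "\<gamma> - 1" d] powr_inf_integral(2)[of "\<gamma> - 2" d] \<gamma> d
      by (subst Bochner_Integration.integral_add[OF i1 i2]) simp
    also have "d * (d powr (\<gamma> - 1) / (1 - \<gamma>)) = d powr \<gamma> / (1 - \<gamma>)" using powr_add[of d 1 "\<gamma> - 1"] d by simp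
    finally show ?thesis by (simp add: distrib_left)
  qed
  have b: "\<bar>indicator {0<..<b} t * (t powr (\<gamma> - 1) * min 1 (d / t))\<bar> \<le> ?g t" for t
  proof (cases "0 < t \<and> t < b")
    case True
    have eq: "t powr (\<gamma> - 1) * (d / t) = d * t powr (\<gamma> - 2)"
    proof -
      have e: "(\<gamma> - 1) + (- 1) = \<gamma> - 2" by simp
      have "t powr (- 1) = 1 / t" using True by (simp add: powr_minus_divide)
      then show ?thesis using powr_add[of t "\<gamma> - 1" "- 1"] unfolding e by simp
    qed
    show ?thesis
    proof (cases "t \<le> d")
      case t: True
      have "t powr (\<gamma> - 1) * min 1 (d / t) \<le> t powr (\<gamma> - 1) * 1" by (intro mult_left_mono) auto
      then show ?thesis using True t d by (auto simp: indicator_def abs_mult add_increasing2)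
    next
      case t: False
      have "t powr (\<gamma> - 1) * min 1 (d / t) \<le> t powr (\<gamma> - 1) * (d / t)" by (intro mult_left_mono) auto
      then show ?thesis using True t d eq by (auto simp: indicator_def abs_mult)
    qed
  next
    case False then show ?thesis using d by (auto simp: indicator_def)
  qed
  show "integrable lborel (\<lambda>t. indicator {0<..<b} t * (t powr (\<gamma> - 1) * min 1 (d / t)))"
    by (rule integral_dominated(1)[OF gi _ b]) measurable
  show "(LBINT t. indicator {0<..<b} t * (t powr (\<gamma> - 1) * min 1 (d / t))) \<le> d powr \<gamma> * (1 / \<gamma> + 1 / (1 - \<gamma>))"
    unfolding I[symmetric] by (rule order_trans[OF abs_ge_self integral_dominated(2)[OF gi _ b]]) measurable
qed

text \<open>The borderline exponent: the part above d is now the integral of d/t up to 1, which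
  produces the logarithm of the Hoelder scale at exponent 1.\<close>

lemma layer_log:
  assumes d: "0 < (d::real)" "d \<le> 1" and b: "b \<le> 1"
  shows "integrable lborel (\<lambda>t. indicator {0<..<b} t * (t powr (1 - 1) * min 1 (d / t)))"
    "(LBINT t. indicator {0<..<b} t * (t powr (1 - 1) * min 1 (d / t))) \<le> d * (1 + ln (1 / d))"
proof -
  let ?g = "\<lambda>t. indicator {0..d} t + (d / t) * indicator {d..1} t"
  have h2: "has_bochner_integral lborel (\<lambda>t. (d / t) * indicator {d..1} t) (d * ln 1 - d * ln d)"
    using d by (intro has_bochner_integral_FTC_Icc_nonneg[where F="\<lambda>t. d * ln t"]) (auto intro!: derivative_eq_intros)
  have i1: "integrable lborel (indicator {0..d} :: real \<Rightarrow> real)" using d by (intro integrable_real_indicator) auto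
  have i2: "integrable lborel (\<lambda>t. (d / t) * indicator {d..1} t)" using h2 by (rule integrable.intros)
  have gi: "integrable lborel ?g" using i1 i2 by (rule Bochner_Integration.integrable_add)
  have I: "integral\<^sup>L lborel ?g = d * (1 + ln (1 / d))"
    using d has_bochner_integral_integral_eq[OF h2]
    by (subst Bochner_Integration.integral_add[OF i1 i2]) (simp add: ln_div algebra_simps)
  have bd: "\<bar>indicator {0<..<b} t * (t powr (1 - 1) * min 1 (d / t))\<bar> \<le> ?g t" for t
    using d b by (cases "t \<le> d") (auto simp: indicator_def abs_mult)
  show "integrable lborel (\<lambda>t. indicator {0<..<b} t * (t powr (1 - 1) * min 1 (d / t)))"
    by (rule integral_dominated(1)[OF gi _ bd]) measurable
  show "(LBINT t. indicator {0<..<b} t * (t powr (1 - 1) * min 1 (d / t))) \<le> d * (1 + ln (1 / d))"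
    unfolding I[symmetric] by (rule order_trans[OF abs_ge_self integral_dominated(2)[OF gi _ bd]]) measurable
qed

definition Gpot :: "real \<Rightarrow> real \<Rightarrow> ('a::euclidean_space \<Rightarrow> complex) \<Rightarrow> 'a \<Rightarrow> complex" where
  "Gpot s b h x = (LBINT y. Gk s {0..<b} (x - y) *\<^sub>R h y)"

text \<open>The potential differentiated under the scale integral in direction w. The factor 1/t
  costs one power of the scale, so for \<alpha> > 1 the integral still converges absolutely.\<close>

definition DGpot :: "real \<Rightarrow> real \<Rightarrow> ('a::euclidean_space \<Rightarrow> complex) \<Rightarrow> 'a \<Rightarrow> 'a \<Rightarrow> complex" where
  "DGpot s b h w x = integral\<^sup>L lborel2 (LPf s b h (\<lambda>t y. Deta w ((x - y) /\<^sub>R t) / t))"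

context
  fixes s \<alpha> C b :: real and h :: "'a::euclidean_space \<Rightarrow> complex"
  assumes s: "0 < s" and \<alpha>: "0 < \<alpha>" and h: "morrey s \<alpha> C (\<lambda>y. norm (h y))" and hm: "h \<in> borel_measurable borel"
    and b: "0 < b" "b \<le> 1"
begin

lemma layer_const:
  assumes "0 < \<beta>"
  shows "integrable lborel (\<lambda>t. indicator {0<..<b} t * (t powr (\<beta> - 1) * m))"
proof -
  have i: "integrable lborel (\<lambda>t. \<bar>m\<bar> * (indicator {0..b} t * t powr (\<beta> - 1)))"
    using assms b by (intro integrable_mult_right powr_0_integral(1)) auto
  show ?thesis by (rule integral_dominated(1)[OF i]) (measurable, auto simp: indicator_def abs_mult mult.commute)
qed

lemma Gpot_LP:
  shows "integrable lborel2 (LPf s b h (\<lambda>t y. eta ((x - y) /\<^sub>R t)))"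
    "Gpot s b h x = integral\<^sup>L lborel2 (LPf s b h (\<lambda>t y. eta ((x - y) /\<^sub>R t)))"
proof -
  let ?n = "real DIM('a)"
  note [measurable] = hm
  show i: "integrable lborel2 (LPf s b h (\<lambda>t y. eta ((x - y) /\<^sub>R t)))"
  proof (rule LPf_bound(1)[OF h hm b, where m="\<lambda>_. 1" and x=x and x'=x])
    show "(\<lambda>(t, y). eta ((x - y) /\<^sub>R t)) \<in> borel_measurable lborel2" by measurable
    fix t y assume "0 < t" "t < b"
    then show "\<bar>eta ((x - y) /\<^sub>R t)\<bar> \<le> 1 * (indicator (ball x t) y + indicator (ball x t) y)"
      using eta_le_ball[of t x y] eta_le1[of "(x - y) /\<^sub>R t"] eta_nonneg[of "(x - y) /\<^sub>R t"] by (auto simp: indicator_def split: if_splits)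
  qed (use layer_const[OF \<alpha>, of 1] in auto)
  then have i': "integrable lborel2 (\<lambda>(t, y). (indicator {0..<b} t * (t powr (2 * s - ?n - 1) * eta ((x - y) /\<^sub>R t))) *\<^sub>R h y)"
    by (simp add: LPf_def)
  have "integral\<^sup>L lborel2 (LPf s b h (\<lambda>t y. eta ((x - y) /\<^sub>R t))) = (LBINT y. LBINT t. (indicator {0..<b} t * (t powr (2 * s - ?n - 1) * eta ((x - y) /\<^sub>R t))) *\<^sub>R h y)"
    unfolding LPf_def by (rule lborel_pair.integral_snd[OF i', symmetric])
  also have "\<dots> = Gpot s b h x"
    unfolding Gpot_def
  proof (rule integral_cong_AE)
    show "AE y in lborel. (LBINT t. (indicator {0..<b} t * (t powr (2 * s - ?n - 1) * eta ((x - y) /\<^sub>R t))) *\<^sub>R h y) = Gk s {0..<b} (x - y) *\<^sub>R h y"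
      using AE_lborel_singleton[of x]
    proof eventually_elim
      fix y assume "y \<noteq> x"
      then show "(LBINT t. (indicator {0..<b} t * (t powr (2 * s - ?n - 1) * eta ((x - y) /\<^sub>R t))) *\<^sub>R h y) = Gk s {0..<b} (x - y) *\<^sub>R h y"
        unfolding Gk_def by (intro integral_scaleR_left Gk_integrand[OF s]) auto
    qed
    show "(\<lambda>y. LBINT t. (indicator {0..<b} t * (t powr (2 * s - ?n - 1) * eta ((x - y) /\<^sub>R t))) *\<^sub>R h y) \<in> borel_measurable lborel"
      by (rule lborel.borel_measurable_lebesgue_integral) measurable
  qed measurable
  finally show "Gpot s b h x = integral\<^sup>L lborel2 (LPf s b h (\<lambda>t y. eta ((x - y) /\<^sub>R t)))" ..
qed

text \<open>At scale t the bump changes by at most a constant times min 1 (d/t) between points at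
  distance d. The integral J of this gain is left open so that the power case and the logarithmic
  case share the argument.\<close>

lemma Gpot_modulus:
  obtains K where "0 < K" "\<And>x x' J. x \<noteq> x' \<Longrightarrow> integrable lborel (\<lambda>t. indicator {0<..<b} t * (t powr (\<alpha> - 1) * min 1 (dist x x' / t)))
    \<Longrightarrow> (LBINT t. indicator {0<..<b} t * (t powr (\<alpha> - 1) * min 1 (dist x x' / t))) \<le> J \<Longrightarrow> norm (Gpot s b h x - Gpot s b h x') \<le> K * J"
proof -
  note [measurable] = hm
  obtain L where L: "1 \<le> L" "\<And>v z::'a. \<bar>eta (z + v) - eta z\<bar> \<le> L * norm v" using eta_taylor[where 'a='a] by metis
  show ?thesis
  proof (rule that[of "2 * C * L"])
    show "0 < 2 * C * L" using L morreyD(1)[OF h] by simp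
    fix x x' :: 'a and J assume ne: "x \<noteq> x'" and i: "integrable lborel (\<lambda>t. indicator {0<..<b} t * (t powr (\<alpha> - 1) * min 1 (dist x x' / t)))"
      and J: "(LBINT t. indicator {0<..<b} t * (t powr (\<alpha> - 1) * min 1 (dist x x' / t))) \<le> J"
    have "norm (integral\<^sup>L lborel2 (LPf s b h (\<lambda>t y. eta ((x - y) /\<^sub>R t) - eta ((x' - y) /\<^sub>R t)))) \<le> 2 * C * (L * J)"
    proof (rule LPf_bound(2)[OF h hm b, where m="\<lambda>t. L * min 1 (dist x x' / t)" and x=x and x'=x'])
      show "(\<lambda>(t, y). eta ((x - y) /\<^sub>R t) - eta ((x' - y) /\<^sub>R t)) \<in> borel_measurable lborel2" by measurable
      have e: "indicator {0<..<b} t * (t powr (\<alpha> - 1) * (L * min 1 (dist x x' / t))) = L * (indicator {0<..<b} t * (t powr (\<alpha> - 1) * min 1 (dist x x' / t)))" for t :: real by simp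
      show "integrable lborel (\<lambda>t. indicator {0<..<b} t * (t powr (\<alpha> - 1) * (L * min 1 (dist x x' / t))))" unfolding e by (rule integrable_mult_right[OF i])
      show "(LBINT t. indicator {0<..<b} t * (t powr (\<alpha> - 1) * (L * min 1 (dist x x' / t)))) \<le> L * J"
        unfolding e using J L(1) by (simp add: mult_left_mono)
      show "0 \<le> L * min 1 (dist x x' / t)" if "0 < t" for t using that L(1) by simp
      fix t y assume t: "0 < t" "t < b"
      let ?z = "(x' - y) /\<^sub>R t" and ?v = "(x - x') /\<^sub>R t"
      have zv: "(x - y) /\<^sub>R t = ?z + ?v" by (simp add: scaleR_add_right[symmetric])
      have nv: "norm ?v = dist x x' / t" using t by (simp add: dist_norm divide_inverse mult.commute)
      have q0: "0 \<le> L * min 1 (dist x x' / t)" using L(1) t by simp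
      show "\<bar>eta ((x - y) /\<^sub>R t) - eta ((x' - y) /\<^sub>R t)\<bar> \<le> L * min 1 (dist x x' / t) * (indicator (ball x t) y + indicator (ball x' t) y)"
      proof (cases "y \<in> ball x t \<or> y \<in> ball x' t")
        case True
        have "\<bar>eta ((x - y) /\<^sub>R t) - eta ((x' - y) /\<^sub>R t)\<bar> \<le> 1"
          using eta_nonneg[of "(x - y) /\<^sub>R t"] eta_nonneg[of ?z] eta_le1[of "(x - y) /\<^sub>R t"] eta_le1[of ?z] by linarith
        then have 1: "\<bar>eta ((x - y) /\<^sub>R t) - eta ((x' - y) /\<^sub>R t)\<bar> \<le> L" using L(1) by linarith
        have 2: "\<bar>eta ((x - y) /\<^sub>R t) - eta ((x' - y) /\<^sub>R t)\<bar> \<le> L * (dist x x' / t)" using L(2)[of ?z ?v] unfolding zv nv .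
        have "\<bar>eta ((x - y) /\<^sub>R t) - eta ((x' - y) /\<^sub>R t)\<bar> \<le> L * min 1 (dist x x' / t)" using 1 2 by (simp add: min_def)
        also have "\<dots> \<le> L * min 1 (dist x x' / t) * (indicator (ball x t) y + indicator (ball x' t) y)"
          using True mult_left_mono[OF _ q0, of 1 "indicator (ball x t) y + indicator (ball x' t) y"] by (auto simp: indicator_def)
        finally show ?thesis .
      next
        case False
        then have n: "t \<le> norm (x - y)" "t \<le> norm (x' - y)" by (auto simp: dist_norm)
        show ?thesis using eta_scaled_zero[OF n(1) t(1)] eta_scaled_zero[OF n(2) t(1)] False by simp
      qed
    qed
    moreover have "integral\<^sup>L lborel2 (LPf s b h (\<lambda>t y. eta ((x - y) /\<^sub>R t) - eta ((x' - y) /\<^sub>R t))) = Gpot s b h x - Gpot s b h x'"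
      unfolding LPf_diff Gpot_LP(2) by (rule Bochner_Integration.integral_diff[OF Gpot_LP(1) Gpot_LP(1)])
    ultimately show "norm (Gpot s b h x - Gpot s b h x') \<le> 2 * C * L * J" by (simp add: mult_ac)
  qed
qed

lemma Gpot_holder:
  assumes "\<alpha> < 1"
  obtains K where "0 < K" "\<And>x x'. norm (Gpot s b h x - Gpot s b h x') \<le> K * dist x x' powr \<alpha>"
proof (rule Gpot_modulus)
  fix K :: real assume K: "0 < K" "\<And>x x' J. x \<noteq> x' \<Longrightarrow> integrable lborel (\<lambda>t. indicator {0<..<b} t * (t powr (\<alpha> - 1) * min 1 (dist x x' / t)))
    \<Longrightarrow> (LBINT t. indicator {0<..<b} t * (t powr (\<alpha> - 1) * min 1 (dist x x' / t))) \<le> J \<Longrightarrow> norm (Gpot s b h x - Gpot s b h x') \<le> K * J"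
  show ?thesis
  proof (rule that[of "K * (1 / \<alpha> + 1 / (1 - \<alpha>))"])
    show "0 < K * (1 / \<alpha> + 1 / (1 - \<alpha>))" using K(1) \<alpha> assms by (intro mult_pos_pos add_pos_pos) auto
    fix x x' :: 'a
    show "norm (Gpot s b h x - Gpot s b h x') \<le> K * (1 / \<alpha> + 1 / (1 - \<alpha>)) * dist x x' powr \<alpha>"
    proof (cases "x = x'")
      case False
      then have d: "0 < dist x x'" by simp
      from K(2)[OF False layer_power[OF \<alpha> assms d, of b]] show ?thesis by (simp only: mult_ac)
    qed simp
  qed
qed

lemma Gpot_log:
  assumes "\<alpha> = 1"
  obtains K where "0 < K" "\<And>x x'. dist x x' \<le> 1 \<Longrightarrow> norm (Gpot s b h x - Gpot s b h x') \<le> K * (dist x x' * (1 + ln (1 / dist x x')))"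
proof (rule Gpot_modulus)
  fix K :: real assume K: "0 < K" "\<And>x x' J. x \<noteq> x' \<Longrightarrow> integrable lborel (\<lambda>t. indicator {0<..<b} t * (t powr (\<alpha> - 1) * min 1 (dist x x' / t)))
    \<Longrightarrow> (LBINT t. indicator {0<..<b} t * (t powr (\<alpha> - 1) * min 1 (dist x x' / t))) \<le> J \<Longrightarrow> norm (Gpot s b h x - Gpot s b h x') \<le> K * J"
  show ?thesis
  proof (rule that[OF K(1)])
    fix x x' :: 'a assume d: "dist x x' \<le> 1"
    show "norm (Gpot s b h x - Gpot s b h x') \<le> K * (dist x x' * (1 + ln (1 / dist x x')))"
    proof (cases "x = x'")
      case False
      then have d0: "0 < dist x x'" by simp
      show ?thesis by (rule K(2)[OF False, unfolded assms, OF layer_log[OF d0 d b(2)]])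
    qed simp
  qed
qed

lemma DGpot_integrable:
  assumes "1 < \<alpha>"
  shows "integrable lborel2 (LPf s b h (\<lambda>t y. Deta w ((x - y) /\<^sub>R t) / t))"
proof -
  note [measurable] = hm
  obtain L where L: "1 \<le> L" "\<And>v z::'a. \<bar>Deta v z\<bar> \<le> L * norm v" using eta_taylor[where 'a='a] by metis
  have e: "indicator {0<..<b} t * (t powr (\<alpha> - 1) * (L * norm w / t)) = indicator {0<..<b} t * (t powr ((\<alpha> - 1) - 1) * (L * norm w))" for t :: real
    using powr_diff[of t "\<alpha> - 1" 1] by (auto simp: indicator_def)
  show ?thesis
  proof (rule LPf_bound(1)[OF h hm b, where m="\<lambda>t. L * norm w / t" and x=x and x'=x, OF _ _ _ _ order_refl])
    show "(\<lambda>(t, y). Deta w ((x - y) /\<^sub>R t) / t) \<in> borel_measurable lborel2" by measurable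
    show "integrable lborel (\<lambda>t. indicator {0<..<b} t * (t powr (\<alpha> - 1) * (L * norm w / t)))" unfolding e using assms by (intro layer_const) simp
    show "0 \<le> L * norm w / t" if "0 < t" for t using that L by simp
    fix t y assume t: "0 < t" "t < b"
    show "\<bar>Deta w ((x - y) /\<^sub>R t) / t\<bar> \<le> L * norm w / t * (indicator (ball x t) y + indicator (ball x t) y)"
    proof (cases "y \<in> ball x t")
      case True
      have "\<bar>Deta w ((x - y) /\<^sub>R t) / t\<bar> \<le> L * norm w / t" using L(2)[of w "(x - y) /\<^sub>R t"] t by (simp add: divide_right_mono)
      moreover have "0 \<le> L * norm w / t" using L t by simp
      ultimately have "\<bar>Deta w ((x - y) /\<^sub>R t) / t\<bar> \<le> L * norm w / t * (1 + 1)" unfolding distrib_left mult_1_right by (rule add_increasing[rotated])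
      then show ?thesis using True by simp
    next
      case False
      then have "1 \<le> norm ((x - y) /\<^sub>R t)" using t by (simp add: dist_norm divide_inverse[symmetric] mult.commute[of "inverse t"])
      then show ?thesis using False by (simp add: Deta_outside)
    qed
  qed
qed

lemma DGpot_linear:
  assumes "1 < \<alpha>" shows "linear (\<lambda>w. DGpot s b h w x)"
proof (rule linearI)
  fix u v :: 'a and c :: real
  note i = DGpot_integrable[OF assms, of _ x]
  have "LPf s b h (\<lambda>t y. Deta (u + v) ((x - y) /\<^sub>R t) / t) p = LPf s b h (\<lambda>t y. Deta u ((x - y) /\<^sub>R t) / t) p + LPf s b h (\<lambda>t y. Deta v ((x - y) /\<^sub>R t) / t) p" for p
    by (simp add: LPf_def case_prod_beta linear_add[OF Deta_linear] add_divide_distrib distrib_left scaleR_add_left)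
  then have "LPf s b h (\<lambda>t y. Deta (u + v) ((x - y) /\<^sub>R t) / t) = (\<lambda>p. LPf s b h (\<lambda>t y. Deta u ((x - y) /\<^sub>R t) / t) p + LPf s b h (\<lambda>t y. Deta v ((x - y) /\<^sub>R t) / t) p)" by (rule ext)
  then show "DGpot s b h (u + v) x = DGpot s b h u x + DGpot s b h v x"
    unfolding DGpot_def by (simp only: Bochner_Integration.integral_add[OF i i])
  have "LPf s b h (\<lambda>t y. Deta (c *\<^sub>R u) ((x - y) /\<^sub>R t) / t) p = c *\<^sub>R LPf s b h (\<lambda>t y. Deta u ((x - y) /\<^sub>R t) / t) p" for p
    by (simp add: LPf_def case_prod_beta linear_scale[OF Deta_linear] mult_ac)
  then have "LPf s b h (\<lambda>t y. Deta (c *\<^sub>R u) ((x - y) /\<^sub>R t) / t) = (\<lambda>p. c *\<^sub>R LPf s b h (\<lambda>t y. Deta u ((x - y) /\<^sub>R t) / t) p)" by (rule ext)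
  then show "DGpot s b h (c *\<^sub>R u) x = c *\<^sub>R DGpot s b h u x"
    unfolding DGpot_def by (simp only: integral_scaleR_right)
qed

lemma layer_shift: "indicator {0<..<b} t * (t powr (\<alpha> - 1) * (k / t * m)) = k * (indicator {0<..<b} t * (t powr ((\<alpha> - 1) - 1) * m))" for t k m :: real
  using powr_diff[of t "\<alpha> - 1" 1] by (auto simp: indicator_def)

text \<open>The same splitting with \<alpha> - 1 in the place of \<alpha>. For the remainder, scales
  above |w| use the second-order bound (|w|/t)^2 and scales below it bound each term by |w|/t; for
  the derivative the splitting is at the distance of the two points. The range 1 < \<alpha> < 2 puts
  \<alpha> - 1 strictly between 0 and 1.\<close>

lemma DGpot_estimates:
  assumes \<alpha>1: "1 < \<alpha>" "\<alpha> < 2"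
  obtains K where "0 < K" "\<And>x w. norm (Gpot s b h (x + w) - Gpot s b h x - DGpot s b h w x) \<le> K * norm w powr \<alpha>"
    "\<And>x x' w. norm (DGpot s b h w x - DGpot s b h w x') \<le> K * norm w * dist x x' powr (\<alpha> - 1)"
proof -
  note [measurable] = hm
  obtain L where L: "1 \<le> L" "\<And>v z::'a. \<bar>eta (z + v) - eta z\<bar> \<le> L * norm v"
    "\<And>v z::'a. \<bar>Deta v z\<bar> \<le> L * norm v"
    "\<And>w v z::'a. \<bar>Deta w (z + v) - Deta w z\<bar> \<le> L * norm w * norm v"
    "\<And>v z::'a. \<bar>eta (z + v) - eta z - Deta v z\<bar> \<le> L * (norm v)\<^sup>2" using eta_taylor[where 'a='a] by metis
  have C: "0 < C" by (rule morreyD(1)[OF h])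
  define k where "k = 1 / (\<alpha> - 1) + 1 / (1 - (\<alpha> - 1))"
  have k: "0 < k" using \<alpha>1 unfolding k_def by (intro add_pos_pos) auto
  have lp: "integrable lborel (\<lambda>t. indicator {0<..<b} t * (t powr ((\<alpha> - 1) - 1) * min 1 (d / t)))"
    "(LBINT t. indicator {0<..<b} t * (t powr ((\<alpha> - 1) - 1) * min 1 (d / t))) \<le> d powr (\<alpha> - 1) * k" if "0 < d" for d
    unfolding k_def by (rule layer_power; use \<alpha>1 that in simp)+
  have E1: "norm (Gpot s b h (x + w) - Gpot s b h x - DGpot s b h w x) \<le> 2 * C * (2 * L * k) * norm w powr \<alpha>" if w: "w \<noteq> 0" for x w
  proof -
    let ?\<Phi> = "\<lambda>t y. eta ((x + w - y) /\<^sub>R t) - eta ((x - y) /\<^sub>R t) - Deta w ((x - y) /\<^sub>R t) / t"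
    have "norm (integral\<^sup>L lborel2 (LPf s b h ?\<Phi>)) \<le> 2 * C * (2 * L * norm w * (norm w powr (\<alpha> - 1) * k))"
    proof (rule LPf_bound(2)[OF h hm b, where m="\<lambda>t. 2 * L * norm w / t * min 1 (norm w / t)" and x="x + w" and x'=x])
      show "(\<lambda>(t, y). ?\<Phi> t y) \<in> borel_measurable lborel2" by measurable
      show "integrable lborel (\<lambda>t. indicator {0<..<b} t * (t powr (\<alpha> - 1) * (2 * L * norm w / t * min 1 (norm w / t))))"
        unfolding layer_shift using w by (intro integrable_mult_right lp) simp
      show "(LBINT t. indicator {0<..<b} t * (t powr (\<alpha> - 1) * (2 * L * norm w / t * min 1 (norm w / t)))) \<le> 2 * L * norm w * (norm w powr (\<alpha> - 1) * k)"
        unfolding layer_shift integral_mult_right_zero using w L(1) by (intro mult_left_mono lp) auto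
      show "0 \<le> 2 * L * norm w / t * min 1 (norm w / t)" if "0 < t" for t using that L by simp
      fix t y assume t: "0 < t" "t < b"
      let ?z = "(x - y) /\<^sub>R t" and ?v = "w /\<^sub>R t"
      have zv: "(x + w - y) /\<^sub>R t = ?z + ?v" unfolding scaleR_add_right[symmetric] by (rule arg_cong[where f="\<lambda>v. v /\<^sub>R t"]) simp
      have nv: "norm ?v = norm w / t" using t by (simp add: divide_inverse mult.commute)
      have Dv: "Deta w ?z / t = Deta ?v ?z" using linear_scale[OF Deta_linear[of ?z], of "inverse t" w] by (simp add: divide_inverse mult.commute)
      have q0: "0 \<le> 2 * L * norm w / t * min 1 (norm w / t)" using L t by simp
      show "\<bar>?\<Phi> t y\<bar> \<le> 2 * L * norm w / t * min 1 (norm w / t) * (indicator (ball (x + w) t) y + indicator (ball x t) y)"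
      proof (cases "y \<in> ball (x + w) t \<or> y \<in> ball x t")
        case True
        have "\<bar>?\<Phi> t y\<bar> \<le> 2 * L * norm w / t * min 1 (norm w / t)"
        proof (cases "norm w / t \<le> 1")
          case T: True
          have "\<bar>?\<Phi> t y\<bar> \<le> L * (norm w / t)\<^sup>2" using L(5)[of ?z ?v] unfolding zv nv Dv .
          also have "\<dots> \<le> 2 * L * (norm w / t)\<^sup>2" using L(1) by (intro mult_right_mono) auto
          also have "\<dots> = 2 * L * norm w / t * min 1 (norm w / t)" using T by (simp add: min_def power2_eq_square)
          finally show ?thesis .
        next
          case F: False
          have "\<bar>?\<Phi> t y\<bar> \<le> \<bar>eta (?z + ?v) - eta ?z\<bar> + \<bar>Deta ?v ?z\<bar>" unfolding zv Dv by linarith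
          also have "\<dots> \<le> L * (norm w / t) + L * (norm w / t)" using L(2)[of ?z ?v] L(3)[of ?v ?z] unfolding nv by (rule add_mono)
          also have "\<dots> = 2 * L * norm w / t * min 1 (norm w / t)" using F by (simp add: min_def)
          finally show ?thesis .
        qed
        also have "\<dots> \<le> 2 * L * norm w / t * min 1 (norm w / t) * (indicator (ball (x + w) t) y + indicator (ball x t) y)"
          using True mult_left_mono[OF _ q0, of 1 "indicator (ball (x + w) t) y + indicator (ball x t) y"] by (auto simp: indicator_def)
        finally show ?thesis .
      next
        case False
        then have n: "t \<le> norm (x + w - y)" "t \<le> norm (x - y)" by (auto simp: dist_norm)
        then have "1 \<le> norm ?z" using t by (simp add: divide_inverse[symmetric] mult.commute[of "inverse t"])
        then show ?thesis using eta_scaled_zero[OF n(1) t(1)] eta_scaled_zero[OF n(2) t(1)] False by (simp add: Deta_outside)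
      qed
    qed
    moreover have "integral\<^sup>L lborel2 (LPf s b h ?\<Phi>) = Gpot s b h (x + w) - Gpot s b h x - DGpot s b h w x"
      unfolding LPf_diff Gpot_LP(2) DGpot_def
      by (simp only: Bochner_Integration.integral_diff Bochner_Integration.integrable_diff Gpot_LP(1) DGpot_integrable[OF \<alpha>1(1)])
    moreover have "2 * C * (2 * L * norm w * (norm w powr (\<alpha> - 1) * k)) = 2 * C * (2 * L * k) * norm w powr \<alpha>"
    proof -
      have "norm w * norm w powr (\<alpha> - 1) = norm w powr \<alpha>" using powr_add[of "norm w" 1 "\<alpha> - 1"] w by simp
      then show ?thesis by (simp add: mult_ac)
    qed
    ultimately show ?thesis by simp
  qed
  have E2: "norm (DGpot s b h w x - DGpot s b h w x') \<le> 2 * C * (2 * L * k) * norm w * dist x x' powr (\<alpha> - 1)" if ne: "x \<noteq> x'" for x x' w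
  proof -
    let ?\<Phi> = "\<lambda>t y. Deta w ((x - y) /\<^sub>R t) / t - Deta w ((x' - y) /\<^sub>R t) / t"
    have "norm (integral\<^sup>L lborel2 (LPf s b h ?\<Phi>)) \<le> 2 * C * (2 * L * norm w * (dist x x' powr (\<alpha> - 1) * k))"
    proof (rule LPf_bound(2)[OF h hm b, where m="\<lambda>t. 2 * L * norm w / t * min 1 (dist x x' / t)" and x=x and x'=x'])
      show "(\<lambda>(t, y). ?\<Phi> t y) \<in> borel_measurable lborel2" by measurable
      show "integrable lborel (\<lambda>t. indicator {0<..<b} t * (t powr (\<alpha> - 1) * (2 * L * norm w / t * min 1 (dist x x' / t))))"
        unfolding layer_shift using ne by (intro integrable_mult_right lp) simp
      show "(LBINT t. indicator {0<..<b} t * (t powr (\<alpha> - 1) * (2 * L * norm w / t * min 1 (dist x x' / t)))) \<le> 2 * L * norm w * (dist x x' powr (\<alpha> - 1) * k)"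
        unfolding layer_shift integral_mult_right_zero using ne L(1) by (intro mult_left_mono lp) auto
      show "0 \<le> 2 * L * norm w / t * min 1 (dist x x' / t)" if "0 < t" for t using that L by simp
      fix t y assume t: "0 < t" "t < b"
      let ?z = "(x' - y) /\<^sub>R t" and ?v = "(x - x') /\<^sub>R t"
      have zv: "(x - y) /\<^sub>R t = ?z + ?v" by (simp add: scaleR_add_right[symmetric])
      have nv: "norm ?v = dist x x' / t" using t by (simp add: dist_norm divide_inverse mult.commute)
      have q0: "0 \<le> 2 * L * norm w / t * min 1 (dist x x' / t)" using L t by simp
      have abs: "\<bar>?\<Phi> t y\<bar> = \<bar>Deta w (?z + ?v) - Deta w ?z\<bar> / t" unfolding zv using t by (simp add: diff_divide_distrib[symmetric])
      show "\<bar>?\<Phi> t y\<bar> \<le> 2 * L * norm w / t * min 1 (dist x x' / t) * (indicator (ball x t) y + indicator (ball x' t) y)"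
      proof (cases "y \<in> ball x t \<or> y \<in> ball x' t")
        case True
        have 1: "\<bar>Deta w (?z + ?v) - Deta w ?z\<bar> \<le> 2 * L * norm w" using L(3)[of w "?z + ?v"] L(3)[of w ?z] by linarith
        have "\<bar>Deta w (?z + ?v) - Deta w ?z\<bar> \<le> L * norm w * (dist x x' / t)" using L(4)[of w ?z ?v] unfolding nv .
        also have "\<dots> \<le> 2 * L * norm w * (dist x x' / t)" using L(1) t by (intro mult_right_mono) auto
        finally have "\<bar>Deta w (?z + ?v) - Deta w ?z\<bar> \<le> 2 * L * norm w * min 1 (dist x x' / t)" using 1 by (simp add: min_def)
        then have "\<bar>?\<Phi> t y\<bar> \<le> 2 * L * norm w * min 1 (dist x x' / t) / t" unfolding abs using t by (intro divide_right_mono) auto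
        also have "\<dots> = 2 * L * norm w / t * min 1 (dist x x' / t)" by simp
        also have "\<dots> \<le> 2 * L * norm w / t * min 1 (dist x x' / t) * (indicator (ball x t) y + indicator (ball x' t) y)"
          using True mult_left_mono[OF _ q0, of 1 "indicator (ball x t) y + indicator (ball x' t) y"] by (auto simp: indicator_def)
        finally show ?thesis .
      next
        case False
        then have n: "t \<le> norm (x - y)" "t \<le> norm (x' - y)" by (auto simp: dist_norm)
        then have "1 \<le> norm ((x - y) /\<^sub>R t)" "1 \<le> norm ?z" using t by (simp_all add: divide_inverse[symmetric] mult.commute[of "inverse t"])
        then show ?thesis using False by (simp add: Deta_outside)
      qed
    qed
    moreover have "integral\<^sup>L lborel2 (LPf s b h ?\<Phi>) = DGpot s b h w x - DGpot s b h w x'"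
      unfolding LPf_diff DGpot_def by (rule Bochner_Integration.integral_diff[OF DGpot_integrable[OF \<alpha>1(1)] DGpot_integrable[OF \<alpha>1(1)]])
    ultimately show ?thesis by (simp add: mult_ac)
  qed
  show ?thesis
  proof (rule that[of "2 * C * (2 * L * k)"])
    show "0 < 2 * C * (2 * L * k)" using C L(1) k by simp
    fix x x' w :: 'a
    show "norm (Gpot s b h (x + w) - Gpot s b h x - DGpot s b h w x) \<le> 2 * C * (2 * L * k) * norm w powr \<alpha>"
      using E1[of w x] linear_0[OF DGpot_linear[OF \<alpha>1(1), of x]] by (cases "w = 0") auto
    show "norm (DGpot s b h w x - DGpot s b h w x') \<le> 2 * C * (2 * L * k) * norm w * dist x x' powr (\<alpha> - 1)"
      using E2[of x x' w] by (cases "x = x'") auto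
  qed
qed

end

section \<open>The smooth convolution of the solution\<close>

definition Tpot :: "real \<Rightarrow> real \<Rightarrow> ('a::euclidean_space \<Rightarrow> complex) \<Rightarrow> 'a \<Rightarrow> complex" where
  "Tpot s b \<psi> x = (LBINT y. Tht s b (x - y) *\<^sub>R \<psi> y)"

text \<open>At a fixed scale b the kernel inherits the smoothness of \<open>Theta\<close> with all
  bounds proportional to the weight, so \<open>\<psi>\<close> enters only through its weighted L1
  norm. The radius R is fixed because moving the weight from x - y to y costs a power of 1 +
  R.\<close>

lemma Tpot_estimates:
  fixes \<psi> :: "'a::euclidean_space \<Rightarrow> complex"
  assumes s: "0 < s" "s < 1" and \<psi>m: "\<psi> \<in> borel_measurable borel"
    and \<psi>i: "integrable lborel (\<lambda>y. jw s y *\<^sub>R \<psi> y)" and b: "0 < b" "b \<le> 1"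
  obtains K D where "0 < K"
    "\<And>x x'. norm x \<le> R \<Longrightarrow> norm x' \<le> R \<Longrightarrow> norm (Tpot s b \<psi> x - Tpot s b \<psi> x') \<le> K * dist x x'"
    "\<And>x w. norm x \<le> R \<Longrightarrow> norm w \<le> b \<Longrightarrow> norm (Tpot s b \<psi> (x + w) - Tpot s b \<psi> x - D w x) \<le> K * (norm w)\<^sup>2"
    "\<And>x x' w. norm x \<le> R \<Longrightarrow> norm x' \<le> R \<Longrightarrow> norm (D w x - D w x') \<le> K * norm w * dist x x'"
    "\<And>x. norm x \<le> R \<Longrightarrow> linear (\<lambda>w. D w x)"
proof -
  note [measurable] = \<psi>m
  obtain C where C: "0 < C"
    "\<And>z::'a. \<bar>Theta s z\<bar> \<le> C * jw s z"
    "\<And>w z::'a. norm w \<le> 1 \<Longrightarrow> \<bar>Theta s (z + w) - Theta s z - dTheta s w z\<bar> \<le> C * (norm w)\<^sup>2 * jw s z"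
    "\<And>w z::'a. \<bar>dTheta s w z\<bar> \<le> C * norm w * jw s z"
    "\<And>w v z::'a. norm v \<le> 1 \<Longrightarrow> \<bar>dTheta s w (z + v) - dTheta s w z\<bar> \<le> C * norm w * norm v * jw s z"
    "\<And>z::'a. linear (\<lambda>w. dTheta s w z)" using Theta_bounds[OF s, where 'a='a] by metis
  let ?n = "DIM('a)"
  define E where "E = (1 + R) powr (real ?n + 2 * s)"
  define M where "M = (LBINT y. jw s y * norm (\<psi> y))"
  define K0 where "K0 = C * E * M / b ^ ?n"
  define K where "K = 2 * (K0 / b\<^sup>2) + 1"
  \<comment> \<open>The derivative of the convolution; the direction is divided by b because the
    kernel is a dilate.\<close>
  define D where "D w x = (LBINT y. (dTheta s (w /\<^sub>R b) ((x - y) /\<^sub>R b) / b ^ ?n) *\<^sub>R \<psi> y)" for w x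
  have E0: "0 \<le> E" by (simp add: E_def)
  have M0: "0 \<le> M" unfolding M_def by (intro integral_nonneg_AE AE_I2) simp
  have K00: "0 \<le> K0" using C E0 M0 b by (simp add: K0_def)
  have Kd: "0 \<le> K0 / b\<^sup>2" using K00 by simp
  have K1: "K0 / b \<le> K0 / b\<^sup>2" using K00 b by (intro divide_left_mono) (auto simp: power2_eq_square mult_left_le_one_le)
  have K2: "K0 \<le> K0 / b" using K00 b by (simp add: le_divide_eq mult_left_le)
  have core: "integrable lborel (\<lambda>y. F y *\<^sub>R \<psi> y) \<and> norm (LBINT y. F y *\<^sub>R \<psi> y) \<le> K0 * q"
    if [measurable]: "F \<in> borel_measurable borel" and F: "\<And>y. \<bar>F y\<bar> \<le> C * q * jw s ((x - y) /\<^sub>R b) / b ^ ?n" and x: "norm x \<le> R" and q: "0 \<le> q"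
    for F q x
  proof -
    have le: "\<bar>F y\<bar> \<le> (C * q * E / b ^ ?n) * jw s y" for y
    proof -
      have "C * q * jw s ((x - y) /\<^sub>R b) / b ^ ?n \<le> C * q * (E * jw s y) / b ^ ?n"
        unfolding E_def using C q b by (intro divide_right_mono mult_left_mono jw_convolve s x) auto
      with F[of y] show ?thesis by simp
    qed
    have e: "C * q * E / b ^ ?n * M = K0 * q" by (simp add: K0_def)
    show ?thesis using jw_integral_bound[OF _ _ \<psi>i le] unfolding M_def[symmetric] e by simp
  qed
  \<comment> \<open>A version of \<open>core\<close> without a bound on x: integrability is also
    needed at x + w, which may leave the ball of radius R.\<close>
  have int: "integrable lborel (\<lambda>y. F y *\<^sub>R \<psi> y)"
    if [measurable]: "F \<in> borel_measurable borel" and F: "\<And>y. \<bar>F y\<bar> \<le> C * q * jw s ((x - y) /\<^sub>R b) / b ^ ?n" and q: "0 \<le> q"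
    for F q x
  proof -
    have le: "\<bar>F y\<bar> \<le> (C * q * (1 + norm x) powr (real ?n + 2 * s) / b ^ ?n) * jw s y" for y
    proof -
      have "C * q * jw s ((x - y) /\<^sub>R b) / b ^ ?n \<le> C * q * ((1 + norm x) powr (real ?n + 2 * s) * jw s y) / b ^ ?n"
        using C q b by (intro divide_right_mono mult_left_mono jw_convolve s order_refl) auto
      with F[of y] show ?thesis by simp
    qed
    show ?thesis by (rule jw_integral_bound(1)[OF _ _ \<psi>i le]) measurable
  qed
  have absd: "\<bar>a / b ^ ?n\<bar> \<le> B / b ^ ?n" if "\<bar>a\<bar> \<le> B" for a B :: real
    using that b by (simp add: divide_right_mono)
  have TI: "integrable lborel (\<lambda>y. Tht s b (x - y) *\<^sub>R \<psi> y)" for x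
  proof (rule int[where q=1])
    show "\<bar>Tht s b (x - y)\<bar> \<le> C * 1 * jw s ((x - y) /\<^sub>R b) / b ^ ?n" for y
      unfolding Tht_def by (rule absd) (use C(2) in simp)
  qed auto
  have TN: "norm (Tpot s b \<psi> x) \<le> K0" if x: "norm x \<le> R" for x
  proof -
    have "\<bar>Tht s b (x - y)\<bar> \<le> C * 1 * jw s ((x - y) /\<^sub>R b) / b ^ ?n" for y
      unfolding Tht_def by (rule absd) (use C(2) in simp)
    from core[OF _ this x] show ?thesis by (simp add: Tpot_def)
  qed
  have Dle: "\<bar>dTheta s (w /\<^sub>R b) ((x - y) /\<^sub>R b) / b ^ ?n\<bar> \<le> C * norm (w /\<^sub>R b) * jw s ((x - y) /\<^sub>R b) / b ^ ?n" for w x y :: 'a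
    by (rule absd) (rule C(4))
  have DI: "integrable lborel (\<lambda>y. (dTheta s (w /\<^sub>R b) ((x - y) /\<^sub>R b) / b ^ ?n) *\<^sub>R \<psi> y)" for w x
    by (rule int[OF _ Dle]) auto
  have DN: "norm (D w x) \<le> K0 * norm (w /\<^sub>R b)" if x: "norm x \<le> R" for w x
    using core[OF _ Dle x] by (simp add: D_def)
  have nb: "norm (w /\<^sub>R b) = norm w / b" for w :: 'a using b by (simp add: divide_inverse mult.commute)
  have nb1: "norm (w /\<^sub>R b) \<le> 1" if "norm w \<le> b" for w :: 'a unfolding nb using b that by simp
  have sh: "(x + w - y) /\<^sub>R b = (x - y) /\<^sub>R b + w /\<^sub>R b" for x w y :: 'a
    unfolding scaleR_add_right[symmetric] by (rule arg_cong[where f="\<lambda>v. v /\<^sub>R b"]) simp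
  show ?thesis
  proof (rule that)
    show "0 < K" using Kd by (simp add: K_def)
  next
    fix x w :: 'a assume x: "norm x \<le> R" and w: "norm w \<le> b"
    have "norm (LBINT y. (Tht s b (x + w - y) - Tht s b (x - y) - dTheta s (w /\<^sub>R b) ((x - y) /\<^sub>R b) / b ^ ?n) *\<^sub>R \<psi> y) \<le> K0 * (norm (w /\<^sub>R b))\<^sup>2"
    proof (rule conjunct2[OF core[OF _ _ x]])
      fix y
      show "\<bar>Tht s b (x + w - y) - Tht s b (x - y) - dTheta s (w /\<^sub>R b) ((x - y) /\<^sub>R b) / b ^ ?n\<bar> \<le> C * (norm (w /\<^sub>R b))\<^sup>2 * jw s ((x - y) /\<^sub>R b) / b ^ ?n"
        unfolding Tht_def sh diff_divide_distrib[symmetric] by (rule absd) (rule C(3)[OF nb1[OF w]])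
    qed auto
    also have "(LBINT y. (Tht s b (x + w - y) - Tht s b (x - y) - dTheta s (w /\<^sub>R b) ((x - y) /\<^sub>R b) / b ^ ?n) *\<^sub>R \<psi> y) = Tpot s b \<psi> (x + w) - Tpot s b \<psi> x - D w x"
      unfolding scaleR_left.diff Tpot_def D_def
      by (simp only: Bochner_Integration.integral_diff Bochner_Integration.integrable_diff TI DI)
    also have "K0 * (norm (w /\<^sub>R b))\<^sup>2 = K0 / b\<^sup>2 * (norm w)\<^sup>2" unfolding nb by (simp add: power_divide)
    also have "\<dots> \<le> K * (norm w)\<^sup>2" using Kd by (intro mult_right_mono) (auto simp: K_def)
    finally show "norm (Tpot s b \<psi> (x + w) - Tpot s b \<psi> x - D w x) \<le> K * (norm w)\<^sup>2" .
  next
    fix x x' :: 'a assume x: "norm x \<le> R" and x': "norm x' \<le> R"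
    show "norm (Tpot s b \<psi> x - Tpot s b \<psi> x') \<le> K * dist x x'"
    proof (cases "dist x x' \<le> b")
      case True
      define w where "w = x - x'"
      have w: "norm w \<le> b" using True by (simp add: w_def dist_norm)
      have xw: "x = x' + w" by (simp add: w_def)
      have "norm (LBINT y. (Tht s b (x' + w - y) - Tht s b (x' - y)) *\<^sub>R \<psi> y) \<le> K0 * (2 * norm (w /\<^sub>R b))"
      proof (rule conjunct2[OF core[OF _ _ x']])
        fix y
        let ?z = "(x' - y) /\<^sub>R b" and ?v = "w /\<^sub>R b"
        have "\<bar>Theta s (?z + ?v) - Theta s ?z\<bar> \<le> C * (norm ?v)\<^sup>2 * jw s ?z + C * norm ?v * jw s ?z"
          using C(3)[OF nb1[OF w], of ?z] C(4)[of ?v ?z] by linarith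
        also have "\<dots> \<le> C * norm ?v * jw s ?z + C * norm ?v * jw s ?z"
        proof -
          have "(norm ?v)\<^sup>2 \<le> norm ?v" unfolding power2_eq_square by (rule mult_left_le_one_le[OF norm_ge_zero norm_ge_zero nb1[OF w]])
          then show ?thesis using C(1) by (intro add_right_mono mult_right_mono mult_left_mono) auto
        qed
        finally have "\<bar>Theta s (?z + ?v) - Theta s ?z\<bar> \<le> C * (2 * norm ?v) * jw s ?z" by (simp only: mult_2 distrib_left distrib_right)
        then show "\<bar>Tht s b (x' + w - y) - Tht s b (x' - y)\<bar> \<le> C * (2 * norm ?v) * jw s ?z / b ^ ?n"
          unfolding Tht_def sh diff_divide_distrib[symmetric] by (rule absd)
      qed auto
      also have "(LBINT y. (Tht s b (x' + w - y) - Tht s b (x' - y)) *\<^sub>R \<psi> y) = Tpot s b \<psi> (x' + w) - Tpot s b \<psi> x'"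
        unfolding scaleR_left.diff Tpot_def
        by (simp only: Bochner_Integration.integral_diff TI)
      also have "K0 * (2 * norm (w /\<^sub>R b)) = 2 * (K0 / b) * norm w" unfolding nb by simp
      also have "\<dots> \<le> K * norm w" using K1 by (intro mult_right_mono) (auto simp: K_def)
      finally show ?thesis unfolding xw[symmetric] by (simp add: w_def dist_norm)
    next
      \<comment> \<open>Points further apart than b are handled by the uniform bound, whose value is
        absorbed because the distance exceeds b.\<close>
      case False
      have "norm (Tpot s b \<psi> x - Tpot s b \<psi> x') \<le> 2 * K0" using norm_triangle_ineq4[of "Tpot s b \<psi> x" "Tpot s b \<psi> x'"] TN[OF x] TN[OF x'] by linarith
      also have "\<dots> = 2 * (K0 / b) * b" using b by simp
      also have "\<dots> \<le> K * dist x x'" using False K1 K00 b by (intro mult_mono) (auto simp: K_def)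
      finally show ?thesis .
    qed
  next
    fix x x' w :: 'a assume x: "norm x \<le> R" and x': "norm x' \<le> R"
    show "norm (D w x - D w x') \<le> K * norm w * dist x x'"
    proof (cases "dist x x' \<le> b")
      case True
      define v where "v = x - x'"
      have v: "norm v \<le> b" using True by (simp add: v_def dist_norm)
      have xv: "x = x' + v" by (simp add: v_def)
      have "norm (LBINT y. (dTheta s (w /\<^sub>R b) ((x' + v - y) /\<^sub>R b) / b ^ ?n - dTheta s (w /\<^sub>R b) ((x' - y) /\<^sub>R b) / b ^ ?n) *\<^sub>R \<psi> y) \<le> K0 * (norm (w /\<^sub>R b) * norm (v /\<^sub>R b))"
      proof (rule conjunct2[OF core[OF _ _ x']])
        fix y
        show "\<bar>dTheta s (w /\<^sub>R b) ((x' + v - y) /\<^sub>R b) / b ^ ?n - dTheta s (w /\<^sub>R b) ((x' - y) /\<^sub>R b) / b ^ ?n\<bar> \<le> C * (norm (w /\<^sub>R b) * norm (v /\<^sub>R b)) * jw s ((x' - y) /\<^sub>R b) / b ^ ?n"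
          unfolding sh diff_divide_distrib[symmetric] mult.assoc[symmetric] by (rule absd) (rule C(5)[OF nb1[OF v]])
      qed auto
      also have "(LBINT y. (dTheta s (w /\<^sub>R b) ((x' + v - y) /\<^sub>R b) / b ^ ?n - dTheta s (w /\<^sub>R b) ((x' - y) /\<^sub>R b) / b ^ ?n) *\<^sub>R \<psi> y) = D w (x' + v) - D w x'"
        unfolding scaleR_left.diff D_def
        by (simp only: Bochner_Integration.integral_diff DI)
      also have "K0 * (norm (w /\<^sub>R b) * norm (v /\<^sub>R b)) = K0 / b\<^sup>2 * (norm w * norm v)" unfolding nb by (simp add: power2_eq_square)
      also have "\<dots> \<le> K * (norm w * norm v)" using Kd by (intro mult_right_mono) (auto simp: K_def)
      finally show ?thesis unfolding xv[symmetric] by (simp add: v_def dist_norm mult.assoc)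
    next
      case False
      have "norm (D w x - D w x') \<le> 2 * (K0 * norm (w /\<^sub>R b))" using norm_triangle_ineq4[of "D w x" "D w x'"] DN[OF x, of w] DN[OF x', of w] by linarith
      also have "\<dots> = 2 * (K0 / b\<^sup>2) * norm w * b" unfolding nb using b by (simp add: power2_eq_square)
      also have "\<dots> \<le> K * norm w * dist x x'" using False Kd b by (intro mult_mono) (auto simp: K_def)
      finally show ?thesis .
    qed
  next
    fix x :: 'a
    show "linear (\<lambda>w. D w x)"
    proof (rule linearI)
      fix u v :: 'a and a :: real
      have "(dTheta s ((u + v) /\<^sub>R b) z / b ^ ?n) *\<^sub>R p = (dTheta s (u /\<^sub>R b) z / b ^ ?n) *\<^sub>R p + (dTheta s (v /\<^sub>R b) z / b ^ ?n) *\<^sub>R p" for z and p :: complex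
        by (simp only: scaleR_add_right linear_add[OF C(6)] add_divide_distrib scaleR_add_left)
      then show "D (u + v) x = D u x + D v x" unfolding D_def by (simp only: Bochner_Integration.integral_add[OF DI DI])
      have "dTheta s ((a *\<^sub>R u) /\<^sub>R b) z = a * dTheta s (u /\<^sub>R b) z" for z
        using linear_scale[OF C(6)[of z], of a "u /\<^sub>R b"] by (simp add: mult.commute)
      then have "(dTheta s ((a *\<^sub>R u) /\<^sub>R b) z / b ^ ?n) *\<^sub>R p = a *\<^sub>R ((dTheta s (u /\<^sub>R b) z / b ^ ?n) *\<^sub>R p)" for z and p :: complex
        by simp
      then show "D (a *\<^sub>R u) x = a *\<^sub>R D u x" unfolding D_def by (simp only: integral_scaleR_right)
    qed
  qed
qed

section \<open>From estimates of the two potentials to Hoelder classes\<close>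

lemma powr_lipschitz:
  fixes d :: real
  assumes "0 \<le> d" "d \<le> R" "\<beta> \<le> 1" shows "d \<le> R powr (1 - \<beta>) * d powr \<beta>"
proof (cases "d = 0")
  case False
  then have "d = d powr (1 - \<beta>) * d powr \<beta>" using assms powr_add[of d "1 - \<beta>" \<beta>] by simp
  also have "\<dots> \<le> R powr (1 - \<beta>) * d powr \<beta>" using assms by (intro mult_right_mono powr_mono2) auto
  finally show ?thesis .
qed simp

lemma holder0_continuous:
  assumes \<beta>: "0 < \<beta>" "\<beta> < 1" and g: "holder0 \<beta> U g" shows "continuous_on U g"
  unfolding continuous_on_def
proof
  fix x assume x: "x \<in> U"
  obtain c where c: "\<And>y. y \<in> U \<Longrightarrow> norm (g y - g x) \<le> c * dist y x powr \<beta>" using g \<beta> x unfolding holder0_def by auto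
  have "((\<lambda>y. g y - g x) \<longlongrightarrow> 0) (at x within U)"
  proof (rule Lim_null_comparison)
    show "\<forall>\<^sub>F y in at x within U. norm (g y - g x) \<le> c * dist y x powr \<beta>"
      using c by (auto simp: eventually_at_filter)
    have "((\<lambda>y. dist y x) \<longlongrightarrow> dist x x) (at x within U)" by (intro tendsto_intros)
    then have "((\<lambda>y. dist y x) \<longlongrightarrow> 0) (at x within U)" by simp
    then have "((\<lambda>y. dist y x powr \<beta>) \<longlongrightarrow> 0) (at x within U)" using \<beta> by (intro tendsto_zero_powrI[where b=\<beta>]) auto
    then show "((\<lambda>y. c * dist y x powr \<beta>) \<longlongrightarrow> 0) (at x within U)" by (rule tendsto_mult_right_zero)
  qed
  then show "(g \<longlongrightarrow> g x) (at x within U)" by (rule LIM_zero_cancel)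
qed

lemma ball_norm_le:
  fixes x :: "'a::real_normed_vector"
  assumes "x \<in> ball c' r'" shows "norm x \<le> norm c' + \<bar>r'\<bar>"
proof -
  have "norm x \<le> norm c' + norm (x - c')" using norm_triangle_ineq[of c' "x - c'"] by simp
  then show ?thesis using assms by (simp add: dist_norm norm_minus_commute)
qed

lemma ball_dist_le:
  assumes "x \<in> ball c' r'" "y \<in> ball c' r'" shows "dist x y \<le> 2 * \<bar>r'\<bar>"
  using dist_triangle2[of x y c'] assms by (simp add: dist_commute)

lemma comb_diff: "norm (a *\<^sub>R (t + k *\<^sub>R u) - a *\<^sub>R (t' + k *\<^sub>R u') :: complex) \<le> \<bar>a\<bar> * (norm (t - t') + \<bar>k\<bar> * norm (u - u'))"
proof -
  have "a *\<^sub>R (t + k *\<^sub>R u) - a *\<^sub>R (t' + k *\<^sub>R u') = a *\<^sub>R ((t - t') + k *\<^sub>R (u - u'))" by (simp add: algebra_simps)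
  then have "norm (a *\<^sub>R (t + k *\<^sub>R u) - a *\<^sub>R (t' + k *\<^sub>R u')) = \<bar>a\<bar> * norm ((t - t') + k *\<^sub>R (u - u'))" by simp
  also have "\<dots> \<le> \<bar>a\<bar> * (norm (t - t') + norm (k *\<^sub>R (u - u')))" by (intro mult_left_mono norm_triangle_ineq) simp
  finally show ?thesis by simp
qed

context
  fixes s \<alpha> C b a k r' :: real and h \<psi> :: "'a::euclidean_space \<Rightarrow> complex" and c' :: 'a
  assumes s: "0 < s" "s < 1" and \<psi>m: "\<psi> \<in> borel_measurable borel"
    and \<psi>i: "integrable lborel (\<lambda>y. jw s y *\<^sub>R \<psi> y)"
    and \<alpha>: "0 < \<alpha>" and h: "morrey s \<alpha> C (\<lambda>y. norm (h y))" and hm: "h \<in> borel_measurable borel"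
    and b: "0 < b" "b \<le> 1"
begin

lemma potential_holder0:
  assumes \<alpha>1: "\<alpha> \<le> 1"
  shows "holder0 \<alpha> (ball c' r') (\<lambda>x. a *\<^sub>R (Tpot s b \<psi> x + k *\<^sub>R Gpot s b h x))"
proof (rule Tpot_estimates[OF s \<psi>m \<psi>i b, of "norm c' + \<bar>r'\<bar>"])
  fix K :: real and D :: "'a \<Rightarrow> 'a \<Rightarrow> complex"
  assume K: "0 < K" "\<And>x x'. norm x \<le> norm c' + \<bar>r'\<bar> \<Longrightarrow> norm x' \<le> norm c' + \<bar>r'\<bar> \<Longrightarrow> norm (Tpot s b \<psi> x - Tpot s b \<psi> x') \<le> K * dist x x'"
  let ?g = "\<lambda>x. a *\<^sub>R (Tpot s b \<psi> x + k *\<^sub>R Gpot s b h x)"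
  have T: "norm (Tpot s b \<psi> x - Tpot s b \<psi> y) \<le> K * dist x y" if "x \<in> ball c' r'" "y \<in> ball c' r'" for x y
    using that by (intro K(2) ball_norm_le)
  show ?thesis
  proof (cases "\<alpha> < 1")
    case True
    show ?thesis
    proof (rule Gpot_holder[OF s(1) \<alpha> h hm b True])
      fix L :: real assume L: "0 < L" "\<And>x x'. norm (Gpot s b h x - Gpot s b h x') \<le> L * dist x x' powr \<alpha>"
      define c where "c = \<bar>a\<bar> * (K * (2 * \<bar>r'\<bar>) powr (1 - \<alpha>) + \<bar>k\<bar> * L)"
      have "norm (?g x - ?g y) \<le> c * dist x y powr \<alpha>" if xy: "x \<in> ball c' r'" "y \<in> ball c' r'" for x y
      proof -
        have "norm (?g x - ?g y) \<le> \<bar>a\<bar> * (norm (Tpot s b \<psi> x - Tpot s b \<psi> y) + \<bar>k\<bar> * norm (Gpot s b h x - Gpot s b h y))" by (rule comb_diff)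
        also have "\<dots> \<le> \<bar>a\<bar> * (K * ((2 * \<bar>r'\<bar>) powr (1 - \<alpha>) * dist x y powr \<alpha>) + \<bar>k\<bar> * (L * dist x y powr \<alpha>))"
          using K(1) \<alpha>1 by (intro mult_left_mono add_mono order_trans[OF T[OF xy]] L(2) powr_lipschitz ball_dist_le[OF xy]) auto
        also have "\<dots> = c * dist x y powr \<alpha>" by (simp add: c_def algebra_simps)
        finally show ?thesis .
      qed
      then show ?thesis using True unfolding holder0_def by (auto intro!: exI[of _ c])
    qed
  next
    case False
    then have \<alpha>e: "\<alpha> = 1" using \<alpha>1 by simp
    show ?thesis
    proof (rule Gpot_log[OF s(1) \<alpha> h hm b \<alpha>e])
      fix L :: real assume L: "0 < L" "\<And>x x'. dist x x' \<le> 1 \<Longrightarrow> norm (Gpot s b h x - Gpot s b h x') \<le> L * (dist x x' * (1 + ln (1 / dist x x')))"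
      define c where "c = \<bar>a\<bar> * (K / ln 2 + \<bar>k\<bar> * (L * (1 / ln 2 + 1)))"
      have "norm (?g x - ?g y) \<le> c * dist x y * ln (inverse (dist x y))" if xy: "x \<in> ball c' r'" "y \<in> ball c' r'" and d: "dist x y \<le> 1/2" for x y
      proof (cases "x = y")
        case False
        let ?d = "dist x y" and ?l = "ln (inverse (dist x y))"
        have d0: "0 < ?d" using False by simp
        have "2 \<le> inverse ?d" using d d0 le_imp_inverse_le[OF d] by simp
        \<comment> \<open>At distance at most 1/2 the logarithm is at least ln 2. It can therefore
          absorb both the Lipschitz bound of the smooth part and the summand 1 in the bound of the
          potential.\<close>
        then have l: "ln 2 \<le> ?l" using d0 by simp
        have l2: "1 \<le> ?l / ln 2" using l by (simp add: le_divide_eq)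
        have "norm (?g x - ?g y) \<le> \<bar>a\<bar> * (norm (Tpot s b \<psi> x - Tpot s b \<psi> y) + \<bar>k\<bar> * norm (Gpot s b h x - Gpot s b h y))" by (rule comb_diff)
        also have "\<dots> \<le> \<bar>a\<bar> * (K * (?d * (?l / ln 2)) + \<bar>k\<bar> * (L * (?d * (?l / ln 2 + ?l))))"
        proof (intro mult_left_mono add_mono)
          have "K * ?d * 1 \<le> K * ?d * (?l / ln 2)" using K(1) by (intro mult_left_mono l2) auto
          then show "norm (Tpot s b \<psi> x - Tpot s b \<psi> y) \<le> K * (?d * (?l / ln 2))" using T[OF xy] by (simp only: mult.assoc mult_1_right)
          have "1 + ln (1 / ?d) \<le> ?l / ln 2 + ?l" using l2 by (simp add: inverse_eq_divide)
          then have "L * (?d * (1 + ln (1 / ?d))) \<le> L * (?d * (?l / ln 2 + ?l))" using L(1) by (intro mult_left_mono) auto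
          then show "norm (Gpot s b h x - Gpot s b h y) \<le> L * (?d * (?l / ln 2 + ?l))" using L(2)[of x y] d by linarith
        qed auto
        also have "\<dots> = c * ?d * ?l" by (simp add: c_def algebra_simps)
        finally show ?thesis .
      qed simp
      then show ?thesis using False unfolding holder0_def by (auto intro!: exI[of _ c])
    qed
  qed
qed

lemma potential_holder1:
  assumes \<alpha>1: "1 < \<alpha>" "\<alpha> < 2"
  shows "holder1 (\<alpha> - 1) (ball c' r') (\<lambda>x. a *\<^sub>R (Tpot s b \<psi> x + k *\<^sub>R Gpot s b h x))"
proof (rule Tpot_estimates[OF s \<psi>m \<psi>i b, of "norm c' + \<bar>r'\<bar>"], rule DGpot_estimates[OF s(1) \<alpha> h hm b \<alpha>1])
  fix K L :: real and D :: "'a \<Rightarrow> 'a \<Rightarrow> complex"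
  assume K: "0 < K" "\<And>x w. norm x \<le> norm c' + \<bar>r'\<bar> \<Longrightarrow> norm w \<le> b \<Longrightarrow> norm (Tpot s b \<psi> (x + w) - Tpot s b \<psi> x - D w x) \<le> K * (norm w)\<^sup>2"
    "\<And>x x' w. norm x \<le> norm c' + \<bar>r'\<bar> \<Longrightarrow> norm x' \<le> norm c' + \<bar>r'\<bar> \<Longrightarrow> norm (D w x - D w x') \<le> K * norm w * dist x x'"
    "\<And>x. norm x \<le> norm c' + \<bar>r'\<bar> \<Longrightarrow> linear (\<lambda>w. D w x)"
    and L: "0 < L" "\<And>x w. norm (Gpot s b h (x + w) - Gpot s b h x - DGpot s b h w x) \<le> L * norm w powr \<alpha>"
    "\<And>x x' w. norm (DGpot s b h w x - DGpot s b h w x') \<le> L * norm w * dist x x' powr (\<alpha> - 1)"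
  let ?g = "\<lambda>x. a *\<^sub>R (Tpot s b \<psi> x + k *\<^sub>R Gpot s b h x)"
  let ?D = "\<lambda>x w. a *\<^sub>R (D w x + k *\<^sub>R DGpot s b h w x)"
  have hold: "holder0 (\<alpha> - 1) (ball c' r') (\<lambda>x. ?D x i)" if i: "i \<in> Basis" for i
  proof -
    define c where "c = \<bar>a\<bar> * (K * (2 * \<bar>r'\<bar>) powr (1 - (\<alpha> - 1)) + \<bar>k\<bar> * L)"
    have "norm (?D x i - ?D y i) \<le> c * dist x y powr (\<alpha> - 1)" if xy: "x \<in> ball c' r'" "y \<in> ball c' r'" for x y
    proof -
      have "norm (?D x i - ?D y i) \<le> \<bar>a\<bar> * (norm (D i x - D i y) + \<bar>k\<bar> * norm (DGpot s b h i x - DGpot s b h i y))" by (rule comb_diff)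
      also have "\<dots> \<le> \<bar>a\<bar> * (K * ((2 * \<bar>r'\<bar>) powr (1 - (\<alpha> - 1)) * dist x y powr (\<alpha> - 1)) + \<bar>k\<bar> * (L * dist x y powr (\<alpha> - 1)))"
      proof (intro mult_left_mono add_mono)
        have "norm (D i x - D i y) \<le> K * dist x y" using K(3)[OF ball_norm_le[OF xy(1)] ball_norm_le[OF xy(2)], of i] i by simp
        also have "\<dots> \<le> K * ((2 * \<bar>r'\<bar>) powr (1 - (\<alpha> - 1)) * dist x y powr (\<alpha> - 1))"
          using K(1) \<alpha>1 by (intro mult_left_mono powr_lipschitz ball_dist_le[OF xy]) auto
        finally show "norm (D i x - D i y) \<le> K * ((2 * \<bar>r'\<bar>) powr (1 - (\<alpha> - 1)) * dist x y powr (\<alpha> - 1))" .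
        show "norm (DGpot s b h i x - DGpot s b h i y) \<le> L * dist x y powr (\<alpha> - 1)" using L(3)[of i x y] i by simp
      qed auto
      also have "\<dots> = c * dist x y powr (\<alpha> - 1)" by (simp add: c_def algebra_simps)
      finally show ?thesis .
    qed
    then show ?thesis using \<alpha>1 unfolding holder0_def by (auto intro!: exI[of _ c])
  qed
  have deriv: "(?g has_derivative ?D x) (at x)" if x: "x \<in> ball c' r'" for x
    unfolding has_derivative_at
  proof
    have lin: "linear (?D x)"
    proof -
      note l = K(4)[OF ball_norm_le[OF x]] DGpot_linear[OF s(1) \<alpha> h hm b \<alpha>1(1), of x]
      show ?thesis
        by (intro linearI)
          (simp_all add: linear_add[OF l(1)] linear_add[OF l(2)] linear_scale[OF l(1)] linear_scale[OF l(2)] algebra_simps)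
    qed
    then show "bounded_linear (?D x)" by (simp add: linear_conv_bounded_linear)
    show "((\<lambda>w. norm (?g (x + w) - ?g x - ?D x w) / norm w) \<longlongrightarrow> 0) (at 0)"
    proof (rule Lim_null_comparison)
      have "eventually (\<lambda>w. w \<in> ball (0::'a) b) (at 0)" using b by (intro eventually_at_in_open') auto
      moreover have "eventually (\<lambda>w. w \<noteq> (0::'a)) (at 0)" by (simp add: eventually_at_filter)
      ultimately show "\<forall>\<^sub>F w in at 0. norm (norm (?g (x + w) - ?g x - ?D x w) / norm w) \<le> \<bar>a\<bar> * (K * norm w + \<bar>k\<bar> * (L * norm w powr (\<alpha> - 1)))"
      proof eventually_elim
        case (elim w)
        \<comment> \<open>The remainder splits into a quadratic part from the smooth convolution and
          a part of order \<alpha> > 1 from the potential; divided by |w| both tend to 0.\<close>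
        have "?g (x + w) - ?g x - ?D x w = a *\<^sub>R ((Tpot s b \<psi> (x + w) - Tpot s b \<psi> x - D w x) + k *\<^sub>R (Gpot s b h (x + w) - Gpot s b h x - DGpot s b h w x))"
          by (simp add: algebra_simps)
        then have "norm (?g (x + w) - ?g x - ?D x w) = \<bar>a\<bar> * norm ((Tpot s b \<psi> (x + w) - Tpot s b \<psi> x - D w x) + k *\<^sub>R (Gpot s b h (x + w) - Gpot s b h x - DGpot s b h w x))" by simp
        also have "\<dots> \<le> \<bar>a\<bar> * (norm (Tpot s b \<psi> (x + w) - Tpot s b \<psi> x - D w x) + norm (k *\<^sub>R (Gpot s b h (x + w) - Gpot s b h x - DGpot s b h w x)))"
          by (intro mult_left_mono norm_triangle_ineq) simp
        also have "\<dots> \<le> \<bar>a\<bar> * (K * (norm w)\<^sup>2 + \<bar>k\<bar> * (L * norm w powr \<alpha>))"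
          unfolding norm_scaleR using elim by (intro mult_left_mono add_mono K(2) L(2) ball_norm_le[OF x]) auto
        also have "norm w powr \<alpha> = norm w powr (\<alpha> - 1) * norm w" using powr_add[of "norm w" "\<alpha> - 1" 1] elim by simp
        also have "\<bar>a\<bar> * (K * (norm w)\<^sup>2 + \<bar>k\<bar> * (L * (norm w powr (\<alpha> - 1) * norm w))) = \<bar>a\<bar> * (K * norm w + \<bar>k\<bar> * (L * norm w powr (\<alpha> - 1))) * norm w"
          by (simp add: algebra_simps power2_eq_square)
        finally show ?case using elim by (simp add: divide_le_eq)
      qed
      have n0: "((\<lambda>w::'a. norm w) \<longlongrightarrow> 0) (at 0)" by (rule tendsto_norm_zero) (rule tendsto_ident_at)
      then have "((\<lambda>w::'a. norm w powr (\<alpha> - 1)) \<longlongrightarrow> 0) (at 0)" using \<alpha>1 by (intro tendsto_zero_powrI[where b="\<alpha> - 1"]) auto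
      with n0 have "((\<lambda>w::'a. \<bar>a\<bar> * (K * norm w + \<bar>k\<bar> * (L * norm w powr (\<alpha> - 1)))) \<longlongrightarrow> \<bar>a\<bar> * (K * 0 + \<bar>k\<bar> * (L * 0))) (at 0)"
        by (intro tendsto_intros)
      then show "((\<lambda>w::'a. \<bar>a\<bar> * (K * norm w + \<bar>k\<bar> * (L * norm w powr (\<alpha> - 1)))) \<longlongrightarrow> 0) (at 0)" by simp
    qed
  qed
  show ?thesis
    unfolding holder1_def
  proof (intro exI conjI ballI)
    show "(?g has_derivative ?D x) (at x)" if "x \<in> ball c' r'" for x using that by (rule deriv)
    fix i :: 'a assume i: "i \<in> Basis"
    show "holder0 (\<alpha> - 1) (ball c' r') (\<lambda>x. ?D x i)" by (rule hold[OF i])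
    then show "continuous_on (ball c' r') (\<lambda>x. ?D x i)" using \<alpha>1 by (intro holder0_continuous) auto
  qed
qed

end

subsection \<open>Local regularity of solutions\<close>

lemma holder0_cong: "(\<And>x. x \<in> U \<Longrightarrow> g x = g' x) \<Longrightarrow> holder0 \<beta> U g = holder0 \<beta> U g'"
  unfolding holder0_def by simp

lemma holder1_cong:
  assumes U: "open U" and eq: "\<And>x. x \<in> U \<Longrightarrow> g x = g' x" and g: "holder1 \<beta> U g" shows "holder1 \<beta> U g'"
proof -
  obtain D where D: "\<forall>x\<in>U. (g has_derivative D x) (at x)" "\<forall>i\<in>Basis. continuous_on U (\<lambda>x. D x i) \<and> holder0 \<beta> U (\<lambda>x. D x i)"
    using g unfolding holder1_def by blast
  have "\<forall>x\<in>U. (g' has_derivative D x) (at x)"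
  proof
    fix x assume x: "x \<in> U"
    show "(g' has_derivative D x) (at x)" by (rule has_derivative_transform_within_open[OF bspec[OF D(1) x] U x eq])
  qed
  with D(2) show ?thesis unfolding holder1_def by blast
qed

text \<open>The data are Lebesgue measurable, whereas kernels and product integrals are handled over
  \<open>lborel\<close>. Replacing the data once by Borel representatives keeps the completion out
  of all later arguments.\<close>

lemma lebesgue_borel_rep:
  fixes f :: "'a::euclidean_space \<Rightarrow> complex"
  assumes f: "f \<in> borel_measurable lebesgue"
  obtains g where "g \<in> borel_measurable borel" "AE x in lborel. f x = g x"
proof -
  have "(\<lambda>x. Re (f x)) \<in> borel_measurable lebesgue" "(\<lambda>x. Im (f x)) \<in> borel_measurable lebesgue" using f by measurable
  then obtain u v where u: "u \<in> borel_measurable lborel" "AE x in lborel. Re (f x) = u x"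
    and v: "v \<in> borel_measurable lborel" "AE x in lborel. Im (f x) = v x"
    using completion_ex_borel_measurable_real by metis
  show ?thesis
  proof (rule that)
    have [measurable]: "u \<in> borel_measurable borel" "v \<in> borel_measurable borel" using u v by auto
    show "(\<lambda>x. Complex (u x) (v x)) \<in> borel_measurable borel" unfolding Complex_eq by measurable
    show "AE x in lborel. f x = Complex (u x) (v x)" using u(2) v(2) by eventually_elim (simp add: complex_eq_iff)
  qed
qed

lemma lebesgue_on_borel_rep:
  fixes f :: "'a::euclidean_space \<Rightarrow> complex"
  assumes S: "S \<in> sets borel" and f: "f \<in> borel_measurable (lebesgue_on S)"
  obtains g where "g \<in> borel_measurable borel" "AE x in lborel. x \<in> S \<longrightarrow> f x = g x"
proof -
  have "(\<lambda>x. indicator S x *\<^sub>R f x) \<in> borel_measurable lebesgue"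
    using f S by (subst borel_measurable_restrict_space_iff[symmetric]) auto
  then obtain g where g: "g \<in> borel_measurable borel" "AE x in lborel. indicator S x *\<^sub>R f x = g x" by (rule lebesgue_borel_rep)
  from g(2) have "AE x in lborel. x \<in> S \<longrightarrow> f x = g x" by eventually_elim (auto simp: indicator_def)
  with g(1) show ?thesis by (rule that)
qed

lemma integrable_lebesgue_on_rep:
  fixes f g :: "'a::euclidean_space \<Rightarrow> 'b::{banach, second_countable_topology}"
  assumes S: "S \<in> sets borel" and f: "integrable (lebesgue_on S) f" and g [measurable]: "g \<in> borel_measurable borel"
    and eq: "AE x in lborel. x \<in> S \<longrightarrow> f x = g x"
  shows "integrable lborel (\<lambda>x. indicator S x *\<^sub>R g x)"
proof -
  note [measurable] = S
  have i: "integrable lebesgue (\<lambda>x. indicator S x *\<^sub>R f x)" using f S by (subst integrable_restrict_space[symmetric]) auto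
  have m: "(\<lambda>x. indicator S x *\<^sub>R g x) \<in> borel_measurable lborel" by measurable
  have "AE x in lebesgue. indicator S x *\<^sub>R f x = indicator S x *\<^sub>R g x"
    unfolding AE_completion_iff using eq by eventually_elim (auto simp: indicator_def)
  then have "integrable lebesgue (\<lambda>x. indicator S x *\<^sub>R g x)"
    using i m measurable_completion[OF m] by (subst integrable_cong_AE[symmetric]) auto
  then show ?thesis using integrable_completion[OF m] by simp
qed

lemma morrey_dominated:
  fixes u1 u2 v :: "'a::euclidean_space \<Rightarrow> real"
  assumes u: "morrey s \<alpha> C1 u1" "morrey s \<alpha> C2 u2" and a: "0 \<le> a" and [measurable]: "v \<in> borel_measurable borel"
    and v: "\<And>x. 0 \<le> v x" "\<And>x. v x \<le> u1 x + a * u2 x"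
  shows "morrey s \<alpha> (C1 + a * C2) v"
  unfolding morrey_def
proof (intro conjI allI impI)
  note D1 = morreyD[OF u(1)] and D2 = morreyD[OF u(2)]
  note [measurable] = D1(4) D2(4)
  show "0 < C1 + a * C2" using D1(1) D2(1) a by (intro add_pos_nonneg) auto
  have i: "integrable lborel (\<lambda>x. u1 x + a * u2 x)" using D1(2) D2(2) by (intro Bochner_Integration.integrable_add integrable_mult_right)
  show vi: "integrable lborel v" by (rule integral_dominated(1)[OF i]) (measurable, use v in auto)
  show "0 \<le> v x" for x by (rule v)
  fix x :: 'a and t :: real assume t: "0 < t" "t \<le> 1"
  have ib: "integrable lborel (\<lambda>y. indicator (ball x t) y * w y)" if "integrable lborel w" for w :: "'a \<Rightarrow> real"
    using integrable_mult_indicator[OF _ that, of "ball x t"] by simp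
  let ?T = "t powr (real DIM('a) - 2 * s + \<alpha>)"
  have "(LBINT y. indicator (ball x t) y * v y) \<le> (LBINT y. indicator (ball x t) y * u1 y + a * (indicator (ball x t) y * u2 y))"
  proof (rule integral_mono)
    show "indicator (ball x t) y * v y \<le> indicator (ball x t) y * u1 y + a * (indicator (ball x t) y * u2 y)" for y
      using v(2)[of y] by (auto simp: indicator_def)
  qed (intro ib vi Bochner_Integration.integrable_add integrable_mult_right D1(2) D2(2))+
  also have "\<dots> = (LBINT y. indicator (ball x t) y * u1 y) + a * (LBINT y. indicator (ball x t) y * u2 y)"
    by (subst Bochner_Integration.integral_add) (intro ib integrable_mult_right D1(2) D2(2), intro ib integrable_mult_right D1(2) D2(2), simp only: integral_mult_right_zero)
  also have "\<dots> \<le> C1 * ?T + a * (C2 * ?T)" using u t a unfolding morrey_def by (intro add_mono mult_left_mono) auto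
  also have "\<dots> = (C1 + a * C2) * ?T" by (simp add: algebra_simps)
  finally show "(LBINT y. indicator (ball x t) y * v y) \<le> (C1 + a * C2) * ?T" .
qed

lemma ball_indicator_integral:
  fixes x :: "'a::euclidean_space"
  assumes "0 \<le> t"
  shows "integrable lborel (indicator (ball x t) :: 'a \<Rightarrow> real)"
    "(LBINT y. indicator (ball x t) y :: real) = measure lborel (ball (0::'a) 1) * t powr real DIM('a)"
proof -
  show "integrable lborel (indicator (ball x t) :: 'a \<Rightarrow> real)"
    using emeasure_lborel_ball_finite[of x t] by (intro integrable_real_indicator) auto
  have "(LBINT y. indicator (ball x t) y :: real) = measure lborel (ball x t)" by simp
  also have "\<dots> = measure lborel (ball (0::'a) 1) * t powr real DIM('a)"
    using content_ball_conv_unit_ball[OF assms, of x] assms by (simp add: powr_realpow' mult.commute)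
  finally show "(LBINT y. indicator (ball x t) y :: real) = measure lborel (ball (0::'a) 1) * t powr real DIM('a)" .
qed

text \<open>Young's inequality in the form \<open>a \<le> \<lambda>\<^sup>1\<^sup>-\<^sup>q a\<^sup>q + \<lambda>\<close> with \<open>\<lambda> = t powr (- N / q)\<close> replaces Hoelder's inequality on balls of radius \<open>t\<close>.\<close>
lemma Lp_on_morrey:
  fixes f f0 :: "'a::euclidean_space \<Rightarrow> complex"
  assumes p: "1 < p" and f: "Lp_on p (ball c r) f" and f0 [measurable]: "f0 \<in> borel_measurable borel"
    and eq: "AE x in lborel. x \<in> ball c r \<longrightarrow> f x = f0 x" and r: "0 < r"
    and \<alpha>: "\<alpha> = real_of_ereal (ereal (2 * s) - ereal (real DIM('a)) / p)"
  obtains C u where "morrey s \<alpha> C u" "AE x in lborel. u x = indicator (ball c r) x * norm (f0 x)"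
proof -
  let ?n = "real DIM('a)"
  define \<omega> where "\<omega> = measure lborel (ball (0::'a) 1)"
  have \<omega>: "0 \<le> \<omega>" by (simp add: \<omega>_def)
  have [measurable]: "ball c r \<in> sets borel" by simp
  show ?thesis
  proof (cases "p = \<infinity>")
    case True
    then obtain M where M: "AE x in lebesgue_on (ball c r). norm (f x) \<le> M" using f unfolding Lp_on_def by auto
    then have "AE x in lborel. x \<in> ball c r \<longrightarrow> norm (f x) \<le> M" by (subst (asm) AE_restrict_space_iff) (auto simp: AE_completion_iff)
    with eq have M': "AE x in lborel. x \<in> ball c r \<longrightarrow> norm (f0 x) \<le> \<bar>M\<bar>" by eventually_elim auto
    \<comment> \<open>Truncation at the essential bound turns it into a pointwise one and changes
      the function only on a null set.\<close>
    define u where "u x = indicator (ball c r) x * min \<bar>M\<bar> (norm (f0 x))" for x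
    have \<alpha>e: "\<alpha> = 2 * s" using True \<alpha> by simp
    show ?thesis
    proof (rule that)
      show "AE x in lborel. u x = indicator (ball c r) x * norm (f0 x)" using M' by eventually_elim (auto simp: u_def indicator_def)
      have [measurable]: "u \<in> borel_measurable borel" unfolding u_def[abs_def] by measurable
      have u0: "0 \<le> u x" for x by (simp add: u_def)
      have ule: "u x \<le> \<bar>M\<bar> * indicator (ball c r) x" for x by (simp add: u_def indicator_def)
      have uM: "u x \<le> \<bar>M\<bar>" for x by (simp add: u_def indicator_def)
      show "morrey s \<alpha> (\<bar>M\<bar> * \<omega> + 1) u"
        unfolding morrey_def
      proof (intro conjI allI impI)
        show "0 < \<bar>M\<bar> * \<omega> + 1" using \<omega> by (intro add_nonneg_pos) auto
        show ui: "integrable lborel u"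
          by (rule integral_dominated(1)[OF integrable_mult_right[OF ball_indicator_integral(1)[OF less_imp_le[OF r], of c], of "\<bar>M\<bar>"]])
            (measurable, use u0 ule in auto)
        show "0 \<le> u x" for x by (rule u0)
        fix x :: 'a and t :: real assume t: "0 < t" "t \<le> 1"
        have "(LBINT y. indicator (ball x t) y * u y) \<le> (LBINT y. \<bar>M\<bar> * indicator (ball x t) y)"
        proof (rule integral_mono)
          show "integrable lborel (\<lambda>y. indicator (ball x t) y * u y)" using integrable_mult_indicator[OF _ ui, of "ball x t"] by simp
          show "integrable lborel (\<lambda>y. \<bar>M\<bar> * indicator (ball x t) y)" using t by (intro integrable_mult_right ball_indicator_integral) auto
          show "indicator (ball x t) y * u y \<le> \<bar>M\<bar> * indicator (ball x t) y" for y using uM by (simp add: indicator_def)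
        qed
        also have "\<dots> = \<bar>M\<bar> * (\<omega> * t powr ?n)" using t unfolding \<omega>_def by (simp only: integral_mult_right_zero ball_indicator_integral)
        also have "\<dots> \<le> (\<bar>M\<bar> * \<omega> + 1) * t powr (?n - 2 * s + \<alpha>)" by (simp add: \<alpha>e algebra_simps)
        finally show "(LBINT y. indicator (ball x t) y * u y) \<le> (\<bar>M\<bar> * \<omega> + 1) * t powr (?n - 2 * s + \<alpha>)" .
      qed
    qed
  next
    case False
    then obtain q where pq: "p = ereal q" using p by (cases p) auto
    have q: "1 < q" using p by (simp add: pq)
    have \<alpha>e: "\<alpha> = 2 * s - ?n / q" using q \<alpha> by (simp add: pq)
    have i: "integrable (lebesgue_on (ball c r)) (\<lambda>x. norm (f x) powr q)" using f unfolding Lp_on_def pq by simp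
    define u where "u x = indicator (ball c r) x * norm (f0 x)" for x
    have [measurable]: "u \<in> borel_measurable borel" unfolding u_def[abs_def] by measurable
    have u0: "0 \<le> u x" for x by (simp add: u_def)
    have iq: "integrable lborel (\<lambda>x. u x powr q)"
    proof -
      have "integrable lborel (\<lambda>x. indicator (ball c r) x *\<^sub>R (norm (f0 x) powr q))"
        by (rule integrable_lebesgue_on_rep[OF _ i]) (measurable, use eq in \<open>auto elim!: eventually_mono\<close>)
      moreover have "(\<lambda>x. indicator (ball c r) x *\<^sub>R (norm (f0 x) powr q)) = (\<lambda>x. u x powr q)"
        using q by (auto simp: u_def indicator_def)
      ultimately show ?thesis by simp
    qed
    define I where "I = (LBINT x. u x powr q)"
    have I0: "0 \<le> I" unfolding I_def by (intro integral_nonneg_AE AE_I2) simp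
    have young: "a \<le> l powr (1 - q) * a powr q + l" if "0 \<le> a" "0 < l" for a l :: real
    proof (cases "a \<le> l")
      case False
      then have "1 \<le> (a / l) powr (q - 1)" using q that by (intro ge_one_powr_ge_zero) auto
      then have "a * 1 \<le> a * (a / l) powr (q - 1)" using that by (intro mult_left_mono) auto
      also have "\<dots> = l powr (1 - q) * a powr q"
      proof -
        have "(a / l) powr (q - 1) = a powr (q - 1) / l powr (q - 1)" by (rule powr_divide)
        then show ?thesis using that False powr_add[of a 1 "q - 1"] powr_minus[of l "q - 1"] by (simp add: divide_inverse)
      qed
      finally show ?thesis using that by simp
    qed (use that in \<open>simp add: add_increasing\<close>)
    show ?thesis
    proof (rule that)
      show "AE x in lborel. u x = indicator (ball c r) x * norm (f0 x)" by (simp add: u_def)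
      show "morrey s \<alpha> (I + \<omega> + 1) u"
        unfolding morrey_def
      proof (intro conjI allI impI)
        show "0 < I + \<omega> + 1" using \<omega> I0 by simp
        have g: "integrable lborel (\<lambda>x. u x powr q + indicator (ball c r) x)"
          using r by (intro Bochner_Integration.integrable_add iq ball_indicator_integral) auto
        have "u x \<le> u x powr q + indicator (ball c r) x" for x
        proof (cases "x \<in> ball c r")
          case True then show ?thesis using young[OF u0[of x], of 1] by simp
        qed (simp add: u_def)
        then show ui: "integrable lborel u" by (intro integral_dominated(1)[OF g]) (measurable, use u0 in auto)
        show "0 \<le> u x" for x by (rule u0)
        fix x :: 'a and t :: real assume t: "0 < t" "t \<le> 1"
        define l where "l = t powr (- ?n / q)"
        have l: "0 < l" using t by (simp add: l_def)
        \<comment> \<open>With this l both terms of Young's inequality scale alike, as t^(N - N/q),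
          and N - N/q is the Morrey exponent for \<alpha> = 2s - N/q.\<close>
        have e1: "l powr (1 - q) = t powr (?n - 2 * s + \<alpha>)"
          unfolding l_def powr_powr using q by (intro arg_cong[where f="\<lambda>e. t powr e"]) (simp add: \<alpha>e field_simps)
        have e2: "l * t powr ?n = t powr (?n - 2 * s + \<alpha>)"
          unfolding l_def powr_add[symmetric] using q by (intro arg_cong[where f="\<lambda>e. t powr e"]) (simp add: \<alpha>e field_simps)
        have "(LBINT y. indicator (ball x t) y * u y) \<le> (LBINT y. l powr (1 - q) * u y powr q + l * indicator (ball x t) y)"
        proof (rule integral_mono)
          show "integrable lborel (\<lambda>y. indicator (ball x t) y * u y)" using integrable_mult_indicator[OF _ ui, of "ball x t"] by simp
          show "integrable lborel (\<lambda>y. l powr (1 - q) * u y powr q + l * indicator (ball x t) y)"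
            using t by (intro Bochner_Integration.integrable_add integrable_mult_right iq ball_indicator_integral) auto
          show "indicator (ball x t) y * u y \<le> l powr (1 - q) * u y powr q + l * indicator (ball x t) y" for y
            using young[OF u0[of y] l] l by (auto simp: indicator_def)
        qed
        also have "\<dots> = (LBINT y. l powr (1 - q) * u y powr q) + (LBINT y. l * indicator (ball x t) y)"
          using t by (intro Bochner_Integration.integral_add integrable_mult_right iq ball_indicator_integral) auto
        also have "\<dots> = l powr (1 - q) * I + l * (\<omega> * t powr ?n)"
          unfolding integral_mult_right_zero I_def \<omega>_def ball_indicator_integral(2)[OF less_imp_le[OF t(1)]] ..
        also have "\<dots> = (I + \<omega>) * t powr (?n - 2 * s + \<alpha>)"
          using e2 unfolding e1 by (simp add: algebra_simps)
        also have "\<dots> \<le> (I + \<omega> + 1) * t powr (?n - 2 * s + \<alpha>)" by (intro mult_right_mono) auto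
        finally show "(LBINT y. indicator (ball x t) y * u y) \<le> (I + \<omega> + 1) * t powr (?n - 2 * s + \<alpha>)" .
      qed
    qed
  qed
qed

lemma L1_loc_ball:
  assumes f: "L1_loc \<Omega> f" and B: "cball c r \<subseteq> \<Omega>" shows "integrable (lebesgue_on (ball c r)) f"
proof -
  have "integrable (lebesgue_on (cball c r)) f" using f B unfolding L1_loc_def by auto
  then have "integrable lebesgue (\<lambda>x. indicator (cball c r) x *\<^sub>R f x)" using integrable_restrict_space[of "cball c r" lebesgue f] by auto
  then have "integrable lebesgue (\<lambda>x. indicator (ball c r) x *\<^sub>R (indicator (cball c r) x *\<^sub>R f x))"
    by (rule integrable_mult_indicator[rotated]) simp
  moreover have "(\<lambda>x. indicator (ball c r) x *\<^sub>R (indicator (cball c r) x *\<^sub>R f x)) = (\<lambda>x. indicator (ball c r) x *\<^sub>R f x)"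
    by (auto simp: indicator_def)
  ultimately show ?thesis using integrable_restrict_space[of "ball c r" lebesgue f] by auto
qed

lemma lebesgue_integral_rep:
  fixes f g :: "'a::euclidean_space \<Rightarrow> 'b::{banach, second_countable_topology}"
  assumes f: "f \<in> borel_measurable lebesgue" and g: "g \<in> borel_measurable borel" and eq: "AE x in lborel. f x = g x"
  shows "integral\<^sup>L lebesgue f = integral\<^sup>L lborel g"
proof -
  have g': "g \<in> borel_measurable lborel" using g by simp
  have "integral\<^sup>L lebesgue f = integral\<^sup>L lebesgue g"
    using f measurable_completion[OF g'] eq by (intro integral_cong_AE) (auto simp: AE_completion_iff)
  also have "\<dots> = integral\<^sup>L lborel g" by (rule integral_completion[OF g'])
  finally show ?thesis .
qed

text \<open>The distributional equation becomes one for Borel representatives, tested against bumps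
  at scale t. Scaling yields t^(-2s), and \<open>symb_const\<close> converts between
  \<open>frac_lap\<close> and \<open>fL\<close>. The right side may be cut off to the ball because
  the bump lives there, whereas \<open>\<psi>\<close> is kept on the whole space on account of the
  nonlocal operator.\<close>

lemma local_equation:
  fixes \<psi> \<psi>0 V V0 f f0 :: "'a::euclidean_space \<Rightarrow> complex"
  assumes s: "0 < s" "s < 1" and sol: "distr_solution s \<Omega> V f \<psi>" and B: "cball c r \<subseteq> \<Omega>"
    and \<psi>0 [measurable]: "\<psi>0 \<in> borel_measurable borel" and \<psi>e: "AE x in lborel. \<psi> x = \<psi>0 x"
    and f0 [measurable]: "f0 \<in> borel_measurable borel" and fe: "AE x in lborel. x \<in> ball c r \<longrightarrow> f x = f0 x"
    and V0 [measurable]: "V0 \<in> borel_measurable borel" and Ve: "AE x in lborel. x \<in> ball c r \<longrightarrow> V x = V0 x"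
  defines "h \<equiv> \<lambda>y. indicator (ball c r) y *\<^sub>R (f0 y - V0 y * \<psi>0 y)"
  shows "integrable lborel h" "integrable lborel (\<lambda>y. jw s y *\<^sub>R \<psi>0 y)"
    "integrable lborel (\<lambda>y. indicator (ball c r) y * norm (V0 y) * norm (\<psi>0 y))"
    "\<And>x t. 0 < t \<Longrightarrow> cball x t \<subseteq> ball c r \<Longrightarrow>
      (LBINT y. theta s ((x - y) /\<^sub>R t) *\<^sub>R \<psi>0 y) = (symb_const TYPE('a) s * t powr (2 * s)) *\<^sub>R (LBINT y. eta ((x - y) /\<^sub>R t) *\<^sub>R h y)"
proof -
  let ?B = "ball c r"
  have [measurable]: "?B \<in> sets borel" by simp
  note S = sol[unfolded distr_solution_def]
  have Sf: "L1_loc \<Omega> f" and S\<psi>: "\<psi> \<in> borel_measurable lebesgue"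
    and Sn: "(\<integral>\<^sup>+ x. ennreal (japanese x powr (- real DIM('a) - 2 * s) * norm (\<psi> x)) \<partial>lebesgue) < \<infinity>"
    and SV: "L1_loc \<Omega> (\<lambda>x. V x * \<psi> x)" using S by simp_all
  define w0 where "w0 y = V0 y * \<psi>0 y" for y
  have w0m [measurable]: "w0 \<in> borel_measurable borel" unfolding w0_def[abs_def] by measurable
  have we: "AE x in lborel. x \<in> ?B \<longrightarrow> V x * \<psi> x = w0 x" using \<psi>e Ve by eventually_elim (auto simp: w0_def)
  have fi: "integrable (lebesgue_on ?B) f" and wi: "integrable (lebesgue_on ?B) (\<lambda>x. V x * \<psi> x)"
    by (rule L1_loc_ball[OF Sf B], rule L1_loc_ball[OF SV B])
  have Fi: "integrable lborel (\<lambda>x. indicator ?B x *\<^sub>R f0 x)" by (rule integrable_lebesgue_on_rep[OF _ fi f0 fe]) simp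
  have Gi: "integrable lborel (\<lambda>x. indicator ?B x *\<^sub>R w0 x)" by (rule integrable_lebesgue_on_rep[OF _ wi w0m we]) simp
  have he: "h = (\<lambda>y. indicator ?B y *\<^sub>R f0 y - indicator ?B y *\<^sub>R w0 y)" by (simp add: h_def w0_def scaleR_diff_right)
  show "integrable lborel h" unfolding he by (rule Bochner_Integration.integrable_diff[OF Fi Gi])
  show "integrable lborel (\<lambda>y. indicator ?B y * norm (V0 y) * norm (\<psi>0 y))"
    using integrable_norm[OF Gi] by (simp add: w0_def norm_mult mult.assoc)
  show "integrable lborel (\<lambda>y. jw s y *\<^sub>R \<psi>0 y)"
  proof (rule integrableI_bounded)
    have "(\<integral>\<^sup>+ x. ennreal (norm (jw s x *\<^sub>R \<psi>0 x)) \<partial>lborel) = (\<integral>\<^sup>+ x. ennreal (japanese x powr (- real DIM('a) - 2 * s) * norm (\<psi> x)) \<partial>lborel)"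
      by (intro nn_integral_cong_AE) (use \<psi>e in \<open>eventually_elim, simp add: jw_def\<close>)
    also have "\<dots> < \<infinity>" using Sn by (simp add: nn_integral_completion)
    finally show "(\<integral>\<^sup>+ x. ennreal (norm (jw s x *\<^sub>R \<psi>0 x)) \<partial>lborel) < \<infinity>" .
  qed measurable
  fix x :: 'a and t :: real assume t: "0 < t" and sub: "cball x t \<subseteq> ?B"
  define k where "k = symb_const TYPE('a) s"
  have k: "0 < k" unfolding k_def by (rule symb_const_pos[OF s])
  define \<phi> where "\<phi> y = ceta ((x - y) /\<^sub>R t)" for y
  have \<phi>e: "\<phi> y = complex_of_real (eta ((x - y) /\<^sub>R t))" for y by (simp add: \<phi>_def ceta_def)
  have tf: "test_fun \<Omega> \<phi>" unfolding \<phi>_def[abs_def] by (rule test_fun_eta[OF t order_trans[OF sub order_trans[OF ball_subset_cball B]]])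
  have fl: "cnj (frac_lap s \<phi> y) = complex_of_real (t powr (- 2 * s) / k * theta s ((x - y) /\<^sub>R t))" for y
  proof -
    obtain R where "smc R \<phi>" using test_fun_smc[OF tf] .
    then have "frac_lap s \<phi> y = fL s \<phi> y / complex_of_real k" unfolding k_def by (rule frac_lap_eq[OF s])
    also have "fL s \<phi> y = fL s (\<lambda>z. ceta (z /\<^sub>R t)) (x - y)" unfolding \<phi>_def[abs_def] by (rule fL_reflect)
    also have "\<dots> = t powr (- 2 * s) *\<^sub>R complex_of_real (theta s ((x - y) /\<^sub>R t))" unfolding fL_ceta[symmetric]
      by (rule fL_scale[OF _ t]) (simp add: ceta_def[abs_def])
    finally show ?thesis by (simp add: scaleR_conv_of_real)
  qed
  have eq: "(LINT x|lebesgue. cnj (frac_lap s \<phi> x) * \<psi> x) + (LINT x|lebesgue. cnj (\<phi> x) * (V x * \<psi> x)) = (LINT x|lebesgue. cnj (\<phi> x) * f x)"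
    by (rule conjunct2[OF conjunct2[OF conjunct2[OF conjunct2[OF S]]], rule_format, OF tf])
  have T1: "(LINT y|lebesgue. cnj (frac_lap s \<phi> y) * \<psi> y) = (t powr (- 2 * s) / k) *\<^sub>R (LBINT y. theta s ((x - y) /\<^sub>R t) *\<^sub>R \<psi>0 y)"
  proof -
    have m: "(\<lambda>y. complex_of_real (t powr (- 2 * s) / k * theta s ((x - y) /\<^sub>R t))) \<in> borel_measurable lborel" by measurable
    have "(LINT y|lebesgue. cnj (frac_lap s \<phi> y) * \<psi> y) = (LBINT y. (t powr (- 2 * s) / k) *\<^sub>R (theta s ((x - y) /\<^sub>R t) *\<^sub>R \<psi>0 y))"
      unfolding fl
    proof (rule lebesgue_integral_rep)
      show "(\<lambda>y. complex_of_real (t powr (- 2 * s) / k * theta s ((x - y) /\<^sub>R t)) * \<psi> y) \<in> borel_measurable lebesgue"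
        by (rule borel_measurable_times[OF measurable_completion[OF m] S\<psi>])
      show "AE y in lborel. complex_of_real (t powr (- 2 * s) / k * theta s ((x - y) /\<^sub>R t)) * \<psi> y = (t powr (- 2 * s) / k) *\<^sub>R (theta s ((x - y) /\<^sub>R t) *\<^sub>R \<psi>0 y)"
        using \<psi>e by eventually_elim (simp only: scaleR_conv_of_real of_real_mult mult.assoc)
    qed measurable
    then show ?thesis by (simp only: integral_scaleR_right)
  qed
  have T2: "(LINT y|lebesgue. cnj (\<phi> y) * w y) = (LBINT y. eta ((x - y) /\<^sub>R t) *\<^sub>R (indicator ?B y *\<^sub>R w' y))"
    if w: "integrable (lebesgue_on ?B) w" and [measurable]: "w' \<in> borel_measurable borel" and e: "AE y in lborel. y \<in> ?B \<longrightarrow> w y = w' y" for w w'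
  proof -
    have z: "eta ((x - y) /\<^sub>R t) = 0" if "y \<notin> ?B" for y
    proof -
      have "y \<notin> cball x t" using that sub by blast
      then show ?thesis using t by (intro eta_scaled_zero) (auto simp: dist_norm)
    qed
    have fe: "(\<lambda>y. cnj (\<phi> y) * w y) = (\<lambda>y. complex_of_real (eta ((x - y) /\<^sub>R t)) * (indicator ?B y *\<^sub>R w y))"
    proof
      fix y show "cnj (\<phi> y) * w y = complex_of_real (eta ((x - y) /\<^sub>R t)) * (indicator ?B y *\<^sub>R w y)"
        using z[of y] by (cases "y \<in> ?B") (simp_all add: \<phi>e)
    qed
    have m: "(\<lambda>y. complex_of_real (eta ((x - y) /\<^sub>R t))) \<in> borel_measurable lborel" by measurable
    have wm: "(\<lambda>y. indicator ?B y *\<^sub>R w y) \<in> borel_measurable lebesgue"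
      using w by (subst (asm) integrable_restrict_space) auto
    show ?thesis unfolding fe
    proof (rule lebesgue_integral_rep)
      show "(\<lambda>y. complex_of_real (eta ((x - y) /\<^sub>R t)) * (indicator ?B y *\<^sub>R w y)) \<in> borel_measurable lebesgue"
        by (rule borel_measurable_times[OF measurable_completion[OF m] wm])
      show "AE y in lborel. complex_of_real (eta ((x - y) /\<^sub>R t)) * (indicator ?B y *\<^sub>R w y) = eta ((x - y) /\<^sub>R t) *\<^sub>R (indicator ?B y *\<^sub>R w' y)"
        using e by eventually_elim (auto simp: scaleR_conv_of_real indicator_def)
    qed measurable
  qed
  have ei: "integrable lborel (\<lambda>y. eta ((x - y) /\<^sub>R t) *\<^sub>R w y)" if w: "integrable lborel w" for w :: "'a \<Rightarrow> complex"
  proof (rule Bochner_Integration.integrable_bound[OF w])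
    have [measurable]: "w \<in> borel_measurable borel" using w by auto
    show "(\<lambda>y. eta ((x - y) /\<^sub>R t) *\<^sub>R w y) \<in> borel_measurable lborel" by measurable
    show "AE y in lborel. norm (eta ((x - y) /\<^sub>R t) *\<^sub>R w y) \<le> norm (w y)"
      by (intro AE_I2) (simp add: mult_left_le_one_le eta_le1)
  qed
  have sd: "eta z *\<^sub>R (a - b) = eta z *\<^sub>R a - eta z *\<^sub>R b" for z :: 'a and a b :: complex by (rule scaleR_diff_right)
  let ?Th = "LBINT y. theta s ((x - y) /\<^sub>R t) *\<^sub>R \<psi>0 y"
  have "(t powr (- 2 * s) / k) *\<^sub>R ?Th = (LBINT y. eta ((x - y) /\<^sub>R t) *\<^sub>R (indicator ?B y *\<^sub>R f0 y)) - (LBINT y. eta ((x - y) /\<^sub>R t) *\<^sub>R (indicator ?B y *\<^sub>R w0 y))"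
    using eq unfolding T1 T2[OF wi w0m we] T2[OF fi f0 fe] by (simp only: eq_diff_eq)
  also have "\<dots> = (LBINT y. eta ((x - y) /\<^sub>R t) *\<^sub>R h y)"
    unfolding he sd by (rule Bochner_Integration.integral_diff[OF ei[OF Fi] ei[OF Gi], symmetric])
  finally have fin: "(t powr (- 2 * s) / k) *\<^sub>R ?Th = (LBINT y. eta ((x - y) /\<^sub>R t) *\<^sub>R h y)" .
  have "t powr (2 * s) * t powr (- 2 * s) = 1" using t by (simp add: powr_add[symmetric])
  then have "(k * t powr (2 * s)) * (t powr (- 2 * s) / k) = 1" using k by (simp add: field_simps)
  then have "?Th = (k * t powr (2 * s)) *\<^sub>R ((t powr (- 2 * s) / k) *\<^sub>R ?Th)" by simp
  then have "?Th = (k * t powr (2 * s)) *\<^sub>R (LBINT y. eta ((x - y) /\<^sub>R t) *\<^sub>R h y)" unfolding fin .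
  then show "?Th = (symb_const TYPE('a) s * t powr (2 * s)) *\<^sub>R (LBINT y. eta ((x - y) /\<^sub>R t) *\<^sub>R h y)"
    unfolding k_def .
qed

text \<open>The representation at scale b = b0 2^(-j) is turned into the inequality for |\<psi>|
  that is iterated. The convolution term is bounded by a constant times b^(-N), which is the growth
  2^(jN) that the iteration tolerates; the data term is bounded by the Morrey condition on u; the
  rest is the potential of v |\<psi>|. The result is a bound for v |\<psi>| because the iteration
  sees \<open>\<psi>\<close> only where v is positive.\<close>

lemma drift_bound:
  fixes \<psi> h :: "'a::euclidean_space \<Rightarrow> complex"
  assumes s: "0 < s" "s < 1" and \<psi>m [measurable]: "\<psi> \<in> borel_measurable borel"
    and \<psi>i: "integrable lborel (\<lambda>y. jw s y *\<^sub>R \<psi> y)" and hi: "integrable lborel h"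
    and \<alpha>: "0 < \<alpha>" and v: "morrey s \<alpha> Cv v" and u: "morrey s \<alpha> Cu u"
    and v\<psi>: "integrable lborel (\<lambda>y. v y * norm (\<psi> y))" and hle: "AE y in lborel. norm (h y) \<le> u y + v y * norm (\<psi> y)"
    and k: "0 < k" and R1: "R1 < r"
    and E: "\<And>t x. 0 < t \<Longrightarrow> cball x t \<subseteq> ball c r \<Longrightarrow> (LBINT y. theta s ((x - y) /\<^sub>R t) *\<^sub>R \<psi> y) = (k * t powr (2 * s)) *\<^sub>R (LBINT y. eta ((x - y) /\<^sub>R t) *\<^sub>R h y)"
  obtains A where "0 \<le> A" "AE x in lborel. x \<in> ball c R1 \<longrightarrow> v x * norm (\<psi> x) \<le> 2 * A * v x"
proof -
  let ?n = "DIM('a)"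
  note Dv = morreyD[OF v] and Du = morreyD[OF u]
  have [measurable]: "h \<in> borel_measurable borel" using hi by auto
  note [measurable] = Dv(4) Du(4)
  define \<kappa> where "\<kappa> = kappa s TYPE('a)"
  have \<kappa>: "0 < \<kappa>" unfolding \<kappa>_def by (rule kappa_pos[OF s])
  define K where "K = k / \<kappa>"
  have K: "0 < K" using k \<kappa> by (simp add: K_def)
  define e where "e = (1/2) ^ (?n + 1) * \<alpha> / (K * Cv)"
  have e: "0 < e" using K Dv(1) \<alpha> by (simp add: e_def)
  \<comment> \<open>The first entry makes the Morrey condition available, the second keeps all bumps
    of all steps inside radius r, and the third makes the potential of v so small that a step gains
    the factor 2^(-N-1).\<close>
  define b0 where "b0 = min (min 1 ((r - R1) / 2)) (e powr (1 / \<alpha>))"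
  have b0: "0 < b0" "b0 \<le> 1" using R1 e by (auto simp: b0_def)
  have "b0 \<le> (r - R1) / 2" unfolding b0_def by (intro min.coboundedI1 min.cobounded2)
  then have br: "R1 + 2 * b0 \<le> r" by simp
  have be: "K * (Cv * b0 powr \<alpha> / \<alpha>) \<le> (1/2) ^ (?n + 1)"
  proof -
    have "b0 powr \<alpha> \<le> (e powr (1 / \<alpha>)) powr \<alpha>" using b0 \<alpha> by (intro powr_mono2) (auto simp: b0_def)
    also have "\<dots> = e" using \<alpha> e by (simp add: powr_powr)
    finally have "K * Cv / \<alpha> * b0 powr \<alpha> \<le> K * Cv / \<alpha> * e" using K Dv(1) \<alpha> by (intro mult_left_mono) auto
    also have "\<dots> = (1/2) ^ (?n + 1)" using K Dv(1) \<alpha> by (simp add: e_def)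
    finally show ?thesis by simp
  qed
  obtain C0 where C0: "0 < C0" "\<And>r (x::'a) y R. 0 < r \<Longrightarrow> r \<le> 1 \<Longrightarrow> norm x \<le> R \<Longrightarrow>
    \<bar>Tht s r (x - y)\<bar> \<le> C0 / r ^ ?n * (1 + R) powr (real ?n + 2 * s) * jw s y" using Tht_bound[OF s, where 'a='a] by metis
  define T where "T = C0 * (1 + (norm c + \<bar>r\<bar>)) powr (real ?n + 2 * s) * (LBINT y. jw s y * norm (\<psi> y))"
  have T: "0 \<le> T" unfolding T_def using C0(1) by (intro mult_nonneg_nonneg integral_nonneg_AE AE_I2) auto
  \<comment> \<open>The two summands bound the convolution term and the potential of u at j = 0; for
    larger j the first grows by 2^(jN), while the second remains bounded.\<close>
  define A where "A = T / b0 ^ ?n / \<kappa> + K * (Cu / \<alpha>)"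
  have A: "0 \<le> A" using T \<kappa> b0 K Du(1) \<alpha> by (simp add: A_def)
  show ?thesis
  proof (rule that[OF A], rule morrey_iteration[OF s(1) v \<alpha> b0 _ _ v\<psi> less_imp_le[OF K] be A])
    fix j :: nat
    define b where "b = b0 * (1/2) ^ j"
    have b: "0 < b" "b \<le> b0" using b0 by (auto simp: b_def power_le_one mult_left_le)
    have b1: "b \<le> 1" using b b0 by simp
    let ?U = "ball c (R1 + 2 * b0 * (1 - (1/2) ^ j))"
    have sub: "cball x t \<subseteq> ball c r" if x: "x \<in> ?U" and t: "t < b" for x t
    proof
      fix y assume "y \<in> cball x t"
      then have "dist c y < R1 + 2 * b0 * (1 - (1/2) ^ j) + b" using x t dist_triangle[of c y x] by (simp add: dist_commute)
      also have "\<dots> \<le> R1 + 2 * b0" using b by (simp add: b_def algebra_simps)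
      finally show "y \<in> ball c r" using br by simp
    qed
    have rep: "AE x in lborel. x \<in> ?U \<longrightarrow> integrable lborel (\<lambda>y. Gk s {0..<b} (x - y) *\<^sub>R h y) \<and>
      kappa s TYPE('a) *\<^sub>R \<psi> x = (LBINT y. Tht s b (x - y) *\<^sub>R \<psi> y) + k *\<^sub>R (LBINT y. Gk s {0..<b} (x - y) *\<^sub>R h y)"
    proof (rule repr_AE[OF s \<psi>m \<psi>i hi b(1) b1 open_ball])
      fix t x assume x: "x \<in> ?U" "0 < t" "t < b"
      show "(LBINT y. theta s ((x - y) /\<^sub>R t) *\<^sub>R \<psi> y) = (k * t powr (2 * s)) *\<^sub>R (LBINT y. eta ((x - y) /\<^sub>R t) *\<^sub>R h y)"
        by (rule E[OF x(2) sub[OF x(1,3)]])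
    qed
    show "AE x in lborel. x \<in> ?U \<longrightarrow> ennreal (norm (\<psi> x)) \<le> ennreal (A * 2 ^ (j * ?n)) +
      ennreal K * (\<integral>\<^sup>+ y. ennreal (Gk s {0..<b0 * (1/2) ^ j} (x - y)) * ennreal (v y * norm (\<psi> y)) \<partial>lborel)"
      using rep
    proof eventually_elim
      case (elim x)
      show ?case
      proof
        assume x: "x \<in> ?U"
        let ?T = "LBINT y. Tht s b (x - y) *\<^sub>R \<psi> y" and ?G = "LBINT y. Gk s {0..<b} (x - y) *\<^sub>R h y"
        let ?X = "\<integral>\<^sup>+ y. ennreal (Gk s {0..<b} (x - y)) * ennreal (v y * norm (\<psi> y)) \<partial>lborel"
        have gi: "integrable lborel (\<lambda>y. Gk s {0..<b} (x - y) *\<^sub>R h y)" and eqn: "\<kappa> *\<^sub>R \<psi> x = ?T + k *\<^sub>R ?G" using elim x by (auto simp: \<kappa>_def)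
        have "\<kappa> * norm (\<psi> x) = norm (?T + k *\<^sub>R ?G)" using eqn \<kappa> by (metis norm_scaleR abs_of_pos)
        also have "\<dots> \<le> norm ?T + k * norm ?G" using norm_triangle_ineq[of ?T "k *\<^sub>R ?G"] k by simp
        finally have "norm (\<psi> x) \<le> norm ?T / \<kappa> + K * norm ?G" using \<kappa> by (simp add: K_def field_simps)
        have "x \<in> ball c r" using sub[OF x, of 0] b by auto
        then have nx: "norm x \<le> norm c + \<bar>r\<bar>" by (rule ball_norm_le)
        have nT: "norm ?T \<le> T / b0 ^ ?n * 2 ^ (j * ?n)"
        proof -
          have "norm ?T \<le> C0 / b ^ ?n * (1 + (norm c + \<bar>r\<bar>)) powr (real ?n + 2 * s) * (LBINT y. jw s y * norm (\<psi> y))"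
            by (rule jw_integral_bound(2)[OF \<psi>m _ \<psi>i C0(2)[OF b(1) b1 nx]]) measurable
          also have "\<dots> = T / b ^ ?n" by (simp add: T_def)
          also have "\<dots> = T / b0 ^ ?n * 2 ^ (j * ?n)" by (simp add: b_def power_divide power_mult)
          finally show ?thesis .
        qed
        have "ennreal (norm ?G) \<le> (\<integral>\<^sup>+ y. ennreal (norm (Gk s {0..<b} (x - y) *\<^sub>R h y)) \<partial>lborel)" by (rule integral_norm_bound_ennreal[OF gi])
        also have "\<dots> \<le> (\<integral>\<^sup>+ y. ennreal (Gk s {0..<b} (x - y)) * ennreal (u y) + ennreal (Gk s {0..<b} (x - y)) * ennreal (v y * norm (\<psi> y)) \<partial>lborel)"
        proof (rule nn_integral_mono_AE, use hle in eventually_elim)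
          case (elim y)
          have "norm (Gk s {0..<b} (x - y) *\<^sub>R h y) \<le> Gk s {0..<b} (x - y) * (u y + v y * norm (\<psi> y))" using elim by (simp add: mult_left_mono)
          then have "ennreal (norm (Gk s {0..<b} (x - y) *\<^sub>R h y)) \<le> ennreal (Gk s {0..<b} (x - y) * (u y + v y * norm (\<psi> y)))" by (rule ennreal_leI)
          also have "\<dots> = ennreal (Gk s {0..<b} (x - y)) * ennreal (u y) + ennreal (Gk s {0..<b} (x - y)) * ennreal (v y * norm (\<psi> y))"
            using Du(3)[of y] Dv(3)[of y] by (simp only: ennreal_mult' ennreal_plus mult_nonneg_nonneg norm_ge_zero Gk_nonneg distrib_left)
          finally show ?case .
        qed
        also have "\<dots> = (\<integral>\<^sup>+ y. ennreal (Gk s {0..<b} (x - y)) * ennreal (u y) \<partial>lborel) + ?X" by (rule nn_integral_add) measurable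
        also have "\<dots> \<le> ennreal (Cu / \<alpha>) + ?X"
        proof (rule add_right_mono)
          have "(\<integral>\<^sup>+ y. ennreal (Gk s {0..<b} (x - y)) * ennreal (u y) \<partial>lborel) \<le> ennreal (Cu * b powr \<alpha> / \<alpha>)" by (rule Gk_morrey(1)[OF s(1) u \<alpha> b(1) b1])
          also have "Cu * b powr \<alpha> / \<alpha> \<le> Cu / \<alpha>" using b b1 \<alpha> Du(1) by (intro divide_right_mono) (auto intro!: mult_left_le powr_le1)
          finally show "(\<integral>\<^sup>+ y. ennreal (Gk s {0..<b} (x - y)) * ennreal (u y) \<partial>lborel) \<le> ennreal (Cu / \<alpha>)" by (simp add: ennreal_leI)
        qed
        finally have nG: "ennreal (norm ?G) \<le> ennreal (Cu / \<alpha>) + ?X" .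
        have "ennreal (norm (\<psi> x)) \<le> ennreal (norm ?T / \<kappa> + K * norm ?G)" by (rule ennreal_leI) fact
        also have "\<dots> = ennreal (norm ?T / \<kappa>) + ennreal K * ennreal (norm ?G)" using \<kappa> K by (simp add: ennreal_mult')
        also have "\<dots> \<le> ennreal (T / b0 ^ ?n * 2 ^ (j * ?n) / \<kappa>) + ennreal K * (ennreal (Cu / \<alpha>) + ?X)"
          using nT nG \<kappa> by (intro add_mono mult_left_mono ennreal_leI divide_right_mono) auto
        also have "\<dots> = ennreal (T / b0 ^ ?n * 2 ^ (j * ?n) / \<kappa> + K * (Cu / \<alpha>)) + ennreal K * ?X"
        proof -
          have "ennreal K * ennreal (Cu / \<alpha>) = ennreal (K * (Cu / \<alpha>))" using K by (intro ennreal_mult'[symmetric]) simp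
          moreover have "0 \<le> T / b0 ^ ?n * 2 ^ (j * ?n) / \<kappa>" "0 \<le> K * (Cu / \<alpha>)" using T b0 \<kappa> K Du(1) \<alpha> by auto
          ultimately show ?thesis by (simp only: distrib_left ennreal_plus add.assoc)
        qed
        also have "\<dots> \<le> ennreal (A * 2 ^ (j * ?n)) + ennreal K * ?X"
        proof (intro add_right_mono ennreal_leI)
          have "K * (Cu / \<alpha>) * 1 \<le> K * (Cu / \<alpha>) * 2 ^ (j * ?n)" using K Du(1) \<alpha> by (intro mult_left_mono) auto
          then show "T / b0 ^ ?n * 2 ^ (j * ?n) / \<kappa> + K * (Cu / \<alpha>) \<le> A * 2 ^ (j * ?n)" by (simp add: A_def distrib_right)
        qed
        finally show "ennreal (norm (\<psi> x)) \<le> ennreal (A * 2 ^ (j * ?n)) +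
          ennreal K * (\<integral>\<^sup>+ y. ennreal (Gk s {0..<b0 * (1/2) ^ j} (x - y)) * ennreal (v y * norm (\<psi> y)) \<partial>lborel)" unfolding b_def .
      qed
    qed
  qed simp_all
qed

theorem theorem3p5:
  fixes \<Omega> :: "'a::euclidean_space set"
    and c c' :: 'a and r r' s s' \<delta> :: real and p :: ereal
    and f V \<psi> :: "'a \<Rightarrow> complex"
  assumes s_pos: "0 < s" and s_lt1: "s < 1" and s_le: "s \<le> real DIM('a) / 2"
    and \<Omega>_open: "open \<Omega>" and \<Omega>_fin: "emeasure lebesgue \<Omega> < \<infinity>"
    and B_sub: "0 < r" "cball c r \<subseteq> \<Omega>"
    and B'_sub: "0 < r'" "cball c' r' \<subseteq> ball c r"
    and p_range: "1 < p"
    and f_Lp: "Lp_on p (ball c r) f" and f_loc: "L1_loc \<Omega> f"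
    and V_Lp: "Lp_on p (ball c r) V"
    and sol: "distr_solution s \<Omega> V f \<psi>"
    and sob: "1/2 \<le> s \<Longrightarrow> 2 * s - 1 < s' \<and> 0 < \<delta> \<and> frac_sobolev s' (1 + \<delta>) \<Omega> \<psi>"
  shows "\<exists>g. (AE x in lebesgue. \<psi> x = g x) \<and>
    (let \<alpha> = real_of_ereal (ereal (2 * s) - ereal (real DIM('a)) / p) in
      (s \<le> 1/2 \<and> p > ereal (real DIM('a) / (2 * s)) \<longrightarrow> holder0 \<alpha> (ball c' r') g) \<and>
      (1/2 < s \<and> ereal (real DIM('a) / (2 * s)) < p \<and> p \<le> ereal (real DIM('a) / (2 * s - 1))
         \<longrightarrow> holder0 \<alpha> (ball c' r') g) \<and>
      (1/2 < s \<and> p > ereal (real DIM('a) / (2 * s - 1)) \<longrightarrow> holder1 (\<alpha> - 1) (ball c' r') g))"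
proof -
  let ?n = "real DIM('a)"
  let ?B = "ball c r"
  define \<alpha> where "\<alpha> = real_of_ereal (ereal (2 * s) - ereal ?n / p)"
  have n: "0 < ?n" by simp
  have s: "0 < s" "s < 1" using s_pos s_lt1 by auto
  \<comment> \<open>Division by \<infinity> in \<open>ereal\<close> is 0, so p = \<infinity> is the
    case \<alpha> = 2s. In the finite case the thresholds on p become 0 < \<alpha> and 1 <
    \<alpha>.\<close>
  have \<alpha>_cases: "(p = \<infinity> \<and> \<alpha> = 2 * s) \<or> (\<exists>q. p = ereal q \<and> 1 < q \<and> \<alpha> = 2 * s - ?n / q)"
    using p_range by (cases p) (auto simp: \<alpha>_def)
  have \<alpha>_le: "\<alpha> \<le> 2 * s" using \<alpha>_cases n by (auto intro!: divide_nonneg_pos)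
  have quot: "a / b < q \<longleftrightarrow> a / q < b" if "0 < b" "0 < q" for a b q :: real
    using that by (simp add: divide_less_eq mult.commute)
  have \<alpha>_pos: "0 < \<alpha>" if "ereal (?n / (2 * s)) < p"
    using \<alpha>_cases that s quot[of "2 * s"] by auto
  have \<alpha>_le1: "\<alpha> \<le> 1" if "1/2 < s" "p \<le> ereal (?n / (2 * s - 1))"
    using \<alpha>_cases that quot[of "2 * s - 1" _ ?n] by (auto simp: not_less[symmetric])
  have \<alpha>_gt1: "1 < \<alpha>" if "1/2 < s" "ereal (?n / (2 * s - 1)) < p"
    using \<alpha>_cases that quot[of "2 * s - 1" _ ?n] by auto
  \<comment> \<open>The three cases of the statement differ only in the position of \<alpha>
    relative to 1, so one g is found for all of them once \<alpha> > 0.\<close>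
  have main: "\<exists>g. (AE x in lebesgue. \<psi> x = g x) \<and> (\<alpha> \<le> 1 \<longrightarrow> holder0 \<alpha> (ball c' r') g) \<and> (1 < \<alpha> \<longrightarrow> holder1 (\<alpha> - 1) (ball c' r') g)"
    if \<alpha>: "0 < \<alpha>"
  proof -
    have "\<psi> \<in> borel_measurable lebesgue" using sol unfolding distr_solution_def by simp
    then obtain \<psi>0 where \<psi>0 [measurable]: "\<psi>0 \<in> borel_measurable borel" and \<psi>e: "AE x in lborel. \<psi> x = \<psi>0 x" by (rule lebesgue_borel_rep)
    have fm: "f \<in> borel_measurable (lebesgue_on ?B)" and Vm: "V \<in> borel_measurable (lebesgue_on ?B)"
      using f_Lp V_Lp unfolding Lp_on_def by simp_all
    obtain f0 where f0 [measurable]: "f0 \<in> borel_measurable borel" and fe: "AE x in lborel. x \<in> ?B \<longrightarrow> f x = f0 x"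
      by (rule lebesgue_on_borel_rep[OF _ fm]) auto
    obtain V0 where V0 [measurable]: "V0 \<in> borel_measurable borel" and Ve: "AE x in lborel. x \<in> ?B \<longrightarrow> V x = V0 x"
      by (rule lebesgue_on_borel_rep[OF _ Vm]) auto
    define h where "h y = indicator ?B y *\<^sub>R (f0 y - V0 y * \<psi>0 y)" for y
    define k where "k = symb_const TYPE('a) s"
    have k: "0 < k" unfolding k_def by (rule symb_const_pos[OF s])
    note LE = local_equation[OF s sol B_sub(2) \<psi>0 \<psi>e f0 fe V0 Ve, folded h_def k_def]
    have [measurable]: "h \<in> borel_measurable borel" using LE(1) by auto
    obtain Cu u where u: "morrey s \<alpha> Cu u" and ue: "AE x in lborel. u x = indicator ?B x * norm (f0 x)"
      using Lp_on_morrey[OF p_range f_Lp f0 fe B_sub(1) \<alpha>_def] by blast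
    obtain Cv v where v: "morrey s \<alpha> Cv v" and ve: "AE x in lborel. v x = indicator ?B x * norm (V0 x)"
      using Lp_on_morrey[OF p_range V_Lp V0 Ve B_sub(1) \<alpha>_def] by blast
    note [measurable] = morreyD(4)[OF u] morreyD(4)[OF v]
    have v\<psi>: "integrable lborel (\<lambda>y. v y * norm (\<psi>0 y))"
      by (rule Bochner_Integration.integrable_cong_AE_imp[OF LE(3)]) (measurable, use ve in \<open>eventually_elim, simp\<close>)
    have hle: "AE y in lborel. norm (h y) \<le> u y + v y * norm (\<psi>0 y)"
      using ue ve
    proof eventually_elim
      case (elim y)
      then show ?case using norm_triangle_ineq4[of "f0 y" "V0 y * \<psi>0 y"] by (simp add: h_def indicator_def norm_mult)
    qed
    have d: "dist c' c + r' < r" using B'_sub cball_subset_ball_iff[of c' r' c r] by auto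
    \<comment> \<open>An intermediate radius: the iteration uses the room between R1 and r, the
      final representation the room between the small ball and R1.\<close>
    define R1 where "R1 = (dist c' c + r' + r) / 2"
    have R1: "dist c' c + r' < R1" "R1 < r" using d by (auto simp: R1_def)
    obtain A where A: "0 \<le> A" and vA: "AE x in lborel. x \<in> ball c R1 \<longrightarrow> v x * norm (\<psi>0 x) \<le> 2 * A * v x"
      using drift_bound[OF s \<psi>0 LE(2,1) \<alpha> v u v\<psi> hle k R1(2) LE(4)] by blast
    \<comment> \<open>The bound on \<open>norm (h y)\<close> holds almost everywhere on the
      intermediate ball; building it into the definition makes it hold everywhere, as
      \<open>morrey_dominated\<close> requires. Bumps about points of the small ball at scales below
      b do not see the cut at R1.\<close>
    define h1 where "h1 y = indicator (ball c R1) y *\<^sub>R (if norm (h y) \<le> u y + 2 * A * v y then h y else 0)" for y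
    have [measurable]: "ball c R1 \<in> sets borel" by simp
    have h1m [measurable]: "h1 \<in> borel_measurable borel" unfolding h1_def[abs_def] by measurable
    have uv0: "0 \<le> u y + 2 * A * v y" for y using A morreyD(3)[OF u, of y] morreyD(3)[OF v, of y] by simp
    have mor: "morrey s \<alpha> (Cu + 2 * A * Cv) (\<lambda>y. norm (h1 y))"
      by (rule morrey_dominated[OF u v]) (use A uv0 in \<open>auto simp: h1_def indicator_def\<close>)
    have h1i: "integrable lborel h1" using morreyD(2)[OF mor] integrable_norm_iff[of h1 lborel] by simp
    have h1e: "AE y in lborel. y \<in> ball c R1 \<longrightarrow> h y = h1 y"
      using hle vA by eventually_elim (auto simp: h1_def)
    define b where "b = min 1 (R1 - dist c' c - r')"
    have b: "0 < b" "b \<le> 1" using R1 by (auto simp: b_def)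
    have sub: "cball x t \<subseteq> ball c R1" if x: "x \<in> ball c' r'" and t: "t < b" for x t
    proof
      fix y assume "y \<in> cball x t"
      then have "dist c y < dist c' c + r' + b" using x t dist_triangle[of c y c'] dist_triangle[of c' y x] by (simp add: dist_commute)
      also have "\<dots> \<le> R1" by (simp add: b_def)
      finally show "y \<in> ball c R1" by simp
    qed
    have E1: "(LBINT y. theta s ((x - y) /\<^sub>R t) *\<^sub>R \<psi>0 y) = (k * t powr (2 * s)) *\<^sub>R (LBINT y. eta ((x - y) /\<^sub>R t) *\<^sub>R h1 y)"
      if x: "x \<in> ball c' r'" and t: "0 < t" "t < b" for x t
    proof -
      have "(LBINT y. eta ((x - y) /\<^sub>R t) *\<^sub>R h y) = (LBINT y. eta ((x - y) /\<^sub>R t) *\<^sub>R h1 y)"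
      proof (rule integral_cong_AE)
        show "AE y in lborel. eta ((x - y) /\<^sub>R t) *\<^sub>R h y = eta ((x - y) /\<^sub>R t) *\<^sub>R h1 y"
          using h1e
        proof eventually_elim
          case (elim y)
          show ?case
          proof (cases "y \<in> ball c R1")
            case True then show ?thesis using elim by simp
          next
            case False
            then have "y \<notin> cball x t" using sub[OF x t(2)] by blast
            then have "t \<le> norm (x - y)" by (simp add: dist_norm)
            then show ?thesis using eta_scaled_zero[of t "x - y"] t by simp
          qed
        qed
      qed measurable
      moreover have "cball x t \<subseteq> ?B" using sub[OF x t(2)] subset_ball[of R1 r c] R1 by auto
      ultimately show ?thesis using LE(4)[OF t(1)] by simp
    qed
    define \<kappa> where "\<kappa> = kappa s TYPE('a)"
    have \<kappa>: "0 < \<kappa>" unfolding \<kappa>_def by (rule kappa_pos[OF s])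
    have "AE x in lborel. x \<in> ball c' r' \<longrightarrow> integrable lborel (\<lambda>y. Gk s {0..<b} (x - y) *\<^sub>R h1 y) \<and>
      \<kappa> *\<^sub>R \<psi>0 x = (LBINT y. Tht s b (x - y) *\<^sub>R \<psi>0 y) + k *\<^sub>R (LBINT y. Gk s {0..<b} (x - y) *\<^sub>R h1 y)"
      unfolding \<kappa>_def by (rule repr_AE[OF s \<psi>0 LE(2) h1i b open_ball E1])
    then have rep: "AE x in lborel. x \<in> ball c' r' \<longrightarrow> \<kappa> *\<^sub>R \<psi>0 x = Tpot s b \<psi>0 x + k *\<^sub>R Gpot s b h1 x"
      unfolding Tpot_def Gpot_def by eventually_elim auto
    define G where "G x = (1 / \<kappa>) *\<^sub>R (Tpot s b \<psi>0 x + k *\<^sub>R Gpot s b h1 x)" for x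
    \<comment> \<open>Outside the small ball \<open>\<psi>\<close> is kept, so that g agrees with
      \<open>\<psi>\<close> almost everywhere on the whole space.\<close>
    define g where "g x = (if x \<in> ball c' r' then G x else \<psi> x)" for x
    have gG: "G x = g x" if "x \<in> ball c' r'" for x using that by (simp add: g_def)
    have "AE x in lborel. \<psi> x = g x" using rep \<psi>e
    proof eventually_elim
      case (elim x)
      show ?case
      proof (cases "x \<in> ball c' r'")
        case True
        then have "G x = (1 / \<kappa>) *\<^sub>R (\<kappa> *\<^sub>R \<psi>0 x)" using elim by (simp add: G_def)
        then show ?thesis using elim True \<kappa> by (simp add: g_def)
      qed (simp add: g_def)
    qed
    moreover have "holder0 \<alpha> (ball c' r') g" if "\<alpha> \<le> 1"
    proof -
      have "holder0 \<alpha> (ball c' r') G" unfolding G_def[abs_def] by (rule potential_holder0[OF s \<psi>0 LE(2) \<alpha> mor h1m b that])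
      then show ?thesis by (simp only: holder0_cong[OF gG])
    qed
    moreover have "holder1 (\<alpha> - 1) (ball c' r') g" if "1 < \<alpha>"
    proof (rule holder1_cong[OF open_ball gG])
      have "\<alpha> < 2" using \<alpha>_le s by simp
      then show "holder1 (\<alpha> - 1) (ball c' r') G"
        unfolding G_def[abs_def] by (rule potential_holder1[OF s \<psi>0 LE(2) \<alpha> mor h1m b that])
    qed
    ultimately show ?thesis by (intro exI[of _ g]) (simp add: AE_completion_iff)
  qed
  show ?thesis unfolding Let_def \<alpha>_def[symmetric]
  proof (cases "0 < \<alpha>")
    case True
    then obtain g where g: "AE x in lebesgue. \<psi> x = g x" "\<alpha> \<le> 1 \<Longrightarrow> holder0 \<alpha> (ball c' r') g" "1 < \<alpha> \<Longrightarrow> holder1 (\<alpha> - 1) (ball c' r') g"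
      using main by blast
    \<comment> \<open>For s \<le> 1/2 the exponent cannot exceed 2s \<le> 1; equality needs s = 1/2
      and p = \<infinity> and falls under the logarithmic class.\<close>
    have "s \<le> 1/2 \<Longrightarrow> \<alpha> \<le> 1" using \<alpha>_le by simp
    with g \<alpha>_le1 \<alpha>_gt1 show "\<exists>g. (AE x in lebesgue. \<psi> x = g x) \<and>
      (s \<le> 1/2 \<and> ereal (?n / (2 * s)) < p \<longrightarrow> holder0 \<alpha> (ball c' r') g) \<and>
      (1/2 < s \<and> ereal (?n / (2 * s)) < p \<and> p \<le> ereal (?n / (2 * s - 1)) \<longrightarrow> holder0 \<alpha> (ball c' r') g) \<and>
      (1/2 < s \<and> ereal (?n / (2 * s - 1)) < p \<longrightarrow> holder1 (\<alpha> - 1) (ball c' r') g)"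
      by (intro exI[of _ g]) blast
  next
    case False
    \<comment> \<open>Each of the three cases would force \<alpha> > 0, so all implications hold
      vacuously and \<open>\<psi>\<close> itself serves as g.\<close>
    with \<alpha>_pos \<alpha>_gt1 show "\<exists>g. (AE x in lebesgue. \<psi> x = g x) \<and>
      (s \<le> 1/2 \<and> ereal (?n / (2 * s)) < p \<longrightarrow> holder0 \<alpha> (ball c' r') g) \<and>
      (1/2 < s \<and> ereal (?n / (2 * s)) < p \<and> p \<le> ereal (?n / (2 * s - 1)) \<longrightarrow> holder0 \<alpha> (ball c' r') g) \<and>
      (1/2 < s \<and> ereal (?n / (2 * s - 1)) < p \<longrightarrow> holder1 (\<alpha> - 1) (ball c' r') g)"
      by (intro exI[of _ \<psi>]) auto
  qed
qed

end
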